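(* Let $\alpha,\beta>-1$ and let $N\ge 1$ be an integer. Then for each $f\in C_c^\infty(0,\pi)$ and all $\theta\in(0,\pi)$: $$R_N^{\alpha,\beta}f(\theta)=\mathrm{P.V.}\int_0^\pi R_N^{\alpha,\beta}(\theta,\varphi)f(\varphi)\,d\mu_{\alpha,\beta}(\varphi)\qquad\text{if }N\text{ is odd},$$ $$R_N^{\alpha,\beta}f(\theta)=(-1)^{N/2}f(\theta)+\int_0^\pi R_N^{\alpha,\beta}(\theta,\varphi)f(\varphi)\,d\mu_{\alpha,\beta}(\varphi)\qquad\text{if }N\text{ is even}.$$
   Context: For $\alpha,\beta>-1$ let $d\mu_{\alpha,\beta}(\theta)=(\sin\frac\theta2)^{2\alpha+1}(\cos\frac\theta2)^{2\beta+1}d\theta$ on $(0,\pi)$ and $\tau_{\alpha,\beta}=\frac{\alpha+\beta+1}{2}$. Let $\mathcal P_n^{\alpha,\beta}(\theta)=c_n^{\alpha,\beta}P_n^{\alpha,\beta}(\cos\theta)$, $n\ge0$, where $P_n^{\alpha,\beta}$ are the classical Jacobi polynomials (Szegő's convention) and $c_n^{\alpha,\beta}>0$ are such that $\{\mathcal P_n^{\alpha,\beta}:n\ge0\}$ is an orthonormal basis of $L^2(d\mu_{\alpha,\beta})$. The Jacobi-Poisson kernel is $$H_t^{\alpha,\beta}(\theta,\varphi)=\sum_{n=0}^\infty e^{-t|n+\tau_{\alpha,\beta}|}\mathcal P_n^{\alpha,\beta}(\theta)\mathcal P_n^{\alpha,\beta}(\varphi),\qquad t>0,\ \theta,\varphi\in(0,\pi),$$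 which is a smooth function of $(t,\theta,\varphi)$ (the series may be differentiated term by term). The Riesz-Jacobi transform of order $N\ge1$ is the bounded operator on $L^2(d\mu_{\alpha,\beta})$ given by the $L^2(d\mu_{\alpha,\beta})$-convergent series $$R_N^{\alpha,\beta}f=\sum_{n=1}^\infty|n+\tau_{\alpha,\beta}|^{-N}\langle f,\mathcal P_n^{\alpha,\beta}\rangle_{d\mu_{\alpha,\beta}}\,\partial_\theta^N\mathcal P_n^{\alpha,\beta}.$$ For $f\in C_c^\infty(0,\pi)$ (smooth functions with compact support contained in $(0,\pi)$) the series converges uniformly on $(0,\pi)$ to a smooth function, and $R_N^{\alpha,\beta}f(\theta)$ denotes its pointwise sum. The Riesz-Jacobi kernel is $$R_N^{\alpha,\beta}(\theta,\varphi)=\frac1{\Gamma(N)}\int_0^\infty\partial_\theta^NH_t^{\alpha,\beta}(\theta,\varphi)\,t^{N-1}\,dt,\qquad\theta,\varphi\in(0,\pi),\ \theta\ne\varphi$$ (the integral converges absolutely). Principal value: $\mathrm{P.V.}\int_0^\pi K(\theta,\varphi)f(\varphi)\,d\mu(\varphi)=\lim_{\varepsilon\to0^+}\int_{0<\varphi<\pi,\,|\varphi-\theta|>\varepsilon}K(\theta,\varphi)f(\varphi)\,d\mu(\varphi)$. Integrals without P.V. are ordinary (absolutely convergent) Lebesgue integrals. *)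

theory Defs
  imports "HOL-Analysis.Analysis"
begin

definition jacobi_measure :: "real \<Rightarrow> real \<Rightarrow> real measure" where
  "jacobi_measure \<alpha> \<beta> =
     density (restrict_space lborel {0<..<pi})
       (\<lambda>\<theta>. ennreal (sin (\<theta> / 2) powr (2 * \<alpha> + 1) * cos (\<theta> / 2) powr (2 * \<beta> + 1)))"

definition jacobi_tau :: "real \<Rightarrow> real \<Rightarrow> real" where
  "jacobi_tau \<alpha> \<beta> = (\<alpha> + \<beta> + 1) / 2"

(* Szego, Orthogonal Polynomials, (4.3.2); only the term s = 0 survives at x = 1, which gives
   Szego's normalization P_n(1) = (n + \<alpha>) gchoose n. *)
definition jacobi_poly :: "real \<Rightarrow> real \<Rightarrow> nat \<Rightarrow> real \<Rightarrow> real" where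
  "jacobi_poly \<alpha> \<beta> n x =
     (\<Sum>s\<le>n. ((real n + \<alpha>) gchoose (n - s)) * ((real n + \<beta>) gchoose s)
            * ((x - 1) / 2) ^ s * ((x + 1) / 2) ^ (n - s))"

(* The only positive constant for which c_n P_n(cos \<theta>) has norm 1 in L^2. *)
definition jacobi_const :: "real \<Rightarrow> real \<Rightarrow> nat \<Rightarrow> real" where
  "jacobi_const \<alpha> \<beta> n =
     1 / sqrt (LINT \<theta>|jacobi_measure \<alpha> \<beta>. (jacobi_poly \<alpha> \<beta> n (cos \<theta>))\<^sup>2)"

definition jacobi_fun :: "real \<Rightarrow> real \<Rightarrow> nat \<Rightarrow> real \<Rightarrow> real" where
  "jacobi_fun \<alpha> \<beta> n \<theta> = jacobi_const \<alpha> \<beta> n * jacobi_poly \<alpha> \<beta> n (cos \<theta>)"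

(* No complex conjugation is needed because jacobi_fun is real-valued. *)
definition jacobi_coeff :: "real \<Rightarrow> real \<Rightarrow> (real \<Rightarrow> complex) \<Rightarrow> nat \<Rightarrow> complex" where
  "jacobi_coeff \<alpha> \<beta> f n =
     (LINT \<phi>|jacobi_measure \<alpha> \<beta>. f \<phi> * complex_of_real (jacobi_fun \<alpha> \<beta> n \<phi>))"

definition jacobi_poisson_kernel ::
  "real \<Rightarrow> real \<Rightarrow> real \<Rightarrow> real \<Rightarrow> real \<Rightarrow> real" where
  "jacobi_poisson_kernel \<alpha> \<beta> t \<theta> \<phi> =
     (\<Sum>n. exp (- t * \<bar>real n + jacobi_tau \<alpha> \<beta>\<bar>) * jacobi_fun \<alpha> \<beta> n \<theta> * jacobi_fun \<alpha> \<beta> n \<phi>)"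

(* The summation starts at degree 1, hence the shift by Suc; the pointwise sum of the series. *)
definition riesz_jacobi_transform ::
  "real \<Rightarrow> real \<Rightarrow> nat \<Rightarrow> (real \<Rightarrow> complex) \<Rightarrow> real \<Rightarrow> complex" where
  "riesz_jacobi_transform \<alpha> \<beta> N f \<theta> =
     (\<Sum>k. complex_of_real (1 / \<bar>real (Suc k) + jacobi_tau \<alpha> \<beta>\<bar> ^ N)
           * jacobi_coeff \<alpha> \<beta> f (Suc k)
           * complex_of_real ((deriv ^^ N) (jacobi_fun \<alpha> \<beta> (Suc k)) \<theta>))"

definition riesz_jacobi_kernel ::
  "real \<Rightarrow> real \<Rightarrow> nat \<Rightarrow> real \<Rightarrow> real \<Rightarrow> real" where
  "riesz_jacobi_kernel \<alpha> \<beta> N \<theta> \<phi> =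
     1 / Gamma (real N) *
     (LBINT t:{0<..}. (deriv ^^ N) (\<lambda>u. jacobi_poisson_kernel \<alpha> \<beta> t u \<phi>) \<theta> * t ^ (N - 1))"

(* Elements of C_c^\<infinity>(S), S open, are represented by their extensions by zero to the real line. *)
definition test_function_on :: "real set \<Rightarrow> (real \<Rightarrow> complex) \<Rightarrow> bool" where
  "test_function_on S f \<longleftrightarrow>
     (\<forall>k x. ((\<lambda>g y. vector_derivative g (at y)) ^^ k) f differentiable (at x)) \<and>
     compact (closure {x. f x \<noteq> 0}) \<and> closure {x. f x \<noteq> 0} \<subseteq> S"

(* The principal value at \<theta> of the integral of g over (0,pi) exists and equals l; the truncated
   integrals are required to converge absolutely. *)
definition has_pv_integral ::
  "(real \<Rightarrow> complex) \<Rightarrow> complex \<Rightarrow> real measure \<Rightarrow> real \<Rightarrow> bool" where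
  "has_pv_integral g l M \<theta> \<longleftrightarrow>
     (\<forall>\<epsilon>>0. set_integrable M {\<phi>. 0 < \<phi> \<and> \<phi> < pi \<and> \<bar>\<phi> - \<theta>\<bar> > \<epsilon>} g) \<and>
     ((\<lambda>\<epsilon>. LINT \<phi>:{\<phi>. 0 < \<phi> \<and> \<phi> < pi \<and> \<bar>\<phi> - \<theta>\<bar> > \<epsilon>}|M. g \<phi>) \<longlongrightarrow> l) (at_right 0)"

end

(* With v_n = sqrt(w) p_n, where w is the Jacobi weight and p_n the normalized Jacobi functions, the
   Jacobi equation becomes v'' = (q - e^2) v on (0,pi) with e = |n + tau|, and the rest is done for
   any complete eigensystem of this kind. Green's identity against explicit kernels supported in a
   small interval compares the Poisson sums of v_n(t) v_n(p) and v_n'(t) v_n(p) with the classical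
   Poisson kernel and its derivative, uniformly up to bounded errors and, off the diagonal, up to
   O(|z|) for complex times z; Cauchy estimates then control all time derivatives. By the
   differential equation the N-th derivative of p_n is a combination of e^(2j) v_n and e^(2j) v_n',
   so the Riesz kernel at positive time equals, up to a term dominated by |p - t|^(-1/2), a multiple
   of the Poisson kernel (N even, producing the point evaluation) or of an odd primitive of its
   derivative (N odd, producing the principal value). *)
theory Submission
  imports Defs "HOL-Complex_Analysis.Complex_Analysis"
begin

section \<open>One-dimensional Sturm--Liouville eigensystems\<close>

text \<open>A factor e^(2j) in a coefficient stands for 2j time derivatives, each costing 1/t, so
  against t^(N-1) the worst term misses integrability at t = 0 by one power of t. Off the diagonal
  the bound O(|z|) supplies that power. A bound at real times alone says nothing about derivatives;
  hence the sector Re (z^2) >= 0, where |s^2 + z^2| stays comparable to s^2 + |z|^2. The exponent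
  1/2 is a compromise: u / (s^2 + u^2) is at most s^(-1/2) u^(-1/2), integrable in time and in space
  alike. The potential is in general singular at 0 and pi, so the comparison kernel must be cut off;
  the cutoff is a polynomial in s, hence entire, and the cosine transform of the product can be
  found by residues. Each use of Green's identity trades the potential for one more antiderivative
  of the kernel, and finitely many uses reach sums that converge absolutely. Index 0 is set apart
  throughout: e_0 = |tau| vanishes when \<alpha> + \<beta> = -1, while the N-th derivative of the
  constant p_0 is zero anyway.\<close>

lemma DERIV_shift_plus:
  "(f has_real_derivative D) (at (y + s)) \<Longrightarrow> ((\<lambda>s. f (y + s)) has_real_derivative D) (at s)"
  using DERIV_shift[of f D s y] by (simp add: add.commute)

lemma DERIV_shift_minus:
  "(f has_real_derivative D) (at (y - s)) \<Longrightarrow> ((\<lambda>s. f (y - s)) has_real_derivative - D) (at s)"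
  using DERIV_chain2[of f D "\<lambda>s. y - s" s "-1" UNIV] DERIV_diff[OF DERIV_const DERIV_ident, of y s UNIV] by simp

lemma abs_combination_le:
  fixes x y A B K :: real
  assumes "\<bar>A\<bar> \<le> K" "\<bar>B\<bar> \<le> K"
  shows "\<bar>x * A + y * B\<bar> \<le> K * \<bar>x\<bar> + K * \<bar>y\<bar>" "\<bar>x * A - y * B\<bar> \<le> K * \<bar>x\<bar> + K * \<bar>y\<bar>"
proof -
  have "\<bar>x * A\<bar> \<le> K * \<bar>x\<bar>" "\<bar>y * B\<bar> \<le> K * \<bar>y\<bar>"
    using assms by (simp_all add: abs_mult mult.commute mult_right_mono)
  then show "\<bar>x * A + y * B\<bar> \<le> K * \<bar>x\<bar> + K * \<bar>y\<bar>" "\<bar>x * A - y * B\<bar> \<le> K * \<bar>x\<bar> + K * \<bar>y\<bar>"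
    by linarith+
qed

text \<open>The test function has values in a Banach space because it will come from a kernel at
  complex time, while eigenfunctions stay real. Derivatives are required only in the open interval,
  which suits kernels that are differentiable merely within \<open>{0..d}\<close>.\<close>

lemma green_identity:
  fixes V V' V'' :: "real \<Rightarrow> real" and b b' b'' :: "real \<Rightarrow> 'a::banach"
  assumes "0 \<le> d"
    and "continuous_on {0..d} V" "continuous_on {0..d} V'"
    and "continuous_on {0..d} b" "continuous_on {0..d} b'"
    and "\<And>s. 0 < s \<Longrightarrow> s < d \<Longrightarrow> (V has_real_derivative V' s) (at s)"
    and "\<And>s. 0 < s \<Longrightarrow> s < d \<Longrightarrow> (V' has_real_derivative V'' s) (at s)"
    and "\<And>s. 0 < s \<Longrightarrow> s < d \<Longrightarrow> (b has_vector_derivative b' s) (at s)"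
    and "\<And>s. 0 < s \<Longrightarrow> s < d \<Longrightarrow> (b' has_vector_derivative b'' s) (at s)"
  shows "((\<lambda>s. V'' s *\<^sub>R b s - V s *\<^sub>R b'' s) has_integral
     (V' d *\<^sub>R b d - V d *\<^sub>R b' d) - (V' 0 *\<^sub>R b 0 - V 0 *\<^sub>R b' 0)) {0..d}"
proof (rule fundamental_theorem_of_calculus_interior[OF assms(1)])
  show "continuous_on {0..d} (\<lambda>s. V' s *\<^sub>R b s - V s *\<^sub>R b' s)"
    using assms by (intro continuous_intros)
  fix s assume s: "s \<in> {0<..<d}"
  show "((\<lambda>s. V' s *\<^sub>R b s - V s *\<^sub>R b' s) has_vector_derivative V'' s *\<^sub>R b s - V s *\<^sub>R b'' s) (at s)"
    by (rule derivative_eq_intros assms(6-9) | use s in simp)+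
qed

text \<open>Folds an interval at its centre: the even and odd combinations of an eigenfunction about
  \<open>y\<close> live on \<open>{0..d}\<close>, whereas norms and expansion coefficients are
  integrals over the whole interval.\<close>

lemma has_integral_symmetric_split:
  fixes f :: "real \<Rightarrow> 'a::banach"
  assumes "0 \<le> d" "continuous_on {y-d..y+d} f"
  shows "((\<lambda>s. f (y + s) + f (y - s)) has_integral integral {y-d..y+d} f) {0..d}"
proof -
  have i: "f integrable_on {y-d..y+d}" by (rule integrable_continuous_real[OF assms(2)])
  have "f integrable_on {y..y+d}" "f integrable_on {y-d..y}"
    by (rule integrable_on_subinterval[OF i]; use assms in auto)+
  then have 1: "(f has_integral integral {y..y+d} f) {y..y+d}"
    and 2: "(f has_integral integral {y-d..y} f) {y-d..y}" by auto
  have "((\<lambda>s. f (s + y)) has_integral integral {y..y+d} f) {0..d}"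
    using has_integral_shift_real_ivl[OF 1, of y] by simp
  moreover have "((\<lambda>s. f (s + y)) has_integral integral {y-d..y} f) {-d..0}"
    using has_integral_shift_real_ivl[OF 2, of y] by simp
  from has_integral_reflect_lemma_real[OF this]
  have "((\<lambda>s. f (y - s)) has_integral integral {y-d..y} f) {0..d}" by simp
  ultimately have "((\<lambda>s. f (y + s) + f (y - s)) has_integral
      integral {y..y+d} f + integral {y-d..y} f) {0..d}"
    by (intro has_integral_add) (simp_all add: add.commute)
  moreover have "integral {y-d..y} f + integral {y..y+d} f = integral {y-d..y+d} f"
    using assms i by (intro Henstock_Kurzweil_Integration.integral_combine) auto
  ultimately show ?thesis by (simp add: add.commute)
qed

lemma norm_symmetric_integral_le:
  fixes g :: "real \<Rightarrow> 'a::banach" and w :: "real \<Rightarrow> real"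
  assumes "0 \<le> d" "continuous_on {y-d..y+d} w" "g integrable_on {0..d}"
    and "\<And>s. 0 \<le> s \<Longrightarrow> s \<le> d \<Longrightarrow> norm (g s) \<le> w (y + s) + w (y - s)"
  shows "norm (integral {0..d} g) \<le> integral {y-d..y+d} w"
  using integral_norm_bound_integral[OF assms(3) has_integral_integrable[OF has_integral_symmetric_split[OF assms(1,2)]]]
    assms(4) integral_unique[OF has_integral_symmetric_split[OF assms(1,2)]] by auto

text \<open>All estimates are made on compact subintervals of \<open>{l<..<r}\<close>; the size of
  the eigenfunctions enters only through \<open>v_norm\<close>. The bound \<open>e_ge\<close> makes
  1 / (1 + (e n)^2) summable and keeps every frequency except possibly \<open>e 0\<close> at least
  1/2.\<close>

locale eigensystem =
  fixes l r :: real and v v' :: "nat \<Rightarrow> real \<Rightarrow> real" and q :: "real \<Rightarrow> real" and e :: "nat \<Rightarrow> real"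
  assumes v_deriv: "l < x \<Longrightarrow> x < r \<Longrightarrow> (v n has_real_derivative v' n x) (at x)"
    and v'_deriv: "l < x \<Longrightarrow> x < r \<Longrightarrow> (v' n has_real_derivative (q x - (e n)\<^sup>2) * v n x) (at x)"
    and q_cont: "continuous_on {l<..<r} q"
    and e_ge: "real n / 2 \<le> e n"
    and v_norm: "l < a \<Longrightarrow> a \<le> b \<Longrightarrow> b < r \<Longrightarrow> integral {a..b} (\<lambda>x. (v n x)\<^sup>2) \<le> 1"
begin

lemma e_nonneg: "0 \<le> e n"
  using e_ge[of n] by (smt (verit) divide_nonneg_nonneg of_nat_0_le_iff)

lemma v_continuous_on: "S \<subseteq> {l<..<r} \<Longrightarrow> continuous_on S (v n)"
  by (meson DERIV_isCont continuous_at_imp_continuous_on greaterThanLessThan_iff subsetD v_deriv)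

lemma v'_continuous_on: "S \<subseteq> {l<..<r} \<Longrightarrow> continuous_on S (v' n)"
  by (meson DERIV_isCont continuous_at_imp_continuous_on greaterThanLessThan_iff subsetD v'_deriv)

lemma q_continuous_on: "S \<subseteq> {l<..<r} \<Longrightarrow> continuous_on S q"
  by (meson continuous_on_subset q_cont)

lemma q_bounded:
  assumes "l < a" "b < r"
  obtains Q where "Q > 0" "\<And>x. a \<le> x \<Longrightarrow> x \<le> b \<Longrightarrow> \<bar>q x\<bar> \<le> Q"
proof -
  have "compact (q ` {a..b})"
    by (intro compact_continuous_image q_continuous_on) (use assms in auto)
  then obtain Q where "Q > 0" "\<forall>y\<in>q ` {a..b}. norm y \<le> Q"
    using compact_imp_bounded bounded_pos by blast
  then show ?thesis using that[of Q] by auto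
qed

lemma integral_abs_v_le:
  assumes "l < a" "a \<le> b" "b < r"
  shows "integral {a..b} (\<lambda>x. \<bar>v n x\<bar>) \<le> (b - a) + 1"
proof -
  have c: "continuous_on {a..b} (v n)" by (rule v_continuous_on) (use assms in auto)
  have "integral {a..b} (\<lambda>x. \<bar>v n x\<bar>) \<le> integral {a..b} (\<lambda>x. 1 + (v n x)\<^sup>2)"
  proof (rule integral_le)
    show "(\<lambda>x. \<bar>v n x\<bar>) integrable_on {a..b}" "(\<lambda>x. 1 + (v n x)\<^sup>2) integrable_on {a..b}"
      by (intro integrable_continuous_real continuous_intros c)+
    fix x
    have "0 \<le> (\<bar>v n x\<bar> - 1)\<^sup>2" by simp
    then have "2 * \<bar>v n x\<bar> \<le> 1 + (v n x)\<^sup>2"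
      unfolding power2_diff by simp
    then show "\<bar>v n x\<bar> \<le> 1 + (v n x)\<^sup>2" by simp
  qed
  also have "\<dots> = (b - a) + integral {a..b} (\<lambda>x. (v n x)\<^sup>2)"
    by (subst integral_add) (use assms in \<open>auto intro!: integrable_continuous_real continuous_intros c\<close>)
  finally show ?thesis using v_norm[OF assms, of n] by linarith
qed

lemma shifted_eigenfunction_deriv:
  assumes "l < y - t" "y + t < r" "0 \<le> s" "s \<le> t"
  shows "((\<lambda>s. v n (y+s)) has_real_derivative v' n (y+s)) (at s)"
    "((\<lambda>s. v n (y-s)) has_real_derivative - v' n (y-s)) (at s)"
    "((\<lambda>s. v' n (y+s)) has_real_derivative (q (y+s) - (e n)\<^sup>2) * v n (y+s)) (at s)"
    "((\<lambda>s. v' n (y-s)) has_real_derivative - ((q (y-s) - (e n)\<^sup>2) * v n (y-s))) (at s)"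
  using assms by (auto intro!: DERIV_shift_plus DERIV_shift_minus v_deriv v'_deriv)

text \<open>Green's identity on the symmetric interval around a point, with a test function that
  vanishes to second order at the ends, recovers the value at the centre from an average.\<close>

lemma v_bounded:
  assumes ab: "l < a" "a \<le> b" "b < r"
  obtains C where "C > 0" "\<And>n x. a \<le> x \<Longrightarrow> x \<le> b \<Longrightarrow> \<bar>v n x\<bar> \<le> C"
    "\<And>n x. a \<le> x \<Longrightarrow> x \<le> b \<Longrightarrow> \<bar>v' n x\<bar> \<le> C * (1 + e n)"
proof -
  define d where "d = min ((a - l) / 2) ((r - b) / 2)"
  have d: "d > 0" "l < a - d" "b + d < r" using ab by (auto simp: d_def min_def field_simps)
  obtain Q where Q: "Q > 0" "\<And>x. a - d \<le> x \<Longrightarrow> x \<le> b + d \<Longrightarrow> \<bar>q x\<bar> \<le> Q"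
    using q_bounded d by blast
  \<comment> \<open>The simplest cutoff that is 1 at the centre and has a double zero at
    \<open>d\<close>, so that no boundary term survives there.\<close>
  define \<eta> where "\<eta> s = (1 - s / d)\<^sup>2" for s
  define \<eta>' where "\<eta>' s = - 2 / d * (1 - s / d)" for s
  define C1 where "C1 = 2 * d + 1"
  have \<eta>: "(\<eta> has_real_derivative \<eta>' s) (at s)" "(\<eta>' has_real_derivative 2 / d\<^sup>2) (at s)" for s
    unfolding \<eta>_def \<eta>'_def using d
    by (auto intro!: derivative_eq_intros simp: field_simps power2_eq_square)
  have c\<eta>: "continuous_on S \<eta>" "continuous_on S \<eta>'" for S
    by (meson \<eta> DERIV_isCont continuous_at_imp_continuous_on)+
  have b\<eta>: "\<bar>\<eta> s\<bar> \<le> 1" "\<bar>\<eta>' s\<bar> \<le> 2 / d" if "0 \<le> s" "s \<le> d" for s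
  proof -
    have *: "0 \<le> 1 - s / d" "1 - s / d \<le> 1" using that d by (auto simp: field_simps)
    then show "\<bar>\<eta> s\<bar> \<le> 1" by (simp add: \<eta>_def power_le_one)
    have "\<bar>\<eta>' s\<bar> = 2 / d * (1 - s / d)" using d abs_of_nonneg[OF *(1)] unfolding \<eta>'_def abs_mult by simp
    also have "\<dots> \<le> 2 / d * 1" using * d by (intro mult_left_mono) auto
    finally show "\<bar>\<eta>' s\<bar> \<le> 2 / d" by simp
  qed
  have \<eta>0: "\<eta> 0 = 1" "\<eta> d = 0" "\<eta>' d = 0" using d by (auto simp: \<eta>_def \<eta>'_def)
  have sub: "{y-d..y+d} \<subseteq> {l<..<r}" if "a \<le> y" "y \<le> b" for y using that d by auto
  have int: "integral {y-d..y+d} (\<lambda>x. \<bar>v n x\<bar>) \<le> C1" if "a \<le> y" "y \<le> b" for n y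
    using integral_abs_v_le[of "y-d" "y+d" n] d that by (simp add: C1_def)
  define K where "K = 2 * Q + 4 / d\<^sup>2 + 4 / d"
  have K: "K > 0" using Q d by (simp add: K_def add_pos_pos)
  have vb: "\<bar>v n y\<bar> \<le> K * C1" if n: "n \<ge> 1" and y: "a \<le> y" "y \<le> b" for n y
  proof -
    have e: "e n \<ge> 1/2" using e_ge[of n] n by (smt (verit) divide_right_mono of_nat_1 of_nat_mono)
    define E where "E = e n"
    have E: "E \<ge> 1/2" using e by (simp add: E_def)
    define V where "V s = v n (y+s) + v n (y-s)" for s
    define V' where "V' s = v' n (y+s) - v' n (y-s)" for s
    define V'' where "V'' s = (q (y+s) - E\<^sup>2) * v n (y+s) + (q (y-s) - E\<^sup>2) * v n (y-s)" for s
    \<comment> \<open>Here \<open>b 0 = 0\<close> and \<open>b' 0 = 1\<close>, so the boundary term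
      at 0 is \<open>V 0\<close>, twice the value sought. Up to derivatives of the cutoff, b'' = -
      E^2 b; the terms with E^2 cancel in Green's identity and what is left is bounded independently
      of \<open>n\<close>. The division by \<open>E\<close> is the reason for
      \<open>n \<ge> 1\<close>.\<close>
    define b where "b s = \<eta> s * (sin (E * s) / E)" for s
    define b' where "b' s = \<eta>' s * (sin (E * s) / E) + \<eta> s * cos (E * s)" for s
    define b'' where "b'' s = 2 / d\<^sup>2 * (sin (E * s) / E) + 2 * \<eta>' s * cos (E * s) - E\<^sup>2 * \<eta> s * (sin (E * s) / E)" for s
    have "((\<lambda>s. V'' s *\<^sub>R b s - V s *\<^sub>R b'' s) has_integral
        (V' d *\<^sub>R b d - V d *\<^sub>R b' d) - (V' 0 *\<^sub>R b 0 - V 0 *\<^sub>R b' 0)) {0..d}"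
    proof (rule green_identity)
      show "0 \<le> d" using d by simp
      have sh: "l < y - d" "y + d < r" using y d by auto
      note sh = shifted_eigenfunction_deriv[OF sh]
      have V: "(V has_real_derivative V' s) (at s)" "(V' has_real_derivative V'' s) (at s)"
        if "0 \<le> s" "s \<le> d" for s
        unfolding V_def V'_def V''_def E_def
        by (rule derivative_eq_intros sh that refl | simp add: algebra_simps)+
      then show "continuous_on {0..d} V" "continuous_on {0..d} V'"
        by (meson DERIV_isCont atLeastAtMost_iff continuous_at_imp_continuous_on)+
      show "(V has_real_derivative V' s) (at s)" "(V' has_real_derivative V'' s) (at s)"
        if "0 < s" "s < d" for s using V[of s] that by auto
      have sd: "((\<lambda>s. sin (E * s) / E) has_real_derivative cos (E * s)) (at s)"
        "((\<lambda>s. cos (E * s)) has_real_derivative - (E\<^sup>2 * (sin (E * s) / E))) (at s)" for s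
        using E by (auto intro!: derivative_eq_intros simp: power2_eq_square)
      have b: "(b has_real_derivative b' s) (at s)" "(b' has_real_derivative b'' s) (at s)" for s
        unfolding b_def b'_def b''_def
        by (rule derivative_eq_intros \<eta> sd refl | simp add: algebra_simps)+
      then show "continuous_on {0..d} b" "continuous_on {0..d} b'"
        by (meson DERIV_isCont continuous_at_imp_continuous_on)+
      show "(b has_vector_derivative b' s) (at s)" "(b' has_vector_derivative b'' s) (at s)" for s
        using b by (simp_all add: has_real_derivative_iff_has_vector_derivative)
    qed
    moreover have "(V' d *\<^sub>R b d - V d *\<^sub>R b' d) - (V' 0 *\<^sub>R b 0 - V 0 *\<^sub>R b' 0) = 2 * v n y"
      by (simp add: b_def b'_def \<eta>0 V_def)
    ultimately have hi: "((\<lambda>s. V'' s * b s - V s * b'' s) has_integral 2 * v n y) {0..d}" by simp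
    have "norm (integral {0..d} (\<lambda>s. V'' s * b s - V s * b'' s))
        \<le> integral {y-d..y+d} (\<lambda>x. K * \<bar>v n x\<bar>)"
    proof (rule norm_symmetric_integral_le)
      show "0 \<le> d" using d by simp
      show "continuous_on {y-d..y+d} (\<lambda>x. K * \<bar>v n x\<bar>)"
        by (intro continuous_intros v_continuous_on sub y)
      show "(\<lambda>s. V'' s * b s - V s * b'' s) integrable_on {0..d}" using hi by blast
      fix s assume s: "0 \<le> s" "s \<le> d"
      have sin: "\<bar>sin (E * s) / E\<bar> \<le> 2"
      proof -
        have "\<bar>sin (E * s)\<bar> \<le> 2 * E" using E abs_sin_le_one[of "E * s"] by linarith
        then show ?thesis using E by (simp add: abs_divide divide_le_eq)
      qed
      have bb: "\<bar>b s\<bar> \<le> 2" unfolding b_def abs_mult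
        using mult_mono[OF b\<eta>(1)[OF s] sin] by simp
      have F: "\<bar>2 / d\<^sup>2 * (sin (E * s) / E) + 2 * \<eta>' s * cos (E * s)\<bar> \<le> 2 / d\<^sup>2 * 2 + 2 * (2 / d) * 1"
      proof -
        have "\<bar>2 / d\<^sup>2 * (sin (E * s) / E)\<bar> \<le> 2 / d\<^sup>2 * 2"
          unfolding abs_mult using sin d by (intro mult_mono) auto
        moreover have "\<bar>2 * \<eta>' s * cos (E * s)\<bar> \<le> 2 * (2 / d) * 1"
          unfolding abs_mult using b\<eta>(2)[OF s] d by (intro mult_mono) auto
        ultimately show ?thesis by linarith
      qed
      have "V'' s * b s - V s * b'' s = v n (y+s) * (q (y+s) * b s - (2 / d\<^sup>2 * (sin (E * s) / E) + 2 * \<eta>' s * cos (E * s)))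
         + v n (y-s) * (q (y-s) * b s - (2 / d\<^sup>2 * (sin (E * s) / E) + 2 * \<eta>' s * cos (E * s)))"
        unfolding V_def V''_def b''_def b_def by (simp only: algebra_simps)
      moreover have "\<bar>q (y+s) * b s - (2 / d\<^sup>2 * (sin (E * s) / E) + 2 * \<eta>' s * cos (E * s))\<bar> \<le> K"
      proof -
        have "\<bar>q (y+s) * b s\<bar> \<le> Q * 2" unfolding abs_mult
          using Q(1) Q(2)[of "y+s"] bb s y by (intro mult_mono) auto
        then show ?thesis using F unfolding K_def by simp
      qed
      moreover have "\<bar>q (y-s) * b s - (2 / d\<^sup>2 * (sin (E * s) / E) + 2 * \<eta>' s * cos (E * s))\<bar> \<le> K"
      proof -
        have "\<bar>q (y-s) * b s\<bar> \<le> Q * 2" unfolding abs_mult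
          using Q(1) Q(2)[of "y-s"] bb s y by (intro mult_mono) auto
        then show ?thesis using F unfolding K_def by simp
      qed
      ultimately show "norm (V'' s * b s - V s * b'' s) \<le> K * \<bar>v n (y+s)\<bar> + K * \<bar>v n (y-s)\<bar>"
        by (simp only: real_norm_def abs_combination_le)
    qed
    also have "\<dots> \<le> K * C1" using int[OF y, of n] K by simp
    finally show ?thesis using integral_unique[OF hi] by (simp add: abs_mult)
  qed
  \<comment> \<open>The odd combination is paired with a cosine: now \<open>b 0 = 1\<close> and the
    boundary term is \<open>V' 0\<close>. Nothing is divided by \<open>E\<close>, so
    \<open>n = 0\<close> is included, but a derivative of the cutoff meets a factor
    \<open>E\<close>, whence \<open>1 + e n\<close>.\<close>
  have v'b: "\<bar>v' n y\<bar> \<le> (2 * Q + 4 / d\<^sup>2 + 4 / d) * (1 + e n) * C1" if y: "a \<le> y" "y \<le> b" for n y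
  proof -
    define E where "E = e n"
    have E: "E \<ge> 0" using e_nonneg by (simp add: E_def)
    define V where "V s = v n (y+s) - v n (y-s)" for s
    define V' where "V' s = v' n (y+s) + v' n (y-s)" for s
    define V'' where "V'' s = (q (y+s) - E\<^sup>2) * v n (y+s) - (q (y-s) - E\<^sup>2) * v n (y-s)" for s
    define b where "b s = \<eta> s * cos (E * s)" for s
    define b' where "b' s = \<eta>' s * cos (E * s) - \<eta> s * (E * sin (E * s))" for s
    define b'' where "b'' s = 2 / d\<^sup>2 * cos (E * s) - 2 * \<eta>' s * E * sin (E * s) - E\<^sup>2 * \<eta> s * cos (E * s)" for s
    define L where "L = K * (1 + E)"
    have "((\<lambda>s. V'' s *\<^sub>R b s - V s *\<^sub>R b'' s) has_integral
        (V' d *\<^sub>R b d - V d *\<^sub>R b' d) - (V' 0 *\<^sub>R b 0 - V 0 *\<^sub>R b' 0)) {0..d}"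
    proof (rule green_identity)
      show "0 \<le> d" using d by simp
      have sh: "l < y - d" "y + d < r" using y d by auto
      note sh = shifted_eigenfunction_deriv[OF sh]
      have V: "(V has_real_derivative V' s) (at s)" "(V' has_real_derivative V'' s) (at s)"
        if "0 \<le> s" "s \<le> d" for s
        unfolding V_def V'_def V''_def E_def
        by (rule derivative_eq_intros sh that refl | simp add: algebra_simps)+
      then show "continuous_on {0..d} V" "continuous_on {0..d} V'"
        by (meson DERIV_isCont atLeastAtMost_iff continuous_at_imp_continuous_on)+
      show "(V has_real_derivative V' s) (at s)" "(V' has_real_derivative V'' s) (at s)"
        if "0 < s" "s < d" for s using V[of s] that by auto
      have b: "(b has_real_derivative b' s) (at s)" "(b' has_real_derivative b'' s) (at s)" for s
        unfolding b_def b'_def b''_def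
        by (rule derivative_eq_intros \<eta> refl | simp add: field_simps power2_eq_square)+
      then show "continuous_on {0..d} b" "continuous_on {0..d} b'"
        by (meson DERIV_isCont continuous_at_imp_continuous_on)+
      show "(b has_vector_derivative b' s) (at s)" "(b' has_vector_derivative b'' s) (at s)" for s
        using b by (simp_all add: has_real_derivative_iff_has_vector_derivative)
    qed
    moreover have "(V' d *\<^sub>R b d - V d *\<^sub>R b' d) - (V' 0 *\<^sub>R b 0 - V 0 *\<^sub>R b' 0) = - 2 * v' n y"
      by (simp add: b_def b'_def \<eta>0 V_def V'_def)
    ultimately have hi: "((\<lambda>s. V'' s * b s - V s * b'' s) has_integral - 2 * v' n y) {0..d}" by simp
    have "norm (integral {0..d} (\<lambda>s. V'' s * b s - V s * b'' s))
        \<le> integral {y-d..y+d} (\<lambda>x. L * \<bar>v n x\<bar>)"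
    proof (rule norm_symmetric_integral_le)
      show "0 \<le> d" using d by simp
      show "continuous_on {y-d..y+d} (\<lambda>x. L * \<bar>v n x\<bar>)"
        by (intro continuous_intros v_continuous_on sub y)
      show "(\<lambda>s. V'' s * b s - V s * b'' s) integrable_on {0..d}" using hi by blast
      fix s assume s: "0 \<le> s" "s \<le> d"
      have bb: "\<bar>b s\<bar> \<le> 1" unfolding b_def abs_mult
        using mult_mono[OF b\<eta>(1)[OF s] abs_cos_le_one] by simp
      have F: "\<bar>2 / d\<^sup>2 * cos (E * s) - 2 * \<eta>' s * E * sin (E * s)\<bar> \<le> 2 / d\<^sup>2 * 1 + 2 * (2 / d) * E * 1"
      proof -
        have "\<bar>2 / d\<^sup>2 * cos (E * s)\<bar> \<le> 2 / d\<^sup>2 * 1"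
          unfolding abs_mult using d by (intro mult_mono) auto
        moreover have "\<bar>2 * \<eta>' s * E * sin (E * s)\<bar> \<le> 2 * (2 / d) * E * 1"
          unfolding abs_mult using b\<eta>(2)[OF s] d E by (intro mult_mono) auto
        ultimately show ?thesis by linarith
      qed
      have KL: "Q * 1 + (2 / d\<^sup>2 * 1 + 2 * (2 / d) * E * 1) \<le> L"
      proof -
        have *: "Q + (2 * A + 4 * (B * E)) \<le> (2 * Q + 4 * A + 4 * B) * (1 + E)"
          if "0 \<le> A" "0 \<le> B" "0 \<le> A * E" "0 \<le> B * E" "0 \<le> Q * E" "0 \<le> Q" for A B
          using that by (simp add: algebra_simps)
        show ?thesis using *[of "1 / d\<^sup>2" "1 / d"] Q d E by (simp add: L_def K_def)
      qed
      have "V'' s * b s - V s * b'' s = v n (y+s) * (q (y+s) * b s - (2 / d\<^sup>2 * cos (E * s) - 2 * \<eta>' s * E * sin (E * s)))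
         - v n (y-s) * (q (y-s) * b s - (2 / d\<^sup>2 * cos (E * s) - 2 * \<eta>' s * E * sin (E * s)))"
        unfolding V_def V''_def b''_def b_def by (simp only: algebra_simps)
      moreover have "\<bar>q (y+s) * b s - (2 / d\<^sup>2 * cos (E * s) - 2 * \<eta>' s * E * sin (E * s))\<bar> \<le> L"
      proof -
        have "\<bar>q (y+s) * b s\<bar> \<le> Q * 1" unfolding abs_mult
          using Q(1) Q(2)[of "y+s"] bb s y by (intro mult_mono) auto
        then show ?thesis using F KL by linarith
      qed
      moreover have "\<bar>q (y-s) * b s - (2 / d\<^sup>2 * cos (E * s) - 2 * \<eta>' s * E * sin (E * s))\<bar> \<le> L"
      proof -
        have "\<bar>q (y-s) * b s\<bar> \<le> Q * 1" unfolding abs_mult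
          using Q(1) Q(2)[of "y-s"] bb s y by (intro mult_mono) auto
        then show ?thesis using F KL by linarith
      qed
      ultimately show "norm (V'' s * b s - V s * b'' s) \<le> L * \<bar>v n (y+s)\<bar> + L * \<bar>v n (y-s)\<bar>"
        by (simp only: real_norm_def abs_combination_le)
    qed
    also have "\<dots> \<le> L * C1" using int[OF y, of n] K E by (simp add: L_def)
    finally show ?thesis using integral_unique[OF hi] E
      by (simp add: abs_mult L_def K_def[symmetric] E_def[symmetric])
  qed
  \<comment> \<open>Nothing keeps \<open>e 0\<close> away from zero, so index 0 is bounded by
    compactness instead of the sine kernel.\<close>
  have "bounded (v 0 ` {a..b})"
    by (intro compact_imp_bounded compact_continuous_image v_continuous_on) (use ab in auto)
  then obtain C0 where "\<forall>y\<in>v 0 ` {a..b}. norm y \<le> C0" unfolding bounded_iff by blast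
  then have C0: "\<And>x. a \<le> x \<Longrightarrow> x \<le> b \<Longrightarrow> \<bar>v 0 x\<bar> \<le> C0" by simp
  show ?thesis
  proof (rule that[of "max (K * C1) C0"])
    show "max (K * C1) C0 > 0" using K d by (simp add: C1_def less_max_iff_disj)
    show "\<bar>v n x\<bar> \<le> max (K * C1) C0" if "a \<le> x" "x \<le> b" for n x
      using vb[of n x] C0[of x] that by (cases "n = 0") auto
    show "\<bar>v' n x\<bar> \<le> max (K * C1) C0 * (1 + e n)" if "a \<le> x" "x \<le> b" for n x
    proof -
      have "\<bar>v' n x\<bar> \<le> K * C1 * (1 + e n)" using v'b[OF that, of n] by (simp add: K_def mult_ac)
      also have "\<dots> \<le> max (K * C1) C0 * (1 + e n)"
        using e_nonneg[of n] by (intro mult_right_mono) auto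
      finally show ?thesis .
    qed
  qed
qed

end

section \<open>Oscillatory moments of chains of antiderivatives\<close>

lemma series_integral_exchange:
  fixes f :: "nat \<Rightarrow> real \<Rightarrow> 'a::banach"
  assumes cont: "\<And>n. continuous_on {a..b} (f n)"
    and bound: "\<And>n x. a \<le> x \<Longrightarrow> x \<le> b \<Longrightarrow> norm (f n x) \<le> M n" and M: "summable M"
  shows series_continuous_on: "continuous_on {a..b} (\<lambda>x. \<Sum>n. f n x)"
    and integral_sums: "(\<lambda>n. integral {a..b} (f n)) sums integral {a..b} (\<lambda>x. \<Sum>n. f n x)"
proof -
  have u: "uniform_limit {a..b} (\<lambda>N x. \<Sum>n<N. f n x) (\<lambda>x. \<Sum>n. f n x) sequentially"
    using bound by (intro Weierstrass_m_test[OF _ M]) auto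
  have c: "continuous_on {a..b} (\<lambda>x. \<Sum>n<N. f n x)" for N
    by (intro continuous_intros cont)
  show "continuous_on {a..b} (\<lambda>x. \<Sum>n. f n x)"
    by (rule uniform_limit_theorem[OF _ u]) (use c in auto)
  obtain I J where I: "\<And>N. ((\<lambda>x. \<Sum>n<N. f n x) has_integral I N) {a..b}"
    and J: "((\<lambda>x. \<Sum>n. f n x) has_integral J) {a..b}" and IJ: "I \<longlonglongrightarrow> J"
    by (rule uniform_limit_integral[OF u c]) auto
  have "I = (\<lambda>N. \<Sum>n<N. integral {a..b} (f n))"
  proof
    fix N
    show "I N = (\<Sum>n<N. integral {a..b} (f n))"
      using integral_unique[OF I[of N]]
      by (simp add: integral_sum integrable_continuous_real[OF cont])
  qed
  then show "(\<lambda>n. integral {a..b} (f n)) sums integral {a..b} (\<lambda>x. \<Sum>n. f n x)"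
    using IJ integral_unique[OF J] by (simp add: sums_def)
qed

text \<open>Equivalently, \<open>c (Suc m) s\<close> is the integral of \<open>c m\<close> from
  \<open>s\<close> to \<open>d\<close>. Entry 0 is the most singular one, each increase of the index
  gains one order of smoothness, and the zeros at \<open>d\<close> remove the boundary terms in
  integrations by parts.\<close>

definition osc_chain :: "real \<Rightarrow> (nat \<Rightarrow> real \<Rightarrow> complex) \<Rightarrow> bool" where
  "osc_chain d c \<longleftrightarrow> 0 < d \<and> continuous_on {0..d} (c 0) \<and>
     (\<forall>m. c (Suc m) d = 0 \<and> (\<forall>s\<in>{0..d}. (c (Suc m) has_vector_derivative - c m s) (at s within {0..d})))"

text \<open>By parts, the moment of index \<open>Suc m\<close> is the Duhamel integral of sin (E (s
  - x)) / E against \<open>c m\<close>. Writing it as a cosine moment of the next entry avoids the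
  division by \<open>E\<close>, which may be 0 for the lowest frequency.\<close>

definition cos_moment :: "real \<Rightarrow> (nat \<Rightarrow> real \<Rightarrow> complex) \<Rightarrow> nat \<Rightarrow> real \<Rightarrow> real \<Rightarrow> complex" where
  "cos_moment d c m E x = integral {x..d} (\<lambda>s. cos (E * (s - x)) *\<^sub>R c m s)"

definition sin_moment :: "real \<Rightarrow> (nat \<Rightarrow> real \<Rightarrow> complex) \<Rightarrow> nat \<Rightarrow> real \<Rightarrow> real \<Rightarrow> complex" where
  "sin_moment d c m E x = integral {x..d} (\<lambda>s. sin (E * (s - x)) *\<^sub>R c m s)"

context
  fixes d :: real and c :: "nat \<Rightarrow> real \<Rightarrow> complex"
  assumes ch: "osc_chain d c"
begin

lemma osc_chain_pos: "0 < d" using ch by (simp add: osc_chain_def)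

lemma osc_chain_deriv:
  "0 \<le> s \<Longrightarrow> s \<le> d \<Longrightarrow> (c (Suc m) has_vector_derivative - c m s) (at s within {0..d})"
  using ch by (simp add: osc_chain_def)

lemma osc_chain_end: "c (Suc m) d = 0"
  using ch by (simp add: osc_chain_def)

lemma osc_chain_continuous: "continuous_on {0..d} (c m)"
proof (cases m)
  case 0
  then show ?thesis using ch by (simp add: osc_chain_def)
next
  case (Suc k)
  then show ?thesis
    by (auto intro!: continuous_on_vector_derivative osc_chain_deriv)
qed

lemma osc_chain_continuous_sub: "0 \<le> x \<Longrightarrow> continuous_on {x..d} (c m)"
  by (rule continuous_on_subset[OF osc_chain_continuous]) auto

lemma scaled_sin_moment:
  assumes x: "0 \<le> x" "x \<le> d"
  shows "E *\<^sub>R sin_moment d c (Suc m) E x = c (Suc m) x - cos_moment d c m E x"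
    and "E *\<^sub>R cos_moment d c (Suc m) E x = sin_moment d c m E x"
proof -
  have sub: "{x..d} \<subseteq> {0..d}" using x by auto
  have dc: "(c (Suc m) has_vector_derivative - c m s) (at s within {x..d})" if "s \<in> {x..d}" for s
    by (rule has_vector_derivative_within_subset[OF osc_chain_deriv sub]) (use that x in auto)
  have i: "(\<lambda>s. cos (E * (s - x)) *\<^sub>R c k s) integrable_on {x..d}"
     "(\<lambda>s. sin (E * (s - x)) *\<^sub>R c k s) integrable_on {x..d}" for k
    by (intro integrable_continuous_real continuous_intros osc_chain_continuous_sub x)+
  have "((\<lambda>s. - (E *\<^sub>R (sin (E * (s - x)) *\<^sub>R c (Suc m) s)) - cos (E * (s - x)) *\<^sub>R c m s)
      has_integral cos (E * (d - x)) *\<^sub>R c (Suc m) d - cos (E * (x - x)) *\<^sub>R c (Suc m) x) {x..d}"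
    by (rule fundamental_theorem_of_calculus[OF x(2)])
       (rule derivative_eq_intros dc refl | simp add: algebra_simps)+
  then have "((\<lambda>s. - (E *\<^sub>R (sin (E * (s - x)) *\<^sub>R c (Suc m) s)) - cos (E * (s - x)) *\<^sub>R c m s)
      has_integral - c (Suc m) x) {x..d}"
    by (simp add: osc_chain_end)
  moreover have "((\<lambda>s. - (E *\<^sub>R (sin (E * (s - x)) *\<^sub>R c (Suc m) s)) - cos (E * (s - x)) *\<^sub>R c m s)
      has_integral - (E *\<^sub>R sin_moment d c (Suc m) E x) - cos_moment d c m E x) {x..d}"
    unfolding sin_moment_def cos_moment_def
    by (intro has_integral_diff has_integral_neg has_integral_cmul integrable_integral i)
  ultimately have "- c (Suc m) x = - (E *\<^sub>R sin_moment d c (Suc m) E x) - cos_moment d c m E x"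
    by (rule has_integral_unique)
  then show "E *\<^sub>R sin_moment d c (Suc m) E x = c (Suc m) x - cos_moment d c m E x"
    by (simp add: algebra_simps)
  have "((\<lambda>s. E *\<^sub>R (cos (E * (s - x)) *\<^sub>R c (Suc m) s) - sin (E * (s - x)) *\<^sub>R c m s)
      has_integral sin (E * (d - x)) *\<^sub>R c (Suc m) d - sin (E * (x - x)) *\<^sub>R c (Suc m) x) {x..d}"
    by (rule fundamental_theorem_of_calculus[OF x(2)])
       (rule derivative_eq_intros dc refl | simp add: algebra_simps)+
  then have "((\<lambda>s. E *\<^sub>R (cos (E * (s - x)) *\<^sub>R c (Suc m) s) - sin (E * (s - x)) *\<^sub>R c m s)
      has_integral 0) {x..d}"
    by (simp add: osc_chain_end)
  moreover have "((\<lambda>s. E *\<^sub>R (cos (E * (s - x)) *\<^sub>R c (Suc m) s) - sin (E * (s - x)) *\<^sub>R c m s)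
      has_integral E *\<^sub>R cos_moment d c (Suc m) E x - sin_moment d c m E x) {x..d}"
    unfolding sin_moment_def cos_moment_def
    by (intro has_integral_diff has_integral_neg has_integral_cmul integrable_integral i)
  ultimately have "0 = E *\<^sub>R cos_moment d c (Suc m) E x - sin_moment d c m E x"
    by (rule has_integral_unique)
  then show "E *\<^sub>R cos_moment d c (Suc m) E x = sin_moment d c m E x" by simp
qed

text \<open>Two integrations by parts: a factor E^2 costs two entries of the chain. This is the
  source of all decay in the frequency.\<close>

lemma scaled_cos_moment:
  assumes "0 \<le> x" "x \<le> d"
  shows "E\<^sup>2 *\<^sub>R cos_moment d c (Suc (Suc m)) E x = c (Suc m) x - cos_moment d c m E x"
  using scaled_sin_moment[OF assms, of E] by (metis power2_eq_square scaleR_scaleR)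

lemma cos_moment_end: "cos_moment d c m E d = 0"
  by (simp add: cos_moment_def)

text \<open>The variable sits both in the limit of integration and in the oscillating factor. The
  addition formulas take it out of the latter, so only integrals with a moving limit have to be
  differentiated.\<close>

lemma cos_moment_deriv_gen:
  assumes x: "0 \<le> x" "x \<le> d"
  shows "(cos_moment d c m E has_vector_derivative E *\<^sub>R sin_moment d c m E x - c m x) (at x within {0..d})"
proof -
  define A where "A x = integral {x..d} (\<lambda>s. cos (E * s) *\<^sub>R c m s)" for x
  define B where "B x = integral {x..d} (\<lambda>s. sin (E * s) *\<^sub>R c m s)" for x
  have i: "(\<lambda>s. cos (E * s) *\<^sub>R c m s) integrable_on {x..d}"
     "(\<lambda>s. sin (E * s) *\<^sub>R c m s) integrable_on {x..d}" if "0 \<le> x" for x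
    by (intro integrable_continuous_real continuous_intros osc_chain_continuous_sub that)+
  have cm: "cos_moment d c m E y = cos (E * y) *\<^sub>R A y + sin (E * y) *\<^sub>R B y" if "0 \<le> y" for y
  proof -
    have "cos_moment d c m E y = integral {y..d} (\<lambda>s. cos (E * y) *\<^sub>R (cos (E * s) *\<^sub>R c m s)
        + sin (E * y) *\<^sub>R (sin (E * s) *\<^sub>R c m s))"
      unfolding cos_moment_def by (simp add: right_diff_distrib cos_diff scaleR_add_left mult_ac)
    also have "\<dots> = cos (E * y) *\<^sub>R A y + sin (E * y) *\<^sub>R B y"
      unfolding A_def B_def integral_cmul[symmetric]
      by (intro integral_add integrable_cmul i that)
    finally show ?thesis .
  qed
  have sm: "sin_moment d c m E y = cos (E * y) *\<^sub>R B y - sin (E * y) *\<^sub>R A y" if "0 \<le> y" for y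
  proof -
    have "sin_moment d c m E y = integral {y..d} (\<lambda>s. cos (E * y) *\<^sub>R (sin (E * s) *\<^sub>R c m s)
        - sin (E * y) *\<^sub>R (cos (E * s) *\<^sub>R c m s))"
      unfolding sin_moment_def by (simp add: right_diff_distrib sin_diff scaleR_diff_left mult_ac)
    also have "\<dots> = cos (E * y) *\<^sub>R B y - sin (E * y) *\<^sub>R A y"
      unfolding A_def B_def integral_cmul[symmetric]
      by (intro integral_diff integrable_cmul i that)
    finally show ?thesis .
  qed
  have lower: "((\<lambda>x. integral {x..d} f) has_vector_derivative - f x) (at x within {0..d})"
    if f: "continuous_on {0..d} f" for f :: "real \<Rightarrow> complex"
  proof -
    have "((\<lambda>x. integral {0..d} f - integral {0..x} f) has_vector_derivative 0 - f x) (at x within {0..d})"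
      by (intro derivative_intros integral_has_vector_derivative f) (use x in auto)
    moreover have "integral {0..d} f - integral {0..y} f = integral {y..d} f" if "y \<in> {0..d}" for y
      using Henstock_Kurzweil_Integration.integral_combine[of 0 y d f] that
        integrable_continuous_real[OF f] by (simp add: algebra_simps)
    ultimately show ?thesis
      using x by (auto intro: has_vector_derivative_transform[rotated 2])
  qed
  have "continuous_on {0..d} (\<lambda>s. cos (E * s) *\<^sub>R c m s)" "continuous_on {0..d} (\<lambda>s. sin (E * s) *\<^sub>R c m s)"
    by (intro continuous_intros osc_chain_continuous)+
  from this[THEN lower] have
    AB: "(A has_vector_derivative - (cos (E * x) *\<^sub>R c m x)) (at x within {0..d})"
    "(B has_vector_derivative - (sin (E * x) *\<^sub>R c m x)) (at x within {0..d})"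
    unfolding A_def B_def by auto
  have "((\<lambda>y. cos (E * y) *\<^sub>R A y + sin (E * y) *\<^sub>R B y) has_vector_derivative
      E *\<^sub>R (cos (E * x) *\<^sub>R B x - sin (E * x) *\<^sub>R A x) - (cos (E * x) *\<^sub>R cos (E * x) *\<^sub>R c m x + sin (E * x) *\<^sub>R sin (E * x) *\<^sub>R c m x)) (at x within {0..d})"
    by (rule derivative_eq_intros AB refl | simp add: algebra_simps)+
  moreover have "cos (E * x) *\<^sub>R cos (E * x) *\<^sub>R c m x + sin (E * x) *\<^sub>R sin (E * x) *\<^sub>R c m x = c m x"
    unfolding scaleR_scaleR scaleR_add_left[symmetric] power2_eq_square[symmetric] by simp
  ultimately have "((\<lambda>y. cos (E * y) *\<^sub>R A y + sin (E * y) *\<^sub>R B y) has_vector_derivative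
      E *\<^sub>R sin_moment d c m E x - c m x) (at x within {0..d})"
    using sm x by simp
  then show ?thesis
    by (rule has_vector_derivative_transform[rotated 2]) (use x cm in auto)
qed

lemma cos_moment_deriv:
  assumes "0 \<le> x" "x \<le> d"
  shows "(cos_moment d c (Suc m) E has_vector_derivative - cos_moment d c m E x) (at x within {0..d})"
  using cos_moment_deriv_gen[OF assms, of "Suc m" E] scaled_sin_moment(1)[OF assms, of E m] by simp

lemma cos_moment_deriv2:
  assumes "0 \<le> x" "x \<le> d"
  shows "(cos_moment d c m E has_vector_derivative E\<^sup>2 *\<^sub>R cos_moment d c (Suc m) E x - c m x) (at x within {0..d})"
  using cos_moment_deriv_gen[OF assms, of m E] scaled_sin_moment(2)[OF assms, of E m, symmetric]
  by (simp add: power2_eq_square)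

lemma cos_moment_continuous: "continuous_on {0..d} (cos_moment d c m E)"
  by (auto intro!: continuous_on_vector_derivative cos_moment_deriv_gen)

lemma norm_cos_moment_le:
  assumes "0 \<le> x" "x \<le> d" "\<And>s. x \<le> s \<Longrightarrow> s \<le> d \<Longrightarrow> norm (c m s) \<le> g s" "g integrable_on {x..d}"
  shows "norm (cos_moment d c m E x) \<le> integral {x..d} g"
  unfolding cos_moment_def
proof (rule integral_norm_bound_integral)
  show "(\<lambda>s. cos (E * (s - x)) *\<^sub>R c m s) integrable_on {x..d}"
    by (intro integrable_continuous_real continuous_intros osc_chain_continuous_sub assms)
  fix s assume "s \<in> {x..d}"
  then have "norm (c m s) \<le> g s" using assms by auto
  then show "norm (cos (E * (s - x)) *\<^sub>R c m s) \<le> g s"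
    using mult_mono[OF abs_cos_le_one, of "norm (c m s)" "g s" "E * (s - x)"] by simp
qed (use assms in auto)

text \<open>\<open>B0\<close> and \<open>B1\<close> handle large \<open>E\<close> through the double
  integration by parts, \<open>B2\<close> handles \<open>E\<close> near 0; their sum serves all
  \<open>E\<close> at once.\<close>

lemma norm_cos_moment_decay:
  assumes "0 \<le> x" "x \<le> d" "norm (cos_moment d c m E x) \<le> B0" "norm (c (Suc m) x) \<le> B1"
    "norm (cos_moment d c (Suc (Suc m)) E x) \<le> B2"
  shows "norm (cos_moment d c (Suc (Suc m)) E x) \<le> (B0 + B1 + B2) / (1 + E\<^sup>2)"
proof -
  have "E\<^sup>2 * norm (cos_moment d c (Suc (Suc m)) E x) \<le> B0 + B1"
    using arg_cong[OF scaled_cos_moment[OF assms(1,2), of E m], of norm]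
      norm_triangle_ineq4[of "c (Suc m) x" "cos_moment d c m E x"] assms by simp
  then have "(1 + E\<^sup>2) * norm (cos_moment d c (Suc (Suc m)) E x) \<le> B0 + B1 + B2"
    using assms(5) by (simp add: algebra_simps)
  moreover have "1 + E\<^sup>2 > 0" by (smt (verit) zero_le_power2)
  ultimately show ?thesis by (simp add: field_simps)
qed

lemma cos_moment_summable_bound:
  obtains M where "M \<ge> 0" "\<And>x E. 0 \<le> x \<Longrightarrow> x \<le> d \<Longrightarrow> norm (cos_moment d c (Suc (Suc m)) E x) \<le> M / (1 + E\<^sup>2)"
proof -
  have "\<exists>B\<ge>0. \<forall>s\<in>{0..d}. norm (c k s) \<le> B" for k
  proof -
    have "bounded (c k ` {0..d})"
      by (intro compact_imp_bounded compact_continuous_image osc_chain_continuous) auto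
    then obtain B where "B > 0" "\<forall>y\<in>c k ` {0..d}. norm y \<le> B" unfolding bounded_pos by auto
    then show ?thesis by (intro exI[of _ B]) auto
  qed
  then obtain B where B: "\<And>k. B k \<ge> 0" "\<And>k s. 0 \<le> s \<Longrightarrow> s \<le> d \<Longrightarrow> norm (c k s) \<le> B k"
    by (metis atLeastAtMost_iff)
  have cb: "norm (cos_moment d c k E x) \<le> d * B k" if "0 \<le> x" "x \<le> d" for k E x
  proof -
    have "norm (cos_moment d c k E x) \<le> integral {x..d} (\<lambda>_. B k)"
      by (rule norm_cos_moment_le) (use that B in auto)
    also have "\<dots> = (d - x) * B k" using that by simp
    also have "\<dots> \<le> d * B k" using that B by (intro mult_right_mono) auto
    finally show ?thesis .
  qed
  show ?thesis
    by (rule that[OF _ norm_cos_moment_decay[OF _ _ cb B(2) cb]])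
      (use B osc_chain_pos in \<open>auto intro!: add_nonneg_nonneg mult_nonneg_nonneg simp: less_imp_le\<close>)
qed

end

context eigensystem
begin

lemma inverse_energy_summable: "summable (\<lambda>n. M / (1 + (e n)\<^sup>2))"
proof -
  have "summable (\<lambda>n. \<bar>M\<bar> * 4 * (1 / (real (Suc n))\<^sup>2))"
    using summable_Suc_iff[of "\<lambda>n. inverse (real n ^ 2)"] inverse_power_summable[of 2]
    by (intro summable_mult) (simp add: field_simps)
  then have "summable (\<lambda>n. M / (1 + (e (Suc n))\<^sup>2))"
  proof (rule summable_comparison_test'[where N=0])
    fix n
    have "(real (Suc n) / 2)\<^sup>2 \<le> (e (Suc n))\<^sup>2"
      by (intro power_mono e_ge) simp
    then have "(real (Suc n))\<^sup>2 \<le> 4 * (1 + (e (Suc n))\<^sup>2)"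
      by (simp add: power_divide)
    moreover have "0 < (real (Suc n))\<^sup>2" by simp
    moreover have "1 + (e (Suc n))\<^sup>2 > 0" by (smt (verit) zero_le_power2)
    ultimately have "1 / (1 + (e (Suc n))\<^sup>2) \<le> 4 / (real (Suc n))\<^sup>2"
      by (simp add: field_simps)
    then have "\<bar>M\<bar> * (1 / (1 + (e (Suc n))\<^sup>2)) \<le> \<bar>M\<bar> * (4 / (real (Suc n))\<^sup>2)"
      by (intro mult_left_mono) auto
    then show "norm (M / (1 + (e (Suc n))\<^sup>2)) \<le> \<bar>M\<bar> * 4 * (1 / (real (Suc n))\<^sup>2)"
      using \<open>1 + (e (Suc n))\<^sup>2 > 0\<close> by (simp add: abs_divide)
  qed
  then show ?thesis by (subst (asm) summable_Suc_iff)
qed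

text \<open>The function \<open>cos_moment d c (Suc m) (e n)\<close> solves the oscillator equation with right-hand
  side \<open>c m\<close> and vanishing data at \<open>d\<close>; both identities are Green's identity for it.\<close>

lemma mean_value_identity:
  assumes ch: "osc_chain d c" and x: "0 \<le> x" "x \<le> d" and y: "l < y - (d - x)" "y + (d - x) < r"
  shows "((\<lambda>s. (v n (y+s) + v n (y-s)) *\<^sub>R c m (x+s)
        - (q (y+s) * v n (y+s) + q (y-s) * v n (y-s)) *\<^sub>R cos_moment d c (Suc m) (e n) (x+s))
      has_integral (2 * v n y) *\<^sub>R cos_moment d c m (e n) x) {0..d-x}"
    and "((\<lambda>s. (v n (y+s) - v n (y-s)) *\<^sub>R c m (x+s)
        - (q (y+s) * v n (y+s) - q (y-s) * v n (y-s)) *\<^sub>R cos_moment d c (Suc m) (e n) (x+s))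
      has_integral (2 * v' n y) *\<^sub>R cos_moment d c (Suc m) (e n) x) {0..d-x}"
proof -
  define E where "E = e n"
  define b where "b s = cos_moment d c (Suc m) E (x+s)" for s
  define b' where "b' s = - cos_moment d c m E (x+s)" for s
  define b'' where "b'' s = c m (x+s) - E\<^sup>2 *\<^sub>R cos_moment d c (Suc m) E (x+s)" for s
  have cont: "continuous_on {0..d-x} b" "continuous_on {0..d-x} b'"
    unfolding b_def b'_def
    by (intro continuous_intros continuous_on_compose2[OF cos_moment_continuous[OF ch]]; use x in force)+
  have der: "(b has_vector_derivative b' s) (at s)" "(b' has_vector_derivative b'' s) (at s)"
    if s: "0 < s" "s < d - x" for s
  proof -
    have at: "at (x+s) within {0..d} = at (x+s)" using s x by (intro at_within_Icc_at) auto
    have sh: "((+) x has_vector_derivative 1) (at s)"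
      by (auto intro!: derivative_eq_intros simp: has_real_derivative_iff_has_vector_derivative[symmetric])
    have "((cos_moment d c (Suc m) E \<circ> (+) x) has_vector_derivative 1 *\<^sub>R (- cos_moment d c m E (x+s))) (at s)"
      by (rule vector_diff_chain_at[OF sh]) (use cos_moment_deriv[OF ch, of "x+s" m E] s x at in simp)
    moreover have "b = cos_moment d c (Suc m) E \<circ> (+) x" by (auto simp: b_def)
    ultimately show "(b has_vector_derivative b' s) (at s)" by (simp add: b'_def)
    have "((cos_moment d c m E \<circ> (+) x) has_vector_derivative
         1 *\<^sub>R (E\<^sup>2 *\<^sub>R cos_moment d c (Suc m) E (x+s) - c m (x+s))) (at s)"
      by (rule vector_diff_chain_at[OF sh]) (use cos_moment_deriv2[OF ch, of "x+s" m E] s x at in simp)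
    from has_vector_derivative_minus[OF this]
    have "((\<lambda>s. - (cos_moment d c m E \<circ> (+) x) s) has_vector_derivative b'' s) (at s)"
      by (simp add: b''_def)
    moreover have "b' = (\<lambda>s. - (cos_moment d c m E \<circ> (+) x) s)" by (auto simp: b'_def)
    ultimately show "(b' has_vector_derivative b'' s) (at s)" by simp
  qed
  have end0: "b (d-x) = 0" "b' (d-x) = 0"
    using x cos_moment_end by (simp_all add: b_def b'_def cos_moment_def)
  note sh = shifted_eigenfunction_deriv[OF y]
  define V where "V s = v n (y+s) + v n (y-s)" for s
  define V' where "V' s = v' n (y+s) - v' n (y-s)" for s
  define V'' where "V'' s = (q (y+s) - E\<^sup>2) * v n (y+s) + (q (y-s) - E\<^sup>2) * v n (y-s)" for s
  have V: "(V has_real_derivative V' s) (at s)" "(V' has_real_derivative V'' s) (at s)"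
    if "0 \<le> s" "s \<le> d-x" for s
    unfolding V_def V'_def V''_def E_def
    by (rule derivative_eq_intros sh[OF that] refl | simp)+
  have "((\<lambda>s. V'' s *\<^sub>R b s - V s *\<^sub>R b'' s) has_integral
        (V' (d-x) *\<^sub>R b (d-x) - V (d-x) *\<^sub>R b' (d-x)) - (V' 0 *\<^sub>R b 0 - V 0 *\<^sub>R b' 0)) {0..d-x}"
    using x V by (intro green_identity cont der)
      (auto intro!: continuous_at_imp_continuous_on DERIV_isCont[OF V(1)] DERIV_isCont[OF V(2)])
  from has_integral_neg[OF this]
  have "((\<lambda>s. V s *\<^sub>R b'' s - V'' s *\<^sub>R b s) has_integral (2 * v n y) *\<^sub>R cos_moment d c m (e n) x) {0..d-x}"
    by (simp only: end0 minus_diff_eq) (simp add: b'_def V_def V'_def E_def)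
  moreover have "V s *\<^sub>R b'' s - V'' s *\<^sub>R b s = (v n (y+s) + v n (y-s)) *\<^sub>R c m (x+s)
      - (q (y+s) * v n (y+s) + q (y-s) * v n (y-s)) *\<^sub>R cos_moment d c (Suc m) (e n) (x+s)" for s
    by (simp add: V_def V''_def b''_def b_def E_def algebra_simps)
  ultimately show "((\<lambda>s. (v n (y+s) + v n (y-s)) *\<^sub>R c m (x+s)
        - (q (y+s) * v n (y+s) + q (y-s) * v n (y-s)) *\<^sub>R cos_moment d c (Suc m) (e n) (x+s))
      has_integral (2 * v n y) *\<^sub>R cos_moment d c m (e n) x) {0..d-x}" by simp
  \<comment> \<open>The odd combination vanishes at the centre, so \<open>b 0\<close> survives there
    instead of \<open>b' 0\<close>: this is why \<open>v'\<close> is paired with the moment of index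
    \<open>Suc m\<close> and \<open>v\<close> with that of index \<open>m\<close>.\<close>
  define W where "W s = v n (y+s) - v n (y-s)" for s
  define W' where "W' s = v' n (y+s) + v' n (y-s)" for s
  define W'' where "W'' s = (q (y+s) - E\<^sup>2) * v n (y+s) - (q (y-s) - E\<^sup>2) * v n (y-s)" for s
  have W: "(W has_real_derivative W' s) (at s)" "(W' has_real_derivative W'' s) (at s)"
    if "0 \<le> s" "s \<le> d-x" for s
    unfolding W_def W'_def W''_def E_def
    by (rule derivative_eq_intros sh[OF that] refl | simp)+
  have "((\<lambda>s. W'' s *\<^sub>R b s - W s *\<^sub>R b'' s) has_integral
        (W' (d-x) *\<^sub>R b (d-x) - W (d-x) *\<^sub>R b' (d-x)) - (W' 0 *\<^sub>R b 0 - W 0 *\<^sub>R b' 0)) {0..d-x}"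
    using x W by (intro green_identity cont der)
      (auto intro!: continuous_at_imp_continuous_on DERIV_isCont[OF W(1)] DERIV_isCont[OF W(2)])
  from has_integral_neg[OF this]
  have "((\<lambda>s. W s *\<^sub>R b'' s - W'' s *\<^sub>R b s) has_integral (2 * v' n y) *\<^sub>R cos_moment d c (Suc m) (e n) x) {0..d-x}"
    by (simp only: end0 minus_diff_eq) (simp add: b_def W_def W'_def E_def)
  moreover have "W s *\<^sub>R b'' s - W'' s *\<^sub>R b s = (v n (y+s) - v n (y-s)) *\<^sub>R c m (x+s)
      - (q (y+s) * v n (y+s) - q (y-s) * v n (y-s)) *\<^sub>R cos_moment d c (Suc m) (e n) (x+s)" for s
    by (simp add: W_def W''_def b''_def b_def E_def algebra_simps)
  ultimately show "((\<lambda>s. (v n (y+s) - v n (y-s)) *\<^sub>R c m (x+s)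
        - (q (y+s) * v n (y+s) - q (y-s) * v n (y-s)) *\<^sub>R cos_moment d c (Suc m) (e n) (x+s))
      has_integral (2 * v' n y) *\<^sub>R cos_moment d c (Suc m) (e n) x) {0..d-x}" by simp
qed

end

section \<open>Completeness and pointwise expansions\<close>

text \<open>Completeness is asked for as arbitrarily long partial sums with a small error on one
  compact interval, the form in which a density argument delivers it. It suffices because the series
  to be identified converge uniformly, and their limit is then determined along any
  subsequence.\<close>

locale complete_eigensystem = eigensystem +
  assumes l2_dense: "\<And>h a b m0 \<epsilon>. l < a \<Longrightarrow> a < b \<Longrightarrow> b < r \<Longrightarrow> continuous_on UNIV h \<Longrightarrow>
      (\<And>x. x \<notin> {a..b} \<Longrightarrow> h x = 0) \<Longrightarrow> 0 < \<epsilon> \<Longrightarrow>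
      \<exists>m\<ge>m0. integral {a..b} (\<lambda>x. (h x - (\<Sum>n<m. integral {a..b} (\<lambda>y. v n y * h y) * v n x))\<^sup>2) \<le> \<epsilon>"
begin

text \<open>Summable coefficients make the series converge uniformly to a continuous
  \<open>g\<close>; mean square approximation forces the integral of (h - g)^2 to vanish, and
  continuity turns this into equality at every point.\<close>

lemma expansion_real:
  fixes h :: "real \<Rightarrow> real"
  assumes ab: "l < a" "a < b" "b < r" and h: "continuous_on UNIV h" "\<And>x. x \<notin> {a..b} \<Longrightarrow> h x = 0"
    and B: "\<And>n. \<bar>integral {a..b} (\<lambda>x. v n x * h x)\<bar> \<le> B n" "summable B" and p: "p \<in> {a..b}"
  shows "(\<lambda>n. v n p * integral {a..b} (\<lambda>x. v n x * h x)) sums h p"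
proof -
  define k where "k n = integral {a..b} (\<lambda>x. v n x * h x)" for n
  define g where "g x = (\<Sum>n. k n * v n x)" for x
  obtain C where C: "C > 0" "\<And>n x. a \<le> x \<Longrightarrow> x \<le> b \<Longrightarrow> \<bar>v n x\<bar> \<le> C"
    using v_bounded[of a b] ab by (metis less_imp_le)
  have bd: "norm (k n * v n x) \<le> B n * C" if "x \<in> {a..b}" for n x
    unfolding norm_mult using B(1)[of n] C(2)[of x n] that
    by (intro mult_mono) (auto simp: k_def intro: order_trans[OF abs_ge_zero])
  have sB: "summable (\<lambda>n. B n * C)" by (intro summable_mult2 B)
  have vc: "continuous_on {a..b} (v n)" for n by (rule v_continuous_on) (use ab in auto)
  have hc: "continuous_on {a..b} h" using h(1) by (rule continuous_on_subset) auto
  have u: "uniform_limit {a..b} (\<lambda>m x. \<Sum>n<m. k n * v n x) g sequentially"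
    unfolding g_def[abs_def] by (rule Weierstrass_m_test[OF bd sB])
  have Sc: "continuous_on {a..b} (\<lambda>x. \<Sum>n<m. k n * v n x)" for m by (intro continuous_intros vc)
  have gc: "continuous_on {a..b} g"
    by (rule uniform_limit_theorem[OF _ u]) (use Sc in auto)
  have i: "(\<lambda>x. (h x - g x)\<^sup>2) integrable_on {a..b}"
    by (intro integrable_continuous_real continuous_intros hc gc)
  have small: "integral {a..b} (\<lambda>x. (h x - g x)\<^sup>2) \<le> \<epsilon>" if "\<epsilon> > 0" for \<epsilon>
  proof -
    \<comment> \<open>Chosen so that the uniform error contributes 2 \<eta>^2 (b - a) = \<epsilon> /
      2, the other half being twice the mean square error \<epsilon> / 4.\<close>
    define \<eta> where "\<eta> = sqrt (\<epsilon> / (4 * (b - a)))"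
    have \<eta>: "\<eta> > 0" "\<eta>\<^sup>2 * (b - a) = \<epsilon> / 4" using that ab by (auto simp: \<eta>_def field_simps)
    from uniform_limitD[OF u \<eta>(1)] obtain m0 where
      m0: "\<And>m x. m \<ge> m0 \<Longrightarrow> x \<in> {a..b} \<Longrightarrow> \<bar>(\<Sum>n<m. k n * v n x) - g x\<bar> < \<eta>"
      unfolding eventually_sequentially dist_real_def by blast
    from l2_dense[OF ab h, of "\<epsilon> / 4" m0] that obtain m where
      m: "m \<ge> m0" "integral {a..b} (\<lambda>x. (h x - (\<Sum>n<m. k n * v n x))\<^sup>2) \<le> \<epsilon> / 4"
      unfolding k_def by auto
    have ii: "(\<lambda>x. (h x - (\<Sum>n<m. k n * v n x))\<^sup>2) integrable_on {a..b}"
      by (intro integrable_continuous_real continuous_intros hc vc)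
    have "integral {a..b} (\<lambda>x. (h x - g x)\<^sup>2)
        \<le> integral {a..b} (\<lambda>x. 2 * (h x - (\<Sum>n<m. k n * v n x))\<^sup>2 + 2 * \<eta>\<^sup>2)"
    proof (rule integral_le[OF i])
      show "(\<lambda>x. 2 * (h x - (\<Sum>n<m. k n * v n x))\<^sup>2 + 2 * \<eta>\<^sup>2) integrable_on {a..b}"
        by (intro integrable_continuous_real continuous_intros hc vc)
      fix x assume x: "x \<in> {a..b}"
      have "((\<Sum>n<m. k n * v n x) - g x)\<^sup>2 \<le> \<eta>\<^sup>2"
        using m0[OF m(1) x] by (intro power2_le_iff_abs_le[THEN iffD2]) auto
      moreover have "(h x - g x)\<^sup>2 \<le> 2 * (h x - (\<Sum>n<m. k n * v n x))\<^sup>2 + 2 * ((\<Sum>n<m. k n * v n x) - g x)\<^sup>2"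
        (is "(?h - ?g)\<^sup>2 \<le> 2 * (?h - ?S)\<^sup>2 + 2 * (?S - ?g)\<^sup>2")
        using zero_le_power2[of "(?h - ?S) - (?S - ?g)"] by (simp add: power2_eq_square algebra_simps)
      ultimately show "(h x - g x)\<^sup>2 \<le> 2 * (h x - (\<Sum>n<m. k n * v n x))\<^sup>2 + 2 * \<eta>\<^sup>2" by linarith
    qed
    also have "\<dots> = 2 * integral {a..b} (\<lambda>x. (h x - (\<Sum>n<m. k n * v n x))\<^sup>2) + 2 * (\<eta>\<^sup>2 * (b - a))"
      using ab ii by (subst integral_add) (auto intro!: integrable_on_cmult_left simp: mult.commute)
    also have "\<dots> \<le> \<epsilon>" using m(2) \<eta>(2) by linarith
    finally show ?thesis .
  qed
  have "integral {a..b} (\<lambda>x. (h x - g x)\<^sup>2) \<le> 0"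
    by (rule field_le_epsilon) (simp add: small)
  moreover have "0 \<le> integral {a..b} (\<lambda>x. (h x - g x)\<^sup>2)"
    by (rule integral_nonneg[OF i]) simp
  moreover have "continuous_on {a..b} (\<lambda>x. (h x - g x)\<^sup>2)" by (intro continuous_intros hc gc)
  ultimately have "(h p - g p)\<^sup>2 = 0"
    using integral_eq_0_iff[of a b "\<lambda>x. (h x - g x)\<^sup>2"] ab p by simp
  then have "h p = g p" by simp
  moreover have "summable (\<lambda>n. k n * v n p)"
    by (rule summable_comparison_test'[OF sB bd[OF p]])
  ultimately show ?thesis
    by (simp add: g_def sums_iff k_def mult.commute)
qed

lemma expansion:
  fixes h :: "real \<Rightarrow> complex"
  assumes ab: "l < a" "a < b" "b < r" and h: "continuous_on UNIV h" "\<And>x. x \<notin> {a..b} \<Longrightarrow> h x = 0"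
    and B: "\<And>n. norm (integral {a..b} (\<lambda>x. v n x *\<^sub>R h x)) \<le> B n" "summable B" and p: "p \<in> {a..b}"
  shows "(\<lambda>n. v n p *\<^sub>R integral {a..b} (\<lambda>x. v n x *\<^sub>R h x)) sums h p"
proof -
  have vc: "continuous_on {a..b} (v n)" for n by (rule v_continuous_on) (use ab in auto)
  have hc: "continuous_on {a..b} h" using h(1) by (rule continuous_on_subset) auto
  have i: "(\<lambda>x. v n x *\<^sub>R h x) integrable_on {a..b}" for n
    by (intro integrable_continuous_real continuous_intros vc hc)
  have Re: "Re (integral {a..b} (\<lambda>x. v n x *\<^sub>R h x)) = integral {a..b} (\<lambda>x. v n x * Re (h x))"
    and Im: "Im (integral {a..b} (\<lambda>x. v n x *\<^sub>R h x)) = integral {a..b} (\<lambda>x. v n x * Im (h x))" for n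
    using integral_linear[OF i[of n] bounded_linear_Re] integral_linear[OF i[of n] bounded_linear_Im]
    by (simp_all add: o_def)
  have "(\<lambda>n. v n p * integral {a..b} (\<lambda>x. v n x * Re (h x))) sums Re (h p)"
    by (rule expansion_real[OF ab _ _ _ B(2) p])
      (use h B(1) in \<open>auto intro!: continuous_intros simp flip: Re intro: order_trans[OF abs_Re_le_cmod]\<close>)
  moreover have "(\<lambda>n. v n p * integral {a..b} (\<lambda>x. v n x * Im (h x))) sums Im (h p)"
    by (rule expansion_real[OF ab _ _ _ B(2) p])
      (use h B(1) in \<open>auto intro!: continuous_intros simp flip: Im intro: order_trans[OF abs_Im_le_cmod]\<close>)
  ultimately show ?thesis by (simp add: sums_complex_iff Re Im)
qed

text \<open>Formally the integral kernel, at \<open>(y, p)\<close>, of the function E ->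
  \<open>cos_moment d c m E x\<close> of the square root of - d^2/dx^2 + q.\<close>

definition osc_kernel :: "real \<Rightarrow> (nat \<Rightarrow> real \<Rightarrow> complex) \<Rightarrow> nat \<Rightarrow> real \<Rightarrow> real \<Rightarrow> real \<Rightarrow> complex" where
  "osc_kernel d c m x y p = (\<Sum>n. (v n y * v n p) *\<^sub>R cos_moment d c m (e n) x)"

text \<open>The common core of the recursions for \<open>v\<close> and \<open>v'\<close>, with
  \<sigma> the parity of the reflection about \<open>y\<close>. When the coefficients of
  \<open>h\<close> split into a main part \<open>A\<close> and a correction by the potential,
  summation against \<open>v n p\<close> turns the correction into an integral over kernels; the
  decay of \<gamma> permits exchanging sum and integral.\<close>

lemma expansion_exchange:
  fixes h :: "real \<Rightarrow> complex" and \<gamma> :: "nat \<Rightarrow> real \<Rightarrow> complex"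
  assumes ab: "l < a" "a < b" "b < r" and h: "continuous_on UNIV h" "\<And>x. x \<notin> {a..b} \<Longrightarrow> h x = 0"
    and p: "p \<in> {a..b}" and D: "0 \<le> D" "a \<le> y - D" "y + D \<le> b"
    and \<gamma>: "\<And>n. continuous_on {0..D} (\<gamma> n)" "\<And>n s. 0 \<le> s \<Longrightarrow> s \<le> D \<Longrightarrow> norm (\<gamma> n s) \<le> M / (1 + (e n)\<^sup>2)"
    and A: "\<And>n. norm (A n) \<le> B / (1 + (e n)\<^sup>2)" and \<sigma>: "\<bar>\<sigma>\<bar> \<le> (1::real)"
    and coeff: "\<And>n. integral {a..b} (\<lambda>x. v n x *\<^sub>R h x) = A n + integral {0..D}
      (\<lambda>s. (q (y+s) * v n (y+s)) *\<^sub>R \<gamma> n s + (\<sigma> * (q (y-s) * v n (y-s))) *\<^sub>R \<gamma> n s)"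
  shows "continuous_on {0..D} (\<lambda>s. q (y+s) *\<^sub>R (\<Sum>n. (v n (y+s) * v n p) *\<^sub>R \<gamma> n s)
         + (\<sigma> * q (y-s)) *\<^sub>R (\<Sum>n. (v n (y-s) * v n p) *\<^sub>R \<gamma> n s))"
    and "(\<lambda>n. v n p *\<^sub>R A n) sums (h p - integral {0..D} (\<lambda>s. q (y+s) *\<^sub>R (\<Sum>n. (v n (y+s) * v n p) *\<^sub>R \<gamma> n s)
         + (\<sigma> * q (y-s)) *\<^sub>R (\<Sum>n. (v n (y-s) * v n p) *\<^sub>R \<gamma> n s)))"
proof -
  obtain C where C: "C > 0" "\<And>n x. a \<le> x \<Longrightarrow> x \<le> b \<Longrightarrow> \<bar>v n x\<bar> \<le> C"
    using v_bounded[of a b] ab by (metis less_imp_le)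
  obtain Q where Q: "Q > 0" "\<And>x. a \<le> x \<Longrightarrow> x \<le> b \<Longrightarrow> \<bar>q x\<bar> \<le> Q"
    using q_bounded[of a b] ab by blast
  define w where "w n = 1 / (1 + (e n)\<^sup>2)" for n
  have w0: "w n \<ge> 0" for n by (simp add: w_def add_nonneg_nonneg)
  have sw: "summable (\<lambda>n. K * w n)" for K
    using inverse_energy_summable[of K] by (simp add: w_def)
  have M0: "M \<ge> 0"
  proof -
    have "0 \<le> M / (1 + (e 0)\<^sup>2)" using order_trans[OF norm_ge_zero \<gamma>(2)[of 0 0]] D(1) by simp
    moreover have "1 + (e 0)\<^sup>2 > 0" by (smt (verit) zero_le_power2)
    ultimately show ?thesis by (simp add: zero_le_divide_iff)
  qed
  define F where "F n s = (q (y+s) * v n (y+s)) *\<^sub>R \<gamma> n s + (\<sigma> * (q (y-s) * v n (y-s))) *\<^sub>R \<gamma> n s" for n s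
  have cv: "continuous_on {0..D} (\<lambda>s. v n (y+s))" "continuous_on {0..D} (\<lambda>s. v n (y-s))"
    "continuous_on {0..D} (\<lambda>s. q (y+s))" "continuous_on {0..D} (\<lambda>s. q (y-s))" for n
    by (intro continuous_on_compose2[OF v_continuous_on[of "{a..b}"]]
       continuous_on_compose2[OF q_continuous_on[of "{a..b}"]] continuous_intros;
       use ab D in force)+
  have cF: "continuous_on {0..D} (F n)" for n
    unfolding F_def by (intro continuous_intros cv \<gamma>)
  have bq: "norm ((v n u * v n p) *\<^sub>R \<gamma> n s) \<le> C * C * M * w n" "\<bar>q u * v n u\<bar> \<le> Q * C"
    if "u \<in> {a..b}" "0 \<le> s" "s \<le> D" for n u s
  proof -
    have "\<bar>v n u * v n p\<bar> \<le> C * C" unfolding abs_mult using C that p by (intro mult_mono) auto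
    then have "\<bar>v n u * v n p\<bar> * norm (\<gamma> n s) \<le> (C * C) * (M / (1 + (e n)\<^sup>2))"
      using \<gamma>(2)[OF that(2,3), of n] by (intro mult_mono) auto
    then show "norm ((v n u * v n p) *\<^sub>R \<gamma> n s) \<le> C * C * M * w n" by (simp add: w_def)
    show "\<bar>q u * v n u\<bar> \<le> Q * C" unfolding abs_mult using C Q that by (intro mult_mono) auto
  qed
  have bF: "norm (F n s) \<le> 2 * Q * C * M * w n" if "0 \<le> s" "s \<le> D" for n s
  proof -
    have u: "y + s \<in> {a..b}" "y - s \<in> {a..b}" using that D by auto
    have g: "norm (\<gamma> n s) \<le> M * w n" using \<gamma>(2)[OF that, of n] by (simp add: w_def)
    have "norm ((q (y+s) * v n (y+s)) *\<^sub>R \<gamma> n s) \<le> (Q * C) * (M * w n)"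
      unfolding norm_scaleR using bq(2)[OF u(1) that, of n] g by (intro mult_mono) auto
    moreover have "norm ((\<sigma> * (q (y-s) * v n (y-s))) *\<^sub>R \<gamma> n s) \<le> (1 * (Q * C)) * (M * w n)"
      unfolding norm_scaleR abs_mult[of \<sigma>] using bq(2)[OF u(2) that, of n] g \<sigma> C Q
      by (intro mult_mono) auto
    ultimately show ?thesis unfolding F_def
      using norm_triangle_ineq[of "(q (y+s) * v n (y+s)) *\<^sub>R \<gamma> n s" "(\<sigma> * (q (y-s) * v n (y-s))) *\<^sub>R \<gamma> n s"]
      by (simp add: algebra_simps)
  qed
  define G where "G s = q (y+s) *\<^sub>R (\<Sum>n. (v n (y+s) * v n p) *\<^sub>R \<gamma> n s)
         + (\<sigma> * q (y-s)) *\<^sub>R (\<Sum>n. (v n (y-s) * v n p) *\<^sub>R \<gamma> n s)" for s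
  have G: "G s = (\<Sum>n. v n p *\<^sub>R F n s)" if "s \<in> {0..D}" for s
  proof -
    have s: "summable (\<lambda>n. (v n u * v n p) *\<^sub>R \<gamma> n s)" if "u \<in> {a..b}" for u
      by (rule summable_comparison_test'[OF sw bq(1)[OF that]]) (use \<open>s \<in> {0..D}\<close> in auto)
    have u: "y + s \<in> {a..b}" "y - s \<in> {a..b}" using that D by auto
    have "(\<lambda>n. q (y+s) *\<^sub>R ((v n (y+s) * v n p) *\<^sub>R \<gamma> n s)
        + (\<sigma> * q (y-s)) *\<^sub>R ((v n (y-s) * v n p) *\<^sub>R \<gamma> n s)) sums G s"
      unfolding G_def by (intro sums_add sums_scaleR_right summable_sums s u)
    moreover have "q (y+s) *\<^sub>R ((v n (y+s) * v n p) *\<^sub>R \<gamma> n s)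
        + (\<sigma> * q (y-s)) *\<^sub>R ((v n (y-s) * v n p) *\<^sub>R \<gamma> n s) = v n p *\<^sub>R F n s" for n
      by (simp add: F_def algebra_simps)
    ultimately show ?thesis by (simp add: sums_iff)
  qed
  have vF: "continuous_on {0..D} (\<lambda>s. v n p *\<^sub>R F n s)" for n by (intro continuous_intros cF)
  have bvF: "norm (v n p *\<^sub>R F n s) \<le> C * (2 * Q * C * M) * w n" if "0 \<le> s" "s \<le> D" for n s
    using mult_mono[OF C(2)[of p n] bF[OF that, of n]] C(1) p by (simp add: mult_ac)
  have "continuous_on {0..D} (\<lambda>s. \<Sum>n. v n p *\<^sub>R F n s)"
    by (rule series_continuous_on[OF vF bvF sw])
  then show "continuous_on {0..D} G" by (rule continuous_on_eq) (simp add: G)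
  have "(\<lambda>n. integral {0..D} (\<lambda>s. v n p *\<^sub>R F n s)) sums integral {0..D} (\<lambda>s. \<Sum>n. v n p *\<^sub>R F n s)"
    by (rule integral_sums[OF vF bvF sw])
  then have 1: "(\<lambda>n. v n p *\<^sub>R integral {0..D} (F n)) sums integral {0..D} G"
    using integral_cong[of "{0..D}" G "\<lambda>s. \<Sum>n. v n p *\<^sub>R F n s", OF G] by simp
  have "(\<lambda>n. v n p *\<^sub>R integral {a..b} (\<lambda>x. v n x *\<^sub>R h x)) sums h p"
  proof (rule expansion[OF ab h])
    fix n
    have "norm (integral {0..D} (F n)) \<le> integral {0..D} (\<lambda>s. 2 * Q * C * M * w n)"
      by (rule integral_norm_bound_integral) (use bF cF D in \<open>auto intro!: integrable_continuous_real\<close>)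
    also have "\<dots> = (D * (2 * Q * C * M)) * w n" using D by simp
    finally have I: "norm (integral {0..D} (F n)) \<le> (D * (2 * Q * C * M)) * w n" .
    have "norm (A n) \<le> B * w n" using A[of n] by (simp add: w_def)
    then show "norm (integral {a..b} (\<lambda>x. v n x *\<^sub>R h x)) \<le> (B + D * (2 * Q * C * M)) * w n"
      unfolding coeff F_def[symmetric] distrib_right
      by (intro order_trans[OF norm_triangle_ineq] add_mono I)
  qed (use sw p in auto)
  from sums_diff[OF this 1]
  show "(\<lambda>n. v n p *\<^sub>R A n) sums (h p - integral {0..D} G)"
    unfolding coeff F_def[symmetric] by (simp add: scaleR_add_right)
qed

lemma integral_zero_extend:
  fixes f :: "real \<Rightarrow> complex"
  assumes "a \<le> a'" "b' \<le> b" "\<And>x. x \<notin> {a'..b'} \<Longrightarrow> f x = 0" "f integrable_on {a'..b'}"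
  shows "integral {a..b} f = integral {a'..b'} f"
  using has_integral_on_superset[OF integrable_integral[OF assms(4)] assms(3), of "{a..b}"] assms(1,2)
  by (intro integral_unique) auto

lemma enclosing_interval:
  assumes "0 \<le> D" "l < y - D" "y + D < r" "l < p" "p < r"
  obtains a b where "l < a" "a < b" "b < r" "a \<le> y - D" "y + D \<le> b" "p \<in> {a..b}"
proof -
  obtain a where "l < a" "a < min (y - D) p" using dense[of l "min (y - D) p"] assms by auto
  moreover obtain b where "max (y + D) p < b" "b < r" using dense[of "max (y + D) p" r] assms by auto
  ultimately show ?thesis using that[of a b] assms by auto
qed

text \<open>The mean value identity read as a formula for the coefficients of a profile around
  \<open>y\<close>. For q = 0 it is d'Alembert's formula; the potential contributes the kernel with
  the index raised by one, hence smoother. The offset 2 in the index gives the moments the decay 1 /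
  (1 + E^2) that makes the sums converge absolutely.\<close>

lemma osc_kernel_recursion:
  assumes ch: "osc_chain d c" and x: "0 \<le> x" "x \<le> d" and y: "l < y - (d - x)" "y + (d - x) < r"
    and p: "l < p" "p < r"
  shows "continuous_on {0..d-x} (\<lambda>s. q (y+s) *\<^sub>R osc_kernel d c (m + 3) (x+s) (y+s) p
         + q (y-s) *\<^sub>R osc_kernel d c (m + 3) (x+s) (y-s) p)" (is ?cont)
    and "2 *\<^sub>R osc_kernel d c (m + 2) x y p = (if \<bar>p - y\<bar> \<le> d - x then c (m + 2) (x + \<bar>p - y\<bar>) else 0)
       - integral {0..d-x} (\<lambda>s. q (y+s) *\<^sub>R osc_kernel d c (m + 3) (x+s) (y+s) p
         + q (y-s) *\<^sub>R osc_kernel d c (m + 3) (x+s) (y-s) p)" (is ?eq)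
proof -
  define D where "D = d - x"
  have D: "0 \<le> D" "l < y - D" "y + D < r" using x y by (auto simp: D_def)
  obtain a b where ab: "l < a" "a < b" "b < r" "a \<le> y - D" "y + D \<le> b" "p \<in> {a..b}"
    using enclosing_interval[OF D p] .
  \<comment> \<open>Clamping at \<open>d\<close>, where \<open>c (m + 2)\<close> vanishes, yields
    the extension by zero in a visibly continuous form.\<close>
  define h where "h u = c (m + 2) (min d (x + \<bar>u - y\<bar>))" for u
  have h_eq: "h u = (if \<bar>u - y\<bar> \<le> D then c (m + 2) (x + \<bar>u - y\<bar>) else 0)" for u
    using osc_chain_end[OF ch, of "Suc m"] x
    by (cases "\<bar>u - y\<bar> \<le> D") (simp_all add: h_def D_def min_absorb1 min_absorb2)
  have hc: "continuous_on UNIV h" unfolding h_def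
    by (intro continuous_on_compose2[OF osc_chain_continuous[OF ch]] continuous_intros)
      (use x osc_chain_pos[OF ch] in \<open>auto simp: min_def\<close>)
  have h0: "h u = 0" if "u \<notin> {a..b}" for u using that ab by (auto simp: h_eq)
  obtain M1 where M1: "M1 \<ge> 0" "\<And>x E. 0 \<le> x \<Longrightarrow> x \<le> d \<Longrightarrow> norm (cos_moment d c (m + 2) E x) \<le> M1 / (1 + E\<^sup>2)"
    using cos_moment_summable_bound[OF ch, of m] by auto
  obtain M2 where M2: "M2 \<ge> 0" "\<And>x E. 0 \<le> x \<Longrightarrow> x \<le> d \<Longrightarrow> norm (cos_moment d c (m + 3) E x) \<le> M2 / (1 + E\<^sup>2)"
    using cos_moment_summable_bound[OF ch, of "Suc m"] by (auto simp: numeral_3_eq_3)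
  obtain C where C: "C > 0" "\<And>n x. a \<le> x \<Longrightarrow> x \<le> b \<Longrightarrow> \<bar>v n x\<bar> \<le> C"
    using v_bounded[of a b] ab by (metis less_imp_le)
  define \<gamma> where "\<gamma> n s = cos_moment d c (m + 3) (e n) (x + s)" for n s
  have \<gamma>c: "continuous_on {0..D} (\<gamma> n)" for n unfolding \<gamma>_def D_def
    by (intro continuous_on_compose2[OF cos_moment_continuous[OF ch]] continuous_intros) (use x in auto)
  have \<gamma>b: "norm (\<gamma> n s) \<le> M2 / (1 + (e n)\<^sup>2)" if "0 \<le> s" "s \<le> D" for n s
    using M2(2)[of "x + s" "e n"] that x by (simp add: \<gamma>_def D_def)
  define A where "A n = (2 * v n y) *\<^sub>R cos_moment d c (m + 2) (e n) x" for n
  have Ab: "norm (A n) \<le> (2 * C * M1) / (1 + (e n)\<^sup>2)" for n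
  proof -
    have "norm (A n) \<le> (2 * C) * (M1 / (1 + (e n)\<^sup>2))" unfolding A_def norm_scaleR
      using C(2)[of y n] M1 x ab D C(1) by (intro mult_mono) auto
    then show ?thesis by simp
  qed
  have cv: "continuous_on {0..D} (\<lambda>s. v n (y+s))" "continuous_on {0..D} (\<lambda>s. v n (y-s))"
    "continuous_on {0..D} (\<lambda>s. q (y+s))" "continuous_on {0..D} (\<lambda>s. q (y-s))" for n
    by (intro continuous_on_compose2[OF v_continuous_on[of "{a..b}"]]
       continuous_on_compose2[OF q_continuous_on[of "{a..b}"]] continuous_intros;
       use ab D in force)+
  have co: "integral {a..b} (\<lambda>x. v n x *\<^sub>R h x) = A n + integral {0..D}
      (\<lambda>s. (q (y+s) * v n (y+s)) *\<^sub>R \<gamma> n s + (1 * (q (y-s) * v n (y-s))) *\<^sub>R \<gamma> n s)" for n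
  proof -
    have c1: "continuous_on {y-D..y+D} (\<lambda>u. v n u *\<^sub>R h u)"
      by (intro continuous_intros v_continuous_on continuous_on_subset[OF hc]) (use D in auto)
    have i0: "integral {a..b} (\<lambda>u. v n u *\<^sub>R h u) = integral {y-D..y+D} (\<lambda>u. v n u *\<^sub>R h u)"
      by (rule integral_zero_extend) (use ab c1 in \<open>auto simp: h_eq intro: integrable_continuous_real\<close>)
    have i1: "((\<lambda>s. (v n (y+s) + v n (y-s)) *\<^sub>R c (m + 2) (x+s)) has_integral
        integral {y-D..y+D} (\<lambda>u. v n u *\<^sub>R h u)) {0..D}"
      by (rule has_integral_eq[OF _ has_integral_symmetric_split[OF D(1) c1]])
        (auto simp: h_eq scaleR_add_left)
    have i2: "((\<lambda>s. (v n (y+s) + v n (y-s)) *\<^sub>R c (m + 2) (x+s)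
        - (q (y+s) * v n (y+s) + q (y-s) * v n (y-s)) *\<^sub>R \<gamma> n s) has_integral A n) {0..D}"
      using mean_value_identity(1)[OF ch x y, of n "m + 2"]
      by (simp add: \<gamma>_def A_def D_def numeral_3_eq_3)
    have "((\<lambda>s. (q (y+s) * v n (y+s) + q (y-s) * v n (y-s)) *\<^sub>R \<gamma> n s) has_integral
        integral {a..b} (\<lambda>u. v n u *\<^sub>R h u) - A n) {0..D}"
      using has_integral_diff[OF i1 i2] by (simp add: i0)
    then show ?thesis by (simp add: integral_unique scaleR_add_left)
  qed
  note X = expansion_exchange[where h=h and D=D and y=y and \<gamma>=\<gamma> and A=A and \<sigma>=1,
      OF ab(1,2,3) hc h0 ab(6) D(1) ab(4,5) \<gamma>c \<gamma>b Ab _ co]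
  have K: "osc_kernel d c (m + 3) (x+s) u p = (\<Sum>n. (v n u * v n p) *\<^sub>R \<gamma> n s)" for s u
    by (simp add: osc_kernel_def \<gamma>_def)
  show ?cont using X(1) by (simp add: K D_def)
  have "(\<lambda>n. v n p *\<^sub>R A n) sums (2 *\<^sub>R osc_kernel d c (m + 2) x y p)"
  proof -
    have "summable (\<lambda>n. (v n y * v n p) *\<^sub>R cos_moment d c (m + 2) (e n) x)"
    proof (rule summable_comparison_test'[OF inverse_energy_summable])
      fix n
      have "\<bar>v n y * v n p\<bar> \<le> C * C" unfolding abs_mult
        using C ab D by (intro mult_mono) auto
      then show "norm ((v n y * v n p) *\<^sub>R cos_moment d c (m + 2) (e n) x) \<le> (C * C * M1) / (1 + (e n)\<^sup>2)"
        using mult_mono[OF _ M1(2)[OF x, of "e n"], of "\<bar>v n y * v n p\<bar>" "C * C"] by simp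
    qed
    from sums_scaleR_right[OF summable_sums[OF this], of 2] show ?thesis
      by (simp add: osc_kernel_def A_def algebra_simps)
  qed
  from sums_unique2[OF this X(2)] show ?eq
    by (simp add: K h_eq D_def)
qed

text \<open>The profile is now the odd extension of \<open>c 1\<close> about \<open>y\<close>,
  continuous because \<open>c 1 0 = 0\<close>. The general decay of moments does not cover the extra
  factor \<open>1 + e n\<close> carried by \<open>v'\<close>, so decay is a hypothesis; its constant
  \<open>B\<close> serves convergence only and may depend on the chain.\<close>

lemma osc_kernel_deriv_recursion:
  assumes ch: "osc_chain d c" and y: "l < y - d" "y + d < r"
    and p: "l < p" "p < r" and c10: "c 1 0 = 0"
    and decay: "\<And>n. norm (v' n y *\<^sub>R cos_moment d c 2 (e n) 0) \<le> B / (1 + (e n)\<^sup>2)"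
  shows "continuous_on {0..d} (\<lambda>s. q (y+s) *\<^sub>R osc_kernel d c 2 s (y+s) p
         + (- q (y-s)) *\<^sub>R osc_kernel d c 2 s (y-s) p)" (is ?cont)
    and "(\<lambda>n. (2 * v' n y * v n p) *\<^sub>R cos_moment d c 2 (e n) 0) sums
       ((if \<bar>p - y\<bar> \<le> d then sgn (p - y) *\<^sub>R c 1 \<bar>p - y\<bar> else 0)
       - integral {0..d} (\<lambda>s. q (y+s) *\<^sub>R osc_kernel d c 2 s (y+s) p
         + (- q (y-s)) *\<^sub>R osc_kernel d c 2 s (y-s) p))" (is ?eq)
proof -
  have D: "0 \<le> d" "l < y - d" "y + d < r" using osc_chain_pos[OF ch] y by auto
  obtain a b where ab: "l < a" "a < b" "b < r" "a \<le> y - d" "y + d \<le> b" "p \<in> {a..b}"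
    using enclosing_interval[OF D p] .
  define h where "h u = (if y \<le> u then c 1 (min d (u - y)) else - c 1 (min d (y - u)))" for u
  have h_eq: "h u = (if \<bar>u - y\<bar> \<le> d then sgn (u - y) *\<^sub>R c 1 \<bar>u - y\<bar> else 0)" for u
    using osc_chain_end[OF ch, of 0] c10 D(1)
    by (auto simp: h_def min_def sgn_if abs_if)
  have hc: "continuous_on UNIV h"
  proof -
    have "continuous_on ({y..} \<union> {..y}) h" unfolding h_def
      by (intro continuous_on_cases continuous_on_compose2[OF osc_chain_continuous[OF ch]] continuous_intros)
        (use osc_chain_pos[OF ch] c10 in \<open>auto simp: min_def\<close>)
    moreover have "{y..} \<union> {..y} = UNIV" by auto
    ultimately show ?thesis by simp
  qed
  have h0: "h u = 0" if "u \<notin> {a..b}" for u using that ab by (auto simp: h_eq)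
  obtain M2 where M2: "M2 \<ge> 0" "\<And>x E. 0 \<le> x \<Longrightarrow> x \<le> d \<Longrightarrow> norm (cos_moment d c 2 E x) \<le> M2 / (1 + E\<^sup>2)"
    using cos_moment_summable_bound[OF ch, of 0] by (auto simp: numeral_2_eq_2)
  define \<gamma> where "\<gamma> n s = cos_moment d c 2 (e n) s" for n s
  have \<gamma>c: "continuous_on {0..d} (\<gamma> n)" for n unfolding \<gamma>_def
    by (intro cos_moment_continuous[OF ch])
  have \<gamma>b: "norm (\<gamma> n s) \<le> M2 / (1 + (e n)\<^sup>2)" if "0 \<le> s" "s \<le> d" for n s
    using M2(2)[of s "e n"] that by (simp add: \<gamma>_def)
  define A where "A n = (2 * v' n y) *\<^sub>R cos_moment d c 2 (e n) 0" for n
  have Ab: "norm (A n) \<le> (2 * B) / (1 + (e n)\<^sup>2)" for n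
    using decay[of n] by (simp add: A_def abs_mult)
  have cv: "continuous_on {0..d} (\<lambda>s. v n (y+s))" "continuous_on {0..d} (\<lambda>s. v n (y-s))"
    "continuous_on {0..d} (\<lambda>s. q (y+s))" "continuous_on {0..d} (\<lambda>s. q (y-s))" for n
    by (intro continuous_on_compose2[OF v_continuous_on[of "{a..b}"]]
       continuous_on_compose2[OF q_continuous_on[of "{a..b}"]] continuous_intros;
       use ab D in force)+
  have co: "integral {a..b} (\<lambda>x. v n x *\<^sub>R h x) = A n + integral {0..d}
      (\<lambda>s. (q (y+s) * v n (y+s)) *\<^sub>R \<gamma> n s + ((-1) * (q (y-s) * v n (y-s))) *\<^sub>R \<gamma> n s)" for n
  proof -
    have c1: "continuous_on {y-d..y+d} (\<lambda>u. v n u *\<^sub>R h u)"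
      by (intro continuous_intros v_continuous_on continuous_on_subset[OF hc]) (use D in auto)
    have i0: "integral {a..b} (\<lambda>u. v n u *\<^sub>R h u) = integral {y-d..y+d} (\<lambda>u. v n u *\<^sub>R h u)"
      by (rule integral_zero_extend) (use ab c1 in \<open>auto simp: h_eq intro: integrable_continuous_real\<close>)
    have i1: "((\<lambda>s. (v n (y+s) - v n (y-s)) *\<^sub>R c 1 s) has_integral
        integral {y-d..y+d} (\<lambda>u. v n u *\<^sub>R h u)) {0..d}"
      by (rule has_integral_eq[OF _ has_integral_symmetric_split[OF D(1) c1]])
        (auto simp: h_eq scaleR_diff_left sgn_if c10[simplified])
    have i2: "((\<lambda>s. (v n (y+s) - v n (y-s)) *\<^sub>R c 1 s
        - (q (y+s) * v n (y+s) - q (y-s) * v n (y-s)) *\<^sub>R \<gamma> n s) has_integral A n) {0..d}"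
      using mean_value_identity(2)[OF ch, of 0 y n 1] D
      by (simp add: \<gamma>_def A_def numeral_2_eq_2)
    have "((\<lambda>s. (q (y+s) * v n (y+s) - q (y-s) * v n (y-s)) *\<^sub>R \<gamma> n s) has_integral
        integral {a..b} (\<lambda>u. v n u *\<^sub>R h u) - A n) {0..d}"
      using has_integral_diff[OF i1 i2] by (simp add: i0)
    then show ?thesis by (simp add: integral_unique scaleR_diff_left)
  qed
  note X = expansion_exchange[where h=h and D=d and y=y and \<gamma>=\<gamma> and A=A and \<sigma>="-1",
      OF ab(1,2,3) hc h0 ab(6) D(1) ab(4,5) \<gamma>c \<gamma>b Ab _ co]
  have K: "osc_kernel d c 2 s u p = (\<Sum>n. (v n u * v n p) *\<^sub>R \<gamma> n s)" for s u
    by (simp add: osc_kernel_def \<gamma>_def)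
  show ?cont using X(1) by (simp add: K)
  show ?eq using X(2) by (simp add: K h_eq A_def mult_ac)
qed

text \<open>Both conditions propagate along the recursion: passing from (x, y) to (x + s, y + s) or
  (x + s, y - s) stays in the cone |y - t| <= x and does not decrease x + |p - y|. With \<xi> = 0
  this gives bounds up to the diagonal, with \<xi> = |p - t| bounds away from it.\<close>

lemma osc_kernel_bound_step:
  assumes ch: "osc_chain d c" and t: "l < t - d" "t + d < r" and p: "l < p" "p < r"
    and Q: "\<And>x. \<bar>x - t\<bar> \<le> d \<Longrightarrow> \<bar>q x\<bar> \<le> Q"
    and K: "\<And>x y. 0 \<le> x \<Longrightarrow> x \<le> d \<Longrightarrow> \<bar>y - t\<bar> \<le> x \<Longrightarrow> \<xi> \<le> x + \<bar>p - y\<bar> \<Longrightarrow>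
       norm (osc_kernel d c (m + 3) x y p) \<le> \<kappa>"
    and c: "\<And>s. 0 \<le> s \<Longrightarrow> \<xi> \<le> s \<Longrightarrow> s \<le> d \<Longrightarrow> norm (c (m + 2) s) \<le> \<kappa>'"
    and x: "0 \<le> x" "x \<le> d" and y: "\<bar>y - t\<bar> \<le> x" "\<xi> \<le> x + \<bar>p - y\<bar>"
    and \<kappa>: "0 \<le> \<kappa>" "0 \<le> \<kappa>'"
  shows "norm (osc_kernel d c (m + 2) x y p) \<le> \<kappa>' + d * Q * \<kappa>"
proof -
  have y': "l < y - (d - x)" "y + (d - x) < r" using y x t by (auto simp: abs_le_iff)
  note R = osc_kernel_recursion[OF ch x y' p, of m]
  have Q0: "0 \<le> Q" using Q[of t] osc_chain_pos[OF ch] by (smt (verit) abs_ge_zero)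
  have "norm (integral {0..d-x} (\<lambda>s. q (y+s) *\<^sub>R osc_kernel d c (m + 3) (x+s) (y+s) p
         + q (y-s) *\<^sub>R osc_kernel d c (m + 3) (x+s) (y-s) p)) \<le> integral {0..d-x} (\<lambda>s. 2 * (Q * \<kappa>))"
  proof (rule integral_norm_bound_integral)
    fix s assume s: "s \<in> {0..d-x}"
    have "norm (q (y+s) *\<^sub>R osc_kernel d c (m + 3) (x+s) (y+s) p) \<le> Q * \<kappa>"
      unfolding norm_scaleR
      by (intro mult_mono Q K Q0) (use s x y \<kappa> in auto)
    moreover have "norm (q (y-s) *\<^sub>R osc_kernel d c (m + 3) (x+s) (y-s) p) \<le> Q * \<kappa>"
      unfolding norm_scaleR
      by (intro mult_mono Q K Q0) (use s x y \<kappa> in auto)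
    ultimately show "norm (q (y+s) *\<^sub>R osc_kernel d c (m + 3) (x+s) (y+s) p
         + q (y-s) *\<^sub>R osc_kernel d c (m + 3) (x+s) (y-s) p) \<le> 2 * (Q * \<kappa>)"
      by (smt (verit) norm_triangle_ineq)
  qed (use R(1) in \<open>auto intro: integrable_continuous_real\<close>)
  also have "\<dots> = 2 * ((d - x) * (Q * \<kappa>))" using x by simp
  also have "\<dots> \<le> 2 * (d * (Q * \<kappa>))" using x Q0 \<kappa> by (intro mult_left_mono mult_right_mono) auto
  finally have 1: "norm (integral {0..d-x} (\<lambda>s. q (y+s) *\<^sub>R osc_kernel d c (m + 3) (x+s) (y+s) p
         + q (y-s) *\<^sub>R osc_kernel d c (m + 3) (x+s) (y-s) p)) \<le> 2 * (d * (Q * \<kappa>))" .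
  have 2: "norm (if \<bar>p - y\<bar> \<le> d - x then c (m + 2) (x + \<bar>p - y\<bar>) else 0) \<le> \<kappa>'"
    using c[of "x + \<bar>p - y\<bar>"] x y \<kappa> by auto
  have "2 * norm (osc_kernel d c (m + 2) x y p) = norm (2 *\<^sub>R osc_kernel d c (m + 2) x y p)" by simp
  also have "\<dots> \<le> \<kappa>' + 2 * (d * (Q * \<kappa>))"
    unfolding R(2) by (intro order_trans[OF norm_triangle_ineq4] add_mono 1 2)
  finally show ?thesis using \<kappa> by (simp add: mult_ac)
qed

lemma osc_kernel_base_bound:
  assumes "\<And>n. \<bar>v n y\<bar> \<le> C" "\<And>n. \<bar>v n p\<bar> \<le> C" "\<And>n. norm (cos_moment d c m (e n) x) \<le> B / (1 + (e n)\<^sup>2)"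
  shows "norm (osc_kernel d c m x y p) \<le> C * C * B * (\<Sum>n. 1 / (1 + (e n)\<^sup>2))"
proof -
  have *: "norm ((v n y * v n p) *\<^sub>R cos_moment d c m (e n) x) \<le> C * C * B * (1 / (1 + (e n)\<^sup>2))" for n
  proof -
    have "0 \<le> C" using assms(1)[of 0] by simp
    then have "\<bar>v n y * v n p\<bar> * norm (cos_moment d c m (e n) x) \<le> C * C * (B / (1 + (e n)\<^sup>2))"
      unfolding abs_mult using assms by (intro mult_mono) auto
    then show ?thesis by simp
  qed
  have s: "summable (\<lambda>n. C * C * B * (1 / (1 + (e n)\<^sup>2)))"
    using inverse_energy_summable[of "C * C * B"] by simp
  have "norm (osc_kernel d c m x y p) \<le> (\<Sum>n. C * C * B * (1 / (1 + (e n)\<^sup>2)))"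
    unfolding osc_kernel_def by (rule norm_suminf_le[OF * s])
  then show ?thesis
    using suminf_mult[OF inverse_energy_summable[of 1], of "C * C * B"] by simp
qed

end

section \<open>A complexified Poisson kernel on an interval\<close>

text \<open>The hypothesis confines z to the sectors within pi / 4 of the real axis, where the cross
  term 2 s^2 Re (z^2) in |s^2 + z^2|^2 is nonnegative.\<close>

lemma sector_norm_ge:
  fixes z :: complex
  assumes "0 \<le> Re (z\<^sup>2)"
  shows "(s\<^sup>2 + (norm z)\<^sup>2) / 2 \<le> norm ((of_real s)\<^sup>2 + z\<^sup>2)"
proof (rule power2_le_imp_le)
  have a: "(norm z)^4 = (Re (z\<^sup>2))\<^sup>2 + (Im (z\<^sup>2))\<^sup>2"
    using cmod_power2[of "z\<^sup>2"] by (simp add: norm_power)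
  have "(norm ((of_real s)\<^sup>2 + z\<^sup>2))\<^sup>2 = (s\<^sup>2 + Re (z\<^sup>2))\<^sup>2 + (Im (z\<^sup>2))\<^sup>2"
    unfolding cmod_power2 by (simp add: power2_eq_square)
  also have "\<dots> = (s\<^sup>2)\<^sup>2 + 2 * s\<^sup>2 * Re (z\<^sup>2) + (norm z)^4"
    unfolding a by (simp add: power2_eq_square algebra_simps)
  also have "\<dots> \<ge> (s\<^sup>2)\<^sup>2 + ((norm z)\<^sup>2)\<^sup>2" using assms by simp
  finally have 1: "(s\<^sup>2)\<^sup>2 + ((norm z)\<^sup>2)\<^sup>2 \<le> (norm ((of_real s)\<^sup>2 + z\<^sup>2))\<^sup>2" .
  have "((a + b) / 2)\<^sup>2 \<le> a\<^sup>2 + b\<^sup>2" for a b :: real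
  proof -
    have "0 \<le> (a - b)\<^sup>2 + 2 * a\<^sup>2 + 2 * b\<^sup>2" by simp
    then show ?thesis by (simp add: power2_eq_square field_simps)
  qed
  from this[of "s\<^sup>2" "(norm z)\<^sup>2"]
  show "((s\<^sup>2 + (norm z)\<^sup>2) / 2)\<^sup>2 \<le> (norm ((of_real s)\<^sup>2 + z\<^sup>2))\<^sup>2" using 1 by linarith
qed simp

definition poisson_coeff :: "real \<Rightarrow> complex \<Rightarrow> complex" where
  "poisson_coeff d z = z / (of_real pi * (1 + (z / of_real d)\<^sup>2) ^ 3)"

text \<open>Entry 2 is the Poisson kernel \<open>z / (\<pi> (s\<^sup>2 + z\<^sup>2))\<close> times the cutoff \<open>(1 - s\<^sup>2/d\<^sup>2)\<^sup>3\<close>, which is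
  normalised to be 1 at the pole \<open>s = \<i> z\<close> rather than at \<open>s = 0\<close>: then the cosine transform of
  the product differs from \<open>exp (- z E)\<close> only by integrals along the sides of a rectangle.\<close>

fun poisson_chain :: "real \<Rightarrow> complex \<Rightarrow> nat \<Rightarrow> real \<Rightarrow> complex" where
  "poisson_chain d z 0 s = (let k = 1 / (of_real d)\<^sup>2; w = 1 - k * (of_real s)\<^sup>2; R = inverse ((of_real s)\<^sup>2 + z\<^sup>2) in
     poisson_coeff d z * ((24 * (of_real s)\<^sup>2 * k\<^sup>2 * w - 6 * k * w\<^sup>2) * R + 24 * (of_real s)\<^sup>2 * k * w\<^sup>2 * R\<^sup>2
       + w^3 * (8 * (of_real s)\<^sup>2 * R^3 - 2 * R\<^sup>2)))"
| "poisson_chain d z (Suc 0) s = (let k = 1 / (of_real d)\<^sup>2; w = 1 - k * (of_real s)\<^sup>2; R = inverse ((of_real s)\<^sup>2 + z\<^sup>2) in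
     poisson_coeff d z * (6 * of_real s * k * w\<^sup>2 * R + 2 * of_real s * w^3 * R\<^sup>2))"
| "poisson_chain d z (Suc (Suc 0)) s = (let k = 1 / (of_real d)\<^sup>2; w = 1 - k * (of_real s)\<^sup>2; R = inverse ((of_real s)\<^sup>2 + z\<^sup>2) in
     poisson_coeff d z * (w^3 * R))"
| "poisson_chain d z (Suc (Suc (Suc m))) s = integral {s..d} (poisson_chain d z (Suc (Suc m)))"

declare poisson_chain.simps [simp del]

lemma poisson_denominator_nz:
  assumes "0 < Re z" shows "(of_real s)\<^sup>2 + z\<^sup>2 \<noteq> 0"
proof
  assume "(of_real s)\<^sup>2 + z\<^sup>2 = 0"
  then have "(z + \<i> * of_real s) * (z - \<i> * of_real s) = 0"
    by (simp add: power2_eq_square algebra_simps)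
  then have "z = - (\<i> * of_real s) \<or> z = \<i> * of_real s" by (auto simp: eq_neg_iff_add_eq_0)
  then show False using assms by auto
qed

lemma poisson_chain_deriv:
  assumes z: "0 < Re z"
  shows "(poisson_chain d z (Suc 0) has_vector_derivative - poisson_chain d z 0 s) (at s within S)"
    and "(poisson_chain d z (Suc (Suc 0)) has_vector_derivative - poisson_chain d z (Suc 0) s) (at s within S)"
proof -
  define k :: complex where "k = 1 / (of_real d)\<^sup>2"
  define R where "R \<zeta> = inverse (\<zeta>\<^sup>2 + z\<^sup>2)" for \<zeta>
  define w where "w \<zeta> = 1 - k * \<zeta>\<^sup>2" for \<zeta>
  define p where "p = poisson_coeff d z"
  have R: "(R has_field_derivative (- 2 * of_real s * (R (of_real s))\<^sup>2)) (at (of_real s))"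
    unfolding R_def using poisson_denominator_nz[OF z]
    by (auto intro!: derivative_eq_intros simp: field_simps power2_eq_square)
  have w: "(w has_field_derivative (- 2 * of_real s * k)) (at (of_real s))"
    unfolding w_def by (auto intro!: derivative_eq_intros)
  have c0: "poisson_chain d z 0 s = p * ((24 * (of_real s)\<^sup>2 * k\<^sup>2 * w (of_real s) - 6 * k * (w (of_real s))\<^sup>2) * R (of_real s)
      + 24 * (of_real s)\<^sup>2 * k * (w (of_real s))\<^sup>2 * (R (of_real s))\<^sup>2
       + (w (of_real s))^3 * (8 * (of_real s)\<^sup>2 * (R (of_real s))^3 - 2 * (R (of_real s))\<^sup>2))"
    by (simp add: poisson_chain.simps Let_def w_def R_def k_def p_def)
  have c1: "poisson_chain d z (Suc 0) = (\<lambda>s. p * (6 * of_real s * k * (w (of_real s))\<^sup>2 * R (of_real s)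
      + 2 * of_real s * (w (of_real s))^3 * (R (of_real s))\<^sup>2))"
    by (rule ext) (simp add: poisson_chain.simps Let_def w_def R_def k_def p_def)
  have c2: "poisson_chain d z (Suc (Suc 0)) = (\<lambda>s. p * ((w (of_real s))^3 * R (of_real s)))"
    by (rule ext) (simp add: poisson_chain.simps Let_def w_def R_def k_def p_def)
  have "((\<lambda>\<zeta>. p * (6 * \<zeta> * k * (w \<zeta>)\<^sup>2 * R \<zeta> + 2 * \<zeta> * (w \<zeta>)^3 * (R \<zeta>)\<^sup>2))
     has_field_derivative - poisson_chain d z 0 s) (at (of_real s))"
    unfolding c0
    by (rule R w derivative_eq_intros refl)+
      (simp add: algebra_simps power2_eq_square power3_eq_cube)
  from has_vector_derivative_real_field[OF this]
  show "(poisson_chain d z (Suc 0) has_vector_derivative - poisson_chain d z 0 s) (at s within S)"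
    unfolding c1 .
  have "((\<lambda>\<zeta>. p * ((w \<zeta>)^3 * R \<zeta>)) has_field_derivative - poisson_chain d z (Suc 0) s) (at (of_real s))"
    unfolding c1
    by (rule R w derivative_eq_intros refl)+
      (simp add: algebra_simps power2_eq_square power3_eq_cube)
  from has_vector_derivative_real_field[OF this]
  show "(poisson_chain d z (Suc (Suc 0)) has_vector_derivative - poisson_chain d z (Suc 0) s) (at s within S)"
    unfolding c2 .
qed

lemma poisson_chain_continuous_0:
  assumes z: "0 < Re z"
  shows "continuous_on S (poisson_chain d z 0)"
  unfolding poisson_chain.simps(1)[abs_def] Let_def
  using poisson_denominator_nz[OF z] by (intro continuous_intros) auto

lemma lower_integral_deriv:
  fixes f :: "real \<Rightarrow> complex"
  assumes f: "continuous_on {0..d} f" and x: "0 \<le> x" "x \<le> d"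
  shows "((\<lambda>x. integral {x..d} f) has_vector_derivative - f x) (at x within {0..d})"
proof -
  have "((\<lambda>x. integral {0..d} f - integral {0..x} f) has_vector_derivative 0 - f x) (at x within {0..d})"
    by (intro derivative_intros integral_has_vector_derivative f) (use x in auto)
  moreover have "integral {0..d} f - integral {0..y} f = integral {y..d} f" if "y \<in> {0..d}" for y
    using Henstock_Kurzweil_Integration.integral_combine[of 0 y d f] that
      integrable_continuous_real[OF f] by (simp add: algebra_simps)
  ultimately show ?thesis
    using x by (auto intro: has_vector_derivative_transform[rotated 2])
qed

text \<open>Entries 1 and 2 vanish at \<open>d\<close> because the cutoff has a triple zero there,
  of which one differentiation leaves a double zero; from index 3 on the zero is built into the
  integral.\<close>

lemma osc_chain_poisson:
  assumes z: "0 < Re z" and d: "0 < d"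
  shows "osc_chain d (poisson_chain d z)"
proof -
  have step: "(poisson_chain d z (Suc m) has_vector_derivative - poisson_chain d z m s) (at s within {0..d})"
    if "0 \<le> s" "s \<le> d" for m s
    using that
  proof (induction m arbitrary: s)
    case 0
    show ?case by (rule poisson_chain_deriv[OF z])
  next
    case (Suc m)
    show ?case
    proof (cases m)
      case 0
      then show ?thesis using poisson_chain_deriv(2)[OF z, of d s] by simp
    next
      case (Suc k)
      have "continuous_on {0..d} (poisson_chain d z (Suc m))"
        by (rule continuous_on_vector_derivative) (use Suc.IH in auto)
      from lower_integral_deriv[OF this Suc.prems] show ?thesis
        unfolding Suc poisson_chain.simps(4)[abs_def] .
    qed
  qed
  have "poisson_chain d z (Suc m) d = 0" for m
  proof (cases m)
    case (Suc k)
    then show ?thesis using d by (cases k) (auto simp: poisson_chain.simps)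
  qed (use d in \<open>auto simp: poisson_chain.simps\<close>)
  then show ?thesis
    using step d poisson_chain_continuous_0[OF z] by (auto simp: osc_chain_def)
qed

lemma norm_poisson_coeff_le:
  assumes "0 \<le> Re (z\<^sup>2)" "0 < d"
  shows "norm (poisson_coeff d z) \<le> norm z"
proof -
  have "1 \<le> Re (1 + (z / of_real d)\<^sup>2)"
    using assms by (simp add: power_divide Re_divide_of_real flip: of_real_power)
  also have "\<dots> \<le> norm (1 + (z / of_real d)\<^sup>2)" by (rule complex_Re_le_cmod)
  finally have "1 \<le> norm (1 + (z / of_real d)\<^sup>2) ^ 3" by (rule one_le_power)
  then have "1 * 1 \<le> pi * norm (1 + (z / of_real d)\<^sup>2) ^ 3"
    using pi_gt3 by (intro mult_mono) auto
  then have "norm z / (pi * norm (1 + (z / of_real d)\<^sup>2) ^ 3) \<le> norm z / 1"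
    by (intro divide_left_mono) auto
  then show ?thesis by (simp add: poisson_coeff_def norm_divide norm_mult norm_power)
qed

lemma inverse_denominator_le:
  assumes "0 < Re z" "0 \<le> Re (z\<^sup>2)"
  shows "norm (inverse ((of_real s)\<^sup>2 + z\<^sup>2)) \<le> 2 / (s\<^sup>2 + (norm z)\<^sup>2)"
proof -
  have "z \<noteq> 0" using assms by auto
  then have "0 < s\<^sup>2 + (norm z)\<^sup>2" by (simp add: add_nonneg_pos)
  then have "inverse (norm ((of_real s)\<^sup>2 + z\<^sup>2)) \<le> inverse ((s\<^sup>2 + (norm z)\<^sup>2) / 2)"
    by (intro le_imp_inverse_le sector_norm_ge assms) auto
  then show ?thesis by (simp add: norm_inverse)
qed

lemma cutoff_bounds:
  fixes s d :: real
  assumes "0 < d" "0 \<le> s" "s \<le> d"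
  shows "norm (1 - 1 / (of_real d)\<^sup>2 * (of_real s)\<^sup>2 :: complex) \<le> 1"
proof -
  have "(s / d)\<^sup>2 \<le> 1" using assms by (intro power_le_one) auto
  moreover have "(1 - 1 / (of_real d)\<^sup>2 * (of_real s)\<^sup>2 :: complex) = of_real (1 - (s/d)\<^sup>2)"
    by (simp add: power_divide)
  then have "norm (1 - 1 / (of_real d)\<^sup>2 * (of_real s)\<^sup>2 :: complex) = \<bar>1 - (s/d)\<^sup>2\<bar>"
    by (simp only: norm_of_real)
  ultimately show ?thesis by simp
qed

lemma poisson_chain_2_bound:
  assumes z: "0 < Re z" "0 \<le> Re (z\<^sup>2)" and s: "0 < d" "0 \<le> s" "s \<le> d"
  shows "norm (poisson_chain d z 2 s) \<le> 2 * norm z / (s\<^sup>2 + (norm z)\<^sup>2)"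
proof -
  define w where "w = 1 - 1 / (of_real d)\<^sup>2 * (of_real s :: complex)\<^sup>2"
  define R where "R = inverse ((of_real s)\<^sup>2 + z\<^sup>2)"
  have "poisson_chain d z 2 s = poisson_coeff d z * (w^3 * R)"
    using poisson_chain.simps(3)[of d z s] by (simp add: w_def R_def Let_def flip: numeral_2_eq_2)
  moreover have "norm w \<le> 1" using cutoff_bounds[OF s] by (simp add: w_def)
  moreover have "norm R \<le> 2 / (s\<^sup>2 + (norm z)\<^sup>2)" using inverse_denominator_le[OF z] by (simp add: R_def)
  ultimately have "norm (poisson_chain d z 2 s) \<le> norm z * (1 ^ 3 * (2 / (s\<^sup>2 + (norm z)\<^sup>2)))"
    by (simp only: norm_mult norm_power) (intro mult_mono power_mono norm_poisson_coeff_le z s; simp)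
  then show ?thesis by (simp add: mult_ac)
qed

text \<open>For |z| <= d the quantity 1 / d^2 is at most 2 / (s^2 + |z|^2), so a derivative falling
  on the cutoff is no worse than one falling on the Poisson kernel. The two contributions are 24 and
  8, together 32.\<close>

lemma poisson_chain_1_bound:
  assumes z: "0 < Re z" "0 \<le> Re (z\<^sup>2)" and s: "0 < d" "0 \<le> s" "s \<le> d" and zd: "norm z \<le> d"
  shows "norm (poisson_chain d z 1 s) \<le> 32 * norm z * s / (s\<^sup>2 + (norm z)\<^sup>2)\<^sup>2"
proof -
  define k :: complex where "k = 1 / (of_real d)\<^sup>2"
  define w where "w = 1 - k * (of_real s :: complex)\<^sup>2"
  define R where "R = inverse ((of_real s)\<^sup>2 + z\<^sup>2)"
  define N where "N = s\<^sup>2 + (norm z)\<^sup>2"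
  have "z \<noteq> 0" using z by auto
  then have N: "0 < N" unfolding N_def by (simp add: add_nonneg_pos)
  have w1: "norm w \<le> 1" using cutoff_bounds[OF s] by (simp add: w_def k_def)
  have R: "norm R \<le> 2 / N" using inverse_denominator_le[OF z] by (simp add: R_def N_def)
  have Nd: "1 / d\<^sup>2 \<le> 2 / N"
  proof -
    have "s\<^sup>2 \<le> d\<^sup>2" "(norm z)\<^sup>2 \<le> d\<^sup>2" using s zd by (auto intro!: power_mono)
    then have "N \<le> 2 * d\<^sup>2" unfolding N_def by simp
    then show ?thesis using N s by (simp add: field_simps)
  qed
  have a: "norm (6 * of_real s * k * w\<^sup>2 * R) \<le> 6 * s * (2 / N) * 1 ^ 2 * (2 / N)"
  proof -
    have "norm (6 * of_real s * k * w\<^sup>2 * R) = 6 * s * (1 / d\<^sup>2) * norm w ^ 2 * norm R"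
      using s by (simp add: norm_mult norm_power norm_divide k_def)
    also have "\<dots> \<le> 6 * s * (2 / N) * 1 ^ 2 * (2 / N)"
      using s N by (intro mult_mono Nd R power_mono w1) auto
    finally show ?thesis .
  qed
  have b: "norm (2 * of_real s * w^3 * R\<^sup>2) \<le> 2 * s * 1 ^ 3 * (2 / N) ^ 2"
    unfolding norm_mult norm_power using s N
    by (intro mult_mono power_mono R w1) auto
  have "norm (poisson_chain d z 1 s) \<le> norm z * (6 * s * (2 / N) * 1 ^ 2 * (2 / N) + 2 * s * 1 ^ 3 * (2 / N) ^ 2)"
    unfolding One_nat_def poisson_chain.simps Let_def k_def[symmetric] w_def[symmetric] R_def[symmetric] norm_mult[of "poisson_coeff d z"]
    by (intro mult_mono norm_poisson_coeff_le z s order_trans[OF norm_triangle_ineq] add_mono a b) auto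
  also have "\<dots> = 32 * norm z * s / N\<^sup>2" using N by (simp add: field_simps power2_eq_square)
  finally show ?thesis by (simp add: N_def)
qed

lemma poisson_chain_1_0: "poisson_chain d z 1 0 = 0"
  by (simp add: poisson_chain.simps Let_def)

text \<open>The mass of the Poisson kernel does not depend on t; every estimate that is uniform up
  to the diagonal rests on this.\<close>

lemma integral_poisson_le:
  assumes "0 < t" "0 \<le> x" "x \<le> d"
  shows "(\<lambda>s. 2 * t / (s\<^sup>2 + t\<^sup>2)) integrable_on {x..d}"
    and "integral {x..d} (\<lambda>s. 2 * t / (s\<^sup>2 + t\<^sup>2)) \<le> pi"
proof -
  have nz: "s\<^sup>2 + t\<^sup>2 \<noteq> 0" for s using assms(1) by (smt (verit) zero_le_power2 zero_less_power)
  have "((\<lambda>s. 2 * t / (s\<^sup>2 + t\<^sup>2)) has_integral 2 * arctan (d / t) - 2 * arctan (x / t)) {x..d}"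
  proof (rule fundamental_theorem_of_calculus)
    fix s
    have "((\<lambda>s. 2 * arctan (s / t)) has_real_derivative 2 * (inverse (1 + (s / t)\<^sup>2) * (1 / t))) (at s within {x..d})"
      by (rule derivative_eq_intros refl | use assms in simp)+
    moreover have "2 * (inverse (1 + (s / t)\<^sup>2) * (1 / t)) = 2 * t / (s\<^sup>2 + t\<^sup>2)"
      using assms nz[of s] by (simp add: field_simps power2_eq_square)
    ultimately show "((\<lambda>s. 2 * arctan (s / t)) has_vector_derivative 2 * t / (s\<^sup>2 + t\<^sup>2)) (at s within {x..d})"
      by (simp add: has_real_derivative_iff_has_vector_derivative)
  qed (use assms in auto)
  moreover from this have "integral {x..d} (\<lambda>s. 2 * t / (s\<^sup>2 + t\<^sup>2)) = 2 * arctan (d / t) - 2 * arctan (x / t)"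
    by (rule integral_unique)
  moreover have "2 * arctan (d / t) - 2 * arctan (x / t) \<le> pi"
  proof -
    have "0 \<le> arctan (x / t)" using assms by simp
    moreover have "arctan (d / t) < pi / 2" by (rule arctan_ubound)
    ultimately show ?thesis by linarith
  qed
  ultimately show "(\<lambda>s. 2 * t / (s\<^sup>2 + t\<^sup>2)) integrable_on {x..d}"
    and "integral {x..d} (\<lambda>s. 2 * t / (s\<^sup>2 + t\<^sup>2)) \<le> pi"
    by auto
qed

section \<open>Antiderivatives and moments of the truncated kernel, uniformly in z\<close>

context
  fixes d :: real and z :: complex
  assumes d: "0 < d" and z: "0 < Re z" "0 \<le> Re (z\<^sup>2)"
begin

lemma z_norm_pos: "0 < norm z" using z by auto

lemma poisson_cont: "0 \<le> x \<Longrightarrow> continuous_on {x..d} (poisson_chain d z m)"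
  by (rule osc_chain_continuous_sub[OF osc_chain_poisson[OF z(1) d]])

lemma poisson_chain_Suc: "2 \<le> m \<Longrightarrow> poisson_chain d z (Suc m) s = integral {s..d} (poisson_chain d z m)"
  by (metis Suc_le_D numeral_2_eq_2 Suc_le_mono poisson_chain.simps(4))

lemma poisson_chain_Suc_bound:
  assumes m: "2 \<le> m" and x: "0 \<le> x" "x \<le> d" and B: "\<And>s. x \<le> s \<Longrightarrow> s \<le> d \<Longrightarrow> norm (poisson_chain d z m s) \<le> B"
  shows "norm (poisson_chain d z (Suc m) x) \<le> d * B"
proof -
  have "0 \<le> B" using B[OF order_refl x(2)] by (rule order_trans[OF norm_ge_zero])
  have "norm (poisson_chain d z (Suc m) x) \<le> integral {x..d} (\<lambda>_. B)"
    unfolding poisson_chain_Suc[OF m]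
    by (rule integral_norm_bound_integral) (use x B poisson_cont in \<open>auto intro!: integrable_continuous_real\<close>)
  also have "\<dots> = (d - x) * B" using x by simp
  also have "\<dots> \<le> d * B" using x \<open>0 \<le> B\<close> by (intro mult_right_mono) auto
  finally show ?thesis .
qed

lemma poisson_moment_bound:
  assumes x: "0 \<le> x" "x \<le> d" and B: "\<And>s. x \<le> s \<Longrightarrow> s \<le> d \<Longrightarrow> norm (poisson_chain d z m s) \<le> B"
  shows "norm (cos_moment d (poisson_chain d z) m E x) \<le> d * B"
proof -
  have "0 \<le> B" using B[OF order_refl x(2)] by (rule order_trans[OF norm_ge_zero])
  have "norm (cos_moment d (poisson_chain d z) m E x) \<le> integral {x..d} (\<lambda>_. B)"
    by (rule norm_cos_moment_le[OF osc_chain_poisson[OF z(1) d] x]) (use B in auto)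
  also have "\<dots> = (d - x) * B" using x by simp
  also have "\<dots> \<le> d * B" using x \<open>0 \<le> B\<close> by (intro mult_right_mono) auto
  finally show ?thesis .
qed

lemma poisson_chain_3_bound:
  assumes x: "0 \<le> x" "x \<le> d"
  shows "norm (poisson_chain d z 3 x) \<le> pi"
proof -
  have "norm (integral {x..d} (poisson_chain d z 2)) \<le> integral {x..d} (\<lambda>s. 2 * norm z / (s\<^sup>2 + (norm z)\<^sup>2))"
    by (rule integral_norm_bound_integral[OF integrable_continuous_real[OF poisson_cont] integral_poisson_le(1)[OF z_norm_pos x]])
      (use x poisson_chain_2_bound[OF z d] in auto)
  also have "\<dots> \<le> pi" by (rule integral_poisson_le(2)[OF z_norm_pos x])
  finally show ?thesis using poisson_chain_Suc[of 2 x] by (simp add: numeral_3_eq_3 numeral_2_eq_2)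
qed

lemma poisson_moment_2_bound:
  assumes x: "0 \<le> x" "x \<le> d"
  shows "norm (cos_moment d (poisson_chain d z) 2 E x) \<le> pi"
  by (rule order_trans[OF norm_cos_moment_le[OF osc_chain_poisson[OF z(1) d] x poisson_chain_2_bound[OF z d]]
       integral_poisson_le(2)[OF z_norm_pos x]])
    (use x integral_poisson_le(1)[OF z_norm_pos x] in auto)

text \<open>Index 4 reduces by \<open>scaled_cos_moment\<close> to the chain entry 3 and the moment
  of index 2, both at most pi. The resulting decay is independent of z, which makes index 4 a
  starting point for the recursion near the diagonal.\<close>

lemma poisson_moment_4_decay:
  assumes x: "0 \<le> x" "x \<le> d"
  shows "norm (cos_moment d (poisson_chain d z) 4 E x) \<le> (2 * pi + d * (d * pi)) / (1 + E\<^sup>2)"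
proof -
  have c4: "norm (poisson_chain d z 4 s) \<le> d * pi" if "0 \<le> s" "s \<le> d" for s
    using poisson_chain_Suc_bound[of 3 s pi] poisson_chain_3_bound that by (simp add: eval_nat_numeral)
  have "norm (cos_moment d (poisson_chain d z) 4 E x) \<le> d * (d * pi)"
    by (rule poisson_moment_bound[OF x]) (use c4 x in auto)
  from norm_cos_moment_decay[OF osc_chain_poisson[OF z(1) d] x poisson_moment_2_bound[OF x], of pi E "d * (d * pi)"]
    poisson_chain_3_bound[OF x] this show ?thesis by (simp add: eval_nat_numeral)
qed

text \<open>Taylor's formula with integral remainder: the remainder of order 2 absorbs the
  singularity of the Poisson kernel at the origin.\<close>

lemma poisson_chain_5_bound:
  assumes x: "0 \<le> x" "x \<le> d"
  shows "norm (poisson_chain d z 5 x) \<le> d * norm z"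
proof -
  note ch = osc_chain_poisson[OF z(1) d]
  have der: "(poisson_chain d z (Suc m) has_vector_derivative - poisson_chain d z m s) (at s within {x..d})"
    if "s \<in> {x..d}" for m s
    by (rule has_vector_derivative_within_subset[OF osc_chain_deriv[OF ch]]) (use that x in auto)
  have der': "(poisson_chain d z 5 has_vector_derivative - poisson_chain d z 4 s) (at s within {x..d})"
    "(poisson_chain d z 4 has_vector_derivative - poisson_chain d z 3 s) (at s within {x..d})"
    "(poisson_chain d z 3 has_vector_derivative - poisson_chain d z 2 s) (at s within {x..d})"
    if "s \<in> {x..d}" for s
    using der[OF that, of 4] der[OF that, of 3] der[OF that, of 2]
    by (simp_all add: eval_nat_numeral)
  have h: "((\<lambda>s. (s - x)\<^sup>2 / 2) has_real_derivative s - x) (at s within {x..d})"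
    "((\<lambda>s. s - x) has_real_derivative 1) (at s within {x..d})" for s
    by (auto intro!: derivative_eq_intros)
  have e: "poisson_chain d z 5 d = 0" "poisson_chain d z 4 d = 0" "poisson_chain d z 3 d = 0"
    using osc_chain_end[OF ch, of 4] osc_chain_end[OF ch, of 3] osc_chain_end[OF ch, of 2]
    by (simp_all add: eval_nat_numeral)
  have "((\<lambda>s. - (((s - x)\<^sup>2 / 2) *\<^sub>R poisson_chain d z 2 s)) has_integral
     (poisson_chain d z 5 d + (d - x) *\<^sub>R poisson_chain d z 4 d + ((d - x)\<^sup>2 / 2) *\<^sub>R poisson_chain d z 3 d)
     - (poisson_chain d z 5 x + (x - x) *\<^sub>R poisson_chain d z 4 x + ((x - x)\<^sup>2 / 2) *\<^sub>R poisson_chain d z 3 x)) {x..d}"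
    by (rule fundamental_theorem_of_calculus[OF x(2)])
      (rule h der' derivative_eq_intros refl | simp)+
  then have hi: "((\<lambda>s. - (((s - x)\<^sup>2 / 2) *\<^sub>R poisson_chain d z 2 s)) has_integral - poisson_chain d z 5 x) {x..d}"
    by (simp only: e) simp
  have "norm (integral {x..d} (\<lambda>s. - (((s - x)\<^sup>2 / 2) *\<^sub>R poisson_chain d z 2 s))) \<le> integral {x..d} (\<lambda>_. norm z)"
  proof (rule integral_norm_bound_integral)
    show "(\<lambda>s. - (((s - x)\<^sup>2 / 2) *\<^sub>R poisson_chain d z 2 s)) integrable_on {x..d}" using hi by blast
    fix s assume s: "s \<in> {x..d}"
    have "norm (- (((s - x)\<^sup>2 / 2) *\<^sub>R poisson_chain d z 2 s)) = (s - x)\<^sup>2 / 2 * norm (poisson_chain d z 2 s)"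
      by (simp add: abs_mult)
    also have "\<dots> \<le> (s\<^sup>2 + (norm z)\<^sup>2) / 2 * (2 * norm z / (s\<^sup>2 + (norm z)\<^sup>2))"
    proof (rule mult_mono)
      have "(s - x)\<^sup>2 \<le> s\<^sup>2" using s x by (intro power_mono) auto
      then have "(s - x)\<^sup>2 \<le> s\<^sup>2 + (norm z)\<^sup>2" by (simp add: add_increasing2)
      then show "(s - x)\<^sup>2 / 2 \<le> (s\<^sup>2 + (norm z)\<^sup>2) / 2" by (rule divide_right_mono) simp
      show "norm (poisson_chain d z 2 s) \<le> 2 * norm z / (s\<^sup>2 + (norm z)\<^sup>2)"
        by (rule poisson_chain_2_bound[OF z d]) (use s x in auto)
    qed auto
    also have "\<dots> = norm z"
    proof -
      have "s\<^sup>2 + (norm z)\<^sup>2 > 0" using z_norm_pos by (simp add: add_nonneg_pos)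
      then show ?thesis by (simp add: field_simps)
    qed
    finally show "norm (- (((s - x)\<^sup>2 / 2) *\<^sub>R poisson_chain d z 2 s)) \<le> norm z" .
  qed auto
  also have "\<dots> = (d - x) * norm z" using x by simp
  also have "\<dots> \<le> d * norm z" using x by (intro mult_right_mono) auto
  finally show ?thesis using integral_unique[OF hi] by simp
qed

text \<open>Since the chain is O(|z|) from index 5 on, the double integration by parts from 7 to 5
  keeps the factor |z|. This starts the recursion off the diagonal.\<close>

lemma poisson_moment_7_decay:
  assumes x: "0 \<le> x" "x \<le> d"
  shows "norm (cos_moment d (poisson_chain d z) 7 E x) \<le> (2 * d\<^sup>2 + d ^ 4) * norm z / (1 + E\<^sup>2)"
proof -
  have c6: "norm (poisson_chain d z 6 s) \<le> d * (d * norm z)" if "0 \<le> s" "s \<le> d" for s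
    using poisson_chain_Suc_bound[of 5 s "d * norm z"] poisson_chain_5_bound that
    by (simp add: eval_nat_numeral)
  have c7: "norm (poisson_chain d z 7 s) \<le> d * (d * (d * norm z))" if "0 \<le> s" "s \<le> d" for s
    using poisson_chain_Suc_bound[of 6 s "d * (d * norm z)"] c6 that
    by (simp add: eval_nat_numeral)
  have b5: "norm (cos_moment d (poisson_chain d z) 5 E x) \<le> d * (d * norm z)"
    by (rule poisson_moment_bound[OF x]) (use poisson_chain_5_bound x in auto)
  have b7: "norm (cos_moment d (poisson_chain d z) 7 E x) \<le> d * (d * (d * (d * norm z)))"
    by (rule poisson_moment_bound[OF x]) (use c7 x in auto)
  have "norm (cos_moment d (poisson_chain d z) (Suc (Suc 5)) E x)
     \<le> (d * (d * norm z) + d * (d * norm z) + d * (d * (d * (d * norm z)))) / (1 + E\<^sup>2)"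
    by (rule norm_cos_moment_decay[OF osc_chain_poisson[OF z(1) d] x b5])
      (use c6[OF x] b7 in \<open>simp_all add: eval_nat_numeral\<close>)
  then show ?thesis by (simp add: eval_nat_numeral algebra_simps)
qed

text \<open>Away from s = 0 the kernel itself is O(|z|), and integrating from s to d never comes
  back to the origin.\<close>

lemma poisson_chain_off_diagonal:
  assumes x0: "0 < x0" and s: "x0 \<le> s" "s \<le> d"
  shows "norm (poisson_chain d z (m + 2) s) \<le> d ^ m * (2 / x0\<^sup>2 * norm z)"
  using s
proof (induction m arbitrary: s)
  case 0
  have "norm (poisson_chain d z 2 s) \<le> 2 * norm z / (s\<^sup>2 + (norm z)\<^sup>2)"
    by (rule poisson_chain_2_bound[OF z d]) (use 0 x0 in auto)
  also have "\<dots> \<le> 2 * norm z / x0\<^sup>2"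
  proof (rule divide_left_mono)
    have "x0\<^sup>2 \<le> s\<^sup>2" using 0 x0 by (intro power_mono) auto
    then show "x0\<^sup>2 \<le> s\<^sup>2 + (norm z)\<^sup>2" by (simp add: add_increasing2)
  qed (use x0 in \<open>auto intro!: mult_pos_pos add_pos_nonneg\<close>, use 0 in auto)
  finally show ?case by (simp add: numeral_2_eq_2)
next
  case (Suc m)
  have "norm (poisson_chain d z (Suc (m + 2)) s) \<le> d * (d ^ m * (2 / x0\<^sup>2 * norm z))"
    by (rule poisson_chain_Suc_bound) (use Suc x0 in auto)
  then show ?case by (simp add: mult_ac)
qed

end

text \<open>For y <= 1 one has y (1 + E) <= 1 + E y, and the cubic Taylor polynomial of exp
  dominates (1 + x)^3 up to a constant. The constant 6 would do; 56 is generous.\<close>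

lemma cube_exp_decay:
  fixes y E :: real
  assumes "0 \<le> y" "y \<le> 1" "0 \<le> E"
  shows "y ^ 3 * exp (- (E * y)) \<le> 56 / (1 + E) ^ 3"
proof -
  have 1: "(y * (1 + E)) ^ 3 \<le> (1 + E * y) ^ 3"
    using assms by (intro power_mono) (auto simp: algebra_simps)
  have 2: "(1 + x) ^ 3 \<le> 56 * exp x" if "0 \<le> x" for x :: real
  proof -
    have e: "1 + x + x\<^sup>2 / 2 + x ^ 3 / 6 \<le> exp x"
    proof -
      have "(\<Sum>i<4. x ^ i /\<^sub>R fact i) \<le> exp x"
        unfolding exp_def by (rule sum_le_suminf[OF summable_exp_generic]) (use that in auto)
      then show ?thesis by (simp add: eval_nat_numeral fact_numeral field_simps)
    qed
    have "(1 + x) ^ 3 = 1 + 3 * x + 3 * x\<^sup>2 + x ^ 3" by (simp add: power2_eq_square power3_eq_cube algebra_simps)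
    also have "\<dots> \<le> 56 * (1 + x + x\<^sup>2 / 2 + x ^ 3 / 6)"
    proof -
      have "1 + 3 * x + 3 * a + b \<le> 56 * (1 + x + a / 2 + b / 6)" if "0 \<le> a" "0 \<le> b" for a b
        using that \<open>0 \<le> x\<close> by (simp add: field_simps)
      from this[of "x\<^sup>2" "x ^ 3"] show ?thesis using \<open>0 \<le> x\<close> by simp
    qed
    also have "\<dots> \<le> 56 * exp x" using e by simp
    finally show ?thesis .
  qed
  have "(y * (1 + E)) ^ 3 \<le> 56 * exp (E * y)" using order_trans[OF 1 2[of "E * y"]] assms by simp
  then have "(y * (1 + E)) ^ 3 * exp (- (E * y)) \<le> 56 * exp (E * y) * exp (- (E * y))"
    by (rule mult_right_mono) simp
  also have "\<dots> = 56" by (simp add: mult.assoc flip: exp_add)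
  finally have "y ^ 3 * exp (- (E * y)) * (1 + E) ^ 3 \<le> 56" by (simp add: power_mult_distrib mult_ac)
  then show ?thesis using assms by (simp add: pos_le_divide_eq)
qed

text \<open>The contour integrand is evaluated by Cauchy's formula on the rectangle with vertices
  \<open>\<plusminus>d\<close>, \<open>\<plusminus>d + \<i>\<close>; the cutoff vanishes to third order at \<open>\<plusminus>d\<close>, which gives the decay in \<open>E\<close>
  of the vertical sides.\<close>

lemma poisson_cosine_transform:
  assumes d: "0 < d"
  obtains C where "C > 0" "\<And>z E. 0 < Re z \<Longrightarrow> 0 \<le> Re (z\<^sup>2) \<Longrightarrow> norm z \<le> min d 1 / 2 \<Longrightarrow> 0 \<le> E \<Longrightarrow>
     norm (2 * cos_moment d (poisson_chain d z) 2 E 0 - exp (- (z * of_real E))) \<le> C * norm z / (1 + E) ^ 3"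
proof -
  define K1 where "K1 = ((2 * d + 1) / d\<^sup>2) ^ 3 * (4 / d\<^sup>2)"
  define K2 where "K2 = (1 + (d + 1)\<^sup>2 / d\<^sup>2) ^ 3 * 4"
  define C where "C = (2 * K1 + 2 * d * K2) * 56"
  have K: "K1 > 0" "K2 > 0" using d by (auto simp: K1_def K2_def intro!: mult_pos_pos zero_less_power add_pos_pos add_pos_nonneg)
  have "norm (2 * cos_moment d (poisson_chain d z) 2 E 0 - exp (- (z * of_real E))) \<le> C * norm z / (1 + E) ^ 3"
    if z: "0 < Re z" "0 \<le> Re (z\<^sup>2)" "norm z \<le> min d 1 / 2" and E: "0 \<le> E" for z E
  proof -
    define k :: complex where "k = 1 / (of_real d)\<^sup>2"
    define \<kappa> where "\<kappa> = poisson_coeff d z"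
    \<comment> \<open>Only the pole i z is divided out in \<open>f\<close>. The other pole, - i z,
      has imaginary part - Re z and so lies outside the open half plane \<open>S\<close>, on which
      \<open>F\<close> is holomorphic.\<close>
    define F where "F \<zeta> = \<kappa> * (1 - k * \<zeta>\<^sup>2) ^ 3 * exp (\<i> * \<zeta> * of_real E) / (\<zeta> + \<i> * z)" for \<zeta>
    define f where "f \<zeta> = F \<zeta> / (\<zeta> - \<i> * z)" for \<zeta>
    define a1 :: complex where "a1 = of_real (- d)"
    define a2 :: complex where "a2 = of_real d"
    define a3 where "a3 = Complex d 1"
    define a4 where "a4 = Complex (- d) 1"
    define S where "S = {\<zeta>. - Re z < Im \<zeta>}"
    have rect: "rectpath a1 a3 = linepath a1 a2 +++ linepath a2 a3 +++ linepath a3 a4 +++ linepath a4 a1"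
      by (simp add: rectpath_def Let_def a1_def a2_def a3_def a4_def complex_of_real_def)
    have zn: "norm z \<le> d / 2" "norm z \<le> 1 / 2" using z(3) by auto
    have ReIm: "\<bar>Re z\<bar> \<le> 1 / 2" "\<bar>Im z\<bar> \<le> d / 2"
      using abs_Re_le_cmod[of z] abs_Im_le_cmod[of z] zn by linarith+
    \<comment> \<open>The bound |z| <= min d 1 / 2 keeps the pole strictly inside the rectangle and
      away from the three sides that are going to be estimated.\<close>
    have box: "\<i> * z \<in> box a1 a3"
      using ReIm z d by (auto simp: in_box_complex_iff a1_def a3_def)
    have nz: "\<zeta> + \<i> * z \<noteq> 0" if "\<zeta> \<in> S" for \<zeta>
    proof
      assume "\<zeta> + \<i> * z = 0"
      then have "Im (\<zeta> + \<i> * z) = 0" by simp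
      then show False using that by (simp add: S_def)
    qed
    have S: "convex S" "open S"
      unfolding S_def using convex_halfspace_Im_gt[of "- Re z"] open_halfspace_Im_gt[of "- Re z"] by auto
    have ho: "F holomorphic_on S" unfolding F_def
      by (intro holomorphic_intros nz) auto
    have img: "path_image (rectpath a1 a3) \<subseteq> S - {\<i> * z}"
    proof -
      have "path_image (rectpath a1 a3) = {z. Re z \<in> {- d, d} \<and> Im z \<in> {0..1}} \<union> {z. Im z \<in> {0, 1} \<and> Re z \<in> {- d..d}}"
        using d by (subst path_image_rectpath) (auto simp: a1_def a3_def)
      then show ?thesis using z ReIm d by (auto simp: S_def)
    qed
    have ci: "(f has_contour_integral (2 * pi * \<i> * winding_number (rectpath a1 a3) (\<i> * z) * F (\<i> * z))) (rectpath a1 a3)"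
      unfolding f_def using S z img
      by (intro Cauchy_integral_formula_convex_simple[OF S(1) ho]) (auto simp: interior_open S_def)
    have val: "2 * pi * \<i> * winding_number (rectpath a1 a3) (\<i> * z) * F (\<i> * z) = exp (- (z * of_real E))"
    proof -
      have z0: "z \<noteq> 0" using z by auto
      have "1 \<le> Re (1 + k * z\<^sup>2)"
        using z d by (simp add: k_def Re_divide_of_real flip: of_real_power)
      then have "Re (1 + k * z\<^sup>2) \<noteq> 0" by linarith
      then have "1 + k * z\<^sup>2 \<noteq> 0" by (metis zero_complex.sel(1))
      then show ?thesis
        unfolding winding_number_rectpath[OF box] F_def \<kappa>_def poisson_coeff_def using z0
        by (simp add: power_mult_distrib power_divide k_def field_simps)
    qed
    have cint: "f contour_integrable_on linepath a1 a2" "f contour_integrable_on linepath a2 a3"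
      "f contour_integrable_on linepath a3 a4" "f contour_integrable_on linepath a4 a1"
      using has_contour_integral_integrable[OF ci] unfolding rect by auto
    have total: "contour_integral (linepath a1 a2) f + (contour_integral (linepath a2 a3) f
       + (contour_integral (linepath a3 a4) f + contour_integral (linepath a4 a1) f)) = exp (- (z * of_real E))"
      using contour_integral_unique[OF ci] val cint unfolding rect by simp
    have den: "f \<zeta> = \<kappa> * (1 - k * \<zeta>\<^sup>2) ^ 3 * exp (\<i> * \<zeta> * of_real E) / (\<zeta>\<^sup>2 + z\<^sup>2)" for \<zeta>
    proof -
      have "(\<zeta> + \<i> * z) * (\<zeta> - \<i> * z) = \<zeta>\<^sup>2 + z\<^sup>2"
        by (simp add: power2_eq_square algebra_simps)
      then show ?thesis by (simp add: f_def F_def)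
    qed
    \<comment> \<open>The truncated kernel is even, so the exponentials at s and - s combine to a
      cosine and the real side is exactly twice the moment over \<open>{0..d}\<close>.\<close>
    have bottom: "contour_integral (linepath a1 a2) f = 2 * cos_moment d (poisson_chain d z) 2 E 0"
    proof -
      have fs: "f (of_real s) = poisson_chain d z 2 s * exp (\<i> * of_real s * of_real E)" for s
        unfolding den using poisson_chain.simps(3)[of d z s]
        by (simp add: Let_def k_def \<kappa>_def divide_inverse flip: numeral_2_eq_2)
      have c: "continuous_on {-d..d} (\<lambda>s. f (of_real s))"
        unfolding den using poisson_denominator_nz[OF z(1)] by (intro continuous_intros) auto
      have even: "poisson_chain d z 2 (- s) = poisson_chain d z 2 s" for s
        using poisson_chain.simps(3)[of d z s] poisson_chain.simps(3)[of d z "- s"]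
        by (simp add: Let_def flip: numeral_2_eq_2)
      have "((\<lambda>s. f (of_real (0 + s)) + f (of_real (0 - s))) has_integral integral {0-d..0+d} (\<lambda>s. f (of_real s))) {0..d}"
        by (rule has_integral_symmetric_split) (use d c in auto)
      moreover have "f (of_real (0 + s)) + f (of_real (0 - s)) = 2 * (cos (E * s) *\<^sub>R poisson_chain d z 2 s)" for s
      proof -
        have "exp (\<i> * of_real s * of_real E) + exp (\<i> * of_real (- s) * of_real E) = of_real (2 * cos (E * s))"
          by (simp add: exp_eq_polar complex_eq_iff Re_exp Im_exp mult.commute)
        then have "poisson_chain d z 2 s * (exp (\<i> * of_real s * of_real E) + exp (\<i> * of_real (- s) * of_real E))
          = poisson_chain d z 2 s * of_real (2 * cos (E * s))" by simp
        then show ?thesis unfolding add_0 diff_0 fs even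
          by (simp add: scaleR_conv_of_real algebra_simps)
      qed
      ultimately have "integral {-d..d} (\<lambda>s. f (of_real s)) = integral {0..d} (\<lambda>s. 2 * (cos (E * s) *\<^sub>R poisson_chain d z 2 s))"
        by (simp only: integral_unique) (simp add: integral_unique)
      also have "\<dots> = 2 * integral {0..d} (\<lambda>s. cos (E * s) *\<^sub>R poisson_chain d z 2 s)"
        by (rule integral_mult_right)
      finally show ?thesis unfolding cos_moment_def
        using d by (subst contour_integral_linepath_Reals_eq) (auto simp: a1_def a2_def)
    qed
    have kn: "norm \<kappa> \<le> norm z" unfolding \<kappa>_def by (rule norm_poisson_coeff_le[OF z(2) d])
    have exp_n: "norm (exp (\<i> * \<zeta> * of_real E)) = exp (- (E * Im \<zeta>))" for \<zeta>
      by (simp add: norm_exp_eq_Re mult.commute)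
    have side: "norm (f \<zeta>) \<le> K1 * norm z * (56 / (1 + E) ^ 3)" if \<zeta>: "\<bar>Re \<zeta>\<bar> = d" "0 \<le> Im \<zeta>" "Im \<zeta> \<le> 1" for \<zeta>
    proof -
      define y where "y = Im \<zeta>"
      have y: "0 \<le> y" "y \<le> 1" using \<zeta> by (auto simp: y_def)
      \<comment> \<open>On a vertical side one of the factors d - \<zeta>, d + \<zeta> has modulus y
        = Im \<zeta>. The cube of the cutoff thus gains y^3, and y^3 exp (- E y) decays like (1 +
        E)^(-3).\<close>
      have "norm (1 - k * \<zeta>\<^sup>2) \<le> (2 * d + 1) / d\<^sup>2 * y"
      proof -
        have "(1 - k * \<zeta>\<^sup>2) = k * ((of_real d - \<zeta>) * (of_real d + \<zeta>))"
          using d by (simp add: k_def field_simps power2_eq_square)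
        moreover have "norm ((of_real d - \<zeta>) * (of_real d + \<zeta>)) \<le> y * (2 * d + 1)"
        proof (cases "Re \<zeta> = d")
          case True
          then have \<zeta>': "\<zeta> = of_real d + \<i> * of_real y" by (simp add: complex_eq_iff y_def)
          have "norm (of_real d - \<zeta>) = y" "norm (of_real d + \<zeta>) \<le> 2 * d + y"
            using norm_triangle_ineq[of "of_real (2 * d)" "\<i> * of_real y"] y d
            by (simp_all add: \<zeta>' norm_mult)
          then show ?thesis using y d unfolding norm_mult by (intro mult_mono) auto
        next
          case False
          then have \<zeta>': "\<zeta> = - of_real d + \<i> * of_real y" using \<zeta> by (auto simp: complex_eq_iff y_def abs_if split: if_splits)
          have "norm (of_real d + \<zeta>) = y" "norm (of_real d - \<zeta>) \<le> 2 * d + y"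
            using norm_triangle_ineq4[of "of_real (2 * d)" "\<i> * of_real y"] y d
            by (simp_all add: \<zeta>' norm_mult algebra_simps)
          then have "norm (of_real d - \<zeta>) * norm (of_real d + \<zeta>) \<le> (2 * d + 1) * y"
            using y d by (intro mult_mono) auto
          then show ?thesis by (simp add: norm_mult mult.commute)
        qed
        moreover have "norm k = 1 / d\<^sup>2" by (simp add: k_def norm_divide norm_power)
        ultimately have "norm (1 - k * \<zeta>\<^sup>2) \<le> 1 / d\<^sup>2 * (y * (2 * d + 1))"
          using mult_left_mono[of "norm ((of_real d - \<zeta>) * (of_real d + \<zeta>))" "y * (2 * d + 1)" "1 / d\<^sup>2"]
          by (simp only: norm_mult[of k]) simp
        then show ?thesis by (simp add: mult_ac)
      qed
      then have p: "norm (1 - k * \<zeta>\<^sup>2) ^ 3 \<le> ((2 * d + 1) / d\<^sup>2) ^ 3 * y ^ 3"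
        unfolding power_mult_distrib[symmetric] by (rule power_mono) simp
      have q: "d\<^sup>2 / 4 \<le> norm (\<zeta>\<^sup>2 + z\<^sup>2)"
      proof -
        have "d \<le> norm \<zeta>" using abs_Re_le_cmod[of \<zeta>] \<zeta> by simp
        then have dd: "d\<^sup>2 \<le> norm (\<zeta>\<^sup>2)" using d by (simp add: norm_power power_mono)
        have zz: "norm (z\<^sup>2) \<le> (d / 2)\<^sup>2" using zn by (simp add: norm_power power_mono)
        from zz have "norm (z\<^sup>2) \<le> d\<^sup>2 / 4" by (simp add: power_divide)
        then show ?thesis using dd norm_diff_ineq[of "\<zeta>\<^sup>2" "z\<^sup>2"] zero_le_power2[of d] by linarith
      qed
      have "norm (f \<zeta>) = norm \<kappa> * norm (1 - k * \<zeta>\<^sup>2) ^ 3 * exp (- (E * y)) / norm (\<zeta>\<^sup>2 + z\<^sup>2)"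
        by (simp add: den norm_mult norm_divide norm_power exp_n y_def)
      also have "\<dots> \<le> norm z * (((2 * d + 1) / d\<^sup>2) ^ 3 * y ^ 3) * exp (- (E * y)) / (d\<^sup>2 / 4)"
        using q d kn p y by (intro frac_le mult_mono mult_nonneg_nonneg) auto
      also have "\<dots> = K1 * norm z * (y ^ 3 * exp (- (E * y)))"
        by (simp add: K1_def)
      also have "\<dots> \<le> K1 * norm z * (56 / (1 + E) ^ 3)"
        using K by (intro mult_left_mono cube_exp_decay y E) auto
      finally show ?thesis .
    qed
    have top: "norm (f \<zeta>) \<le> K2 * norm z * (56 / (1 + E) ^ 3)" if \<zeta>: "\<bar>Re \<zeta>\<bar> \<le> d" "Im \<zeta> = 1" for \<zeta>
    proof -
      have n: "norm \<zeta> \<le> d + 1" using cmod_le[of \<zeta>] \<zeta> by simp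
      have "norm (1 - k * \<zeta>\<^sup>2) \<le> 1 + (d + 1)\<^sup>2 / d\<^sup>2"
      proof -
        have "norm (k * \<zeta>\<^sup>2) = (norm \<zeta>)\<^sup>2 / d\<^sup>2" by (simp add: k_def norm_divide norm_mult norm_power)
        also have "\<dots> \<le> (d + 1)\<^sup>2 / d\<^sup>2" using n by (intro divide_right_mono power_mono) auto
        finally show ?thesis using norm_triangle_ineq4[of 1 "k * \<zeta>\<^sup>2"] by simp
      qed
      then have p: "norm (1 - k * \<zeta>\<^sup>2) ^ 3 \<le> (1 + (d + 1)\<^sup>2 / d\<^sup>2) ^ 3"
        by (rule power_mono) simp
      have q: "1 / 4 \<le> norm (\<zeta>\<^sup>2 + z\<^sup>2)"
      proof -
        have "1 \<le> norm \<zeta>" using abs_Im_le_cmod[of \<zeta>] \<zeta> by simp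
        then have "1 \<le> norm (\<zeta>\<^sup>2)" by (simp add: norm_power)
        moreover have "norm (z\<^sup>2) \<le> (1 / 2)\<^sup>2" using zn unfolding norm_power by (intro power_mono) auto
        ultimately show ?thesis using norm_diff_ineq[of "\<zeta>\<^sup>2" "z\<^sup>2"] by (simp add: power_divide)
      qed
      have "norm (f \<zeta>) = norm \<kappa> * norm (1 - k * \<zeta>\<^sup>2) ^ 3 * exp (- (E * 1)) / norm (\<zeta>\<^sup>2 + z\<^sup>2)"
        using \<zeta> by (simp add: den norm_mult norm_divide norm_power exp_n)
      also have "\<dots> \<le> norm z * (1 + (d + 1)\<^sup>2 / d\<^sup>2) ^ 3 * exp (- (E * 1)) / (1 / 4)"
        using q kn p by (intro frac_le mult_mono mult_nonneg_nonneg) auto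
      also have "\<dots> = K2 * norm z * (1 ^ 3 * exp (- (E * 1)))"
        by (simp add: K2_def)
      also have "\<dots> \<le> K2 * norm z * (56 / (1 + E) ^ 3)"
        using K by (intro mult_left_mono cube_exp_decay E) auto
      finally show ?thesis .
    qed
    define B where "B = norm z * (56 / (1 + E) ^ 3)"
    have B: "B \<ge> 0" using E by (simp add: B_def)
    have i2: "norm (contour_integral (linepath a2 a3) f) \<le> K1 * B * norm (a3 - a2)"
    proof (rule contour_integral_bound_linepath[OF cint(2)])
      show "0 \<le> K1 * B" using K B by simp
      fix \<zeta> assume "\<zeta> \<in> closed_segment a2 a3"
      then have "Re \<zeta> = d" "0 \<le> Im \<zeta>" "Im \<zeta> \<le> 1"
        by (auto simp: a2_def a3_def closed_segment_same_Re closed_segment_eq_real_ivl)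
      then show "norm (f \<zeta>) \<le> K1 * B" using side[of \<zeta>] d by (simp add: B_def)
    qed
    have i4: "norm (contour_integral (linepath a4 a1) f) \<le> K1 * B * norm (a1 - a4)"
    proof (rule contour_integral_bound_linepath[OF cint(4)])
      show "0 \<le> K1 * B" using K B by simp
      fix \<zeta> assume "\<zeta> \<in> closed_segment a4 a1"
      then have "Re \<zeta> = - d" "0 \<le> Im \<zeta>" "Im \<zeta> \<le> 1"
        by (auto simp: a1_def a4_def closed_segment_same_Re closed_segment_eq_real_ivl)
      then show "norm (f \<zeta>) \<le> K1 * B" using side[of \<zeta>] d by (simp add: B_def)
    qed
    have i3: "norm (contour_integral (linepath a3 a4) f) \<le> K2 * B * norm (a4 - a3)"
    proof (rule contour_integral_bound_linepath[OF cint(3)])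
      show "0 \<le> K2 * B" using K B by simp
      fix \<zeta> assume "\<zeta> \<in> closed_segment a3 a4"
      then have "Im \<zeta> = 1" "\<bar>Re \<zeta>\<bar> \<le> d" using d
        by (auto simp: a3_def a4_def closed_segment_same_Im closed_segment_eq_real_ivl)
      then show "norm (f \<zeta>) \<le> K2 * B" using top[of \<zeta>] d by (simp add: B_def)
    qed
    have "a3 - a2 = \<i>" "a1 - a4 = - \<i>" "a4 - a3 = of_real (- 2 * d)"
      by (simp_all add: a1_def a2_def a3_def a4_def complex_eq_iff)
    then have n: "norm (a3 - a2) = 1" "norm (a1 - a4) = 1" "norm (a4 - a3) = 2 * d"
      using d by simp_all
    have "2 * cos_moment d (poisson_chain d z) 2 E 0 - exp (- (z * of_real E))
      = - (contour_integral (linepath a2 a3) f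
       + (contour_integral (linepath a3 a4) f + contour_integral (linepath a4 a1) f))"
      unfolding total[symmetric] bottom by simp
    then have "norm (2 * cos_moment d (poisson_chain d z) 2 E 0 - exp (- (z * of_real E)))
      \<le> K1 * B * 1 + (K2 * B * (2 * d) + K1 * B * 1)"
      using i2 i3 i4 unfolding n
      by (simp only: norm_minus_cancel) (intro order_trans[OF norm_triangle_ineq] add_mono)
    also have "\<dots> = (2 * K1 + 2 * d * K2) * B" by (simp add: algebra_simps)
    also have "\<dots> = C * norm z / (1 + E) ^ 3"
      by (simp add: C_def B_def)
    finally show ?thesis .
  qed
  moreover have "C > 0" using K d by (simp add: C_def add_pos_pos)
  ultimately show ?thesis using that by blast
qed

section \<open>Poisson sums of eigenfunctions\<close>

lemma power_exp_bounded:
  fixes x :: real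
  assumes "0 < x"
  obtains K where "K > 0" "\<And>E. 0 \<le> E \<Longrightarrow> (1 + E) ^ k * exp (- (x * E)) \<le> K"
proof (cases "k = 0")
  case True
  show ?thesis using assms True by (intro that[of 1]) auto
next
  case False
  \<comment> \<open>Makes w (1 + E) <= 1 + x E / k <= exp (x E / k), whose k-th power is the
    claim.\<close>
  define w where "w = min 1 (x / real k)"
  have w: "w > 0" using assms False by (simp add: w_def)
  have "(1 + E) ^ k * exp (- (x * E)) \<le> (1 / w) ^ k" if E: "0 \<le> E" for E
  proof -
    have "w * (1 + E) \<le> 1 + x / real k * E"
      using E mult_right_mono[of w "x / real k" E] by (simp add: w_def distrib_left)
    also have "\<dots> \<le> exp (x / real k * E)" by (rule exp_ge_add_one_self)
    finally have "(w * (1 + E)) ^ k \<le> exp (x / real k * E) ^ k"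
      using w E by (intro power_mono) auto
    also have "\<dots> = exp (x * E)" using False by (simp flip: exp_of_nat_mult)
    finally have "w ^ k * (1 + E) ^ k * exp (- (x * E)) \<le> exp (x * E) * exp (- (x * E))"
      by (intro mult_right_mono) (auto simp: power_mult_distrib)
    then have "w ^ k * ((1 + E) ^ k * exp (- (x * E))) \<le> 1" by (simp add: mult.assoc flip: exp_add)
    then show ?thesis using w by (simp add: power_divide field_simps)
  qed
  then show ?thesis using w by (intro that[of "(1 / w) ^ k"]) auto
qed

context eigensystem
begin

text \<open>With \<open>g n = v n t\<close> this is the Poisson kernel of the system at complex
  time, with \<open>g n = v' n t\<close> its derivative in the first variable.\<close>

definition exp_series :: "(nat \<Rightarrow> real) \<Rightarrow> real \<Rightarrow> complex \<Rightarrow> complex" where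
  "exp_series g p z = (\<Sum>n. (g n * v n p) *\<^sub>R exp (- (z * of_real (e n))))"

lemma inverse_energy_mono: "0 \<le> E \<Longrightarrow> 1 / (1 + E)\<^sup>2 \<le> 1 / (1 + E\<^sup>2)" for E :: real
  by (intro divide_left_mono mult_pos_pos add_pos_nonneg zero_less_power) (auto simp: power2_sum)

lemma polynomial_exp_summable_bound:
  assumes "0 < x"
  obtains K where "K > 0" "\<And>n. (1 + e n) ^ k * exp (- (x * e n)) \<le> K / (1 + (e n)\<^sup>2)"
proof -
  obtain K where K: "K > 0" "\<And>E. 0 \<le> E \<Longrightarrow> (1 + E) ^ (k + 2) * exp (- (x * E)) \<le> K"
    using power_exp_bounded[OF assms] by blast
  show ?thesis
  proof (rule that[OF K(1)])
    fix n
    have "(1 + e n) ^ k * exp (- (x * e n)) * (1 + e n)\<^sup>2 \<le> K"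
      using K(2)[OF e_nonneg[of n]] by (simp only: power_add mult_ac)
    moreover have "1 + (e n)\<^sup>2 \<le> (1 + e n)\<^sup>2" using e_nonneg[of n] by (simp add: power2_sum)
    moreover have "0 \<le> (1 + e n) ^ k * exp (- (x * e n))" using e_nonneg[of n] by simp
    ultimately have "(1 + e n) ^ k * exp (- (x * e n)) * (1 + (e n)\<^sup>2) \<le> K"
      by (meson mult_left_mono order_trans)
    moreover have "1 + (e n)\<^sup>2 > 0" by (smt (verit) zero_le_power2)
    ultimately show "(1 + e n) ^ k * exp (- (x * e n)) \<le> K / (1 + (e n)\<^sup>2)"
      by (simp add: pos_le_divide_eq)
  qed
qed

lemma exp_term_bound:
  assumes "\<bar>g n\<bar> \<le> C * (1 + e n) ^ k" "\<bar>v n p\<bar> \<le> D" "0 \<le> C" "x \<le> Re z"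
  shows "norm ((g n * v n p) *\<^sub>R exp (- (z * of_real (e n)))) \<le> C * D * ((1 + e n) ^ k * exp (- (x * e n)))"
proof -
  have "norm ((g n * v n p) *\<^sub>R exp (- (z * of_real (e n)))) = \<bar>g n\<bar> * \<bar>v n p\<bar> * exp (- (Re z * e n))"
    by (simp add: abs_mult)
  also have "\<dots> \<le> C * (1 + e n) ^ k * D * exp (- (x * e n))"
    using assms e_nonneg[of n] order_trans[OF abs_ge_zero assms(1)]
    by (intro mult_mono) (auto intro: mult_right_mono)
  finally show ?thesis by (simp add: mult_ac)
qed

lemma exp_series_summable:
  assumes g: "\<And>n. \<bar>g n\<bar> \<le> C * (1 + e n) ^ k" and p: "l < p" "p < r" and z: "0 < Re z"
  shows "summable (\<lambda>n. (g n * v n p) *\<^sub>R exp (- (z * of_real (e n))))"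
proof -
  obtain D where D: "\<And>n. \<bar>v n p\<bar> \<le> D" using v_bounded[of p p] p by (metis order_refl)
  obtain K where K: "\<And>n. (1 + e n) ^ k * exp (- (Re z * e n)) \<le> K / (1 + (e n)\<^sup>2)"
    using polynomial_exp_summable_bound[OF z] by blast
  have C: "0 \<le> C"
    using order_trans[OF abs_ge_zero g[of 0]] e_nonneg[of 0]
    by (metis add_strict_increasing linorder_not_less mult_less_0_iff zero_less_one zero_less_power)
  have D0: "0 \<le> D" using D[of 0] by simp
  show ?thesis
  proof (rule summable_comparison_test'[OF inverse_energy_summable])
    fix n
    have "norm ((g n * v n p) *\<^sub>R exp (- (z * of_real (e n)))) \<le> C * D * (K / (1 + (e n)\<^sup>2))"
      by (rule order_trans[OF exp_term_bound[OF g D C order_refl] mult_left_mono[OF K]]) (simp add: C D0)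
    then show "norm ((g n * v n p) *\<^sub>R exp (- (z * of_real (e n)))) \<le> (C * D * K) / (1 + (e n)\<^sup>2)" by simp
  qed
qed

end

context complete_eigensystem
begin

text \<open>The exponentials are replaced by twice the moments of index 2, whose sums obey the
  kernel recursion. Running it down from an index with absolutely convergent sums leaves the
  truncated Poisson kernel, or its derivative, as the only unbounded contribution.\<close>

lemma poisson_kernel_estimates:
  assumes d: "0 < d" "l < t - d" "t + d < r" and AB: "l < A" "A \<le> B" "B < r"
  obtains \<rho> C where "0 < \<rho>" "\<rho> \<le> d" "0 < C"
    and "\<And>z p. 0 < Re z \<Longrightarrow> 0 \<le> Re (z\<^sup>2) \<Longrightarrow> norm z \<le> \<rho> \<Longrightarrow> A \<le> p \<Longrightarrow> p \<le> B \<Longrightarrow>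
      norm (exp_series (\<lambda>n. v n t) p z) \<le> C * (norm z / ((p - t)\<^sup>2 + (norm z)\<^sup>2) + 1)"
    and "\<And>z p. 0 < Re z \<Longrightarrow> 0 \<le> Re (z\<^sup>2) \<Longrightarrow> norm z \<le> \<rho> \<Longrightarrow> A \<le> p \<Longrightarrow> p \<le> B \<Longrightarrow>
      norm (exp_series (\<lambda>n. v' n t) p z -
        (if \<bar>p - t\<bar> \<le> d then sgn (p - t) *\<^sub>R poisson_chain d z 1 \<bar>p - t\<bar> else 0)) \<le> C"
    and "\<And>p. A \<le> p \<Longrightarrow> p \<le> B \<Longrightarrow> p \<noteq> t \<Longrightarrow> \<exists>C'. \<forall>z. 0 < Re z \<longrightarrow> 0 \<le> Re (z\<^sup>2) \<longrightarrow> norm z \<le> \<rho> \<longrightarrow>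
      norm (exp_series (\<lambda>n. v n t) p z) \<le> C' * norm z \<and> norm (exp_series (\<lambda>n. v' n t) p z) \<le> C' * norm z"
proof -
  define a where "a = min A (t - d)"
  define b where "b = max B (t + d)"
  have ab: "l < a" "a \<le> b" "b < r" using d AB by (auto simp: a_def b_def)
  obtain V where V: "V > 0" "\<And>n x. a \<le> x \<Longrightarrow> x \<le> b \<Longrightarrow> \<bar>v n x\<bar> \<le> V"
    "\<And>n x. a \<le> x \<Longrightarrow> x \<le> b \<Longrightarrow> \<bar>v' n x\<bar> \<le> V * (1 + e n)"
    using v_bounded[OF ab] by blast
  obtain Q where Q: "Q > 0" "\<And>x. a \<le> x \<Longrightarrow> x \<le> b \<Longrightarrow> \<bar>q x\<bar> \<le> Q"
    using q_bounded[of a b] ab by blast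
  have Vt: "\<bar>v n x\<bar> \<le> V" "\<bar>q x\<bar> \<le> Q" if "\<bar>x - t\<bar> \<le> d" for n x
    by (rule V(2) Q(2); use that in \<open>simp add: a_def b_def abs_le_iff min_le_iff_disj le_max_iff_disj\<close>)+
  have Vp: "\<bar>v n p\<bar> \<le> V" if "A \<le> p" "p \<le> B" for n p
    using that by (intro V) (auto simp: a_def b_def)
  have V't: "\<bar>v' n t\<bar> \<le> V * (1 + e n)" for n
    using d by (intro V) (auto simp: a_def b_def)
  obtain T where T: "T > 0" "\<And>z E. 0 < Re z \<Longrightarrow> 0 \<le> Re (z\<^sup>2) \<Longrightarrow> norm z \<le> min d 1 / 2 \<Longrightarrow> 0 \<le> E \<Longrightarrow>
     norm (2 * cos_moment d (poisson_chain d z) 2 E 0 - exp (- (z * of_real E))) \<le> T * norm z / (1 + E) ^ 3"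
    using poisson_cosine_transform[OF d(1)] by blast
  define \<rho> where "\<rho> = min d 1 / 2"
  have \<rho>: "0 < \<rho>" "\<rho> \<le> d" using d by (auto simp: \<rho>_def)
  define S where "S = (\<Sum>n. 1 / (1 + (e n)\<^sup>2))"
  have S0: "0 \<le> S" unfolding S_def by (intro suminf_nonneg inverse_energy_summable) (simp add: add_nonneg_nonneg)
  \<comment> \<open>The cubic decay of this error leaves room for the factor \<open>1 + e n\<close>
    of \<open>v'\<close>: the remaining (1 + e n)^(-2) is still summable.\<close>
  define \<epsilon> where "\<epsilon> z n = exp (- (z * of_real (e n))) - 2 * cos_moment d (poisson_chain d z) 2 (e n) 0" for z n
  have \<epsilon>: "norm (\<epsilon> z n) \<le> T * norm z / (1 + e n) ^ 3" if "0 < Re z" "0 \<le> Re (z\<^sup>2)" "norm z \<le> \<rho>" for z n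
    using T(2)[OF that(1,2), of "e n"] that(3) e_nonneg[of n] by (simp add: \<epsilon>_def \<rho>_def norm_minus_commute)
  have arith: "(V * u) * V * (T * norm z / u ^ 3) = V * V * T * norm z * (1 / u\<^sup>2)"
    "(V * u) * (E + T * norm z / u ^ 3) = V * (u ^ 1 * E) + V * T * norm z * (1 / u\<^sup>2)"
    if "0 < u" for u E and z :: complex
    using that by (simp_all add: field_simps power2_eq_square power3_eq_cube)
  \<comment> \<open>the part of the series not captured by the cosine transform\<close>
  have rest: "summable (\<lambda>n. (g n * v n p) *\<^sub>R \<epsilon> z n)" "norm (\<Sum>n. (g n * v n p) *\<^sub>R \<epsilon> z n) \<le> V * V * T * S * norm z"
    if z: "0 < Re z" "0 \<le> Re (z\<^sup>2)" "norm z \<le> \<rho>" and p: "A \<le> p" "p \<le> B" and g: "\<And>n. \<bar>g n\<bar> \<le> V * (1 + e n)"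
    for g z p
  proof -
    have *: "norm ((g n * v n p) *\<^sub>R \<epsilon> z n) \<le> V * V * T * norm z * (1 / (1 + (e n)\<^sup>2))" for n
    proof -
      have e1: "0 < 1 + e n" using e_nonneg[of n] by simp
      have "norm ((g n * v n p) *\<^sub>R \<epsilon> z n) = \<bar>g n\<bar> * \<bar>v n p\<bar> * norm (\<epsilon> z n)" by (simp add: abs_mult)
      also have "\<dots> \<le> (V * (1 + e n)) * V * (T * norm z / (1 + e n) ^ 3)"
        using V(1) e1 by (intro mult_mono g Vp p \<epsilon> z) auto
      also have "\<dots> = V * V * T * norm z * (1 / (1 + e n)\<^sup>2)"
        using arith(1)[OF e1] by (simp add: mult_ac)
      also have "\<dots> \<le> V * V * T * norm z * (1 / (1 + (e n)\<^sup>2))"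
        using V(1) T(1) e_nonneg[of n] by (intro mult_left_mono inverse_energy_mono) auto
      finally show ?thesis .
    qed
    have s: "summable (\<lambda>n. V * V * T * norm z * (1 / (1 + (e n)\<^sup>2)))"
      using inverse_energy_summable[of "V * V * T * norm z"] by simp
    show "summable (\<lambda>n. (g n * v n p) *\<^sub>R \<epsilon> z n)" by (rule summable_comparison_test'[OF s *])
    have "norm (\<Sum>n. (g n * v n p) *\<^sub>R \<epsilon> z n) \<le> (\<Sum>n. V * V * T * norm z * (1 / (1 + (e n)\<^sup>2)))"
      by (rule norm_suminf_le[OF * s])
    also have "\<dots> = V * V * T * norm z * S" unfolding S_def
      by (rule suminf_mult) (rule inverse_energy_summable)
    finally show "norm (\<Sum>n. (g n * v n p) *\<^sub>R \<epsilon> z n) \<le> V * V * T * S * norm z" by (simp add: mult_ac)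
  qed
  have g1: "\<bar>v n t\<bar> \<le> V * (1 + e n)" for n
  proof -
    have "V * 1 \<le> V * (1 + e n)" using V(1) e_nonneg[of n] by (intro mult_left_mono) auto
    then show ?thesis using Vt(1)[of t n] d by simp
  qed
  \<comment> \<open>Bounds for the kernels of index 4, 3 and 2. Index 4 converges absolutely; each
    step down multiplies by d Q and adds the size of the chain entry, which is pi at index 3. At
    index 2 the entry is the Poisson kernel, which is kept separate from
    \<open>\<kappa>2\<close>.\<close>
  define \<kappa>4 where "\<kappa>4 = V * V * (2 * pi + d * (d * pi)) * S"
  define \<kappa>3 where "\<kappa>3 = pi + d * Q * \<kappa>4"
  define \<kappa>2 where "\<kappa>2 = d * Q * \<kappa>3"
  have \<kappa>: "0 \<le> \<kappa>4" "0 \<le> \<kappa>3" "0 \<le> \<kappa>2"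
    using V(1) Q(1) d S0 by (auto simp: \<kappa>4_def \<kappa>3_def \<kappa>2_def intro!: mult_nonneg_nonneg add_nonneg_nonneg)
  have lp: "l < p" "p < r" if "A \<le> p" "p \<le> B" for p using that AB by auto
  have K2: "norm (osc_kernel d (poisson_chain d z) 2 x y p) \<le> 2 * norm z / ((x + \<bar>p - y\<bar>)\<^sup>2 + (norm z)\<^sup>2) + \<kappa>2"
    if z: "0 < Re z" "0 \<le> Re (z\<^sup>2)" and p: "A \<le> p" "p \<le> B" and x: "0 \<le> x" "x \<le> d" "\<bar>y - t\<bar> \<le> x" for z p x y
  proof -
    note ch = osc_chain_poisson[OF z(1) d(1)]
    have K4: "norm (osc_kernel d (poisson_chain d z) 4 x y p) \<le> \<kappa>4"
      if "0 \<le> x" "x \<le> d" "\<bar>y - t\<bar> \<le> x" for x y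
      unfolding \<kappa>4_def S_def
      by (rule osc_kernel_base_bound) (use that Vt Vp p poisson_moment_4_decay[OF d(1) z] in auto)
    have K3: "norm (osc_kernel d (poisson_chain d z) (1 + 2) x y p) \<le> \<kappa>3"
      if "0 \<le> x" "x \<le> d" "\<bar>y - t\<bar> \<le> x" for x y
      unfolding \<kappa>3_def
      by (rule osc_kernel_bound_step[OF ch d(2,3) lp[OF p], where \<xi>=0])
        (use that Vt K4 \<kappa> poisson_chain_3_bound[OF d(1) z] in \<open>auto simp: eval_nat_numeral\<close>)
    have sq: "(x + \<bar>p - y\<bar>)\<^sup>2 + (norm z)\<^sup>2 > 0" using z by (intro add_nonneg_pos) auto
    have "norm (osc_kernel d (poisson_chain d z) (0 + 2) x y p) \<le> 2 * norm z / ((x + \<bar>p - y\<bar>)\<^sup>2 + (norm z)\<^sup>2) + d * Q * \<kappa>3"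
    \<comment> \<open>Taking \<xi> equal to the current distance preserves the spatial decay of the
      Poisson kernel instead of its maximum.\<close>
    proof (rule osc_kernel_bound_step[OF ch d(2,3) lp[OF p], where \<xi>="x + \<bar>p - y\<bar>"])
      fix s assume s: "0 \<le> s" "x + \<bar>p - y\<bar> \<le> s" "s \<le> d"
      have "norm (poisson_chain d z 2 s) \<le> 2 * norm z / (s\<^sup>2 + (norm z)\<^sup>2)"
        by (rule poisson_chain_2_bound[OF z d(1) s(1,3)])
      also have "\<dots> \<le> 2 * norm z / ((x + \<bar>p - y\<bar>)\<^sup>2 + (norm z)\<^sup>2)"
      proof (rule divide_left_mono)
        have "(x + \<bar>p - y\<bar>)\<^sup>2 \<le> s\<^sup>2" using s x by (intro power_mono) auto
        then show "(x + \<bar>p - y\<bar>)\<^sup>2 + (norm z)\<^sup>2 \<le> s\<^sup>2 + (norm z)\<^sup>2" by simp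
        then show "0 < (s\<^sup>2 + (norm z)\<^sup>2) * ((x + \<bar>p - y\<bar>)\<^sup>2 + (norm z)\<^sup>2)"
          using sq by (intro mult_pos_pos) auto
      qed simp
      finally show "norm (poisson_chain d z (0 + 2) s) \<le> 2 * norm z / ((x + \<bar>p - y\<bar>)\<^sup>2 + (norm z)\<^sup>2)"
        by (simp only: add_0_left)
    qed (use K3 Vt x \<kappa> in \<open>auto simp: eval_nat_numeral\<close>)
    then show ?thesis by (simp only: add_0_left \<kappa>2_def)
  qed
  have main: "exp_series (\<lambda>n. v n t) p z = 2 *\<^sub>R osc_kernel d (poisson_chain d z) 2 0 t p + (\<Sum>n. (v n t * v n p) *\<^sub>R \<epsilon> z n)"
    if z: "0 < Re z" "0 \<le> Re (z\<^sup>2)" "norm z \<le> \<rho>" and p: "A \<le> p" "p \<le> B" for z p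
  proof -
    have s1: "summable (\<lambda>n. (v n t * v n p) *\<^sub>R exp (- (z * of_real (e n))))"
      by (rule exp_series_summable[OF _ lp[OF p] z(1), of _ V 1]) (use g1 in auto)
    have "(v n t * v n p) *\<^sub>R exp (- (z * of_real (e n))) - (v n t * v n p) *\<^sub>R \<epsilon> z n
      = 2 *\<^sub>R ((v n t * v n p) *\<^sub>R cos_moment d (poisson_chain d z) 2 (e n) 0)" for n
      by (simp add: \<epsilon>_def scaleR_conv_of_real algebra_simps)
    with summable_diff[OF s1 rest(1)[OF z p g1]]
    have "summable (\<lambda>n. 2 *\<^sub>R ((v n t * v n p) *\<^sub>R cos_moment d (poisson_chain d z) 2 (e n) 0))"
      by (simp only:)
    then have s2: "summable (\<lambda>n. (v n t * v n p) *\<^sub>R cos_moment d (poisson_chain d z) 2 (e n) 0)"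
      using summable_scaleR_right[of _ "1/2"] by fastforce
    have "(\<lambda>n. 2 *\<^sub>R ((v n t * v n p) *\<^sub>R cos_moment d (poisson_chain d z) 2 (e n) 0) + (v n t * v n p) *\<^sub>R \<epsilon> z n)
      sums (2 *\<^sub>R osc_kernel d (poisson_chain d z) 2 0 t p + (\<Sum>n. (v n t * v n p) *\<^sub>R \<epsilon> z n))"
      unfolding osc_kernel_def by (intro sums_add sums_scaleR_right summable_sums s2 rest(1)[OF z p g1])
    moreover have "2 *\<^sub>R ((v n t * v n p) *\<^sub>R cos_moment d (poisson_chain d z) 2 (e n) 0) + (v n t * v n p) *\<^sub>R \<epsilon> z n
      = (v n t * v n p) *\<^sub>R exp (- (z * of_real (e n)))" for n
      by (simp add: \<epsilon>_def scaleR_conv_of_real algebra_simps)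
    ultimately show ?thesis by (simp add: exp_series_def sums_iff)
  qed
  define I where "I z p = integral {0..d} (\<lambda>s. q (t+s) *\<^sub>R osc_kernel d (poisson_chain d z) 2 s (t+s) p
         + (- q (t-s)) *\<^sub>R osc_kernel d (poisson_chain d z) 2 s (t-s) p)" for z p
  define h where "h z p = (if \<bar>p - t\<bar> \<le> d then sgn (p - t) *\<^sub>R poisson_chain d z 1 \<bar>p - t\<bar> else 0)" for z p
  have deriv: "continuous_on {0..d} (\<lambda>s. q (t+s) *\<^sub>R osc_kernel d (poisson_chain d z) 2 s (t+s) p
         + (- q (t-s)) *\<^sub>R osc_kernel d (poisson_chain d z) 2 s (t-s) p)"
    "exp_series (\<lambda>n. v' n t) p z = h z p - I z p + (\<Sum>n. (v' n t * v n p) *\<^sub>R \<epsilon> z n)"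
    if z: "0 < Re z" "0 \<le> Re (z\<^sup>2)" "norm z \<le> \<rho>" and p: "A \<le> p" "p \<le> B" for z p
  proof -
    note ch = osc_chain_poisson[OF z(1) d(1)]
    \<comment> \<open>This constant depends on Re z. It only secures convergence of the series and
      does not enter the final bounds.\<close>
    obtain K where K: "K > 0" "\<And>n. (1 + e n) ^ 1 * exp (- (Re z * e n)) \<le> K / (1 + (e n)\<^sup>2)"
      using polynomial_exp_summable_bound[OF z(1), of 1] by blast
    have dec: "norm (v' n t *\<^sub>R cos_moment d (poisson_chain d z) 2 (e n) 0) \<le> (V * K + V * T * norm z) / (1 + (e n)\<^sup>2)" for n
    proof -
      have e1: "0 < 1 + e n" using e_nonneg[of n] by simp
      have "2 *\<^sub>R cos_moment d (poisson_chain d z) 2 (e n) 0 = exp (- (z * of_real (e n))) - \<epsilon> z n"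
        by (simp add: \<epsilon>_def scaleR_conv_of_real)
      then have "2 * norm (cos_moment d (poisson_chain d z) 2 (e n) 0) = norm (exp (- (z * of_real (e n))) - \<epsilon> z n)"
        by (metis norm_scaleR abs_numeral)
      also have "\<dots> \<le> exp (- (Re z * e n)) + T * norm z / (1 + e n) ^ 3"
        using norm_triangle_ineq4[of "exp (- (z * of_real (e n)))" "\<epsilon> z n"] \<epsilon>[OF z, of n] by simp
      finally have "norm (cos_moment d (poisson_chain d z) 2 (e n) 0) \<le> exp (- (Re z * e n)) + T * norm z / (1 + e n) ^ 3"
        using norm_ge_zero[of "cos_moment d (poisson_chain d z) 2 (e n) 0"] by linarith
      then have "norm (v' n t *\<^sub>R cos_moment d (poisson_chain d z) 2 (e n) 0)
         \<le> (V * (1 + e n)) * (exp (- (Re z * e n)) + T * norm z / (1 + e n) ^ 3)"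
        unfolding norm_scaleR using V't[of n] V(1) e1 by (intro mult_mono) auto
      also have "\<dots> = V * ((1 + e n) ^ 1 * exp (- (Re z * e n))) + V * T * norm z * (1 / (1 + e n)\<^sup>2)"
        using arith(2)[OF e1] by simp
      also have "\<dots> \<le> V * (K / (1 + (e n)\<^sup>2)) + V * T * norm z * (1 / (1 + (e n)\<^sup>2))"
        using V(1) T(1) e_nonneg[of n] by (intro add_mono mult_left_mono K inverse_energy_mono) auto
      finally show ?thesis by (simp add: add_divide_distrib)
    qed
    note R = osc_kernel_deriv_recursion[OF ch d(2,3) lp[OF p] poisson_chain_1_0 dec]
    show "continuous_on {0..d} (\<lambda>s. q (t+s) *\<^sub>R osc_kernel d (poisson_chain d z) 2 s (t+s) p
         + (- q (t-s)) *\<^sub>R osc_kernel d (poisson_chain d z) 2 s (t-s) p)" by (rule R(1))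
    from sums_add[OF R(2) summable_sums[OF rest(1)[OF z p V't]]]
    have "(\<lambda>n. (2 * v' n t * v n p) *\<^sub>R cos_moment d (poisson_chain d z) 2 (e n) 0 + (v' n t * v n p) *\<^sub>R \<epsilon> z n)
      sums (h z p - I z p + (\<Sum>n. (v' n t * v n p) *\<^sub>R \<epsilon> z n))"
      by (simp add: h_def I_def)
    moreover have "(2 * v' n t * v n p) *\<^sub>R cos_moment d (poisson_chain d z) 2 (e n) 0 + (v' n t * v n p) *\<^sub>R \<epsilon> z n
      = (v' n t * v n p) *\<^sub>R exp (- (z * of_real (e n)))" for n
      by (simp add: \<epsilon>_def scaleR_conv_of_real algebra_simps)
    ultimately show "exp_series (\<lambda>n. v' n t) p z = h z p - I z p + (\<Sum>n. (v' n t * v n p) *\<^sub>R \<epsilon> z n)"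
      by (simp add: exp_series_def sums_iff)
  qed
  \<comment> \<open>The correction runs along |y - t| = s, where the kernel of index 2 is at most a
    Poisson kernel in s plus a constant. The integral over s is therefore bounded uniformly in z,
    although the kernel is not.\<close>
  have I_bound: "norm (I z p) \<le> 2 * Q * integral {0..d} w"
    if z: "0 < Re z" "0 \<le> Re (z\<^sup>2)" "norm z \<le> \<rho>" and p: "A \<le> p" "p \<le> B" and w: "w integrable_on {0..d}"
      "\<And>s y. 0 \<le> s \<Longrightarrow> s \<le> d \<Longrightarrow> \<bar>y - t\<bar> = s \<Longrightarrow> norm (osc_kernel d (poisson_chain d z) 2 s y p) \<le> w s"
    for z p w
  proof -
    have "norm (I z p) \<le> integral {0..d} (\<lambda>s. 2 * Q * w s)" unfolding I_def
    proof (rule integral_norm_bound_integral)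
      show "(\<lambda>s. 2 * Q * w s) integrable_on {0..d}" by (rule integrable_on_mult_right[OF w(1)])
      fix s assume s: "s \<in> {0..d}"
      have "norm (q (t+s) *\<^sub>R osc_kernel d (poisson_chain d z) 2 s (t+s) p) \<le> Q * w s"
        unfolding norm_scaleR using s Q(1) by (intro mult_mono Vt w) auto
      moreover have "norm ((- q (t-s)) *\<^sub>R osc_kernel d (poisson_chain d z) 2 s (t-s) p) \<le> Q * w s"
        unfolding norm_scaleR abs_minus_cancel using s Q(1) by (intro mult_mono Vt w) auto
      ultimately show "norm (q (t+s) *\<^sub>R osc_kernel d (poisson_chain d z) 2 s (t+s) p
         + (- q (t-s)) *\<^sub>R osc_kernel d (poisson_chain d z) 2 s (t-s) p) \<le> 2 * Q * w s"
        by (intro order_trans[OF norm_triangle_ineq]) linarith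
    qed (use deriv(1)[OF z p] in \<open>auto intro: integrable_continuous_real\<close>)
    then show ?thesis by simp
  qed
  define C where "C = max 4 (2 * \<kappa>2 + V * V * T * S * \<rho>) + 2 * Q * (pi + d * \<kappa>2)"
  have "0 \<le> 2 * Q * (pi + d * \<kappa>2)" using Q(1) d \<kappa> by (intro mult_nonneg_nonneg add_nonneg_nonneg) auto
  then have C: "0 < C" "4 \<le> C" "2 * \<kappa>2 + V * V * T * S * \<rho> \<le> C" "2 * Q * (pi + d * \<kappa>2) + V * V * T * S * \<rho> \<le> C"
    using \<kappa> by (auto simp: C_def)
  have VT: "0 \<le> V * V * T * S" using V(1) T(1) S0 by simp
  have 1: "norm (exp_series (\<lambda>n. v n t) p z) \<le> C * (norm z / ((p - t)\<^sup>2 + (norm z)\<^sup>2) + 1)"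
    if z: "0 < Re z" "0 \<le> Re (z\<^sup>2)" "norm z \<le> \<rho>" and p: "A \<le> p" "p \<le> B" for z p
  proof -
    define X where "X = norm z / ((p - t)\<^sup>2 + (norm z)\<^sup>2)"
    have X: "0 \<le> X" by (simp add: X_def)
    have k: "norm (osc_kernel d (poisson_chain d z) 2 0 t p) \<le> 2 * X + \<kappa>2"
      using K2[OF z(1,2) p, of 0 t] d by (simp add: X_def)
    have r: "norm (\<Sum>n. (v n t * v n p) *\<^sub>R \<epsilon> z n) \<le> V * V * T * S * \<rho>"
      by (rule order_trans[OF rest(2)[OF z p g1] mult_left_mono[OF z(3) VT]])
    have "norm (exp_series (\<lambda>n. v n t) p z) \<le> 2 * (2 * X + \<kappa>2) + V * V * T * S * \<rho>"
      unfolding main[OF z p] using k r by (intro order_trans[OF norm_triangle_ineq] add_mono) auto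
    also have "\<dots> = 4 * X + (2 * \<kappa>2 + V * V * T * S * \<rho>)" by simp
    also have "\<dots> \<le> C * X + C" by (intro add_mono mult_right_mono C X)
    finally show ?thesis by (simp add: X_def distrib_left)
  qed
  have 2: "norm (exp_series (\<lambda>n. v' n t) p z - h z p) \<le> C"
    if z: "0 < Re z" "0 \<le> Re (z\<^sup>2)" "norm z \<le> \<rho>" and p: "A \<le> p" "p \<le> B" for z p
  proof -
    have z0: "0 < norm z" using z by auto
    note ii = integral_poisson_le[OF z0 order_refl less_imp_le[OF d(1)]]
    have wi: "(\<lambda>s. 2 * norm z / (s\<^sup>2 + (norm z)\<^sup>2) + \<kappa>2) integrable_on {0..d}"
      by (intro integrable_add ii) auto
    have w: "norm (osc_kernel d (poisson_chain d z) 2 s y p) \<le> 2 * norm z / (s\<^sup>2 + (norm z)\<^sup>2) + \<kappa>2"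
      if s: "0 \<le> s" "s \<le> d" "\<bar>y - t\<bar> = s" for s y
    proof -
      have "norm (osc_kernel d (poisson_chain d z) 2 s y p) \<le> 2 * norm z / ((s + \<bar>p - y\<bar>)\<^sup>2 + (norm z)\<^sup>2) + \<kappa>2"
        by (rule K2[OF z(1,2) p]) (use s in auto)
      also have "\<dots> \<le> 2 * norm z / (s\<^sup>2 + (norm z)\<^sup>2) + \<kappa>2"
      proof (rule add_right_mono, rule divide_left_mono)
        have "s\<^sup>2 \<le> (s + \<bar>p - y\<bar>)\<^sup>2" using s by (intro power_mono) auto
        then show "s\<^sup>2 + (norm z)\<^sup>2 \<le> (s + \<bar>p - y\<bar>)\<^sup>2 + (norm z)\<^sup>2" by simp
        show "0 < ((s + \<bar>p - y\<bar>)\<^sup>2 + (norm z)\<^sup>2) * (s\<^sup>2 + (norm z)\<^sup>2)"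
          using z0 by (intro mult_pos_pos add_nonneg_pos) auto
      qed simp
      finally show ?thesis .
    qed
    have "norm (I z p) \<le> 2 * Q * integral {0..d} (\<lambda>s. 2 * norm z / (s\<^sup>2 + (norm z)\<^sup>2) + \<kappa>2)"
      by (rule I_bound[OF z p wi w])
    also have "integral {0..d} (\<lambda>s. 2 * norm z / (s\<^sup>2 + (norm z)\<^sup>2) + \<kappa>2)
        = integral {0..d} (\<lambda>s. 2 * norm z / (s\<^sup>2 + (norm z)\<^sup>2)) + d * \<kappa>2"
      using d ii by (subst integral_add) auto
    also have "2 * Q * \<dots> \<le> 2 * Q * (pi + d * \<kappa>2)"
      using Q(1) ii(2) by (intro mult_left_mono add_right_mono) auto
    finally have i: "norm (I z p) \<le> 2 * Q * (pi + d * \<kappa>2)" .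
    have r: "norm (\<Sum>n. (v' n t * v n p) *\<^sub>R \<epsilon> z n) \<le> V * V * T * S * \<rho>"
      by (rule order_trans[OF rest(2)[OF z p V't] mult_left_mono[OF z(3) VT]])
    have "exp_series (\<lambda>n. v' n t) p z - h z p = (\<Sum>n. (v' n t * v n p) *\<^sub>R \<epsilon> z n) - I z p"
      unfolding deriv(2)[OF z p] by simp
    then show ?thesis using norm_triangle_ineq4[of "\<Sum>n. (v' n t * v n p) *\<^sub>R \<epsilon> z n" "I z p"] i r C(4) by simp
  qed
  have 3: "\<exists>C'. \<forall>z. 0 < Re z \<longrightarrow> 0 \<le> Re (z\<^sup>2) \<longrightarrow> norm z \<le> \<rho> \<longrightarrow>
      norm (exp_series (\<lambda>n. v n t) p z) \<le> C' * norm z \<and> norm (exp_series (\<lambda>n. v' n t) p z) \<le> C' * norm z"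
    if p: "A \<le> p" "p \<le> B" "p \<noteq> t" for p
  proof -
    define x0 where "x0 = \<bar>p - t\<bar>"
    have x0: "0 < x0" using p by (simp add: x0_def)
    \<comment> \<open>Bounds O(|z|) on the part of the cone at distance at least |p - t|, which the
      recursion preserves. From index 7, where the moments themselves are O(|z|), five steps lead
      down to index 2.\<close>
    define off where "off m \<kappa> \<longleftrightarrow> (\<forall>z x y. 0 < Re z \<longrightarrow> 0 \<le> Re (z\<^sup>2) \<longrightarrow> 0 \<le> x \<longrightarrow> x \<le> d \<longrightarrow> \<bar>y - t\<bar> \<le> x \<longrightarrow>
      x0 \<le> x + \<bar>p - y\<bar> \<longrightarrow> norm (osc_kernel d (poisson_chain d z) m x y p) \<le> \<kappa> * norm z)" for m \<kappa>
    have o7: "off 7 (V * V * (2 * d\<^sup>2 + d ^ 4) * S)"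
      unfolding off_def
    proof (intro allI impI)
      fix z :: complex and x y :: real
      assume a: "0 < Re z" "0 \<le> Re (z\<^sup>2)" "0 \<le> x" "x \<le> d" "\<bar>y - t\<bar> \<le> x" "x0 \<le> x + \<bar>p - y\<bar>"
      have "norm (osc_kernel d (poisson_chain d z) 7 x y p) \<le> V * V * ((2 * d\<^sup>2 + d ^ 4) * norm z) * S"
        unfolding S_def
        by (rule osc_kernel_base_bound) (use a Vt Vp p poisson_moment_7_decay[OF d(1) a(1,2)] in auto)
      then show "norm (osc_kernel d (poisson_chain d z) 7 x y p) \<le> V * V * (2 * d\<^sup>2 + d ^ 4) * S * norm z"
        by (simp add: mult_ac)
    qed
    have step: "\<exists>\<kappa>'\<ge>0. off (m + 2) \<kappa>'" if ex: "\<exists>\<kappa>\<ge>0. off (m + 3) \<kappa>" for m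
    proof -
      from ex obtain \<kappa> where "0 \<le> \<kappa> \<and> off (m + 3) \<kappa>" ..
      then have \<kappa>: "0 \<le> \<kappa>" "off (m + 3) \<kappa>" by (auto simp only:)
      have "off (m + 2) (d ^ m * (2 / x0\<^sup>2) + d * Q * \<kappa>)" unfolding off_def
      proof (intro allI impI)
        fix z :: complex and x y :: real
        assume a: "0 < Re z" "0 \<le> Re (z\<^sup>2)" "0 \<le> x" "x \<le> d" "\<bar>y - t\<bar> \<le> x" "x0 \<le> x + \<bar>p - y\<bar>"
        have "norm (osc_kernel d (poisson_chain d z) (m + 2) x y p)
          \<le> d ^ m * (2 / x0\<^sup>2 * norm z) + d * Q * (\<kappa> * norm z)"
          using \<kappa> unfolding off_def
          by (intro osc_kernel_bound_step[OF osc_chain_poisson[OF a(1) d(1)] d(2,3) lp[OF p(1,2)], where \<xi>=x0])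
            (use a d x0 Vt(2) poisson_chain_off_diagonal[OF d(1) a(1,2) x0] in auto)
        then show "norm (osc_kernel d (poisson_chain d z) (m + 2) x y p)
          \<le> (d ^ m * (2 / x0\<^sup>2) + d * Q * \<kappa>) * norm z" by (simp add: algebra_simps)
      qed
      moreover have "0 \<le> d ^ m * (2 / x0\<^sup>2) + d * Q * \<kappa>" using d Q(1) \<kappa>(1) by simp
      ultimately show ?thesis by blast
    qed
    have "\<exists>\<kappa>\<ge>0. off 7 \<kappa>"
      using o7 V(1) d S0 by (intro exI[of _ "V * V * (2 * d\<^sup>2 + d ^ 4) * S"]) simp
    with step[of 4] step[of 3] step[of 2] step[of 1] step[of 0]
    obtain \<kappa> where \<kappa>: "0 \<le> \<kappa>" "off 2 \<kappa>" by (auto simp: eval_nat_numeral)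
    define C' where "C' = 2 * \<kappa> + V * V * T * S + 32 / x0 ^ 3 + 2 * Q * (d * \<kappa>)"
    have "norm (exp_series (\<lambda>n. v n t) p z) \<le> C' * norm z \<and> norm (exp_series (\<lambda>n. v' n t) p z) \<le> C' * norm z"
      if z: "0 < Re z" "0 \<le> Re (z\<^sup>2)" "norm z \<le> \<rho>" for z
    proof
      have k: "norm (osc_kernel d (poisson_chain d z) 2 s y p) \<le> \<kappa> * norm z"
        if "0 \<le> s" "s \<le> d" "\<bar>y - t\<bar> = s" for s y
        using \<kappa>(2) that z unfolding off_def by (auto simp: x0_def)
      have r1: "norm (\<Sum>n. (v n t * v n p) *\<^sub>R \<epsilon> z n) \<le> V * V * T * S * norm z"
        by (rule rest(2)[OF z p(1,2) g1])
      have r2: "norm (\<Sum>n. (v' n t * v n p) *\<^sub>R \<epsilon> z n) \<le> V * V * T * S * norm z"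
        by (rule rest(2)[OF z p(1,2) V't])
      have "norm (exp_series (\<lambda>n. v n t) p z) \<le> 2 * (\<kappa> * norm z) + V * V * T * S * norm z"
        unfolding main[OF z p(1,2)] using k[of 0 t] d r1
        by (intro order_trans[OF norm_triangle_ineq] add_mono) auto
      also have "\<dots> = (2 * \<kappa> + V * V * T * S) * norm z" by (simp add: algebra_simps)
      also have "\<dots> \<le> C' * norm z" unfolding C'_def using x0 Q(1) d \<kappa>(1)
        by (intro mult_right_mono) auto
      finally show "norm (exp_series (\<lambda>n. v n t) p z) \<le> C' * norm z" .
      have i: "norm (I z p) \<le> 2 * Q * integral {0..d} (\<lambda>_. \<kappa> * norm z)"
        by (rule I_bound[OF z p(1,2)]) (use k in auto)
      have hb: "norm (h z p) \<le> 32 / x0 ^ 3 * norm z"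
      proof (cases "\<bar>p - t\<bar> \<le> d")
        case True
        have "norm (poisson_chain d z 1 x0) \<le> 32 * norm z * x0 / (x0\<^sup>2 + (norm z)\<^sup>2)\<^sup>2"
          by (rule poisson_chain_1_bound) (use z d x0 \<rho> True in \<open>auto simp: x0_def\<close>)
        also have "\<dots> \<le> 32 * norm z * x0 / (x0\<^sup>2)\<^sup>2"
          using x0 by (intro divide_left_mono power_mono mult_pos_pos zero_less_power add_pos_nonneg) auto
        also have "\<dots> = 32 / x0 ^ 3 * norm z" using x0 by (simp add: field_simps eval_nat_numeral)
        finally have "norm (poisson_chain d z 1 x0) \<le> 32 / x0 ^ 3 * norm z" .
        moreover have "norm (h z p) = norm (poisson_chain d z 1 x0)"
          using True p(3) unfolding h_def x0_def by (simp only: if_True norm_scaleR abs_sgn_eq) simp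
        ultimately show ?thesis by (simp only:)
      qed (use x0 in \<open>simp add: h_def\<close>)
      have "norm (exp_series (\<lambda>n. v' n t) p z) \<le> (32 / x0 ^ 3 * norm z + 2 * Q * integral {0..d} (\<lambda>_. \<kappa> * norm z))
          + V * V * T * S * norm z"
        unfolding deriv(2)[OF z p(1,2)]
        by (intro order_trans[OF norm_triangle_ineq] order_trans[OF norm_triangle_ineq4] add_mono hb i r2)
      also have "\<dots> = (V * V * T * S + 32 / x0 ^ 3 + 2 * Q * (d * \<kappa>)) * norm z"
        using d by (simp add: algebra_simps)
      also have "\<dots> \<le> C' * norm z" unfolding C'_def using \<kappa>(1)
        by (intro mult_right_mono) auto
      finally show "norm (exp_series (\<lambda>n. v' n t) p z) \<le> C' * norm z" .
    qed
    then show ?thesis by blast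
  qed
  show ?thesis
    by (rule that[OF \<rho> C(1) 1 2[unfolded h_def] 3])
qed

end

text \<open>Euler's integral after the substitution t = c s, carried out for nonnegative integrals
  so that integrability comes together with the value.\<close>

lemma has_integral_power_times_exp:
  fixes c :: real
  assumes c: "0 < c"
  shows "((\<lambda>s. s ^ k * exp (- (s * c))) has_integral fact k / c ^ Suc k) {0<..}"
proof -
  define f where "f s = indicator {0..} s * (s ^ k * exp (- (s * c)))" for s :: real
  have f: "f \<in> borel_measurable borel" unfolding f_def by measurable
  have f0: "0 \<le> f s" for s by (auto simp: f_def indicator_def)
  have "ennreal (fact k) = (\<integral>\<^sup>+t. ennreal (indicator {0..} t * t powr (real (Suc k) - 1) / exp t) \<partial>lborel)"
    using Gamma_conv_nn_integral_real[of "real (Suc k)"] by (simp add: Gamma_fact add.commute)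
  also have "\<dots> = (\<integral>\<^sup>+t. ennreal (indicator {0..} t * (t ^ k * exp (- t))) \<partial>lborel)"
  proof (intro nn_integral_cong_AE AE_I[where N="{0}"] subsetI)
    have "t powr real k = t ^ k" if "0 < t" for t :: real using that by (rule powr_realpow)
    then show "t \<in> {0}" if "t \<in> {t \<in> space lborel. ennreal (indicator {0..} t * t powr (real (Suc k) - 1) / exp t)
        \<noteq> ennreal (indicator {0..} t * (t ^ k * exp (- t)))}" for t
      using that by (cases "0 < t") (auto simp: indicator_def exp_minus divide_inverse)
  qed auto
  also have "\<dots> = ennreal \<bar>c\<bar> * (\<integral>\<^sup>+s. ennreal (indicator {0..} (0 + c * s) * ((0 + c * s) ^ k * exp (- (0 + c * s)))) \<partial>lborel)"
    by (rule nn_integral_real_affine) (use c in auto)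
  also have "(\<lambda>s. indicator {0..} (0 + c * s) * ((0 + c * s) ^ k * exp (- (0 + c * s)))) = (\<lambda>s. c ^ k * f s)"
    using c by (auto simp: f_def indicator_def fun_eq_iff power_mult_distrib zero_le_mult_iff mult.commute)
  also have "(\<integral>\<^sup>+s. ennreal (c ^ k * f s) \<partial>lborel) = ennreal (c ^ k) * (\<integral>\<^sup>+s. ennreal (f s) \<partial>lborel)"
    using c f f0 by (simp add: ennreal_mult nn_integral_cmult)
  finally have "ennreal (fact k) = ennreal (c ^ Suc k) * (\<integral>\<^sup>+s. ennreal (f s) \<partial>lborel)"
    using c by (simp add: ennreal_mult mult.assoc)
  then have "(\<integral>\<^sup>+s. ennreal (f s) \<partial>lborel) = ennreal (fact k / c ^ Suc k)"
    using c by (metis divide_ennreal ennreal_mult_divide_eq ennreal_neq_top fact_ge_zero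
        less_numeral_extra(3) mult.commute zero_less_power ennreal_eq_0_iff linorder_not_less)
  then have "(f has_integral fact k / c ^ Suc k) UNIV"
    by (intro nn_integral_has_integral) (use f f0 c in auto)
  moreover have "f = (\<lambda>s. if s \<in> {0..} then s ^ k * exp (- (s * c)) else 0)" by (simp add: f_def fun_eq_iff)
  ultimately have hi: "((\<lambda>s. s ^ k * exp (- (s * c))) has_integral fact k / c ^ Suc k) {0..}"
    using has_integral_restrict_UNIV[of "{0..}" "\<lambda>s. s ^ k * exp (- (s * c))"] by (simp only:)
  have n: "negligible {s \<in> {0..} - {0<..}. s ^ k * exp (- (s * c)) \<noteq> 0}"
    "negligible {s \<in> {0<..} - {0..}. s ^ k * exp (- (s * c)) \<noteq> 0}"
    by (rule negligible_subset[of "{0}"]; force)+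
  show ?thesis by (rule iffD1[OF has_integral_spike_set_eq[OF n] hi])
qed

text \<open>Connects the two theories of integration: majorants are found with the fundamental
  theorem for the gauge integral, while kernels and principal values are Lebesgue integrals.\<close>

lemma set_integrable_lborel_dominated:
  fixes f :: "real \<Rightarrow> 'a::euclidean_space"
  assumes S: "S \<in> sets borel" and f: "set_borel_measurable borel S f"
    and h: "h integrable_on S" and le: "\<And>x. x \<in> S \<Longrightarrow> norm (f x) \<le> h x"
  shows "set_integrable lborel S f"
proof -
  have "(\<lambda>x. indicat_real S x *\<^sub>R f x) \<in> borel_measurable lborel"
    using f by (simp add: set_borel_measurable_def)
  then have m: "(\<lambda>x. indicator S x *\<^sub>R f x) \<in> borel_measurable lebesgue" by (rule measurable_completion)
  then have "(\<lambda>x. if x \<in> S then f x else 0) \<in> borel_measurable lebesgue"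
    by (rule measurable_cong[THEN iffD1, rotated]) (auto simp: indicator_def)
  then have "f \<in> borel_measurable (lebesgue_on S)" by (rule borel_measurable_if_D)
  then have "f absolutely_integrable_on S"
    using S h le by (intro measurable_bounded_by_integrable_imp_absolutely_integrable) auto
  then show ?thesis unfolding set_integrable_def
    by (rule integrable_completion[THEN iffD1, rotated]) fact
qed

section \<open>Holomorphy in time, inverse powers of the frequency and Laplace integrals\<close>

context eigensystem
begin

lemma exp_series_deriv:
  assumes g: "\<And>n. \<bar>g n\<bar> \<le> C * (1 + e n) ^ k" and p: "l < p" "p < r" and z: "0 < Re z"
  shows "(exp_series g p has_field_derivative exp_series (\<lambda>n. - e n * g n) p z) (at z)"
proof -
  define x where "x = Re z / 2"
  have x: "0 < x" "x < Re z" using z by (auto simp: x_def)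
  define S where "S = {w. x < Re w}"
  have S: "convex S" "open S" "z \<in> S"
    unfolding S_def using x convex_halfspace_Re_gt[of x] open_halfspace_Re_gt[of x] by auto
  obtain D where D: "\<And>n. \<bar>v n p\<bar> \<le> D" using v_bounded[of p p] p by (metis order_refl)
  have C: "0 \<le> C"
    using order_trans[OF abs_ge_zero g[of 0]] e_nonneg[of 0]
    by (metis add_strict_increasing linorder_not_less mult_less_0_iff zero_less_one zero_less_power)
  have g': "\<bar>- e n * g n\<bar> \<le> C * (1 + e n) ^ Suc k" for n
  proof -
    have "\<bar>- e n * g n\<bar> \<le> (1 + e n) * (C * (1 + e n) ^ k)"
      unfolding abs_mult using g[of n] e_nonneg[of n] by (intro mult_mono) auto
    then show ?thesis by (simp add: mult_ac)
  qed
  obtain K where K: "\<And>n. (1 + e n) ^ Suc k * exp (- (x * e n)) \<le> K / (1 + (e n)\<^sup>2)"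
    using polynomial_exp_summable_bound[OF x(1)] by blast
  have bd: "norm (((- e n * g n) * v n p) *\<^sub>R exp (- (w * of_real (e n)))) \<le> (C * D * K) / (1 + (e n)\<^sup>2)" if "w \<in> S" for n w
  proof -
    have "norm (((- e n * g n) * v n p) *\<^sub>R exp (- (w * of_real (e n)))) \<le> C * D * ((1 + e n) ^ Suc k * exp (- (x * e n)))"
      by (rule exp_term_bound[OF g' D C]) (use that in \<open>simp add: S_def\<close>)
    also have "\<dots> \<le> C * D * (K / (1 + (e n)\<^sup>2))"
      using C D[of 0] by (intro mult_left_mono K) auto
    finally show ?thesis by simp
  qed
  show ?thesis unfolding exp_series_def[abs_def]
  proof (rule has_field_derivative_series'(2)[OF S(1), where x0=z])
    show "((\<lambda>z. (g n * v n p) *\<^sub>R exp (- (z * of_real (e n)))) has_field_derivative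
      ((- e n * g n) * v n p) *\<^sub>R exp (- (w * of_real (e n)))) (at w within S)" for n w
      by (auto intro!: derivative_eq_intros simp: scaleR_conv_of_real)
    show "uniformly_convergent_on S (\<lambda>n w. \<Sum>i<n. ((- e i * g i) * v i p) *\<^sub>R exp (- (w * of_real (e i))))"
      by (rule Weierstrass_m_test'[OF bd inverse_energy_summable])
    show "summable (\<lambda>n. (g n * v n p) *\<^sub>R exp (- (z * of_real (e n))))"
      by (rule exp_series_summable[OF g p z])
  qed (use S in \<open>auto simp: interior_open\<close>)
qed

lemma exp_series_deriv_funpow:
  assumes g: "\<And>n. \<bar>g n\<bar> \<le> C * (1 + e n) ^ k" and p: "l < p" "p < r" and z: "0 < Re z"
  shows "(deriv ^^ m) (exp_series g p) z = exp_series (\<lambda>n. (- e n) ^ m * g n) p z"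
  using z
proof (induction m arbitrary: z)
  case (Suc m)
  have C: "0 \<le> C"
    using order_trans[OF abs_ge_zero g[of 0]] e_nonneg[of 0]
    by (metis add_strict_increasing linorder_not_less mult_less_0_iff zero_less_one zero_less_power)
  have g': "\<bar>(- e n) ^ m * g n\<bar> \<le> C * (1 + e n) ^ (m + k)" for n
  proof -
    have "\<bar>(- e n) ^ m * g n\<bar> \<le> (1 + e n) ^ m * (C * (1 + e n) ^ k)"
      unfolding abs_mult power_abs using g[of n] e_nonneg[of n] by (intro mult_mono power_mono) auto
    then show ?thesis by (simp add: power_add mult_ac)
  qed
  have "(deriv ^^ Suc m) (exp_series g p) z = deriv (exp_series (\<lambda>n. (- e n) ^ m * g n) p) z"
    using Suc.prems open_halfspace_Re_gt[of 0] Suc.IH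
    by (auto intro!: deriv_cong_ev eventually_nhds_in_open[of "{w. 0 < Re w}", THEN eventually_mono])
  also have "\<dots> = exp_series (\<lambda>n. - e n * ((- e n) ^ m * g n)) p z"
    by (rule DERIV_imp_deriv[OF exp_series_deriv[OF g' p Suc.prems]])
  finally show ?case by (simp add: mult_ac)
qed simp

text \<open>The disc of radius s / 2 about s stays in the sector and within modulus 2 s, so Cauchy's
  estimate applies with a supremum O(s). Beyond scaling, one factor s is retained.\<close>

lemma exp_series_cauchy_bound:
  assumes g: "\<And>n. \<bar>g n\<bar> \<le> C * (1 + e n) ^ k" and p: "l < p" "p < r"
    and b: "\<And>z. 0 < Re z \<Longrightarrow> 0 \<le> Re (z\<^sup>2) \<Longrightarrow> norm z \<le> \<rho> \<Longrightarrow> norm (exp_series g p z) \<le> C' * norm z"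
    and s: "0 < s" "2 * s \<le> \<rho>"
  shows "s ^ m * norm (exp_series (\<lambda>n. (- e n) ^ m * g n) p (of_real s)) \<le> fact m * 2 ^ m * (2 * C' + 1) * s"
proof -
  have C': "0 \<le> C'"
  proof -
    have "0 \<le> C' * norm (of_real s :: complex)"
      using s by (intro order_trans[OF norm_ge_zero b]) (auto simp flip: of_real_power)
    then show ?thesis using s by (simp add: zero_le_mult_iff)
  qed
  have sec: "0 < Re z \<and> 0 \<le> Re (z\<^sup>2) \<and> norm z \<le> 2 * s" if z: "dist (of_real s) z \<le> s / 2" for z :: complex
  proof -
    have n: "norm (z - of_real s) \<le> s / 2" using z by (simp add: dist_norm norm_minus_commute)
    have "\<bar>Re z - s\<bar> \<le> s / 2" "\<bar>Im z\<bar> \<le> s / 2"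
      using abs_Re_le_cmod[of "z - of_real s"] abs_Im_le_cmod[of "z - of_real s"] n by auto
    then have *: "s / 2 \<le> Re z" "\<bar>Im z\<bar> \<le> Re z" using s by linarith+
    then have "(Im z)\<^sup>2 \<le> (Re z)\<^sup>2" using s by (metis abs_ge_zero power2_abs power_mono)
    moreover have "norm z \<le> 2 * s" using norm_triangle_sub[of z "of_real s"] n s by simp
    ultimately show ?thesis using * s by (auto simp: power2_eq_square)
  qed
  have hol: "exp_series g p holomorphic_on {z. 0 < Re z}"
    using exp_series_deriv[OF g p] by (auto simp: holomorphic_on_open[OF open_halfspace_Re_gt])
  have sub: "cball (of_real s) (s / 2) \<subseteq> {z. 0 < Re z}" using sec by auto
  have "norm ((deriv ^^ m) (exp_series g p) (of_real s)) \<le> fact m * ((2 * C' + 1) * s) / (s / 2) ^ m"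
  proof (cases "m = 0")
    case True
    have "norm (exp_series g p (of_real s)) \<le> C' * norm (of_real s :: complex)"
      using s by (intro b) (auto simp flip: of_real_power)
    also have "\<dots> \<le> (2 * C' + 1) * s" using s C' by (simp add: mult_right_mono)
    finally show ?thesis using True by simp
  next
    case False
    show ?thesis
    \<comment> \<open>The estimate asks for values in an open ball and a positive order: hence
      \<open>2 * C' + 1\<close> instead of \<open>2 * C'\<close>, and the separate treatment of
      \<open>m = 0\<close>.\<close>
    proof (rule Cauchy_higher_deriv_bound[where y=0])
      show "exp_series g p holomorphic_on ball (of_real s) (s / 2)"
        by (rule holomorphic_on_subset[OF hol order_trans[OF ball_subset_cball sub]])
      show "continuous_on (cball (of_real s) (s / 2)) (exp_series g p)"
        by (rule continuous_on_subset[OF holomorphic_on_imp_continuous_on[OF hol] sub])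
      fix w :: complex assume "w \<in> ball (of_real s) (s / 2)"
      then have w: "0 < Re w" "0 \<le> Re (w\<^sup>2)" "norm w \<le> 2 * s" using sec[of w] by auto
      have "norm (exp_series g p w) \<le> C' * norm w" using w s by (intro b) auto
      also have "\<dots> \<le> C' * (2 * s)" using w C' by (intro mult_left_mono) auto
      also have "\<dots> < (2 * C' + 1) * s" using s by (simp add: algebra_simps)
      finally show "exp_series g p w \<in> ball 0 ((2 * C' + 1) * s)" by simp
    qed (use s False in auto)
  qed
  also have "(deriv ^^ m) (exp_series g p) (of_real s) = exp_series (\<lambda>n. (- e n) ^ m * g n) p (of_real s)"
    by (rule exp_series_deriv_funpow[OF g p]) (use s in simp)
  finally have "s ^ m * norm (exp_series (\<lambda>n. (- e n) ^ m * g n) p (of_real s))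
      \<le> s ^ m * (fact m * ((2 * C' + 1) * s) / (s / 2) ^ m)"
    using s by (intro mult_left_mono) auto
  also have "\<dots> = fact m * 2 ^ m * (2 * C' + 1) * s" using s by (simp add: power_divide)
  finally show ?thesis .
qed

definition heat :: "(nat \<Rightarrow> real) \<Rightarrow> real \<Rightarrow> real \<Rightarrow> real" where
  "heat g \<tau> p = (\<Sum>n. g n * v n p * exp (- (\<tau> * e n)))"

text \<open>Division by the k-th power of the frequency is k-fold integration in time from \<tau> to
  infinity. Entry 0 is dropped since \<open>e 0\<close> may vanish, so even \<open>lower 0 g\<close>
  is \<open>g\<close> without its zeroth entry.\<close>

definition lower :: "nat \<Rightarrow> (nat \<Rightarrow> real) \<Rightarrow> nat \<Rightarrow> real" where
  "lower k g n = (if n = 0 then 0 else g n / e n ^ k)"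

lemma heat_eq_exp_series:
  assumes g: "\<And>n. \<bar>g n\<bar> \<le> C * (1 + e n) ^ k" and p: "l < p" "p < r" and \<tau>: "0 < \<tau>"
  shows heat_summable: "summable (\<lambda>n. g n * v n p * exp (- (\<tau> * e n)))"
    and of_real_heat: "of_real (heat g \<tau> p) = exp_series g p (of_real \<tau>)"
proof -
  have eq: "(g n * v n p) *\<^sub>R exp (- (of_real \<tau> * of_real (e n))) = complex_of_real (g n * v n p * exp (- (\<tau> * e n)))" for n
    by (simp add: scaleR_conv_of_real exp_of_real[symmetric])
  have "summable (\<lambda>n. complex_of_real (g n * v n p * exp (- (\<tau> * e n))))"
    using exp_series_summable[OF g p, of "of_real \<tau>"] \<tau> by (simp only: eq Re_complex_of_real simp_thms)
  then show s: "summable (\<lambda>n. g n * v n p * exp (- (\<tau> * e n)))" by (simp only: summable_of_real_iff)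
  show "of_real (heat g \<tau> p) = exp_series g p (of_real \<tau>)"
    unfolding heat_def exp_series_def eq by (rule suminf_of_real[OF s])
qed

lemma e_pos: "0 < n \<Longrightarrow> 1 / 2 \<le> e n"
  using e_ge[of n] by (cases n) auto

lemma poly_bound_nonneg:
  assumes "\<And>n. \<bar>g n\<bar> \<le> C * (1 + e n) ^ k" shows "0 \<le> C"
  using order_trans[OF abs_ge_zero assms[of 0]] e_nonneg[of 0]
  by (metis add_strict_increasing linorder_not_less mult_less_0_iff zero_less_one zero_less_power)

lemma lower_poly_bound:
  assumes g: "\<And>n. \<bar>g n\<bar> \<le> C * (1 + e n) ^ k"
  shows "\<bar>lower m g n\<bar> \<le> (2 ^ m * C) * (1 + e n) ^ k"
proof (cases "n = 0")
  case True
  then show ?thesis using poly_bound_nonneg[OF g] e_nonneg[of n] by (simp add: lower_def)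
next
  case False
  then have "1 / 2 \<le> e n" by (intro e_pos) simp
  then have "(1 / 2) ^ m \<le> e n ^ m" by (intro power_mono) auto
  then have "1 \<le> 2 ^ m * e n ^ m" by (simp add: power_divide field_simps)
  then have "\<bar>g n\<bar> * 1 \<le> (C * (1 + e n) ^ k) * (2 ^ m * e n ^ m)"
    using g[of n] by (intro mult_mono) (auto intro: order_trans[OF abs_ge_zero g])
  then show ?thesis using False \<open>1 / 2 \<le> e n\<close> by (simp add: lower_def abs_divide field_simps)
qed

lemma heat_lower_deriv:
  assumes g: "\<And>n. \<bar>g n\<bar> \<le> C * (1 + e n) ^ k" and p: "l < p" "p < r" and \<tau>: "0 < \<tau>"
  shows "((\<lambda>\<tau>. heat (lower (Suc m) g) \<tau> p) has_real_derivative - heat (lower m g) \<tau> p) (at \<tau>)"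
proof -
  note g1 = lower_poly_bound[OF g, of "Suc m"] and g2 = lower_poly_bound[OF g, of m]
  have "- e n * lower (Suc m) g n = - lower m g n" for n
    using e_pos[of n] by (auto simp: lower_def)
  then have "exp_series (\<lambda>n. - e n * lower (Suc m) g n) p (of_real \<tau>) = - exp_series (lower m g) p (of_real \<tau>)"
    using suminf_minus[OF exp_series_summable[OF g2 p, of "of_real \<tau>"]] \<tau> by (simp add: exp_series_def)
  with exp_series_deriv[OF g1 p, of "of_real \<tau>"] \<tau>
  have "(exp_series (lower (Suc m) g) p has_field_derivative - of_real (heat (lower m g) \<tau> p)) (at (of_real \<tau>))"
    by (simp add: of_real_heat[OF g2 p])
  from has_vector_derivative_real_field[OF this]
  have "((\<lambda>x. Re (exp_series (lower (Suc m) g) p (of_real x))) has_vector_derivative Re (- of_real (heat (lower m g) \<tau> p))) (at \<tau>)"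
    by (rule bounded_linear.has_vector_derivative[OF bounded_linear_Re])
  then have der: "((\<lambda>x. Re (exp_series (lower (Suc m) g) p (of_real x))) has_real_derivative - heat (lower m g) \<tau> p) (at \<tau>)"
    by (simp add: has_real_derivative_iff_has_vector_derivative)
  have ev: "\<forall>\<^sub>F x in nhds \<tau>. Re (exp_series (lower (Suc m) g) p (of_real x)) = heat (lower (Suc m) g) x p"
    using eventually_nhds_in_open[of "{0<..}" \<tau>] \<tau>
    by (auto elim!: eventually_mono simp flip: of_real_heat[OF g1 p])
  show ?thesis by (rule DERIV_cong_ev[OF refl ev refl, THEN iffD1, OF der])
qed

lemma heat_continuous_in_p:
  assumes g: "\<And>n. \<bar>g n\<bar> \<le> C * (1 + e n) ^ k" and ab: "l < a" "a \<le> b" "b < r" and \<tau>: "0 < \<tau>"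
  obtains K where "K \<ge> 0" "continuous_on {a..b} (heat g \<tau>)" "\<And>p. a \<le> p \<Longrightarrow> p \<le> b \<Longrightarrow> \<bar>heat g \<tau> p\<bar> \<le> K"
    "\<And>n p. a \<le> p \<Longrightarrow> p \<le> b \<Longrightarrow> \<bar>g n * v n p * exp (- (\<tau> * e n))\<bar> \<le> K / (1 + (e n)\<^sup>2)"
proof -
  obtain D where D: "D > 0" "\<And>n p. a \<le> p \<Longrightarrow> p \<le> b \<Longrightarrow> \<bar>v n p\<bar> \<le> D" using v_bounded[OF ab] by metis
  obtain K where K: "K > 0" "\<And>n. (1 + e n) ^ k * exp (- (\<tau> * e n)) \<le> K / (1 + (e n)\<^sup>2)"
    using polynomial_exp_summable_bound[OF \<tau>] by blast
  have C: "0 \<le> C" by (rule poly_bound_nonneg[OF g])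
  have bd: "\<bar>g n * v n p * exp (- (\<tau> * e n))\<bar> \<le> (C * D * K) / (1 + (e n)\<^sup>2)" if "a \<le> p" "p \<le> b" for n p
  proof -
    have "\<bar>g n * v n p * exp (- (\<tau> * e n))\<bar> \<le> (C * (1 + e n) ^ k) * D * exp (- (\<tau> * e n))"
      unfolding abs_mult using D(2)[OF that, of n] g[of n] order_trans[OF abs_ge_zero g[of n]]
      by (intro mult_mono) auto
    also have "\<dots> = C * D * ((1 + e n) ^ k * exp (- (\<tau> * e n)))" by simp
    also have "\<dots> \<le> C * D * (K / (1 + (e n)\<^sup>2))" using C D by (intro mult_left_mono K) auto
    finally show ?thesis by simp
  qed
  define S where "S = (\<Sum>n. 1 / (1 + (e n)\<^sup>2))"
  have S: "0 \<le> S" unfolding S_def by (intro suminf_nonneg inverse_energy_summable) (simp add: add_nonneg_nonneg)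
  have 1: "\<bar>heat g \<tau> p\<bar> \<le> C * D * K * S" if "a \<le> p" "p \<le> b" for p
  proof -
    have "norm (heat g \<tau> p) \<le> (\<Sum>n. (C * D * K) / (1 + (e n)\<^sup>2))"
      unfolding heat_def by (rule norm_suminf_le) (use bd[OF that] inverse_energy_summable in auto)
    then show ?thesis using suminf_mult[OF inverse_energy_summable[of 1], of "C * D * K"] by (simp add: S_def)
  qed
  have 2: "continuous_on {a..b} (heat g \<tau>)"
    unfolding heat_def[abs_def]
    by (rule series_continuous_on[OF _ _ inverse_energy_summable[of "C * D * K"]])
      (use bd ab in \<open>auto intro!: continuous_intros v_continuous_on\<close>)
  show ?thesis
  proof (rule that[of "C * D * K * (1 + S)"])
    show "0 \<le> C * D * K * (1 + S)" using C D K S by simp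
    show "continuous_on {a..b} (heat g \<tau>)" by (rule 2)
    show "\<bar>heat g \<tau> p\<bar> \<le> C * D * K * (1 + S)" if "a \<le> p" "p \<le> b" for p
      using 1[OF that] C D K by (simp add: distrib_left add_increasing)
    show "\<bar>g n * v n p * exp (- (\<tau> * e n))\<bar> \<le> C * D * K * (1 + S) / (1 + (e n)\<^sup>2)" if "a \<le> p" "p \<le> b" for n p
    proof (rule order_trans[OF bd[OF that] divide_right_mono])
      show "C * D * K \<le> C * D * K * (1 + S)" using C D K S by (simp add: distrib_left)
    qed (simp add: add_nonneg_nonneg)
  qed
qed

text \<open>Since \<open>g 0 = 0\<close>, only frequencies at least 1/2 occur. Half of the exponent
  yields exp (- s / 4), the other half keeps the series summable as at time \<tau> / 2. Partial sums
  are included to be dominated uniformly later.\<close>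

lemma heat_bound_large_time:
  assumes g: "\<And>n. \<bar>g n\<bar> \<le> C * (1 + e n) ^ k" "g 0 = 0" and p: "l < p" "p < r" and \<tau>: "0 < \<tau>"
  obtains K where "K \<ge> 0" "\<And>s N. \<tau> \<le> s \<Longrightarrow> \<bar>\<Sum>n<N. g n * v n p * exp (- (s * e n))\<bar> \<le> K * exp (- (s / 4))"
    "\<And>s. \<tau> \<le> s \<Longrightarrow> \<bar>heat g s p\<bar> \<le> K * exp (- (s / 4))"
proof -
  obtain K where K: "K \<ge> 0" "\<And>n. \<bar>g n * v n p * exp (- (\<tau> / 2 * e n))\<bar> \<le> K / (1 + (e n)\<^sup>2)"
    using heat_continuous_in_p[OF g(1), of p p "\<tau> / 2"] p \<tau> by (metis half_gt_zero order_refl)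
  define S where "S = (\<Sum>n. K / (1 + (e n)\<^sup>2))"
  have bd: "\<bar>g n * v n p * exp (- (s * e n))\<bar> \<le> exp (- (s / 4)) * (K / (1 + (e n)\<^sup>2))" if "\<tau> \<le> s" for n s
  proof (cases "n = 0")
    case True
    then show ?thesis using g(2) K(1) by (simp add: add_nonneg_nonneg)
  next
    case False
    then have en: "1 / 2 \<le> e n" by (intro e_pos) simp
    have "s / 4 + \<tau> / 2 * e n \<le> s * e n"
    proof -
      have "\<tau> / 2 * e n \<le> s / 2 * e n" using that en by (intro mult_right_mono) auto
      moreover have "s / 2 * (1 / 2) \<le> s / 2 * e n" using that \<tau> en by (intro mult_left_mono) auto
      ultimately show ?thesis by simp
    qed
    then have "exp (- (s * e n)) \<le> exp (- (s / 4)) * exp (- (\<tau> / 2 * e n))" by (simp flip: exp_add)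
    then have "\<bar>g n * v n p\<bar> * exp (- (s * e n)) \<le> \<bar>g n * v n p\<bar> * (exp (- (s / 4)) * exp (- (\<tau> / 2 * e n)))"
      by (rule mult_left_mono) simp
    also have "\<dots> = exp (- (s / 4)) * \<bar>g n * v n p * exp (- (\<tau> / 2 * e n))\<bar>" by (simp add: abs_mult)
    also have "\<dots> \<le> exp (- (s / 4)) * (K / (1 + (e n)\<^sup>2))" by (intro mult_left_mono K) simp
    finally show ?thesis by (simp add: abs_mult)
  qed
  have S: "0 \<le> S" unfolding S_def using K(1)
    by (intro suminf_nonneg inverse_energy_summable) (simp add: add_nonneg_nonneg)
  have sm: "summable (\<lambda>n. exp (- (s / 4)) * (K / (1 + (e n)\<^sup>2)))" for s
    by (intro summable_mult inverse_energy_summable)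
  have tot: "(\<Sum>n. exp (- (s / 4)) * (K / (1 + (e n)\<^sup>2))) = S * exp (- (s / 4))" for s
    unfolding S_def by (subst suminf_mult[OF inverse_energy_summable]) simp
  show ?thesis
  proof (rule that[OF S])
    fix s N assume s: "\<tau> \<le> s"
    have "\<bar>\<Sum>n<N. g n * v n p * exp (- (s * e n))\<bar> \<le> (\<Sum>n<N. exp (- (s / 4)) * (K / (1 + (e n)\<^sup>2)))"
      by (rule order_trans[OF sum_abs sum_mono]) (rule bd[OF s])
    also have "\<dots> \<le> (\<Sum>n. exp (- (s / 4)) * (K / (1 + (e n)\<^sup>2)))"
      using K(1) by (intro sum_le_suminf sm) (auto intro!: mult_nonneg_nonneg divide_nonneg_nonneg add_nonneg_nonneg)
    finally show "\<bar>\<Sum>n<N. g n * v n p * exp (- (s * e n))\<bar> \<le> S * exp (- (s / 4))" using tot by simp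
  next
    fix s assume s: "\<tau> \<le> s"
    have "norm (heat g s p) \<le> (\<Sum>n. exp (- (s / 4)) * (K / (1 + (e n)\<^sup>2)))"
      unfolding heat_def by (rule norm_suminf_le[OF _ sm]) (use bd[OF s] in simp)
    then show "\<bar>heat g s p\<bar> \<le> S * exp (- (s / 4))" using tot by simp
  qed
qed

text \<open>Integrates termwise with Euler's integral; the shift by \<tau> > 0 keeps the series
  absolutely convergent down to s = 0.\<close>

lemma heat_laplace:
  assumes g: "\<And>n. \<bar>g n\<bar> \<le> C * (1 + e n) ^ k" "g 0 = 0" and p: "l < p" "p < r" and \<tau>: "0 < \<tau>" and N: "1 \<le> N"
  shows "((\<lambda>s. s ^ (N - 1) * heat g (s + \<tau>) p) has_integral fact (N - 1) * heat (lower N g) \<tau> p) {0<..}"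
proof -
  obtain m where m: "N = Suc m" using N by (cases N) auto
  obtain K where K: "K \<ge> 0" "\<And>s M. \<tau> \<le> s \<Longrightarrow> \<bar>\<Sum>n<M. g n * v n p * exp (- (s * e n))\<bar> \<le> K * exp (- (s / 4))"
    "\<And>s. \<tau> \<le> s \<Longrightarrow> \<bar>heat g s p\<bar> \<le> K * exp (- (s / 4))"
    using heat_bound_large_time[OF g p \<tau>] by blast
  define f where "f M s = s ^ m * (\<Sum>n<M. g n * v n p * exp (- ((s + \<tau>) * e n)))" for M s
  have fi: "(f M has_integral (\<Sum>n<M. fact m * (lower N g n * v n p * exp (- (\<tau> * e n))))) {0<..}" for M
  proof -
    have "((\<lambda>s. \<Sum>n<M. (g n * v n p * exp (- (\<tau> * e n))) * (s ^ m * exp (- (s * e n)))) has_integral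
       (\<Sum>n<M. fact m * (lower N g n * v n p * exp (- (\<tau> * e n))))) {0<..}"
    proof (rule has_integral_sum)
      fix n
      show "((\<lambda>s. (g n * v n p * exp (- (\<tau> * e n))) * (s ^ m * exp (- (s * e n)))) has_integral
       fact m * (lower N g n * v n p * exp (- (\<tau> * e n)))) {0<..}"
      proof (cases "n = 0")
        case False
        then have "0 < e n" using e_pos[of n] by simp
        from has_integral_mult_right[OF has_integral_power_times_exp[OF this, of m], of "g n * v n p * exp (- (\<tau> * e n))"]
        show ?thesis using False by (simp add: lower_def m mult_ac)
      qed (use g(2) in \<open>simp add: lower_def\<close>)
    qed simp
    moreover have "(\<Sum>n<M. (g n * v n p * exp (- (\<tau> * e n))) * (s ^ m * exp (- (s * e n)))) = f M s" for s
    proof -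
      have "exp (- ((s + \<tau>) * e n)) = exp (- (\<tau> * e n)) * exp (- (s * e n))" for n
        by (simp add: algebra_simps flip: exp_add)
      then show ?thesis unfolding f_def sum_distrib_left by (intro sum.cong refl) (simp add: mult_ac)
    qed
    ultimately show ?thesis by (simp only:)
  qed
  have dom: "norm (f M s) \<le> K * (s ^ m * exp (- (s * (1 / 4))))" if "s \<in> {0<..}" for M s
  proof -
    have "\<bar>f M s\<bar> \<le> s ^ m * (K * exp (- ((s + \<tau>) / 4)))"
      unfolding f_def abs_mult using that \<tau> by (intro mult_mono K) auto
    also have "\<dots> \<le> s ^ m * (K * exp (- (s * (1 / 4))))"
      using that \<tau> K(1) by (intro mult_left_mono) auto
    finally show ?thesis by (simp add: mult_ac)
  qed
  have conv: "(\<lambda>M. f M s) \<longlonglongrightarrow> s ^ m * heat g (s + \<tau>) p" if "s \<in> {0<..}" for s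
    unfolding f_def heat_def
    by (intro tendsto_mult_left summable_LIMSEQ heat_summable[OF g(1) p]) (use that \<tau> in auto)
  have h: "(\<lambda>s. K * (s ^ m * exp (- (s * (1 / 4))))) integrable_on {0<..}"
    by (intro integrable_on_mult_right has_integral_integrable[OF has_integral_power_times_exp]) simp
  have fi': "f M integrable_on {0<..}" for M using fi by (rule has_integral_integrable)
  note dc = dominated_convergence[where f=f and S="{0<..}" and g="\<lambda>s. s ^ m * heat g (s + \<tau>) p"
      and h="\<lambda>s. K * (s ^ m * exp (- (s * (1 / 4))))", OF fi' h dom conv]
  have "(\<lambda>M. integral {0<..} (f M)) \<longlonglongrightarrow> fact m * heat (lower N g) \<tau> p"
    unfolding integral_unique[OF fi] sum_distrib_left[symmetric] heat_def
    by (intro tendsto_mult_left summable_LIMSEQ heat_summable[OF lower_poly_bound[OF g(1)] p \<tau>])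
  then have "integral {0<..} (\<lambda>s. s ^ m * heat g (s + \<tau>) p) = fact m * heat (lower N g) \<tau> p"
    using LIMSEQ_unique dc(2) by blast
  then show ?thesis using dc(1) unfolding m by (simp add: has_integral_iff)
qed

lemma heat_continuous_in_time:
  assumes g: "\<And>n. \<bar>g n\<bar> \<le> C * (1 + e n) ^ k" and p: "l < p" "p < r"
  shows "continuous_on {0<..} (\<lambda>s. heat g s p)"
proof -
  have "continuous_on {0<..} (\<lambda>s. Re (exp_series g p (of_real s)))"
  proof (intro continuous_intros continuous_at_imp_continuous_on ballI)
    fix s :: real assume "s \<in> {0<..}"
    then have "isCont (exp_series g p) (of_real s)"
      by (intro DERIV_isCont[OF exp_series_deriv[OF g p]]) auto
    then show "isCont (\<lambda>s. exp_series g p (of_real s)) s"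
      by (rule isCont_o2[rotated]) auto
  qed
  then show ?thesis
    by (rule continuous_on_eq) (simp flip: of_real_heat[OF g p])
qed

text \<open>The Riesz kernel is reached from positive times. A majorant independent of the shift
  exists because s^(N-1) <= (s + \<tau>)^(N-1) while s + \<tau> <= \<rho>, and because of
  exponential decay beyond. Since \<open>p\<close> is fixed, \<open>B\<close> may depend on
  it.\<close>

lemma heat_laplace_limit:
  assumes g: "\<And>n. \<bar>g n\<bar> \<le> C * (1 + e n) ^ k" "g 0 = 0" and p: "l < p" "p < r" and N: "1 \<le> N"
    and small: "0 < \<rho>" "\<And>s. 0 < s \<Longrightarrow> s \<le> \<rho> \<Longrightarrow> s ^ (N - 1) * \<bar>heat g s p\<bar> \<le> B"
  shows "(\<lambda>i. heat (lower N g) (1 / real (Suc i)) p) \<longlonglongrightarrow>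
     1 / Gamma (real N) * (LBINT s:{0<..}. heat g s p * s ^ (N - 1))"
proof -
  obtain m where m: "N = Suc m" using N by (cases N) auto
  obtain K where K: "K \<ge> 0"
    "\<And>s M. \<rho> \<le> s \<Longrightarrow> \<bar>\<Sum>n<M. g n * v n p * exp (- (s * e n))\<bar> \<le> K * exp (- (s / 4))"
    "\<And>s. \<rho> \<le> s \<Longrightarrow> \<bar>heat g s p\<bar> \<le> K * exp (- (s / 4))"
    using heat_bound_large_time[OF g p small(1)] by blast
  have B: "0 \<le> B" using order_trans[OF _ small(2)[of \<rho>]] small(1) by (simp add: zero_le_mult_iff)
  define h where "h s = (if s \<in> {0..\<rho>} then B else 0) + K * (s ^ m * exp (- (s * (1 / 4))))" for s
  have hi: "h integrable_on {0<..}" unfolding h_def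
  proof (intro integrable_add integrable_on_mult_right has_integral_integrable[OF has_integral_power_times_exp])
    have "(\<lambda>_. B) integrable_on ({0<..} \<inter> {0..\<rho>})"
    proof (rule integrable_spike_set)
      show "(\<lambda>_. B) integrable_on {0..\<rho>}" by auto
      show "negligible {s \<in> {0..\<rho>} - {0<..} \<inter> {0..\<rho>}. B \<noteq> 0}"
        "negligible {s \<in> {0<..} \<inter> {0..\<rho>} - {0..\<rho>}. B \<noteq> 0}"
        by (rule negligible_subset[of "{0}"]; force)+
    qed
    then show "(\<lambda>s. if s \<in> {0..\<rho>} then B else 0) integrable_on {0<..}"
      by (simp only: integrable_restrict_Int Int_commute)
  qed simp
  have bd: "\<bar>s ^ m * heat g (s + \<tau>) p\<bar> \<le> h s" if s: "0 < s" and \<tau>: "0 \<le> \<tau>" for s \<tau>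
  proof (cases "s + \<tau> \<le> \<rho>")
    case True
    have "\<bar>s ^ m * heat g (s + \<tau>) p\<bar> \<le> (s + \<tau>) ^ m * \<bar>heat g (s + \<tau>) p\<bar>"
      unfolding abs_mult using s \<tau> by (intro mult_right_mono) (auto intro!: power_mono)
    also have "\<dots> \<le> B" using small(2)[of "s + \<tau>"] True s \<tau> by (simp add: m)
    also have "\<dots> \<le> h s" using True s \<tau> K(1) by (simp add: h_def)
    finally show ?thesis .
  next
    case False
    have "\<bar>s ^ m * heat g (s + \<tau>) p\<bar> \<le> s ^ m * (K * exp (- ((s + \<tau>) / 4)))"
      unfolding abs_mult using s False by (intro mult_mono K) auto
    also have "\<dots> \<le> s ^ m * (K * exp (- (s * (1 / 4))))"
      using s \<tau> K(1) by (intro mult_left_mono) auto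
    also have "\<dots> \<le> h s" using B by (simp add: h_def)
    finally show ?thesis .
  qed
  have lim: "(\<lambda>i. s ^ m * heat g (s + 1 / real (Suc i)) p) \<longlonglongrightarrow> s ^ m * heat g s p" if "s \<in> {0<..}" for s
  proof -
    have isc: "isCont (\<lambda>s. heat g s p) s"
      using heat_continuous_in_time[OF g(1) p] that by (simp add: continuous_on_eq_continuous_at)
    have "(\<lambda>i. s + 1 / real (Suc i)) \<longlonglongrightarrow> s"
      using tendsto_add[OF tendsto_const LIMSEQ_inverse_real_of_nat, of s] by (simp add: inverse_eq_divide)
    from isCont_tendsto_compose[OF isc this] show ?thesis by (rule tendsto_mult_left)
  qed
  have fi: "((\<lambda>s. s ^ m * heat g (s + 1 / real (Suc i)) p) has_integral fact m * heat (lower N g) (1 / real (Suc i)) p) {0<..}" for i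
    using heat_laplace[OF g p, of "1 / real (Suc i)" N] N by (simp add: m)
  have "(\<lambda>i. integral {0<..} (\<lambda>s. s ^ m * heat g (s + 1 / real (Suc i)) p)) \<longlonglongrightarrow> integral {0<..} (\<lambda>s. s ^ m * heat g s p)"
  proof (rule dominated_convergence(2)[where h=h])
    show "(\<lambda>s. s ^ m * heat g (s + 1 / real (Suc i)) p) integrable_on {0<..}" for i
      using fi by (rule has_integral_integrable)
    show "norm (s ^ m * heat g (s + 1 / real (Suc i)) p) \<le> h s" if "s \<in> {0<..}" for i s
      using bd[of s "1 / real (Suc i)"] that by simp
  qed (use hi lim in auto)
  then have "(\<lambda>i. fact m * heat (lower N g) (1 / real (Suc i)) p / fact m) \<longlonglongrightarrow> integral {0<..} (\<lambda>s. s ^ m * heat g s p) / fact m"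
    unfolding integral_unique[OF fi] by (rule tendsto_divide) auto
  moreover have "(LBINT s:{0<..}. heat g s p * s ^ (N - 1)) = integral {0<..} (\<lambda>s. heat g s p * s ^ (N - 1))"
  proof (rule set_borel_integral_eq_integral(2)[OF set_integrable_lborel_dominated[OF _ _ hi]])
    show "set_borel_measurable borel {0<..} (\<lambda>s. heat g s p * s ^ (N - 1))"
      unfolding set_borel_measurable_def
      by (intro borel_measurable_continuous_on_indicator continuous_intros heat_continuous_in_time[OF g(1) p]) auto
    show "norm (heat g s p * s ^ (N - 1)) \<le> h s" if "s \<in> {0<..}" for s
      using bd[of s 0] that by (simp add: m mult.commute)
  qed auto
  moreover have "Gamma (real N) = fact m" using Gamma_fact[of m, where 'a=real] by (simp add: m add.commute)
  ultimately show ?thesis by (simp add: m mult.commute)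
qed

end

section \<open>The odd singular kernel\<close>

text \<open>Ways of dividing a singularity between time u and space x. The first is integrable in
  both. The second is integrable in time and leaves x^(-3/2), harmless against a Lipschitz
  difference. The third keeps x integrable and leaves, after one time integration, again
  u^(-1/2).\<close>

lemma singularity_product_bounds:
  fixes u x :: real
  assumes u: "0 < u" and x: "0 < x"
  shows "u / (x\<^sup>2 + u\<^sup>2) \<le> 1 / sqrt x / sqrt u"
    and "u * x / (x\<^sup>2 + u\<^sup>2)\<^sup>2 \<le> 1 / (x * sqrt x) / sqrt u"
    and "u * x / (x\<^sup>2 + u\<^sup>2)\<^sup>2 \<le> 1 / sqrt x / (u * sqrt u)"
proof -
  define N where "N = x\<^sup>2 + u\<^sup>2"
  have N: "0 < N" using u by (simp add: N_def add_nonneg_pos)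
  have "sqrt u * sqrt x \<le> (u + x) / 2"
    using arith_geo_mean_sqrt[of u x] u x by (simp add: real_sqrt_mult)
  then have "u * (sqrt u * sqrt x) \<le> u * ((u + x) / 2)" using u by (intro mult_left_mono) auto
  also have "\<dots> \<le> N"
  proof -
    have "0 \<le> (x - u / 2)\<^sup>2 + x\<^sup>2 + 3 * u\<^sup>2 / 4" by simp
    then show ?thesis unfolding N_def by (simp add: power2_eq_square field_simps)
  qed
  finally have 1: "u * (sqrt u * sqrt x) \<le> N" .
  have x2: "x\<^sup>2 \<le> N" by (simp add: N_def)
  have ux: "u * x \<le> N"
  proof -
    have "0 \<le> u * x" using u x by simp
    then show ?thesis using sum_squares_bound[of u x] unfolding N_def mult.assoc by linarith
  qed
  show "u / (x\<^sup>2 + u\<^sup>2) \<le> 1 / sqrt x / sqrt u"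
    unfolding N_def[symmetric] using 1 N u x by (simp add: field_simps)
  have 2: "(u * (sqrt u * sqrt x)) * x\<^sup>2 \<le> N * N" using 1 x2 N u x by (intro mult_mono) auto
  show "u * x / (x\<^sup>2 + u\<^sup>2)\<^sup>2 \<le> 1 / (x * sqrt x) / sqrt u"
    unfolding N_def[symmetric] using 2 N u x by (simp add: field_simps power2_eq_square)
  have 3: "(u * (sqrt u * sqrt x)) * (u * x) \<le> N * N" using 1 ux N u x by (intro mult_mono) auto
  show "u * x / (x\<^sup>2 + u\<^sup>2)\<^sup>2 \<le> 1 / sqrt x / (u * sqrt u)"
    unfolding N_def[symmetric] using 3 N u x by (simp add: field_simps power2_eq_square)
qed

lemma inverse_sqrt_integral:
  assumes "0 < \<tau>" "\<tau> \<le> \<rho>"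
  shows "((\<lambda>u. a + b / sqrt u) has_integral (a * (\<rho> - \<tau>) + 2 * b * (sqrt \<rho> - sqrt \<tau>))) {\<tau>..\<rho>}"
proof -
  have "((\<lambda>u. a + b / sqrt u) has_integral (a * \<rho> + 2 * b * sqrt \<rho>) - (a * \<tau> + 2 * b * sqrt \<tau>)) {\<tau>..\<rho>}"
  proof (rule fundamental_theorem_of_calculus[OF assms(2)])
    fix u assume "u \<in> {\<tau>..\<rho>}"
    then have "((\<lambda>u. a * u + 2 * b * sqrt u) has_real_derivative a + b / sqrt u) (at u within {\<tau>..\<rho>})"
      using assms by (auto intro!: derivative_eq_intros simp: field_simps)
    then show "((\<lambda>u. a * u + 2 * b * sqrt u) has_vector_derivative a + b / sqrt u) (at u within {\<tau>..\<rho>})"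
      by (simp add: has_real_derivative_iff_has_vector_derivative)
  qed
  then show ?thesis by (simp add: algebra_simps)
qed

text \<open>Integrates back from the fixed time \<rho>, where bounds are cheap, to a small time
  \<tau>. As u^(-1/2) is integrable at 0, the result is uniform in \<tau>.\<close>

lemma bound_from_derivative:
  fixes F f :: "real \<Rightarrow> real"
  assumes \<tau>: "0 < \<tau>" "\<tau> \<le> \<rho>" and ab: "0 \<le> a" "0 \<le> b"
    and cF: "continuous_on {\<tau>..\<rho>} F"
    and F: "\<And>u. \<tau> < u \<Longrightarrow> u < \<rho> \<Longrightarrow> (F has_real_derivative - f u) (at u)"
    and f: "\<And>u. \<tau> \<le> u \<Longrightarrow> u \<le> \<rho> \<Longrightarrow> \<bar>f u\<bar> \<le> a + b / sqrt u"
  shows "\<bar>F \<tau>\<bar> \<le> \<bar>F \<rho>\<bar> + a * \<rho> + 2 * b * sqrt \<rho>"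
proof -
  have hi: "((\<lambda>u. - f u) has_integral F \<rho> - F \<tau>) {\<tau>..\<rho>}"
    by (rule fundamental_theorem_of_calculus_interior[where f=F, OF \<tau>(2) cF])
      (use F in \<open>auto simp: has_real_derivative_iff_has_vector_derivative[symmetric]\<close>)
  have "norm (integral {\<tau>..\<rho>} (\<lambda>u. - f u)) \<le> integral {\<tau>..\<rho>} (\<lambda>u. a + b / sqrt u)"
    using hi f by (intro integral_norm_bound_integral has_integral_integrable[OF inverse_sqrt_integral[OF \<tau>]]) auto
  then have "\<bar>F \<rho> - F \<tau>\<bar> \<le> a * (\<rho> - \<tau>) + 2 * b * (sqrt \<rho> - sqrt \<tau>)"
    unfolding integral_unique[OF hi] integral_unique[OF inverse_sqrt_integral[OF \<tau>]] by simp
  also have "\<dots> \<le> a * \<rho> + 2 * b * sqrt \<rho>"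
    using \<tau> ab by (intro add_mono mult_left_mono) auto
  finally show ?thesis by linarith
qed

lemma inverse_sqrt_abs_integrable:
  fixes t :: real
  assumes "A \<le> B"
  shows "(\<lambda>p. a + b / sqrt \<bar>p - t\<bar>) integrable_on {A..B}"
proof -
  define F where "F p = 2 * sgn (p - t) * sqrt \<bar>p - t\<bar>" for p
  have F: "(F has_vector_derivative 1 / sqrt \<bar>p - t\<bar>) (at p)" if "p \<noteq> t" for p
  proof (cases "t < p")
    case True
    have "((\<lambda>p. 2 * sqrt (p - t)) has_real_derivative 1 / sqrt \<bar>p - t\<bar>) (at p)"
      using True by (auto intro!: derivative_eq_intros simp: field_simps)
    moreover have "\<forall>\<^sub>F x in nhds p. 2 * sqrt (x - t) = F x"
      using eventually_nhds_in_open[of "{t<..}" p] True by (auto elim!: eventually_mono simp: F_def)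
    ultimately show ?thesis
      unfolding has_real_derivative_iff_has_vector_derivative[symmetric]
      by (simp add: DERIV_cong_ev[OF refl _ refl])
  next
    case False
    have "((\<lambda>p. - 2 * sqrt (t - p)) has_real_derivative 1 / sqrt \<bar>p - t\<bar>) (at p)"
      using False that by (auto intro!: derivative_eq_intros simp: field_simps)
    moreover have "\<forall>\<^sub>F x in nhds p. - 2 * sqrt (t - x) = F x"
      using eventually_nhds_in_open[of "{..<t}" p] False that by (auto elim!: eventually_mono simp: F_def)
    ultimately show ?thesis
      unfolding has_real_derivative_iff_has_vector_derivative[symmetric]
      by (simp add: DERIV_cong_ev[OF refl _ refl])
  qed
  have cF: "continuous_on {A..B} F"
  proof -
    have "F = (\<lambda>p. 2 * sqrt (max 0 (p - t)) - 2 * sqrt (max 0 (t - p)))"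
      by (auto simp: F_def fun_eq_iff sgn_if max_def)
    then show ?thesis by (auto intro!: continuous_intros)
  qed
  have "((\<lambda>p. 1 / sqrt \<bar>p - t\<bar>) has_integral F B - F A) {A..B}"
    by (rule fundamental_theorem_of_calculus_strong[of "{t}"]) (use F cF assms in auto)
  then have "(\<lambda>p. b * (1 / sqrt \<bar>p - t\<bar>)) integrable_on {A..B}" by (intro integrable_on_mult_right) blast
  then have "(\<lambda>p. a + b * (1 / sqrt \<bar>p - t\<bar>)) integrable_on {A..B}" by (intro integrable_add) auto
  then show ?thesis by simp
qed

text \<open>\<open>odd_kernel d u s\<close> is the negative spatial derivative of the truncated Poisson kernel at
  \<open>s \<in> [-d, d]\<close>, extended by zero; the clamping of \<open>s\<close> makes it manifestly continuous.\<close>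

definition odd_kernel :: "real \<Rightarrow> real \<Rightarrow> real \<Rightarrow> real" where
  "odd_kernel d u s = (let s = max (- d) (min d s); k = 1 / d\<^sup>2; w = 1 - k * s\<^sup>2; R = inverse (s\<^sup>2 + u\<^sup>2) in
     u / (pi * (1 + (u / d)\<^sup>2) ^ 3) * (6 * s * k * w\<^sup>2 * R + 2 * s * w^3 * R\<^sup>2))"

text \<open>Identifies the explicit singular term of the \<open>v'\<close> series at real time; the
  sign compensates for the chain being used on s >= 0 only.\<close>

lemma odd_kernel_poisson_chain:
  assumes "0 < d"
  shows "of_real (odd_kernel d u s) = (if \<bar>s\<bar> \<le> d then sgn s *\<^sub>R poisson_chain d (of_real u) 1 \<bar>s\<bar> else 0)"
proof (cases "\<bar>s\<bar> \<le> d")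
  case True
  then have "max (- d) (min d s) = s" by auto
  moreover have "complex_of_real \<bar>s\<bar> = sgn s * s" by (simp add: sgn_if)
  moreover have "sgn s = 1 \<or> sgn s = -1 \<or> s = 0" by (auto simp: sgn_if)
  ultimately show ?thesis using True
    by (auto simp: odd_kernel_def Let_def poisson_chain.simps poisson_coeff_def scaleR_conv_of_real)
next
  case False
  then have "\<bar>max (- d) (min d s)\<bar> = d" using assms by (auto simp: max_def min_def)
  then have "(max (- d) (min d s))\<^sup>2 = d\<^sup>2" by (metis power2_abs)
  then show ?thesis using False assms by (simp add: odd_kernel_def Let_def)
qed

lemma odd_kernel_minus: "odd_kernel d u (- s) = - odd_kernel d u s" if "0 < d"
proof -
  have "max (- d) (min d (- s)) = - max (- d) (min d s)" using that by (auto simp: max_def min_def)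
  then show ?thesis by (simp add: odd_kernel_def Let_def algebra_simps)
qed

lemma odd_kernel_outside: "0 < d \<Longrightarrow> d \<le> \<bar>s\<bar> \<Longrightarrow> odd_kernel d u s = 0"
proof -
  assume "0 < d" "d \<le> \<bar>s\<bar>"
  then have "\<bar>max (- d) (min d s)\<bar> = d" by (auto simp: max_def min_def)
  then have "(max (- d) (min d s))\<^sup>2 = d\<^sup>2" by (metis power2_abs)
  then show ?thesis using \<open>0 < d\<close> by (simp add: odd_kernel_def Let_def)
qed

lemma odd_kernel_continuous:
  assumes d: "0 < d" and S: "\<And>x. x \<in> S \<Longrightarrow> U x \<noteq> 0 \<or> T x \<noteq> 0" and c: "continuous_on S U" "continuous_on S T"
  shows "continuous_on S (\<lambda>x. odd_kernel d (U x) (T x))"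
proof -
  have 1: "(max (- d) (min d (T x)))\<^sup>2 + (U x)\<^sup>2 \<noteq> 0" if "x \<in> S" for x
  proof -
    have "U x \<noteq> 0 \<or> max (- d) (min d (T x)) \<noteq> 0" using S[OF that] d by (auto simp: max_def min_def)
    then show ?thesis by (auto simp: sum_power2_eq_zero_iff)
  qed
  have "1 + (U x / d)\<^sup>2 > 0" for x by (rule add_pos_nonneg) auto
  then have 2: "pi * (1 + (U x / d)\<^sup>2) ^ 3 \<noteq> 0" for x by (metis less_irrefl mult_eq_0_iff pi_neq_zero power_eq_0_iff)
  show ?thesis unfolding odd_kernel_def Let_def
    using 1 2 d by (intro continuous_intros c) auto
qed

lemma odd_kernel_bound:
  assumes "0 < d" "0 < u" "u \<le> d" "s \<noteq> 0"
  shows "\<bar>odd_kernel d u s\<bar> \<le> 32 * (u * \<bar>s\<bar> / (\<bar>s\<bar>\<^sup>2 + u\<^sup>2)\<^sup>2)"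
proof (cases "\<bar>s\<bar> \<le> d")
  case True
  have "\<bar>odd_kernel d u s\<bar> = norm (complex_of_real (odd_kernel d u s))" by simp
  also have "\<dots> \<le> norm (poisson_chain d (of_real u) 1 \<bar>s\<bar>)"
    using True assms unfolding odd_kernel_poisson_chain[OF assms(1)] by (simp add: abs_sgn_eq del: poisson_chain.simps)
  also have "\<dots> \<le> 32 * norm (complex_of_real u) * \<bar>s\<bar> / (\<bar>s\<bar>\<^sup>2 + (norm (complex_of_real u))\<^sup>2)\<^sup>2"
    by (rule poisson_chain_1_bound) (use assms True in \<open>auto simp flip: of_real_power\<close>)
  finally show ?thesis using assms by simp
qed (use assms odd_kernel_outside[of d s u] in simp)

text \<open>The singular part of the \<open>v'\<close> series after one integration in time. At
  \<tau> = 0 it is a truncated analogue of the Hilbert kernel 1 / (pi s).\<close>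

definition odd_primitive :: "real \<Rightarrow> real \<Rightarrow> real \<Rightarrow> real \<Rightarrow> real" where
  "odd_primitive d \<rho> \<tau> s = integral {\<tau>..\<rho>} (\<lambda>u. odd_kernel d u s)"

context
  fixes d \<rho> :: real
  assumes d: "0 < d" and \<rho>: "0 < \<rho>" "\<rho> \<le> d"
begin

lemma odd_primitive_minus: "odd_primitive d \<rho> \<tau> (- s) = - odd_primitive d \<rho> \<tau> s"
  by (simp add: odd_primitive_def odd_kernel_minus[OF d])

lemma odd_primitive_outside: "d \<le> \<bar>s\<bar> \<Longrightarrow> odd_primitive d \<rho> \<tau> s = 0"
  by (simp add: odd_primitive_def odd_kernel_outside[OF d])

lemma odd_kernel_continuous_time:
  "0 \<le> \<tau> \<Longrightarrow> 0 < \<tau> \<or> s \<noteq> 0 \<Longrightarrow> continuous_on {\<tau>..\<rho>} (\<lambda>u. odd_kernel d u s)"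
  by (rule odd_kernel_continuous[OF d]) (auto intro!: continuous_intros)

lemma odd_primitive_continuous:
  assumes "0 \<le> \<tau>" "0 < \<tau> \<or> (\<forall>p\<in>S. p \<noteq> t)"
  shows "continuous_on S (\<lambda>p. odd_primitive d \<rho> \<tau> (p - t))"
proof -
  have "continuous_on (S \<times> cbox \<tau> \<rho>) (\<lambda>(p, u). odd_kernel d u (p - t))"
    unfolding case_prod_beta
    by (rule odd_kernel_continuous[OF d]) (use assms in \<open>auto intro!: continuous_intros\<close>)
  then show ?thesis
    unfolding odd_primitive_def box_real[symmetric] by (rule integral_continuous_on_param)
qed

text \<open>The first bound is uniform in \<tau>; it is cruder than 1 / |s| but becomes |s|^(-1/2)
  against a Lipschitz difference. The second keeps the spatial singularity integrable at the price
  of \<tau>^(-1/2), which one more time integration absorbs.\<close>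

lemma odd_primitive_bounds:
  assumes \<tau>: "0 < \<tau>" "\<tau> \<le> \<rho>" and s: "s \<noteq> 0"
  shows "\<bar>odd_primitive d \<rho> \<tau> s\<bar> \<le> 64 * sqrt \<rho> / (\<bar>s\<bar> * sqrt \<bar>s\<bar>)"
    and "\<bar>odd_primitive d \<rho> \<tau> s\<bar> \<le> 64 / sqrt \<bar>s\<bar> / sqrt \<tau>"
proof -
  have x: "0 < \<bar>s\<bar>" using s by simp
  have oi: "(\<lambda>u. odd_kernel d u s) integrable_on {\<tau>..\<rho>}"
    by (intro integrable_continuous_real odd_kernel_continuous_time) (use \<tau> in auto)
  have kb: "\<bar>odd_kernel d u s\<bar> \<le> 32 * (u * \<bar>s\<bar> / (\<bar>s\<bar>\<^sup>2 + u\<^sup>2)\<^sup>2)" if "u \<in> {\<tau>..\<rho>}" for u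
    by (rule odd_kernel_bound[OF d _ _ s]) (use that \<tau> \<rho> in auto)
  have "norm (odd_primitive d \<rho> \<tau> s) \<le> integral {\<tau>..\<rho>} (\<lambda>u. 0 + 32 / (\<bar>s\<bar> * sqrt \<bar>s\<bar>) / sqrt u)"
    unfolding odd_primitive_def
  proof (rule integral_norm_bound_integral[OF oi has_integral_integrable[OF inverse_sqrt_integral[OF \<tau>, of 0]]])
    fix u assume u: "u \<in> {\<tau>..\<rho>}"
    have "32 * (u * \<bar>s\<bar> / (\<bar>s\<bar>\<^sup>2 + u\<^sup>2)\<^sup>2) \<le> 32 * (1 / (\<bar>s\<bar> * sqrt \<bar>s\<bar>) / sqrt u)"
      by (intro mult_left_mono singularity_product_bounds(2) x) (use u \<tau> in auto)
    with kb[OF u] show "norm (odd_kernel d u s) \<le> 0 + 32 / (\<bar>s\<bar> * sqrt \<bar>s\<bar>) / sqrt u" by simp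
  qed
  also have "\<dots> = 64 / (\<bar>s\<bar> * sqrt \<bar>s\<bar>) * (sqrt \<rho> - sqrt \<tau>)"
    unfolding integral_unique[OF inverse_sqrt_integral[OF \<tau>]] by simp
  also have "\<dots> \<le> 64 / (\<bar>s\<bar> * sqrt \<bar>s\<bar>) * sqrt \<rho>"
    using \<tau> x by (intro mult_left_mono) auto
  finally show "\<bar>odd_primitive d \<rho> \<tau> s\<bar> \<le> 64 * sqrt \<rho> / (\<bar>s\<bar> * sqrt \<bar>s\<bar>)" by simp
  have hi: "((\<lambda>u. 32 / sqrt \<bar>s\<bar> / (u * sqrt u)) has_integral
      (- 64 / sqrt \<bar>s\<bar> / sqrt \<rho>) - (- 64 / sqrt \<bar>s\<bar> / sqrt \<tau>)) {\<tau>..\<rho>}"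
  proof (rule fundamental_theorem_of_calculus[OF \<tau>(2)])
    fix u assume u: "u \<in> {\<tau>..\<rho>}"
    have "((\<lambda>u. - 64 / sqrt \<bar>s\<bar> / sqrt u) has_real_derivative 32 / sqrt \<bar>s\<bar> / (u * sqrt u)) (at u within {\<tau>..\<rho>})"
      using u \<tau> x by (auto intro!: derivative_eq_intros simp: field_simps)
    then show "((\<lambda>u. - 64 / sqrt \<bar>s\<bar> / sqrt u) has_vector_derivative 32 / sqrt \<bar>s\<bar> / (u * sqrt u)) (at u within {\<tau>..\<rho>})"
      by (simp add: has_real_derivative_iff_has_vector_derivative)
  qed
  have "norm (odd_primitive d \<rho> \<tau> s) \<le> integral {\<tau>..\<rho>} (\<lambda>u. 32 / sqrt \<bar>s\<bar> / (u * sqrt u))"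
    unfolding odd_primitive_def
  proof (rule integral_norm_bound_integral[OF oi has_integral_integrable[OF hi]])
    fix u assume u: "u \<in> {\<tau>..\<rho>}"
    have "32 * (u * \<bar>s\<bar> / (\<bar>s\<bar>\<^sup>2 + u\<^sup>2)\<^sup>2) \<le> 32 * (1 / sqrt \<bar>s\<bar> / (u * sqrt u))"
      by (intro mult_left_mono singularity_product_bounds(3) x) (use u \<tau> in auto)
    with kb[OF u] show "norm (odd_kernel d u s) \<le> 32 / sqrt \<bar>s\<bar> / (u * sqrt u)" by simp
  qed
  also have "\<dots> \<le> 64 / sqrt \<bar>s\<bar> / sqrt \<tau>"
    unfolding integral_unique[OF hi] using \<rho> x by simp
  finally show "\<bar>odd_primitive d \<rho> \<tau> s\<bar> \<le> 64 / sqrt \<bar>s\<bar> / sqrt \<tau>"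
    by (simp only: real_norm_def)
qed

lemma odd_primitive_tendsto:
  assumes s: "s \<noteq> 0" and \<tau>: "\<tau> \<longlonglongrightarrow> 0" "\<And>i. 0 < \<tau> i" "\<And>i. \<tau> i \<le> \<rho>"
  shows "(\<lambda>i. odd_primitive d \<rho> (\<tau> i) s) \<longlonglongrightarrow> odd_primitive d \<rho> 0 s"
proof -
  have c: "continuous_on {0..\<rho>} (\<lambda>u. odd_kernel d u s)"
    by (rule odd_kernel_continuous_time) (use s in auto)
  have "continuous_on {0..\<rho>} (\<lambda>x. integral {x..\<rho>} (\<lambda>u. odd_kernel d u s))"
    by (rule indefinite_integral_continuous_1'[OF integrable_continuous_real[OF c]])
  then have "((\<lambda>x. odd_primitive d \<rho> x s) \<longlongrightarrow> odd_primitive d \<rho> 0 s) (at 0 within {0..\<rho>})"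
    using \<rho> by (simp add: odd_primitive_def continuous_on_def)
  moreover have "filterlim \<tau> (at 0 within {0..\<rho>}) sequentially"
    using \<tau> by (auto simp: filterlim_at less_imp_le less_imp_neq[symmetric] intro!: always_eventually)
  ultimately show ?thesis by (rule filterlim_compose)
qed

lemma odd_primitive_bound_0:
  assumes s: "s \<noteq> 0"
  shows "\<bar>odd_primitive d \<rho> 0 s\<bar> \<le> 64 * sqrt \<rho> / (\<bar>s\<bar> * sqrt \<bar>s\<bar>)"
proof (rule LIMSEQ_le_const2)
  have "(\<lambda>i. odd_primitive d \<rho> (\<rho> / real (Suc i)) s) \<longlonglongrightarrow> odd_primitive d \<rho> 0 s"
  proof (rule odd_primitive_tendsto[OF s])
    show "(\<lambda>i. \<rho> / real (Suc i)) \<longlonglongrightarrow> 0"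
      using tendsto_mult_right_zero[OF LIMSEQ_inverse_real_of_nat, of \<rho>] by (simp add: divide_inverse)
    show "\<rho> / real (Suc i) \<le> \<rho>" for i
      using divide_left_mono[of 1 "real (Suc i)" \<rho>] \<rho> by simp
  qed (use \<rho> in simp)
  then show "(\<lambda>i. \<bar>odd_primitive d \<rho> (\<rho> / real (Suc i)) s\<bar>) \<longlonglongrightarrow> \<bar>odd_primitive d \<rho> 0 s\<bar>" by (rule tendsto_rabs)
  show "\<exists>N. \<forall>i\<ge>N. \<bar>odd_primitive d \<rho> (\<rho> / real (Suc i)) s\<bar> \<le> 64 * sqrt \<rho> / (\<bar>s\<bar> * sqrt \<bar>s\<bar>)"
    using odd_primitive_bounds(1)[OF _ _ s] divide_left_mono[of 1 "real (Suc _)" \<rho>] \<rho>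
    by (intro exI[of _ 0] allI impI odd_primitive_bounds(1)[OF _ _ s]) (auto simp: field_simps)
qed

lemma odd_primitive_continuous_time:
  assumes "0 < \<tau>"
  shows "continuous_on {\<tau>..\<rho>} (\<lambda>x. odd_primitive d \<rho> x s)"
  unfolding odd_primitive_def
  by (intro indefinite_integral_continuous_1' integrable_continuous_real odd_kernel_continuous_time)
    (use assms in auto)

lemma odd_primitive_deriv_time:
  assumes "0 < \<tau>" "\<tau> < \<rho>"
  shows "((\<lambda>\<tau>. odd_primitive d \<rho> \<tau> s) has_real_derivative - odd_kernel d \<tau> s) (at \<tau>)"
proof -
  have c: "continuous_on {\<tau>/2..\<rho>} (\<lambda>u. odd_kernel d u s)"
    by (rule odd_kernel_continuous_time) (use assms in auto)
  have "((\<lambda>x. integral {x..\<rho>} (\<lambda>u. odd_kernel d u s)) has_real_derivative - odd_kernel d \<tau> s) (at \<tau> within {\<tau>/2..\<rho>})"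
    by (rule integral_has_real_derivative'[OF c]) (use assms in auto)
  moreover have "at \<tau> within {\<tau>/2..\<rho>} = at \<tau>" using assms by (intro at_within_Icc_at) auto
  ultimately show ?thesis by (simp add: odd_primitive_def)
qed

end

section \<open>Heat sums integrated in time\<close>

context eigensystem
begin

text \<open>From e n >= 1/2 follows 1 + e n <= 3 e n, the origin of 3^k. The two spare powers of the
  frequency leave a summable factor.\<close>

lemma lower_decay:
  assumes g: "\<And>n. \<bar>g n\<bar> \<le> C * (1 + e n) ^ j" and k: "j + 2 \<le> k"
  shows "\<bar>lower k g n\<bar> \<le> 3 ^ k * C / (1 + (e n)\<^sup>2)"
proof (cases "n = 0")
  case True
  then show ?thesis using poly_bound_nonneg[OF g] by (simp add: lower_def add_nonneg_nonneg)
next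
  case False
  then have en: "1 / 2 \<le> e n" by (intro e_pos) simp
  define u where "u = 1 + e n"
  have u: "1 \<le> u" "u \<le> 3 * e n" using en by (auto simp: u_def)
  have "u ^ j * u\<^sup>2 \<le> u ^ k"
    using u(1) k unfolding power_add[symmetric] by (intro power_increasing) auto
  also have "\<dots> \<le> (3 * e n) ^ k" using u by (intro power_mono) auto
  finally have "u ^ j * u\<^sup>2 \<le> 3 ^ k * e n ^ k" by (simp add: power_mult_distrib)
  then have "C * (u ^ j * u\<^sup>2) \<le> C * (3 ^ k * e n ^ k)"
    using poly_bound_nonneg[OF g] by (rule mult_left_mono)
  then have "C * u ^ j / e n ^ k \<le> 3 ^ k * C / u\<^sup>2"
    using en u by (simp add: field_simps)
  moreover have "\<bar>lower k g n\<bar> \<le> C * u ^ j / e n ^ k"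
    using False en g[of n] by (simp add: lower_def abs_divide u_def divide_right_mono)
  moreover have "3 ^ k * C * (1 / u\<^sup>2) \<le> 3 ^ k * C * (1 / (1 + (e n)\<^sup>2))"
    using poly_bound_nonneg[OF g] unfolding u_def by (intro mult_left_mono inverse_energy_mono e_nonneg) auto
  ultimately show ?thesis by simp
qed

lemma heat_lower_bounded:
  assumes g: "\<And>n. \<bar>g n\<bar> \<le> C * (1 + e n) ^ j" and k: "j + 2 \<le> k" and V: "\<And>n. \<bar>v n p\<bar> \<le> V" and \<tau>: "0 \<le> \<tau>"
  shows "\<bar>heat (lower k g) \<tau> p\<bar> \<le> 3 ^ k * C * V * (\<Sum>n. 1 / (1 + (e n)\<^sup>2))"
proof -
  have V0: "0 \<le> V" using V[of 0] by simp
  have *: "norm (lower k g n * v n p * exp (- (\<tau> * e n))) \<le> (3 ^ k * C * V) * (1 / (1 + (e n)\<^sup>2))" for n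
  proof -
    have "norm (lower k g n * v n p * exp (- (\<tau> * e n))) \<le> (3 ^ k * C / (1 + (e n)\<^sup>2)) * V * 1"
      unfolding real_norm_def abs_mult
      using lower_decay[OF g k, of n] V[of n] V0 \<tau> e_nonneg[of n] poly_bound_nonneg[OF g]
      by (intro mult_mono mult_nonneg_nonneg divide_nonneg_nonneg) auto
    then show ?thesis by simp
  qed
  have s: "summable (\<lambda>n. (3 ^ k * C * V) * (1 / (1 + (e n)\<^sup>2)))"
    using inverse_energy_summable[of "3 ^ k * C * V"] by simp
  have "norm (heat (lower k g) \<tau> p) \<le> (\<Sum>n. (3 ^ k * C * V) * (1 / (1 + (e n)\<^sup>2)))"
    unfolding heat_def by (rule norm_suminf_le[OF * s])
  then show ?thesis using suminf_mult[OF inverse_energy_summable[of 1], of "3 ^ k * C * V"] by simp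
qed

lemma heat_lower_0:
  assumes g: "\<And>n. \<bar>g n\<bar> \<le> C * (1 + e n) ^ k" and p: "l < p" "p < r" and \<tau>: "0 < \<tau>"
  shows "heat (lower 0 g) \<tau> p = heat g \<tau> p - g 0 * v 0 p * exp (- (\<tau> * e 0))"
  using suminf_split_head[OF heat_summable[OF g p \<tau>]]
    suminf_split_head[OF heat_summable[OF lower_poly_bound[OF g, of 0] p \<tau>]]
  by (simp add: heat_def lower_def)

lemma abs_heat_eq:
  assumes g: "\<And>n. \<bar>g n\<bar> \<le> C * (1 + e n) ^ k" and p: "l < p" "p < r" and \<tau>: "0 < \<tau>"
  shows "\<bar>heat g \<tau> p\<bar> = norm (exp_series g p (of_real \<tau>))"
  unfolding of_real_heat[OF g p \<tau>, symmetric] by simp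

end

context complete_eigensystem
begin

text \<open>Each integration in time improves the singularity by one order: \<open>v\<close> needs
  one to fall below |p - t|^(-1/2), \<open>v'\<close> needs two. A single integration of
  \<open>v'\<close> leaves the odd primitive, which is subtracted rather than bounded. Further
  integrations give absolutely convergent sums.\<close>

lemma heat_estimates:
  assumes d: "0 < d" "l < t - d" "t + d < r" and AB: "l < A" "A \<le> B" "B < r"
  obtains \<rho> K where "0 < \<rho>" "\<rho> \<le> d" "\<And>k::nat. 0 \<le> (K k :: real)"
    and "\<And>k \<tau> p. 1 \<le> k \<Longrightarrow> 0 < \<tau> \<Longrightarrow> \<tau> \<le> \<rho> \<Longrightarrow> A \<le> p \<Longrightarrow> p \<le> B \<Longrightarrow> p \<noteq> t \<Longrightarrow>
      \<bar>heat (lower k (\<lambda>n. v n t)) \<tau> p\<bar> \<le> K k * (1 + 1 / sqrt \<bar>p - t\<bar>)"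
    and "\<And>k \<tau> p. 2 \<le> k \<Longrightarrow> 0 < \<tau> \<Longrightarrow> \<tau> \<le> \<rho> \<Longrightarrow> A \<le> p \<Longrightarrow> p \<le> B \<Longrightarrow> p \<noteq> t \<Longrightarrow>
      \<bar>heat (lower k (\<lambda>n. v' n t)) \<tau> p\<bar> \<le> K k * (1 + 1 / sqrt \<bar>p - t\<bar>)"
    and "\<And>\<tau> p. 0 < \<tau> \<Longrightarrow> \<tau> \<le> \<rho> \<Longrightarrow> A \<le> p \<Longrightarrow> p \<le> B \<Longrightarrow> p \<noteq> t \<Longrightarrow>
      \<bar>heat (lower 1 (\<lambda>n. v' n t)) \<tau> p - odd_primitive d \<rho> \<tau> (p - t)\<bar> \<le> K 1"
    and "\<And>p. A \<le> p \<Longrightarrow> p \<le> B \<Longrightarrow> p \<noteq> t \<Longrightarrow> \<exists>C'. \<forall>z. 0 < Re z \<longrightarrow> 0 \<le> Re (z\<^sup>2) \<longrightarrow> norm z \<le> \<rho> \<longrightarrow>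
      norm (exp_series (\<lambda>n. v n t) p z) \<le> C' * norm z \<and> norm (exp_series (\<lambda>n. v' n t) p z) \<le> C' * norm z"
proof -
  obtain \<rho> C where \<rho>: "0 < \<rho>" "\<rho> \<le> d" and C: "0 < C"
    and E1: "\<And>z p. 0 < Re z \<Longrightarrow> 0 \<le> Re (z\<^sup>2) \<Longrightarrow> norm z \<le> \<rho> \<Longrightarrow> A \<le> p \<Longrightarrow> p \<le> B \<Longrightarrow>
      norm (exp_series (\<lambda>n. v n t) p z) \<le> C * (norm z / ((p - t)\<^sup>2 + (norm z)\<^sup>2) + 1)"
    and E2: "\<And>z p. 0 < Re z \<Longrightarrow> 0 \<le> Re (z\<^sup>2) \<Longrightarrow> norm z \<le> \<rho> \<Longrightarrow> A \<le> p \<Longrightarrow> p \<le> B \<Longrightarrow>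
      norm (exp_series (\<lambda>n. v' n t) p z -
        (if \<bar>p - t\<bar> \<le> d then sgn (p - t) *\<^sub>R poisson_chain d z 1 \<bar>p - t\<bar> else 0)) \<le> C"
    and E3: "\<And>p. A \<le> p \<Longrightarrow> p \<le> B \<Longrightarrow> p \<noteq> t \<Longrightarrow> \<exists>C'. \<forall>z. 0 < Re z \<longrightarrow> 0 \<le> Re (z\<^sup>2) \<longrightarrow> norm z \<le> \<rho> \<longrightarrow>
      norm (exp_series (\<lambda>n. v n t) p z) \<le> C' * norm z \<and> norm (exp_series (\<lambda>n. v' n t) p z) \<le> C' * norm z"
    by (rule poisson_kernel_estimates[OF d AB]) blast
  define a where "a = min A t"
  define b where "b = max B t"
  have ab: "l < a" "a \<le> b" "b < r" using d AB by (auto simp: a_def b_def)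
  obtain V where V: "V > 0" "\<And>n x. a \<le> x \<Longrightarrow> x \<le> b \<Longrightarrow> \<bar>v n x\<bar> \<le> V"
    "\<And>n x. a \<le> x \<Longrightarrow> x \<le> b \<Longrightarrow> \<bar>v' n x\<bar> \<le> V * (1 + e n)"
    using v_bounded[OF ab] by blast
  have g: "\<bar>v n t\<bar> \<le> V * (1 + e n) ^ 0" and g': "\<bar>v' n t\<bar> \<le> V * (1 + e n) ^ 1" for n
    using V(2)[of t n] V(3)[of t n] by (auto simp: a_def b_def)
  have Vp: "\<bar>v n p\<bar> \<le> V" if "A \<le> p" "p \<le> B" for n p using that by (intro V) (auto simp: a_def b_def)
  have lp: "l < p" "p < r" if "A \<le> p" "p \<le> B" for p using that AB by auto
  define S where "S = (\<Sum>n. 1 / (1 + (e n)\<^sup>2))"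
  have S: "0 \<le> S" unfolding S_def by (intro suminf_nonneg inverse_energy_summable) (simp add: add_nonneg_nonneg)
  have end_bound: "\<exists>K\<ge>0. \<forall>p. A \<le> p \<longrightarrow> p \<le> B \<longrightarrow> \<bar>heat (lower k h) \<rho> p\<bar> \<le> K"
    if "\<And>n. \<bar>h n\<bar> \<le> V * (1 + e n) ^ j" for h k j
    using heat_continuous_in_p[OF lower_poly_bound[OF that] AB \<rho>(1), of k] by metis
  obtain K1 where K1: "0 \<le> K1" "\<And>p. A \<le> p \<Longrightarrow> p \<le> B \<Longrightarrow> \<bar>heat (lower 1 (\<lambda>n. v n t)) \<rho> p\<bar> \<le> K1"
    using end_bound[OF g, of 1] by blast
  obtain K2 where K2: "0 \<le> K2" "\<And>p. A \<le> p \<Longrightarrow> p \<le> B \<Longrightarrow> \<bar>heat (lower 1 (\<lambda>n. v' n t)) \<rho> p\<bar> \<le> K2"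
    using end_bound[OF g', of 1] by blast
  obtain K3 where K3: "0 \<le> K3" "\<And>p. A \<le> p \<Longrightarrow> p \<le> B \<Longrightarrow> \<bar>heat (lower 2 (\<lambda>n. v' n t)) \<rho> p\<bar> \<le> K3"
    using end_bound[OF g', of 2] by blast
  \<comment> \<open>Controls the zeroth term, which is present in the series estimated so far but
    removed by \<open>lower 0\<close>.\<close>
  have low: "\<bar>c * v 0 p * exp (- (u * e 0))\<bar> \<le> V * (1 + e 0) * V"
    if "\<bar>c\<bar> \<le> V * (1 + e 0)" "A \<le> p" "p \<le> B" "0 < u" for c p u
  proof -
    have "\<bar>c * v 0 p * exp (- (u * e 0))\<bar> \<le> (V * (1 + e 0)) * V * 1"
      unfolding abs_mult using that Vp[OF that(2,3), of 0] V(1) e_nonneg[of 0]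
      by (intro mult_mono) auto
    then show ?thesis by simp
  qed
  define W where "W = V * (1 + e 0) * V"
  have W: "0 \<le> W" using V(1) e_nonneg[of 0] by (simp add: W_def)
  have g0: "\<bar>v 0 t\<bar> \<le> V * (1 + e 0)"
    using g[of 0] V(1) e_nonneg[of 0] by (simp add: distrib_left add_increasing2)
  have sec: "0 < Re (of_real u)" "0 \<le> Re ((of_real u)\<^sup>2)" "norm (of_real u :: complex) = u" if "0 < u" for u
    using that by (auto simp flip: of_real_power)
  have base: "\<bar>heat (lower 0 (\<lambda>n. v n t)) u p\<bar> \<le> (C + W) + C / sqrt \<bar>p - t\<bar> / sqrt u"
    if u: "0 < u" "u \<le> \<rho>" and p: "A \<le> p" "p \<le> B" "p \<noteq> t" for u p
  proof -
    have "\<bar>heat (\<lambda>n. v n t) u p\<bar> \<le> C * (u / (\<bar>p - t\<bar>\<^sup>2 + u\<^sup>2) + 1)"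
      using E1[of "of_real u" p] sec[OF u(1)] u p abs_heat_eq[OF g lp[OF p(1,2)] u(1)] by simp
    also have "\<dots> \<le> C * (1 / sqrt \<bar>p - t\<bar> / sqrt u + 1)"
      using C p by (intro mult_left_mono add_right_mono singularity_product_bounds(1) u) auto
    finally have "\<bar>heat (\<lambda>n. v n t) u p\<bar> \<le> C + C / sqrt \<bar>p - t\<bar> / sqrt u" by (simp add: distrib_left)
    moreover have "\<bar>v 0 t * v 0 p * exp (- (u * e 0))\<bar> \<le> W"
      unfolding W_def by (rule low[OF g0 p(1,2) u(1)])
    ultimately show ?thesis unfolding heat_lower_0[OF g lp[OF p(1,2)] u(1)] by linarith
  qed
  have base': "\<bar>heat (lower 0 (\<lambda>n. v' n t)) u p - odd_kernel d u (p - t)\<bar> \<le> (C + W) + 0 / sqrt u"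
    if u: "0 < u" "u \<le> \<rho>" and p: "A \<le> p" "p \<le> B" for u p
  proof -
    have "norm (complex_of_real (heat (\<lambda>n. v' n t) u p) - of_real (odd_kernel d u (p - t))) \<le> C"
      unfolding of_real_heat[OF g' lp[OF p] u(1)] odd_kernel_poisson_chain[OF d(1)]
      by (rule E2) (use sec[OF u(1)] u p in auto)
    then have "\<bar>heat (\<lambda>n. v' n t) u p - odd_kernel d u (p - t)\<bar> \<le> C"
      by (metis norm_of_real of_real_diff)
    moreover have "\<bar>v' 0 t * v 0 p * exp (- (u * e 0))\<bar> \<le> W"
      unfolding W_def by (rule low[OF _ p u(1)]) (use g'[of 0] in simp)
    ultimately show ?thesis unfolding heat_lower_0[OF g' lp[OF p] u(1)] by simp
  qed
  have hcont: "continuous_on {\<tau>..\<rho>} (\<lambda>u. heat (lower k h) u p)"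
    if "\<And>n. \<bar>h n\<bar> \<le> V * (1 + e n) ^ j" "A \<le> p" "p \<le> B" "0 < \<tau>" for \<tau> k h j p
    by (rule continuous_on_subset[OF heat_continuous_in_time[OF lower_poly_bound[OF that(1)] lp[OF that(2,3)]]])
      (use that in auto)
  \<comment> \<open>Each constant is the bound at time \<rho> plus the time integral of the bound
    one integration earlier; 128 = 2 * 64 comes from the second estimate of the odd
    primitive.\<close>
  define L1 where "L1 = K1 + (C + W) * \<rho> + 2 * C * sqrt \<rho>"
  define L2 where "L2 = K2 + (C + W) * \<rho>"
  define L3 where "L3 = K3 + L2 * \<rho> + 128 * sqrt \<rho>"
  have L: "0 \<le> L1" "0 \<le> L2" "0 \<le> L3" using K1 K2 K3 C W \<rho> by (auto simp: L1_def L2_def L3_def)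
  have b1: "\<bar>heat (lower 1 (\<lambda>n. v n t)) \<tau> p\<bar> \<le> L1 * (1 + 1 / sqrt \<bar>p - t\<bar>)"
    if \<tau>: "0 < \<tau>" "\<tau> \<le> \<rho>" and p: "A \<le> p" "p \<le> B" "p \<noteq> t" for \<tau> p
  proof -
    define y where "y = 1 / sqrt \<bar>p - t\<bar>"
    have y: "0 \<le> y" by (simp add: y_def)
    have "\<bar>heat (lower 1 (\<lambda>n. v n t)) \<tau> p\<bar> \<le> \<bar>heat (lower 1 (\<lambda>n. v n t)) \<rho> p\<bar> + (C + W) * \<rho> + 2 * (C / sqrt \<bar>p - t\<bar>) * sqrt \<rho>"
    proof (rule bound_from_derivative[OF \<tau> _ _ hcont[OF g p(1,2) \<tau>(1)]])
      show "((\<lambda>u. heat (lower 1 (\<lambda>n. v n t)) u p) has_real_derivative - heat (lower 0 (\<lambda>n. v n t)) u p) (at u)"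
        if "\<tau> < u" for u
        using heat_lower_deriv[OF g lp[OF p(1,2)], of u 0] \<tau> that by simp
    qed (use C W base p \<tau> in auto)
    also have "\<dots> \<le> K1 + (C + W) * \<rho> + (2 * C * sqrt \<rho>) * y"
      using K1(2)[OF p(1,2)] by (simp add: y_def)
    also have "\<dots> \<le> L1 * 1 + L1 * y"
    proof (rule add_mono)
      show "K1 + (C + W) * \<rho> \<le> L1 * 1" using C \<rho> by (simp add: L1_def)
      show "(2 * C * sqrt \<rho>) * y \<le> L1 * y" using K1(1) C W \<rho> y by (intro mult_right_mono) (auto simp: L1_def)
    qed
    finally show ?thesis by (simp add: y_def distrib_left)
  qed
  have b2: "\<bar>heat (lower 1 (\<lambda>n. v' n t)) \<tau> p - odd_primitive d \<rho> \<tau> (p - t)\<bar> \<le> L2"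
    if \<tau>: "0 < \<tau>" "\<tau> \<le> \<rho>" and p: "A \<le> p" "p \<le> B" for \<tau> p
  proof -
    have "\<bar>heat (lower 1 (\<lambda>n. v' n t)) \<tau> p - odd_primitive d \<rho> \<tau> (p - t)\<bar>
      \<le> \<bar>heat (lower 1 (\<lambda>n. v' n t)) \<rho> p - odd_primitive d \<rho> \<rho> (p - t)\<bar> + (C + W) * \<rho> + 2 * 0 * sqrt \<rho>"
    proof (rule bound_from_derivative[where f="\<lambda>u. heat (lower 0 (\<lambda>n. v' n t)) u p - odd_kernel d u (p - t)", OF \<tau>])
      show "continuous_on {\<tau>..\<rho>} (\<lambda>u. heat (lower 1 (\<lambda>n. v' n t)) u p - odd_primitive d \<rho> u (p - t))"
        by (intro continuous_intros hcont[OF g' p \<tau>(1)] odd_primitive_continuous_time[OF d(1) \<rho> \<tau>(1)])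
      show "((\<lambda>u. heat (lower 1 (\<lambda>n. v' n t)) u p - odd_primitive d \<rho> u (p - t)) has_real_derivative
         - (heat (lower 0 (\<lambda>n. v' n t)) u p - odd_kernel d u (p - t))) (at u)" if "\<tau> < u" "u < \<rho>" for u
        using DERIV_diff[OF heat_lower_deriv[OF g' lp[OF p], of u 0] odd_primitive_deriv_time[OF d(1) \<rho>, of u "p - t"]]
          \<tau> that by simp
    qed (use C W base' p \<tau> in auto)
    then show ?thesis using K2(2)[OF p] by (simp add: L2_def odd_primitive_def)
  qed
  have b3: "\<bar>heat (lower 2 (\<lambda>n. v' n t)) \<tau> p\<bar> \<le> L3 * (1 + 1 / sqrt \<bar>p - t\<bar>)"
    if \<tau>: "0 < \<tau>" "\<tau> \<le> \<rho>" and p: "A \<le> p" "p \<le> B" "p \<noteq> t" for \<tau> p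
  proof -
    define y where "y = 1 / sqrt \<bar>p - t\<bar>"
    have y: "0 \<le> y" by (simp add: y_def)
    have "\<bar>heat (lower 2 (\<lambda>n. v' n t)) \<tau> p\<bar> \<le> \<bar>heat (lower 2 (\<lambda>n. v' n t)) \<rho> p\<bar> + L2 * \<rho> + 2 * (64 / sqrt \<bar>p - t\<bar>) * sqrt \<rho>"
    proof (rule bound_from_derivative[OF \<tau> _ _ hcont[OF g' p(1,2) \<tau>(1)]])
      show "((\<lambda>u. heat (lower 2 (\<lambda>n. v' n t)) u p) has_real_derivative - heat (lower 1 (\<lambda>n. v' n t)) u p) (at u)"
        if "\<tau> < u" for u
        using heat_lower_deriv[OF g' lp[OF p(1,2)], of u 1] \<tau> that by (simp add: numeral_2_eq_2)
      show "\<bar>heat (lower 1 (\<lambda>n. v' n t)) u p\<bar> \<le> L2 + 64 / sqrt \<bar>p - t\<bar> / sqrt u" if "\<tau> \<le> u" "u \<le> \<rho>" for u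
      proof -
        have u: "0 < u" using that \<tau> by simp
        have "\<bar>odd_primitive d \<rho> u (p - t)\<bar> \<le> 64 / sqrt \<bar>p - t\<bar> / sqrt u"
          by (rule odd_primitive_bounds(2)[OF d(1) \<rho> u that(2)]) (use p in simp)
        then show ?thesis using b2[OF u that(2) p(1,2)] by linarith
      qed
    qed (use L in auto)
    also have "\<dots> \<le> K3 + L2 * \<rho> + (128 * sqrt \<rho>) * y"
      using K3(2)[OF p(1,2)] by (simp add: y_def)
    also have "\<dots> \<le> L3 * 1 + L3 * y"
    proof (rule add_mono)
      show "K3 + L2 * \<rho> \<le> L3 * 1" using \<rho> by (simp add: L3_def)
      show "(128 * sqrt \<rho>) * y \<le> L3 * y" using K3(1) L \<rho> y by (intro mult_right_mono) (auto simp: L3_def)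
    qed
    finally show ?thesis by (simp add: y_def distrib_left)
  qed
  define K where "K k = L1 + L2 + L3 + 3 ^ k * V * V * S" for k :: nat
  have VS: "0 \<le> 3 ^ k * V * V * S" for k :: nat using V(1) S by simp
  have K: "0 \<le> K k" "L1 \<le> K k" "L2 \<le> K k" "L3 \<le> K k" "3 ^ k * V * V * S \<le> K k" for k
    using L VS[of k] by (auto simp: K_def)
  have big: "c \<le> K k * (1 + 1 / sqrt \<bar>p - t\<bar>)" if "c \<le> 3 ^ k * V * V * S" for c k p
  proof -
    have "c \<le> K k * 1" using that K(5)[of k] by linarith
    also have "\<dots> \<le> K k * (1 + 1 / sqrt \<bar>p - t\<bar>)" by (intro mult_left_mono K) auto
    finally show ?thesis .
  qed
  have mono: "L * (1 + 1 / sqrt \<bar>p - t\<bar>) \<le> K k * (1 + 1 / sqrt \<bar>p - t\<bar>)" if "L \<le> K k" for L k p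
    using that by (intro mult_right_mono) auto
  show ?thesis
  proof (rule that[of \<rho> K])
    show "\<bar>heat (lower k (\<lambda>n. v n t)) \<tau> p\<bar> \<le> K k * (1 + 1 / sqrt \<bar>p - t\<bar>)"
      if "1 \<le> k" "0 < \<tau>" "\<tau> \<le> \<rho>" "A \<le> p" "p \<le> B" "p \<noteq> t" for k \<tau> p
    proof (cases "k = 1")
      case True
      then show ?thesis using order_trans[OF b1[OF that(2-6)] mono[OF K(2)]] by simp
    next
      case False
      then show ?thesis unfolding S_def[symmetric]
        using heat_lower_bounded[OF g _ Vp[OF that(4,5)], of k \<tau>] that by (intro big) (simp add: S_def)
    qed
    show "\<bar>heat (lower k (\<lambda>n. v' n t)) \<tau> p\<bar> \<le> K k * (1 + 1 / sqrt \<bar>p - t\<bar>)"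
      if "2 \<le> k" "0 < \<tau>" "\<tau> \<le> \<rho>" "A \<le> p" "p \<le> B" "p \<noteq> t" for k \<tau> p
    proof (cases "k = 2")
      case True
      then show ?thesis using order_trans[OF b3[OF that(2-6)] mono[OF K(4)]] by simp
    next
      case False
      then show ?thesis
        using heat_lower_bounded[OF g' _ Vp[OF that(4,5)], of k \<tau>] that by (intro big) (simp add: S_def)
    qed
    show "\<bar>heat (lower 1 (\<lambda>n. v' n t)) \<tau> p - odd_primitive d \<rho> \<tau> (p - t)\<bar> \<le> K 1"
      if "0 < \<tau>" "\<tau> \<le> \<rho>" "A \<le> p" "p \<le> B" for \<tau> p
      by (rule order_trans[OF b2[OF that] K(3)])
  qed (use \<rho> K E3 in auto)
qed

end

section \<open>The expansion theorem for eigensystems\<close>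

text \<open>With \<epsilon> = 0 only the point \<open>t\<close> is removed: the pointwise limits
  needed for dominated convergence are available off the diagonal alone.\<close>

definition punctured :: "real \<Rightarrow> real \<Rightarrow> real \<Rightarrow> real \<Rightarrow> real set" where
  "punctured A B t \<epsilon> = {p. A \<le> p \<and> p \<le> B \<and> \<epsilon> < \<bar>p - t\<bar>}"

lemma punctured_borel [measurable]: "punctured A B t \<epsilon> \<in> sets borel"
  unfolding punctured_def by measurable

lemma set_borel_measurable_continuous_borel:
  fixes f :: "real \<Rightarrow> 'a::euclidean_space"
  assumes "S \<in> sets borel" "continuous_on S f"
  shows "set_borel_measurable borel S f"
  unfolding set_borel_measurable_def by (rule borel_measurable_continuous_on_indicator[OF assms])

lemma inverse_sqrt_abs_set_integrable:
  assumes "A \<le> B" "0 \<le> K"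
  shows "set_integrable lborel {A..B} (\<lambda>p. K * (1 + 1 / sqrt \<bar>p - t\<bar>))"
proof (rule set_integrable_lborel_dominated)
  show "set_borel_measurable borel {A..B} (\<lambda>p. K * (1 + 1 / sqrt \<bar>p - t\<bar>))"
    unfolding set_borel_measurable_def by measurable
  show "(\<lambda>p. K * (1 + 1 / sqrt \<bar>p - t\<bar>)) integrable_on {A..B}"
    using inverse_sqrt_abs_integrable[OF assms(1), of K K t] by (simp add: distrib_left)
qed (use assms in auto)

lemma punctured_integrable:
  fixes f :: "real \<Rightarrow> 'a::euclidean_space"
  assumes AB: "A \<le> B" and K: "0 \<le> K" and m: "set_borel_measurable borel (punctured A B t \<epsilon>) f"
    and b: "\<And>p. p \<in> punctured A B t \<epsilon> \<Longrightarrow> norm (f p) \<le> K * (1 + 1 / sqrt \<bar>p - t\<bar>)"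
  shows "set_integrable lborel (punctured A B t \<epsilon>) f"
  unfolding set_integrable_def
proof (rule Bochner_Integration.integrable_bound[OF inverse_sqrt_abs_set_integrable[OF AB K, unfolded set_integrable_def, of t]])
  show "(\<lambda>p. indicat_real (punctured A B t \<epsilon>) p *\<^sub>R f p) \<in> borel_measurable lborel"
    using m by (simp add: set_borel_measurable_def)
  show "AE p in lborel. norm (indicat_real (punctured A B t \<epsilon>) p *\<^sub>R f p)
      \<le> norm (indicat_real {A..B} p *\<^sub>R (K * (1 + 1 / sqrt \<bar>p - t\<bar>)))"
  proof (rule AE_I2)
    fix p
    have "0 \<le> K * (1 + 1 / sqrt \<bar>p - t\<bar>)" using K by simp
    then show "norm (indicat_real (punctured A B t \<epsilon>) p *\<^sub>R f p)
      \<le> norm (indicat_real {A..B} p *\<^sub>R (K * (1 + 1 / sqrt \<bar>p - t\<bar>)))"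
      using b[of p] by (auto simp: indicator_def punctured_def)
  qed
qed

lemma punctured_dominated:
  fixes f :: "real \<Rightarrow> 'a::euclidean_space"
  assumes AB: "A \<le> B" and K: "0 \<le> K" and c: "\<And>i. continuous_on (punctured A B t 0) (F i)"
    and lim: "\<And>p. p \<in> punctured A B t 0 \<Longrightarrow> (\<lambda>i. F i p) \<longlonglongrightarrow> f p"
    and b: "\<And>i p. p \<in> punctured A B t 0 \<Longrightarrow> norm (F i p) \<le> K * (1 + 1 / sqrt \<bar>p - t\<bar>)"
  shows "set_integrable lborel (punctured A B t 0) f"
    and "(\<lambda>i. LBINT p:punctured A B t 0. F i p) \<longlonglongrightarrow> (LBINT p:punctured A B t 0. f p)"
proof -
  have mF: "(\<lambda>p. indicat_real (punctured A B t 0) p *\<^sub>R F i p) \<in> borel_measurable borel" for i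
    using set_borel_measurable_continuous_borel[OF punctured_borel c] by (simp add: set_borel_measurable_def)
  have l: "(\<lambda>i. indicat_real (punctured A B t 0) p *\<^sub>R F i p) \<longlonglongrightarrow> indicat_real (punctured A B t 0) p *\<^sub>R f p" for p
    using lim[of p] by (cases "p \<in> punctured A B t 0") auto
  have mf: "(\<lambda>p. indicat_real (punctured A B t 0) p *\<^sub>R f p) \<in> borel_measurable borel"
    by (rule borel_measurable_LIMSEQ_metric[OF mF l])
  have bf: "norm (f p) \<le> K * (1 + 1 / sqrt \<bar>p - t\<bar>)" if "p \<in> punctured A B t 0" for p
    using b[OF that] by (intro LIMSEQ_le_const2[OF tendsto_norm[OF lim[OF that]]]) auto
  show "set_integrable lborel (punctured A B t 0) f"
    by (rule punctured_integrable[OF AB K _ bf]) (use mf in \<open>simp_all add: set_borel_measurable_def\<close>)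
  show "(\<lambda>i. LBINT p:punctured A B t 0. F i p) \<longlonglongrightarrow> (LBINT p:punctured A B t 0. f p)"
    unfolding set_lebesgue_integral_def
  proof (rule integral_dominated_convergence[OF _ _ inverse_sqrt_abs_set_integrable[OF AB K, unfolded set_integrable_def, of t]])
    show "AE p in lborel. (\<lambda>i. indicat_real (punctured A B t 0) p *\<^sub>R F i p) \<longlonglongrightarrow> indicat_real (punctured A B t 0) p *\<^sub>R f p"
      by (rule AE_I2[OF l])
    fix i
    show "AE p in lborel. norm (indicat_real (punctured A B t 0) p *\<^sub>R F i p) \<le> indicat_real {A..B} p *\<^sub>R (K * (1 + 1 / sqrt \<bar>p - t\<bar>))"
    proof (rule AE_I2)
      fix p
      have "0 \<le> K * (1 + 1 / sqrt \<bar>p - t\<bar>)" using K by simp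
      then show "norm (indicat_real (punctured A B t 0) p *\<^sub>R F i p) \<le> indicat_real {A..B} p *\<^sub>R (K * (1 + 1 / sqrt \<bar>p - t\<bar>))"
        using b[of p i] by (auto simp: indicator_def punctured_def)
    qed
  qed (use mf mF in simp_all)
qed

lemma punctured_set_integral:
  fixes f :: "real \<Rightarrow> 'a::euclidean_space"
  assumes f: "set_integrable lborel (punctured A B t 0) f"
  shows "set_integrable lborel {A..B} f"
    and "(LBINT p:punctured A B t 0. f p) = (LBINT p:{A..B}. f p)"
proof -
  have "integrable lborel (\<lambda>p. indicat_real {t} p *\<^sub>R f t)"
    by (rule integrable_scaleR_left) simp
  moreover have "indicat_real {t} p *\<^sub>R f t = indicat_real {t} p *\<^sub>R f p" for p by (auto simp: indicator_def)
  ultimately have "set_integrable lborel {t} f" by (simp add: set_integrable_def)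
  then have "set_integrable lborel (punctured A B t 0 \<union> {t}) f"
    by (intro set_integrable_Un f) auto
  then show i: "set_integrable lborel {A..B} f"
    by (rule set_integrable_subset) (auto simp: punctured_def)
  show "(LBINT p:punctured A B t 0. f p) = (LBINT p:{A..B}. f p)"
  proof (rule set_integral_cong_set)
    show "AE p in lborel. (p \<in> {A..B}) = (p \<in> punctured A B t 0)"
      using AE_lborel_singleton[of t] by eventually_elim (auto simp: punctured_def)
  qed (use f i in \<open>auto simp: set_borel_measurable_def set_integrable_def\<close>)
qed

text \<open>Dominated convergence along sequences, with the function itself as majorant; every point
  other than \<open>t\<close> eventually enters the truncated set.\<close>

lemma punctured_limit:
  fixes f :: "real \<Rightarrow> 'a::euclidean_space"
  assumes f: "set_integrable lborel (punctured A B t 0) f"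
  shows "((\<lambda>\<epsilon>. LBINT p:punctured A B t \<epsilon>. f p) \<longlongrightarrow> (LBINT p:punctured A B t 0. f p)) (at_right 0)"
  unfolding tendsto_at_iff_sequentially o_def
proof (intro allI impI)
  fix X :: "nat \<Rightarrow> real" assume X: "\<forall>i. X i \<in> {0<..} - {0}" "X \<longlonglongrightarrow> 0"
  define g where "g p = indicat_real (punctured A B t 0) p *\<^sub>R f p" for p
  have g: "integrable lborel g" using f by (simp add: set_integrable_def g_def[abs_def])
  have eq: "indicat_real (punctured A B t (X i)) p *\<^sub>R f p = indicat_real (punctured A B t (X i)) p *\<^sub>R g p" for i p
    using X(1)[rule_format, of i] by (auto simp: g_def indicator_def punctured_def)
  have "(\<lambda>i. integral\<^sup>L lborel (\<lambda>p. indicat_real (punctured A B t (X i)) p *\<^sub>R g p)) \<longlonglongrightarrow> integral\<^sup>L lborel g"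
  proof (rule integral_dominated_convergence[where w="\<lambda>p. norm (g p)"])
    show "AE p in lborel. (\<lambda>i. indicat_real (punctured A B t (X i)) p *\<^sub>R g p) \<longlonglongrightarrow> g p"
    proof (rule AE_I2)
      fix p
      have "\<forall>\<^sub>F i in sequentially. indicat_real (punctured A B t (X i)) p *\<^sub>R g p = g p"
      proof (cases "p \<in> punctured A B t 0")
        case True
        then have "0 < \<bar>p - t\<bar>" by (simp add: punctured_def)
        then have "\<forall>\<^sub>F i in sequentially. X i < \<bar>p - t\<bar>" by (rule order_tendstoD(2)[OF X(2)])
        then show ?thesis by (rule eventually_mono) (use True in \<open>auto simp: punctured_def indicator_def\<close>)
      qed (simp add: g_def)
      then show "(\<lambda>i. indicat_real (punctured A B t (X i)) p *\<^sub>R g p) \<longlonglongrightarrow> g p" by (rule tendsto_eventually)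
    qed
    show "AE p in lborel. norm (indicat_real (punctured A B t (X i)) p *\<^sub>R g p) \<le> norm (g p)" for i
      by (rule AE_I2) (simp add: indicator_def)
    show "(\<lambda>p. indicat_real (punctured A B t (X i)) p *\<^sub>R g p) \<in> borel_measurable lborel" for i
      using borel_measurable_integrable[OF g] by measurable
  qed (use g in \<open>auto intro: integrable_norm\<close>)
  then show "(\<lambda>i. LBINT p:punctured A B t (X i). f p) \<longlonglongrightarrow> (LBINT p:punctured A B t 0. f p)"
    unfolding set_lebesgue_integral_def eq g_def .
qed

text \<open>Reflection in \<open>t\<close>. The interval \<open>{A..B}\<close> need not be symmetric
  about \<open>t\<close>, but the kernel is supported in \<open>{t-d..t+d}\<close>, which it
  contains.\<close>

lemma odd_primitive_integral_0:
  assumes d: "0 < d" "0 < \<rho>" "\<rho> \<le> d" "A \<le> t - d" "t + d \<le> B" and \<epsilon>: "0 \<le> \<epsilon>"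
  shows "(LBINT p:punctured A B t \<epsilon>. odd_primitive d \<rho> \<tau> (p - t)) = 0"
proof -
  define H where "H p = indicat_real (punctured A B t \<epsilon>) p *\<^sub>R odd_primitive d \<rho> \<tau> (p - t)" for p
  have H: "H (2 * t + - 1 * p) = - H p" for p
  proof (cases "d \<le> \<bar>p - t\<bar>")
    case True
    then show ?thesis using odd_primitive_outside[OF d(1-3), of "p - t" \<tau>] odd_primitive_outside[OF d(1-3), of "t - p" \<tau>]
      by (simp add: H_def abs_minus_commute)
  next
    case False
    have "odd_primitive d \<rho> \<tau> (t - p) = - odd_primitive d \<rho> \<tau> (p - t)"
      using odd_primitive_minus[OF d(1-3), of \<tau> "p - t"] by simp
    moreover have "2 * t - p \<in> punctured A B t \<epsilon> \<longleftrightarrow> p \<in> punctured A B t \<epsilon>"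
      using False d by (auto simp: punctured_def)
    ultimately show ?thesis by (simp add: H_def indicator_def)
  qed
  have "integral\<^sup>L lborel H = integral\<^sup>L lborel (\<lambda>p. - H p)"
    using lborel_integral_real_affine[of "-1" H "2 * t"] unfolding H by simp
  then show ?thesis by (simp add: set_lebesgue_integral_def H_def[abs_def])
qed

context complete_eigensystem
begin

text \<open>At positive time the sum can be integrated termwise; as the time tends to 0, Tannery's
  theorem applies because the coefficients of \<open>F\<close> are O(1 / (1 + e^2)) and
  \<open>h\<close> is bounded.\<close>

lemma heat_integral_limit:
  fixes F :: "real \<Rightarrow> complex"
  assumes AB: "l < A" "A \<le> B" "B < r" and F: "continuous_on {A..B} F"
    and k: "\<And>n. norm (integral {A..B} (\<lambda>x. v n x *\<^sub>R F x)) \<le> K0 / (1 + (e n)\<^sup>2)"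
    and h: "\<And>n. \<bar>h n\<bar> \<le> D" and \<tau>: "\<tau> \<longlonglongrightarrow> 0" "\<And>i. 0 < \<tau> i"
  shows "summable (\<lambda>n. h n *\<^sub>R integral {A..B} (\<lambda>x. v n x *\<^sub>R F x))"
    and "(\<lambda>i. LBINT p:punctured A B t 0. heat h (\<tau> i) p *\<^sub>R F p)
      \<longlonglongrightarrow> (\<Sum>n. h n *\<^sub>R integral {A..B} (\<lambda>x. v n x *\<^sub>R F x))"
proof -
  define k where "k n = integral {A..B} (\<lambda>x. v n x *\<^sub>R F x)" for n
  have h0: "\<bar>h n\<bar> \<le> D * (1 + e n) ^ 0" for n using h by simp
  have D: "0 \<le> D" using h[of 0] by simp
  obtain M where M: "M \<ge> 0" "\<And>x. A \<le> x \<Longrightarrow> x \<le> B \<Longrightarrow> norm (F x) \<le> M"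
  proof -
    have "bounded (F ` {A..B})" using F by (intro compact_imp_bounded compact_continuous_image) auto
    then obtain M where "\<forall>x\<in>{A..B}. norm (F x) \<le> M" by (auto simp: bounded_iff)
    then show ?thesis using that[of "max M 0"] by (auto simp: le_max_iff_disj)
  qed
  have bd: "norm (h n *\<^sub>R k n) \<le> D * (K0 / (1 + (e n)\<^sup>2))" for n
    using mult_mono[OF h[of n] k[of n]] D by (simp add: k_def)
  have sD: "summable (\<lambda>n. D * (K0 / (1 + (e n)\<^sup>2)))"
    by (rule summable_mult[OF inverse_energy_summable])
  show s: "summable (\<lambda>n. h n *\<^sub>R integral {A..B} (\<lambda>x. v n x *\<^sub>R F x))"
    using summable_comparison_test'[OF sD bd] by (simp add: k_def)
  have int: "(LBINT p:punctured A B t 0. heat h \<tau> p *\<^sub>R F p) = (\<Sum>n. exp (- (\<tau> * e n)) *\<^sub>R (h n *\<^sub>R k n))"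
    if \<tau>: "0 < \<tau>" for \<tau>
  proof -
    obtain K where K: "K \<ge> 0" "continuous_on {A..B} (heat h \<tau>)"
      "\<And>n p. A \<le> p \<Longrightarrow> p \<le> B \<Longrightarrow> \<bar>h n * v n p * exp (- (\<tau> * e n))\<bar> \<le> K / (1 + (e n)\<^sup>2)"
      using heat_continuous_in_p[OF h0 AB \<tau>] by metis
    define f where "f n p = (h n * v n p * exp (- (\<tau> * e n))) *\<^sub>R F p" for n p
    have vc: "continuous_on {A..B} (v n)" for n by (rule v_continuous_on) (use AB in auto)
    have fs: "heat h \<tau> p *\<^sub>R F p = (\<Sum>n. f n p)" if "A \<le> p" "p \<le> B" for p
      unfolding f_def heat_def
      by (rule suminf_scaleR_left) (rule heat_summable[OF h0 _ _ \<tau>], use that AB in auto)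
    have "(\<lambda>n. integral {A..B} (f n)) sums integral {A..B} (\<lambda>p. \<Sum>n. f n p)"
    proof (rule integral_sums[where M="\<lambda>n. M * (K / (1 + (e n)\<^sup>2))"])
      show "continuous_on {A..B} (f n)" for n unfolding f_def by (intro continuous_intros vc F)
      show "norm (f n p) \<le> M * (K / (1 + (e n)\<^sup>2))" if "A \<le> p" "p \<le> B" for n p
        using mult_mono[OF K(3)[OF that, of n] M(2)[OF that]] K(1)
        by (simp add: f_def add_nonneg_nonneg mult.commute[of M])
      show "summable (\<lambda>n. M * (K / (1 + (e n)\<^sup>2)))" by (rule summable_mult[OF inverse_energy_summable])
    qed
    moreover have "integral {A..B} (f n) = exp (- (\<tau> * e n)) *\<^sub>R (h n *\<^sub>R k n)" for n
    proof -
      have "integral {A..B} (f n) = integral {A..B} (\<lambda>p. (exp (- (\<tau> * e n)) * h n) *\<^sub>R (v n p *\<^sub>R F p))"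
        by (rule Henstock_Kurzweil_Integration.integral_cong) (simp add: f_def mult_ac)
      also have "\<dots> = (exp (- (\<tau> * e n)) * h n) *\<^sub>R k n" unfolding k_def by (rule integral_cmul)
      finally show ?thesis by simp
    qed
    moreover have "integral {A..B} (\<lambda>p. \<Sum>n. f n p) = integral {A..B} (\<lambda>p. heat h \<tau> p *\<^sub>R F p)"
      by (rule Henstock_Kurzweil_Integration.integral_cong) (simp add: fs)
    moreover have "(LBINT p:punctured A B t 0. heat h \<tau> p *\<^sub>R F p) = integral {A..B} (\<lambda>p. heat h \<tau> p *\<^sub>R F p)"
    proof -
      have si: "set_integrable lborel {A..B} (\<lambda>p. heat h \<tau> p *\<^sub>R F p)"
        by (intro borel_integrable_atLeastAtMost' continuous_intros K F)
      have "set_integrable lborel (punctured A B t 0) (\<lambda>p. heat h \<tau> p *\<^sub>R F p)"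
        by (rule set_integrable_subset[OF si]) (auto simp: punctured_def)
      with punctured_set_integral(2)[OF this] show ?thesis using set_borel_integral_eq_integral(2)[OF si] by simp
    qed
    ultimately show ?thesis by (simp add: sums_iff)
  qed
  have "(\<lambda>i. \<Sum>n. exp (- (\<tau> i * e n)) *\<^sub>R (h n *\<^sub>R k n)) \<longlonglongrightarrow> (\<Sum>n. h n *\<^sub>R k n)"
  proof (rule tannerys_theorem[OF _ _ sD, THEN conjunct2, THEN conjunct2])
    show "(\<lambda>i. exp (- (\<tau> i * e n)) *\<^sub>R (h n *\<^sub>R k n)) \<longlonglongrightarrow> h n *\<^sub>R k n" for n
      using tendsto_scaleR[OF tendsto_exp[OF tendsto_minus[OF tendsto_mult_left_zero[OF \<tau>(1), of "e n"]]] tendsto_const[of "h n *\<^sub>R k n"]]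
      by simp
    have "norm (exp (- (\<tau> i * e n)) *\<^sub>R (h n *\<^sub>R k n)) \<le> D * (K0 / (1 + (e n)\<^sup>2))" for n i
    proof -
      have "exp (- (\<tau> i * e n)) * norm (h n *\<^sub>R k n) \<le> 1 * norm (h n *\<^sub>R k n)"
        using \<tau>(2)[of i] e_nonneg[of n] by (intro mult_right_mono) auto
      then show ?thesis using bd[of n] by (simp add: abs_mult mult.assoc)
    qed
    then show "\<forall>\<^sub>F (n, i) in at_top \<times>\<^sub>F sequentially. norm (exp (- (\<tau> i * e n)) *\<^sub>R (h n *\<^sub>R k n)) \<le> D * (K0 / (1 + (e n)\<^sup>2))"
      by (simp add: case_prod_unfold)
  qed auto
  then show "(\<lambda>i. LBINT p:punctured A B t 0. heat h (\<tau> i) p *\<^sub>R F p)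
      \<longlonglongrightarrow> (\<Sum>n. h n *\<^sub>R integral {A..B} (\<lambda>x. v n x *\<^sub>R F x))"
    unfolding int[OF \<tau>(2)] k_def .
qed

end

section \<open>Jets of eigenfunctions and the Riesz kernel of an eigensystem\<close>

context eigensystem
begin

text \<open>The even entries of the jet carry \<open>v\<close>, the odd ones \<open>v'\<close>; since \<open>v'' = (q - e\<^sup>2) v\<close>, every
  derivative of \<open>c v\<close> of order \<open>N\<close> is a combination of the entries \<open>0, \<dots>, N\<close>.\<close>

definition jet :: "real \<Rightarrow> nat \<Rightarrow> nat \<Rightarrow> real" where
  "jet t j n = e n ^ (2 * (j div 2)) * (if even j then v n t else v' n t)"

lemma jet_bound_on:
  assumes ab: "l < a" "a \<le> b" "b < r"
  obtains V where "0 < V" "\<And>t j n. a \<le> t \<Longrightarrow> t \<le> b \<Longrightarrow> \<bar>jet t j n\<bar> \<le> V * (1 + e n) ^ j"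
proof -
  obtain V where V: "V > 0" "\<And>n x. a \<le> x \<Longrightarrow> x \<le> b \<Longrightarrow> \<bar>v n x\<bar> \<le> V"
    "\<And>n x. a \<le> x \<Longrightarrow> x \<le> b \<Longrightarrow> \<bar>v' n x\<bar> \<le> V * (1 + e n)"
    using v_bounded[OF ab] by blast
  show ?thesis
  proof (rule that[OF V(1)])
    fix t j n assume t: "a \<le> t" "t \<le> b"
    have e: "0 \<le> e n" by (rule e_nonneg)
    have p: "e n ^ m \<le> (1 + e n) ^ m" for m using e by (intro power_mono) auto
    show "\<bar>jet t j n\<bar> \<le> V * (1 + e n) ^ j"
    proof (cases "even j")
      case True
      then have j: "2 * (j div 2) = j" by simp
      have "e n ^ j * \<bar>v n t\<bar> \<le> (1 + e n) ^ j * V" using V(2)[OF t, of n] e by (intro mult_mono p) auto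
      then show ?thesis using True e by (simp add: jet_def j abs_mult mult.commute del: even_two_times_div_two)
    next
      case False
      define m where "m = 2 * (j div 2)"
      have j: "j = Suc m" using False by (simp add: m_def)
      have "e n ^ m * \<bar>v' n t\<bar> \<le> (1 + e n) ^ m * (V * (1 + e n))" using V(3)[OF t, of n] e by (intro mult_mono p) auto
      then show ?thesis using False e
        by (simp add: jet_def m_def[symmetric] abs_mult del: dvd_mult_div_cancel odd_two_times_div_two_succ) (simp add: j mult_ac)
    qed
  qed
qed

lemma jet_bound:
  assumes t: "l < t" "t < r"
  obtains V where "0 < V" "\<And>j n. \<bar>jet t j n\<bar> \<le> V * (1 + e n) ^ j"
  using jet_bound_on[OF t(1) order_refl t(2)] by (metis order_refl)

text \<open>Shows where the singular part sits: for j < N at least one inverse frequency is left on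
  \<open>v\<close>, or at least two on \<open>v'\<close>. Only j = N leaves none on \<open>v\<close>
  (N even) or a single one on \<open>v'\<close> (N odd).\<close>

lemma lower_jet:
  assumes "j \<le> N"
  shows "lower N (jet t j) = lower (N - 2 * (j div 2)) (\<lambda>n. if even j then v n t else v' n t)"
proof
  fix n
  define m where "m = 2 * (j div 2)"
  have "m \<le> N" using assms by (simp add: m_def)
  then have "e n ^ N = e n ^ m * e n ^ (N - m)" by (simp flip: power_add)
  then show "lower N (jet t j) n = lower (N - 2 * (j div 2)) (\<lambda>n. if even j then v n t else v' n t) n"
    using e_pos[of n] by (cases "n = 0") (simp_all add: lower_def jet_def flip: m_def)
qed

lemma heat_combination:
  assumes w: "\<And>j n. j \<in> J \<Longrightarrow> \<bar>w j n\<bar> \<le> C j * (1 + e n) ^ k j" and p: "l < p" "p < r" and \<tau>: "0 < \<tau>"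
  shows "heat (\<lambda>n. \<Sum>j\<in>J. c j * w j n) \<tau> p = (\<Sum>j\<in>J. c j * heat (w j) \<tau> p)"
proof -
  have s: "summable (\<lambda>n. w j n * v n p * exp (- (\<tau> * e n)))" if "j \<in> J" for j
    using heat_summable[OF w[OF that] p \<tau>] .
  have "heat (\<lambda>n. \<Sum>j\<in>J. c j * w j n) \<tau> p = (\<Sum>n. \<Sum>j\<in>J. c j * (w j n * v n p * exp (- (\<tau> * e n))))"
    by (simp add: heat_def sum_distrib_right sum_distrib_left mult_ac)
  also have "\<dots> = (\<Sum>j\<in>J. \<Sum>n. c j * (w j n * v n p * exp (- (\<tau> * e n))))"
    by (rule suminf_sum) (rule summable_mult[OF s])
  also have "\<dots> = (\<Sum>j\<in>J. c j * heat (w j) \<tau> p)"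
    unfolding heat_def by (intro sum.cong refl suminf_mult s)
  finally show ?thesis .
qed

lemma lower_combination: "lower N (\<lambda>n. \<Sum>j\<in>J. c j * w j n) = (\<lambda>n. \<Sum>j\<in>J. c j * lower N (w j) n)"
  by (auto simp: lower_def sum_divide_distrib)

definition jet_combination :: "real \<Rightarrow> (nat \<Rightarrow> real) \<Rightarrow> nat \<Rightarrow> nat \<Rightarrow> real" where
  "jet_combination t c N n = (\<Sum>j\<le>N. c j * jet t j n)"

definition riesz :: "(nat \<Rightarrow> real) \<Rightarrow> nat \<Rightarrow> real \<Rightarrow> real" where
  "riesz g N p = 1 / Gamma (real N) * (LBINT s:{0<..}. heat g s p * s ^ (N - 1))"

lemma jet_combination_bound:
  assumes t: "l < t" "t < r"
  obtains C where "\<And>n. \<bar>jet_combination t c N n\<bar> \<le> C * (1 + e n) ^ N"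
proof -
  obtain V where V: "0 < V" "\<And>j n. \<bar>jet t j n\<bar> \<le> V * (1 + e n) ^ j" using jet_bound[OF t] by blast
  have "\<bar>jet_combination t c N n\<bar> \<le> (\<Sum>j\<le>N. \<bar>c j\<bar> * V) * (1 + e n) ^ N" for n
  proof -
    have "\<bar>jet_combination t c N n\<bar> \<le> (\<Sum>j\<le>N. \<bar>c j * jet t j n\<bar>)"
      unfolding jet_combination_def by (rule sum_abs)
    also have "\<dots> \<le> (\<Sum>j\<le>N. \<bar>c j\<bar> * V * (1 + e n) ^ N)"
    proof (rule sum_mono)
      fix j assume "j \<in> {..N}"
      then have "(1 + e n) ^ j \<le> (1 + e n) ^ N" using e_nonneg[of n] by (intro power_increasing) auto
      then have "\<bar>jet t j n\<bar> \<le> V * (1 + e n) ^ N"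
        using order_trans[OF V(2)[of j n] mult_left_mono] V(1) by simp
      then show "\<bar>c j * jet t j n\<bar> \<le> \<bar>c j\<bar> * V * (1 + e n) ^ N"
        using mult_left_mono[of "\<bar>jet t j n\<bar>" _ "\<bar>c j\<bar>"] by (simp add: abs_mult mult.assoc)
    qed
    finally show ?thesis by (simp add: sum_distrib_right)
  qed
  then show ?thesis by (rule that)
qed

lemma heat_lower_jet_combination:
  assumes t: "l < t" "t < r" and p: "l < p" "p < r" and \<tau>: "0 < \<tau>"
  shows "heat (lower N (jet_combination t c N)) \<tau> p
     = (\<Sum>j\<le>N. c j * heat (lower (N - 2 * (j div 2)) (\<lambda>n. if even j then v n t else v' n t)) \<tau> p)"
proof -
  obtain V where V: "\<And>j n. \<bar>jet t j n\<bar> \<le> V * (1 + e n) ^ j" using jet_bound[OF t] by metis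
  have "heat (lower N (jet_combination t c N)) \<tau> p = (\<Sum>j\<le>N. c j * heat (lower N (jet t j)) \<tau> p)"
    unfolding jet_combination_def[abs_def] lower_combination
    by (rule heat_combination[OF lower_poly_bound[OF V] p \<tau>])
  then show ?thesis by (simp add: lower_jet)
qed

text \<open>Entry j is the time derivative of order m = 2 (j div 2) of a sum that is O(|z|), so s^m
  times it is O(s). That extra s is what survives against s^(N-1) when m = N; without it 1 / s would
  remain. As m is even, the sign (- e)^m disappears.\<close>

lemma heat_jet_combination_bound:
  assumes t: "l < t" "t < r" and p: "l < p" "p < r" and \<rho>: "0 < \<rho>" and N: "1 \<le> N"
    and b: "\<forall>z. 0 < Re z \<longrightarrow> 0 \<le> Re (z\<^sup>2) \<longrightarrow> norm z \<le> \<rho> \<longrightarrow>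
      norm (exp_series (\<lambda>n. v n t) p z) \<le> C' * norm z \<and> norm (exp_series (\<lambda>n. v' n t) p z) \<le> C' * norm z"
  obtains B where "\<And>s. 0 < s \<Longrightarrow> s \<le> \<rho> / 2 \<Longrightarrow> s ^ (N - 1) * \<bar>heat (jet_combination t c N) s p\<bar> \<le> B"
proof -
  obtain V where V: "\<And>j n. \<bar>jet t j n\<bar> \<le> V * (1 + e n) ^ j" using jet_bound[OF t] by metis
  have w: "\<bar>if even j then v n t else v' n t\<bar> \<le> V * (1 + e n) ^ 1" for j n
  proof (cases "even j")
    case True
    have "V * 1 \<le> V * (1 + e n)" using V[of 0 n] e_nonneg[of n] by (intro mult_left_mono) (auto simp: jet_def)
    then show ?thesis using V[of 0 n] True by (simp add: jet_def)
  next
    case False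
    then show ?thesis using V[of 1 n] by (simp add: jet_def)
  qed
  define D where "D j = fact (2 * (j div 2)) * 2 ^ (2 * (j div 2)) * (2 * \<bar>C'\<bar> + 1)" for j :: nat
  have jb: "s ^ (N - 1) * \<bar>heat (jet t j) s p\<bar> \<le> (1 + \<rho>) ^ N * D j" if s: "0 < s" "s \<le> \<rho> / 2" and j: "j \<le> N" for s j
  proof -
    define m where "m = 2 * (j div 2)"
    have m: "m \<le> N" "even m" using j by (auto simp: m_def)
    have "\<bar>heat (jet t j) s p\<bar> = norm (exp_series (jet t j) p (of_real s))"
      by (rule abs_heat_eq[OF V p s(1)])
    moreover have "jet t j = (\<lambda>n. (- e n) ^ m * (if even j then v n t else v' n t))"
      using m(2) by (auto simp: jet_def simp flip: m_def)
    ultimately have h: "\<bar>heat (jet t j) s p\<bar> = norm (exp_series (\<lambda>n. (- e n) ^ m * (if even j then v n t else v' n t)) p (of_real s))" by simp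
    have cb: "C' * norm z \<le> \<bar>C'\<bar> * norm z" for z :: complex by (intro mult_right_mono) auto
    have b': "norm (exp_series (\<lambda>n. if even j then v n t else v' n t) p z) \<le> \<bar>C'\<bar> * norm z"
      if "0 < Re z" "0 \<le> Re (z\<^sup>2)" "norm z \<le> \<rho>" for z
      using b[rule_format, OF that] cb[of z] by (cases "even j") auto
    have "s ^ m * \<bar>heat (jet t j) s p\<bar> \<le> D j * s"
      unfolding h D_def m_def[symmetric]
      by (rule exp_series_cauchy_bound[OF w p b']) (use s in auto)
    then have "s ^ (N - m) * (s ^ m * \<bar>heat (jet t j) s p\<bar>) \<le> s ^ (N - m) * (D j * s)"
      using s by (intro mult_left_mono) auto
    moreover have "s ^ (N - m) * (s ^ m * \<bar>heat (jet t j) s p\<bar>) = (s ^ (N - 1) * \<bar>heat (jet t j) s p\<bar>) * s"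
    proof -
      have "s ^ (N - m) * s ^ m = s ^ (N - 1) * s ^ 1"
        unfolding power_add[symmetric] using m N by simp
      then show ?thesis by (simp add: mult_ac)
    qed
    ultimately have "(s ^ (N - 1) * \<bar>heat (jet t j) s p\<bar>) * s \<le> (s ^ (N - m) * D j) * s"
      by (simp only: mult.assoc)
    then have "s ^ (N - 1) * \<bar>heat (jet t j) s p\<bar> \<le> s ^ (N - m) * D j"
      using s(1) by (rule mult_right_le_imp_le)
    also have "\<dots> \<le> (1 + \<rho>) ^ N * D j"
    proof (rule mult_right_mono)
      have "s ^ (N - m) \<le> (1 + \<rho>) ^ (N - m)" using s \<rho> by (intro power_mono) auto
      also have "\<dots> \<le> (1 + \<rho>) ^ N" using \<rho> by (intro power_increasing) auto
      finally show "s ^ (N - m) \<le> (1 + \<rho>) ^ N" .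
    qed (simp add: D_def)
    finally show ?thesis .
  qed
  show ?thesis
  proof (rule that)
    fix s assume s: "0 < s" "s \<le> \<rho> / 2"
    have "\<bar>heat (jet_combination t c N) s p\<bar> \<le> (\<Sum>j\<le>N. \<bar>c j\<bar> * \<bar>heat (jet t j) s p\<bar>)"
      unfolding jet_combination_def[abs_def] heat_combination[OF V p s(1)]
      by (rule order_trans[OF sum_abs]) (simp add: abs_mult)
    then have "s ^ (N - 1) * \<bar>heat (jet_combination t c N) s p\<bar> \<le> s ^ (N - 1) * (\<Sum>j\<le>N. \<bar>c j\<bar> * \<bar>heat (jet t j) s p\<bar>)"
      using s by (intro mult_left_mono) auto
    also have "\<dots> = (\<Sum>j\<le>N. \<bar>c j\<bar> * (s ^ (N - 1) * \<bar>heat (jet t j) s p\<bar>))"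
      by (simp add: sum_distrib_left mult_ac)
    also have "\<dots> \<le> (\<Sum>j\<le>N. \<bar>c j\<bar> * ((1 + \<rho>) ^ N * D j))"
      by (intro sum_mono mult_left_mono jb s) auto
    finally show "s ^ (N - 1) * \<bar>heat (jet_combination t c N) s p\<bar> \<le> (\<Sum>j\<le>N. \<bar>c j\<bar> * ((1 + \<rho>) ^ N * D j))" .
  qed
qed

lemma lower_bounded:
  assumes g: "\<And>n. \<bar>g n\<bar> \<le> C * (1 + e n) ^ N"
  shows "\<bar>lower N g n\<bar> \<le> 3 ^ N * C"
proof (cases "n = 0")
  case True
  then show ?thesis using poly_bound_nonneg[OF g] by (simp add: lower_def)
next
  case False
  then have en: "1 / 2 \<le> e n" by (intro e_pos) simp
  have "(1 + e n) ^ N \<le> (3 * e n) ^ N" using en by (intro power_mono) auto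
  then have "C * (1 + e n) ^ N \<le> C * (3 * e n) ^ N" using poly_bound_nonneg[OF g] by (rule mult_left_mono)
  then have "\<bar>g n\<bar> \<le> 3 ^ N * C * e n ^ N" using g[of n] by (simp add: power_mult_distrib mult_ac)
  then show ?thesis using False en by (simp add: lower_def abs_divide pos_divide_le_eq)
qed

end

section \<open>From positive time to the Riesz kernel\<close>

context complete_eigensystem
begin

text \<open>At positive time the kernel is \<open>c N\<close> times an explicit singular part
  \<open>S\<close> plus a remainder dominated by a multiple of 1 + |p - t|^(-1/2). The remainder
  passes to the limit under the integral, so only the integrals of \<open>S\<close> need individual
  treatment.\<close>

lemma riesz_expansion:
  fixes F :: "real \<Rightarrow> complex"
  assumes N: "1 \<le> N" and AB: "l < A" "A < t" "t < B" "B < r"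
    and F: "continuous_on UNIV F" "\<And>x. x \<notin> {A..B} \<Longrightarrow> F x = 0"
    and k: "\<And>n. norm (integral {A..B} (\<lambda>x. v n x *\<^sub>R F x)) \<le> K0 / (1 + (e n)\<^sup>2)"
    and Lip: "\<And>p. A \<le> p \<Longrightarrow> p \<le> B \<Longrightarrow> norm (F p - F t) \<le> L * \<bar>p - t\<bar>"
    and g0: "jet_combination t c N 0 = 0"
  defines "R \<equiv> riesz (jet_combination t c N) N"
  defines "T \<equiv> (\<Sum>n. lower N (jet_combination t c N) n *\<^sub>R integral {A..B} (\<lambda>x. v n x *\<^sub>R F x))"
  shows "even N \<Longrightarrow> set_integrable lborel {A..B} (\<lambda>p. R p *\<^sub>R F p)"
    and "even N \<Longrightarrow> T = c N *\<^sub>R F t + (LBINT p:{A..B}. R p *\<^sub>R F p)"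
    and "odd N \<Longrightarrow> 0 < \<epsilon> \<Longrightarrow> set_integrable lborel (punctured A B t \<epsilon>) (\<lambda>p. R p *\<^sub>R F p)"
    and "odd N \<Longrightarrow> ((\<lambda>\<epsilon>. LBINT p:punctured A B t \<epsilon>. R p *\<^sub>R F p) \<longlongrightarrow> T) (at_right 0)"
proof -
  define g where "g = jet_combination t c N"
  define k where "k n = integral {A..B} (\<lambda>x. v n x *\<^sub>R F x)" for n
  define P where "P = punctured A B t 0"
  define d where "d = min (t - A) (B - t) / 2"
  have "0 < d" "d < t - A" "d < B - t" using AB by (auto simp: d_def min_def field_simps)
  then have d: "0 < d" "l < t - d" "t + d < r" "A \<le> t - d" "t + d \<le> B" using AB by auto
  have AB': "l < A" "A \<le> B" "B < r" using AB by auto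
  have t: "l < t" "t < r" using AB by auto
  have lp: "l < p" "p < r" if "A \<le> p" "p \<le> B" for p using that AB by auto
  have FAB: "continuous_on {A..B} F" using F(1) by (rule continuous_on_subset) simp
  obtain \<rho> K where \<rho>: "0 < \<rho>" "\<rho> \<le> d" and K: "\<And>k::nat. 0 \<le> (K k :: real)"
    and K1: "\<And>k \<tau> p. 1 \<le> k \<Longrightarrow> 0 < \<tau> \<Longrightarrow> \<tau> \<le> \<rho> \<Longrightarrow> A \<le> p \<Longrightarrow> p \<le> B \<Longrightarrow> p \<noteq> t \<Longrightarrow>
      \<bar>heat (lower k (\<lambda>n. v n t)) \<tau> p\<bar> \<le> K k * (1 + 1 / sqrt \<bar>p - t\<bar>)"
    and K2: "\<And>k \<tau> p. 2 \<le> k \<Longrightarrow> 0 < \<tau> \<Longrightarrow> \<tau> \<le> \<rho> \<Longrightarrow> A \<le> p \<Longrightarrow> p \<le> B \<Longrightarrow> p \<noteq> t \<Longrightarrow>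
      \<bar>heat (lower k (\<lambda>n. v' n t)) \<tau> p\<bar> \<le> K k * (1 + 1 / sqrt \<bar>p - t\<bar>)"
    and K3: "\<And>\<tau> p. 0 < \<tau> \<Longrightarrow> \<tau> \<le> \<rho> \<Longrightarrow> A \<le> p \<Longrightarrow> p \<le> B \<Longrightarrow> p \<noteq> t \<Longrightarrow>
      \<bar>heat (lower 1 (\<lambda>n. v' n t)) \<tau> p - odd_primitive d \<rho> \<tau> (p - t)\<bar> \<le> K 1"
    and K4: "\<And>p. A \<le> p \<Longrightarrow> p \<le> B \<Longrightarrow> p \<noteq> t \<Longrightarrow> \<exists>C'. \<forall>z. 0 < Re z \<longrightarrow> 0 \<le> Re (z\<^sup>2) \<longrightarrow> norm z \<le> \<rho> \<longrightarrow>
      norm (exp_series (\<lambda>n. v n t) p z) \<le> C' * norm z \<and> norm (exp_series (\<lambda>n. v' n t) p z) \<le> C' * norm z"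
    by (rule heat_estimates[OF d(1-3) AB']) blast
  obtain Cg where Cg: "\<And>n. \<bar>g n\<bar> \<le> Cg * (1 + e n) ^ N"
    using jet_combination_bound[OF t] unfolding g_def by blast
  obtain V where V: "0 < V" "\<And>j n. \<bar>jet t j n\<bar> \<le> V * (1 + e n) ^ j" using jet_bound[OF t] by blast
  have v0: "\<bar>v n t\<bar> \<le> V * (1 + e n) ^ 0" for n using V(2)[of 0 n] by (simp add: jet_def)
  obtain i0 where i0: "inverse (real (Suc i0)) < \<rho>" using reals_Archimedean[OF \<rho>(1)] by blast
  define \<tau> where "\<tau> i = 1 / real (Suc (i + i0))" for i
  have \<tau>: "0 < \<tau> i" "\<tau> i \<le> \<rho>" for i
  proof -
    show "0 < \<tau> i" by (simp add: \<tau>_def)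
    have "\<tau> i \<le> inverse (real (Suc i0))" by (simp add: \<tau>_def field_simps)
    then show "\<tau> i \<le> \<rho>" using i0 by simp
  qed
  have \<tau>0: "\<tau> \<longlonglongrightarrow> 0"
    unfolding \<tau>_def by (rule LIMSEQ_ignore_initial_segment[OF LIMSEQ_inverse_real_of_nat, unfolded inverse_eq_divide])
  define Q where "Q i p = heat (lower N g) (\<tau> i) p" for i p
  define S where "S i p = (if even N then heat (lower 0 (\<lambda>n. v n t)) (\<tau> i) p else odd_primitive d \<rho> (\<tau> i) (p - t))" for i p
  \<comment> \<open>Off the diagonal the full Poisson sum tends to 0, hence without its zeroth term
    it tends to minus that term.\<close>
  define S0 where "S0 p = (if even N then - v 0 t * v 0 p else odd_primitive d \<rho> 0 (p - t))" for p
  define Y where "Y p = R p - c N * S0 p" for p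
  have Qc: "continuous_on {A..B} (Q i)" for i
    unfolding Q_def by (rule heat_continuous_in_p[OF lower_poly_bound[OF Cg] AB' \<tau>(1)])
  have Sc: "continuous_on {A..B} (S i)" for i
  proof -
    have "continuous_on {A..B} (heat (lower 0 (\<lambda>n. v n t)) (\<tau> i))"
      by (rule heat_continuous_in_p[OF lower_poly_bound[OF v0] AB' \<tau>(1)])
    moreover have "continuous_on {A..B} (\<lambda>p. odd_primitive d \<rho> (\<tau> i) (p - t))"
      using \<tau>(1)[of i] by (intro odd_primitive_continuous[OF d(1) \<rho>]) auto
    ultimately show ?thesis unfolding S_def by (cases "even N") auto
  qed
  have PAB: "P \<subseteq> {A..B}" by (auto simp: P_def punctured_def)
  have Q_lim: "(\<lambda>i. Q i p) \<longlonglongrightarrow> R p" if p: "p \<in> P" for p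
  proof -
    have p': "A \<le> p" "p \<le> B" "p \<noteq> t" using p by (auto simp: P_def punctured_def)
    obtain C' where C': "\<forall>z. 0 < Re z \<longrightarrow> 0 \<le> Re (z\<^sup>2) \<longrightarrow> norm z \<le> \<rho> \<longrightarrow>
      norm (exp_series (\<lambda>n. v n t) p z) \<le> C' * norm z \<and> norm (exp_series (\<lambda>n. v' n t) p z) \<le> C' * norm z"
      using K4[OF p'] by blast
    obtain B0 where B0: "\<And>s. 0 < s \<Longrightarrow> s \<le> \<rho> / 2 \<Longrightarrow> s ^ (N - 1) * \<bar>heat g s p\<bar> \<le> B0"
      using heat_jet_combination_bound[OF t lp[OF p'(1,2)] \<rho>(1) N C'] unfolding g_def by blast
    have "(\<lambda>i. heat (lower N g) (1 / real (Suc i)) p) \<longlonglongrightarrow> R p"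
      unfolding R_def riesz_def g_def[symmetric]
      by (rule heat_laplace_limit[OF Cg _ lp[OF p'(1,2)] N _ B0, of "\<rho> / 2"]) (use g0 \<rho> in \<open>auto simp: g_def\<close>)
    then show ?thesis unfolding Q_def \<tau>_def by (rule LIMSEQ_ignore_initial_segment)
  qed
  have S_lim: "(\<lambda>i. S i p) \<longlonglongrightarrow> S0 p" if p: "p \<in> P" for p
  proof (cases "even N")
    case False
    then show ?thesis using odd_primitive_tendsto[OF d(1) \<rho> _ \<tau>0 \<tau>, of "p - t"] p
      by (auto simp: S_def S0_def P_def punctured_def)
  next
    case True
    have p': "A \<le> p" "p \<le> B" "p \<noteq> t" using p by (auto simp: P_def punctured_def)
    obtain C' where C': "\<forall>z. 0 < Re z \<longrightarrow> 0 \<le> Re (z\<^sup>2) \<longrightarrow> norm z \<le> \<rho> \<longrightarrow>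
      norm (exp_series (\<lambda>n. v n t) p z) \<le> C' * norm z \<and> norm (exp_series (\<lambda>n. v' n t) p z) \<le> C' * norm z"
      using K4[OF p'] by blast
    have b: "norm (heat (\<lambda>n. v n t) (\<tau> i) p) \<le> C' * \<tau> i" for i
      using C'[rule_format, of "of_real (\<tau> i)"] \<tau>[of i] abs_heat_eq[OF v0 lp[OF p'(1,2)] \<tau>(1), of i]
      by (simp flip: of_real_power)
    have "(\<lambda>i. heat (\<lambda>n. v n t) (\<tau> i) p) \<longlonglongrightarrow> 0"
      by (rule Lim_null_comparison[OF always_eventually tendsto_mult_right_zero[OF \<tau>0, of C']]) (use b in blast)
    moreover have "(\<lambda>i. exp (- (\<tau> i * e 0))) \<longlonglongrightarrow> exp (- (0 * e 0))"
      by (intro tendsto_intros \<tau>0)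
    ultimately have "(\<lambda>i. heat (\<lambda>n. v n t) (\<tau> i) p - v 0 t * v 0 p * exp (- (\<tau> i * e 0))) \<longlonglongrightarrow> 0 - v 0 t * v 0 p * exp (- (0 * e 0))"
      by (rule tendsto_diff[OF _ tendsto_mult_left])
    then show ?thesis using True by (simp add: S_def S0_def heat_lower_0[OF v0 lp[OF p'(1,2)] \<tau>(1)])
  qed
  define KK where "KK = (\<Sum>j\<le>N. \<bar>c j\<bar> * K (N - 2 * (j div 2)))"
  have KK: "0 \<le> KK" unfolding KK_def using K by (intro sum_nonneg) auto
  have Y_bd: "\<bar>Q i p - c N * S i p\<bar> \<le> KK * (1 + 1 / sqrt \<bar>p - t\<bar>)" if p: "p \<in> P" for i p
  proof -
    have p': "A \<le> p" "p \<le> B" "p \<noteq> t" using p by (auto simp: P_def punctured_def)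
    define y where "y = 1 + 1 / sqrt \<bar>p - t\<bar>"
    have y: "1 \<le> y" by (simp add: y_def)
    define h where "h j = heat (lower (N - 2 * (j div 2)) (\<lambda>n. if even j then v n t else v' n t)) (\<tau> i) p" for j
    have "Q i p = (\<Sum>j\<le>N. c j * h j)"
      unfolding Q_def g_def h_def by (rule heat_lower_jet_combination[OF t lp[OF p'(1,2)] \<tau>(1)])
    moreover have "c N * S i p = (\<Sum>j\<le>N. c j * (if j = N then S i p else 0))" by (simp add: if_distrib cong: if_cong)
    ultimately have "Q i p - c N * S i p = (\<Sum>j\<le>N. c j * (h j - (if j = N then S i p else 0)))"
      by (simp add: sum_subtractf right_diff_distrib)
    also have "\<bar>\<dots>\<bar> \<le> (\<Sum>j\<le>N. \<bar>c j\<bar> * (K (N - 2 * (j div 2)) * y))"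
    proof (rule order_trans[OF sum_abs sum_mono])
      fix j assume "j \<in> {..N}"
      then have j: "j \<le> N" by simp
      \<comment> \<open>For j = N the subtraction is exact if N is even and leaves a bounded
        function if N is odd. For smaller j an even entry keeps at least one inverse frequency and
        an odd one at least two, which are the dominated cases.\<close>
      have "\<bar>h j - (if j = N then S i p else 0)\<bar> \<le> K (N - 2 * (j div 2)) * y"
      proof (cases "j = N")
        case True
        show ?thesis
        proof (cases "even N")
          case ev: True
          then show ?thesis using True K[of 0] y by (simp add: h_def S_def)
        next
          case od: False
          then have "N - 2 * (N div 2) = 1" by (metis minus_mult_div_eq_mod odd_iff_mod_2_eq_one)
          moreover have "K 1 * 1 \<le> K 1 * y" using K[of 1] y by (intro mult_left_mono)
          ultimately show ?thesis using True od K3[OF \<tau> p', of i] by (simp add: h_def S_def)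
        qed
      next
        case False
        then have jN: "j < N" using j by simp
        show ?thesis
        proof (cases "even j")
          case True
          then have "1 \<le> N - 2 * (j div 2)" using jN by simp
          from K1[OF this \<tau> p'] show ?thesis using True False by (simp add: h_def y_def)
        next
          case odd: False
          then have "2 * (j div 2) + 1 = j" by simp
          then have "2 \<le> N - 2 * (j div 2)" using jN by linarith
          from K2[OF this \<tau> p'] show ?thesis using odd False by (simp add: h_def y_def)
        qed
      qed
      then show "\<bar>c j * (h j - (if j = N then S i p else 0))\<bar> \<le> \<bar>c j\<bar> * (K (N - 2 * (j div 2)) * y)"
        unfolding abs_mult by (rule mult_left_mono) simp
    qed
    also have "\<dots> = KK * y" by (simp add: KK_def sum_distrib_right sum_distrib_left mult_ac)
    finally show ?thesis by (simp add: y_def)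
  qed
  obtain M where M: "M \<ge> 0" "\<And>x. A \<le> x \<Longrightarrow> x \<le> B \<Longrightarrow> norm (F x) \<le> M"
  proof -
    have "bounded (F ` {A..B})" using FAB by (intro compact_imp_bounded compact_continuous_image) auto
    then obtain M where "\<forall>x\<in>{A..B}. norm (F x) \<le> M" by (auto simp: bounded_iff)
    then show ?thesis using that[of "max M 0"] by (auto simp: le_max_iff_disj)
  qed
  have Y_dom: "norm ((Q i p - c N * S i p) *\<^sub>R F p) \<le> (KK * M) * (1 + 1 / sqrt \<bar>p - t\<bar>)" if "p \<in> punctured A B t 0" for i p
  proof -
    have "norm ((Q i p - c N * S i p) *\<^sub>R F p) \<le> (KK * (1 + 1 / sqrt \<bar>p - t\<bar>)) * M"
      unfolding norm_scaleR using Y_bd[of p i] M that KK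
      by (intro mult_mono) (auto simp: P_def punctured_def)
    then show ?thesis by (simp add: mult_ac)
  qed
  have Y_int: "set_integrable lborel P (\<lambda>p. Y p *\<^sub>R F p)"
    and Y_conv: "(\<lambda>i. LBINT p:P. (Q i p - c N * S i p) *\<^sub>R F p) \<longlonglongrightarrow> (LBINT p:P. Y p *\<^sub>R F p)"
  proof -
    have c: "continuous_on (punctured A B t 0) (\<lambda>p. (Q i p - c N * S i p) *\<^sub>R F p)" for i
      using PAB unfolding P_def
      by (intro continuous_intros continuous_on_subset[OF Qc] continuous_on_subset[OF Sc] continuous_on_subset[OF FAB])
    have l: "(\<lambda>i. (Q i p - c N * S i p) *\<^sub>R F p) \<longlonglongrightarrow> Y p *\<^sub>R F p" if "p \<in> punctured A B t 0" for p
      using Q_lim S_lim that unfolding Y_def P_def by (intro tendsto_intros) auto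
    have KM: "0 \<le> KK * M" using KK M by simp
    show "set_integrable lborel P (\<lambda>p. Y p *\<^sub>R F p)"
      unfolding P_def by (rule punctured_dominated(1)[OF AB'(2) KM c l Y_dom])
    show "(\<lambda>i. LBINT p:P. (Q i p - c N * S i p) *\<^sub>R F p) \<longlonglongrightarrow> (LBINT p:P. Y p *\<^sub>R F p)"
      unfolding P_def by (rule punctured_dominated(2)[OF AB'(2) KM c l Y_dom])
  qed
  have ci: "set_integrable lborel P f" if "continuous_on {A..B} f" for f :: "real \<Rightarrow> complex"
    by (rule set_integrable_subset[OF borel_integrable_atLeastAtMost'[OF that]]) (use PAB in \<open>auto simp: P_def\<close>)
  have SF: "set_integrable lborel P (\<lambda>p. S i p *\<^sub>R F p)" for i
    by (intro ci continuous_intros Sc FAB)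
  have QS: "(LBINT p:P. Q i p *\<^sub>R F p) = (LBINT p:P. (Q i p - c N * S i p) *\<^sub>R F p) + c N *\<^sub>R (LBINT p:P. S i p *\<^sub>R F p)" for i
  proof -
    have "set_integrable lborel P (\<lambda>p. (Q i p - c N * S i p) *\<^sub>R F p)"
      by (intro ci continuous_intros Qc Sc FAB)
    from set_integral_add(2)[OF this set_integrable_scaleR_right[OF SF[of i], of "c N"]]
    have "(LBINT p:P. (Q i p - c N * S i p) *\<^sub>R F p + c N *\<^sub>R (S i p *\<^sub>R F p))
      = (LBINT p:P. (Q i p - c N * S i p) *\<^sub>R F p) + c N *\<^sub>R (LBINT p:P. S i p *\<^sub>R F p)"
      by (simp only: set_integral_scaleR_right)
    then show ?thesis by (simp add: scaleR_diff_left)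
  qed
  have Q_int: "(\<lambda>i. LBINT p:P. Q i p *\<^sub>R F p) \<longlonglongrightarrow> T"
    unfolding P_def Q_def T_def g_def[symmetric]
    by (rule heat_integral_limit(2)[OF AB' FAB assms(8) lower_bounded[OF Cg] \<tau>0 \<tau>(1)])
  \<comment> \<open>From here the parities differ only in the limit \<open>J\<close> of the singular
    integrals.\<close>
  have T_eq: "T = (LBINT p:P. Y p *\<^sub>R F p) + c N *\<^sub>R J" if "(\<lambda>i. LBINT p:P. S i p *\<^sub>R F p) \<longlonglongrightarrow> J" for J
  proof -
    have "(\<lambda>i. LBINT p:P. Q i p *\<^sub>R F p) \<longlonglongrightarrow> (LBINT p:P. Y p *\<^sub>R F p) + c N *\<^sub>R J"
      unfolding QS by (intro tendsto_intros Y_conv that)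
    with Q_int show ?thesis by (rule LIMSEQ_unique)
  qed
  show "set_integrable lborel {A..B} (\<lambda>p. R p *\<^sub>R F p)"
    and "T = c N *\<^sub>R F t + (LBINT p:{A..B}. R p *\<^sub>R F p)" if ev: "even N"
  proof -
    have vc: "continuous_on {A..B} (v 0)" by (rule v_continuous_on) (use AB in auto)
    have vF: "set_integrable lborel P (\<lambda>p. v 0 p *\<^sub>R F p)" by (intro ci continuous_intros vc FAB)
    have RY: "R p *\<^sub>R F p = Y p *\<^sub>R F p - (c N * v 0 t) *\<^sub>R (v 0 p *\<^sub>R F p)" for p
      using ev by (simp add: Y_def S0_def scaleR_diff_left algebra_simps)
    have RI: "set_integrable lborel P (\<lambda>p. R p *\<^sub>R F p)"
      unfolding RY by (intro set_integral_diff(1) Y_int set_integrable_scaleR_right vF)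
    have v0F: "(LBINT p:P. v 0 p *\<^sub>R F p) = k 0"
    proof -
      have "set_integrable lborel {A..B} (\<lambda>p. v 0 p *\<^sub>R F p)"
        by (intro borel_integrable_atLeastAtMost' continuous_intros vc FAB)
      from set_borel_integral_eq_integral(2)[OF this] show ?thesis
        using punctured_set_integral(2)[OF vF[unfolded P_def]] by (simp add: k_def P_def)
    qed
    have R2: "(LBINT p:P. R p *\<^sub>R F p) = (LBINT p:P. Y p *\<^sub>R F p) - (c N * v 0 t) *\<^sub>R k 0"
      unfolding RY using set_integral_diff(2)[OF Y_int set_integrable_scaleR_right[OF vF, of "c N * v 0 t"]]
      by (simp only: set_integral_scaleR_right v0F)
    \<comment> \<open>For even N these are Poisson means of \<open>F\<close> without the zeroth
      mode, tending to \<open>F t\<close> minus that mode. The missing mode cancels against the one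
      contained in \<open>S0\<close>, and \<open>F t\<close> alone remains.\<close>
    have "(\<lambda>i. LBINT p:P. S i p *\<^sub>R F p) \<longlonglongrightarrow> (\<Sum>n. lower 0 (\<lambda>n. v n t) n *\<^sub>R integral {A..B} (\<lambda>x. v n x *\<^sub>R F x))"
      unfolding P_def S_def if_P[OF ev]
      by (rule heat_integral_limit(2)[OF AB' FAB assms(8) lower_bounded[OF v0] \<tau>0 \<tau>(1)])
    moreover have "(\<Sum>n. lower 0 (\<lambda>n. v n t) n *\<^sub>R integral {A..B} (\<lambda>x. v n x *\<^sub>R F x)) = F t - v 0 t *\<^sub>R k 0"
    proof -
      have "(\<lambda>n. v n t *\<^sub>R integral {A..B} (\<lambda>x. v n x *\<^sub>R F x)) sums F t"
        by (rule expansion[OF AB(1) _ AB(4) F assms(8) inverse_energy_summable]) (use AB in auto)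
      then have s: "summable (\<lambda>n. v n t *\<^sub>R k n)" "(\<Sum>n. v n t *\<^sub>R k n) = F t" by (auto simp: sums_iff k_def)
      have "(\<lambda>n. lower 0 (\<lambda>n. v n t) n *\<^sub>R k n) sums (F t - v 0 t *\<^sub>R k 0)"
      proof -
        have "(\<lambda>n. lower 0 (\<lambda>n. v n t) (Suc n) *\<^sub>R k (Suc n)) sums (F t - v 0 t *\<^sub>R k 0)"
          using s suminf_split_head[OF s(1)] summable_Suc_iff[of "\<lambda>n. v n t *\<^sub>R k n"]
          by (simp add: lower_def sums_iff)
        then show ?thesis using sums_Suc_iff[of "\<lambda>n. lower 0 (\<lambda>n. v n t) n *\<^sub>R k n" "F t - v 0 t *\<^sub>R k 0"]
          by (simp add: lower_def)
      qed
      then show ?thesis by (simp add: sums_iff k_def)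
    qed
    ultimately have "T = (LBINT p:P. Y p *\<^sub>R F p) + c N *\<^sub>R (F t - v 0 t *\<^sub>R k 0)" using T_eq by simp
    then have "T = c N *\<^sub>R F t + (LBINT p:P. R p *\<^sub>R F p)" unfolding R2 by (simp add: scaleR_diff_right)
    then show "T = c N *\<^sub>R F t + (LBINT p:{A..B}. R p *\<^sub>R F p)"
      using punctured_set_integral(2)[OF RI[unfolded P_def]] by (simp add: P_def)
    show "set_integrable lborel {A..B} (\<lambda>p. R p *\<^sub>R F p)"
      by (rule punctured_set_integral(1)[OF RI[unfolded P_def]])
  qed
  define O0 where "O0 p = odd_primitive d \<rho> 0 (p - t)" for p
  have L0: "0 \<le> L"
  proof -
    have "0 \<le> L * \<bar>B - t\<bar>" by (rule order_trans[OF norm_ge_zero Lip]) (use AB in auto)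
    then show ?thesis using AB by (simp add: zero_le_mult_iff)
  qed
  have O_dom: "norm (m *\<^sub>R (F p - F t)) \<le> (64 * sqrt \<rho> * L) * (1 + 1 / sqrt \<bar>p - t\<bar>)"
    if m: "\<bar>m\<bar> \<le> 64 * sqrt \<rho> / (\<bar>p - t\<bar> * sqrt \<bar>p - t\<bar>)" and p: "p \<in> punctured A B t 0" for m p
  proof -
    have p': "A \<le> p" "p \<le> B" "0 < \<bar>p - t\<bar>" using p by (auto simp: punctured_def)
    have "norm (m *\<^sub>R (F p - F t)) \<le> (64 * sqrt \<rho> / (\<bar>p - t\<bar> * sqrt \<bar>p - t\<bar>)) * (L * \<bar>p - t\<bar>)"
      unfolding norm_scaleR using m Lip[OF p'(1,2)] \<rho> by (intro mult_mono) auto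
    also have "\<dots> = (64 * sqrt \<rho> * L) * (1 / sqrt \<bar>p - t\<bar>)" using p'(3) by (simp add: field_simps)
    also have "\<dots> \<le> (64 * sqrt \<rho> * L) * (1 + 1 / sqrt \<bar>p - t\<bar>)" using L0 \<rho> by (intro mult_left_mono) auto
    finally show ?thesis .
  qed
  have KL: "0 \<le> 64 * sqrt \<rho> * L" using L0 \<rho> by simp
  have Oc: "continuous_on (punctured A B t \<epsilon>) O0" if "0 \<le> \<epsilon>" for \<epsilon>
    unfolding O0_def using that by (intro odd_primitive_continuous[OF d(1) \<rho>]) (auto simp: punctured_def)
  have OF_int: "set_integrable lborel P (\<lambda>p. O0 p *\<^sub>R (F p - F t))"
    and OF_conv: "(\<lambda>i. LBINT p:P. odd_primitive d \<rho> (\<tau> i) (p - t) *\<^sub>R (F p - F t)) \<longlonglongrightarrow> (LBINT p:P. O0 p *\<^sub>R (F p - F t))"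
  proof -
    have c: "continuous_on (punctured A B t 0) (\<lambda>p. odd_primitive d \<rho> (\<tau> i) (p - t) *\<^sub>R (F p - F t))" for i
      using PAB \<tau>(1)[of i] unfolding P_def
      by (intro continuous_intros odd_primitive_continuous[OF d(1) \<rho>] continuous_on_subset[OF FAB]) auto
    have l: "(\<lambda>i. odd_primitive d \<rho> (\<tau> i) (p - t) *\<^sub>R (F p - F t)) \<longlonglongrightarrow> O0 p *\<^sub>R (F p - F t)" if "p \<in> punctured A B t 0" for p
      unfolding O0_def using that
      by (intro tendsto_intros odd_primitive_tendsto[OF d(1) \<rho> _ \<tau>0 \<tau>]) (auto simp: punctured_def)
    have b: "norm (odd_primitive d \<rho> (\<tau> i) (p - t) *\<^sub>R (F p - F t)) \<le> (64 * sqrt \<rho> * L) * (1 + 1 / sqrt \<bar>p - t\<bar>)"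
      if "p \<in> punctured A B t 0" for i p
      by (rule O_dom[OF odd_primitive_bounds(1)[OF d(1) \<rho> \<tau>] that]) (use that in \<open>auto simp: punctured_def\<close>)
    show "set_integrable lborel P (\<lambda>p. O0 p *\<^sub>R (F p - F t))"
      unfolding P_def by (rule punctured_dominated(1)[OF AB'(2) KL c l b])
    show "(\<lambda>i. LBINT p:P. odd_primitive d \<rho> (\<tau> i) (p - t) *\<^sub>R (F p - F t)) \<longlonglongrightarrow> (LBINT p:P. O0 p *\<^sub>R (F p - F t))"
      unfolding P_def by (rule punctured_dominated(2)[OF AB'(2) KL c l b])
  qed
  \<comment> \<open>A kernel of mean zero sees only \<open>F p - F t\<close>, which turns the
    singularity |p - t|^(-3/2) into an integrable one.\<close>
  have cancel: "(LBINT p:X. m p *\<^sub>R F p) = (LBINT p:X. m p *\<^sub>R (F p - F t))"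
    if "(LBINT p:X. m p) = 0" "set_integrable lborel X m" "set_integrable lborel X (\<lambda>p. m p *\<^sub>R (F p - F t))"
    for X and m :: "real \<Rightarrow> real"
  proof -
    have "(LBINT p:X. m p *\<^sub>R F t) = (LBINT p:X. m p) *\<^sub>R F t"
      using that(2) integral_scaleR_left[of "F t" lborel "\<lambda>p. indicator X p *\<^sub>R m p"]
      by (simp add: set_lebesgue_integral_def set_integrable_def)
    then have "(LBINT p:X. m p *\<^sub>R F t) = 0" using that(1) by simp
    moreover have "set_integrable lborel X (\<lambda>p. m p *\<^sub>R F t)" by (intro set_integrable_scaleR_left that)
    ultimately show ?thesis using set_integral_add(2)[OF that(3), of "\<lambda>p. m p *\<^sub>R F t"] by (simp add: algebra_simps)
  qed
  have Y_eps: "set_integrable lborel (punctured A B t \<epsilon>) (\<lambda>p. Y p *\<^sub>R F p)"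
    and OF_eps: "set_integrable lborel (punctured A B t \<epsilon>) (\<lambda>p. O0 p *\<^sub>R (F p - F t))"
    and O_eps: "set_integrable lborel (punctured A B t \<epsilon>) O0" if \<epsilon>: "0 < \<epsilon>" for \<epsilon>
  proof -
    have sub: "punctured A B t \<epsilon> \<subseteq> P" using \<epsilon> by (auto simp: P_def punctured_def)
    show "set_integrable lborel (punctured A B t \<epsilon>) (\<lambda>p. Y p *\<^sub>R F p)"
      by (rule set_integrable_subset[OF Y_int _ sub]) simp
    show "set_integrable lborel (punctured A B t \<epsilon>) (\<lambda>p. O0 p *\<^sub>R (F p - F t))"
      by (rule set_integrable_subset[OF OF_int _ sub]) simp
    show "set_integrable lborel (punctured A B t \<epsilon>) O0"
    proof (rule punctured_integrable[OF AB'(2)])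
      show "0 \<le> 64 * sqrt \<rho> / (\<epsilon> * sqrt \<epsilon>)" using \<rho> \<epsilon> by simp
      show "set_borel_measurable borel (punctured A B t \<epsilon>) O0"
        using \<epsilon> by (intro set_borel_measurable_continuous_borel punctured_borel Oc) simp
      fix p assume "p \<in> punctured A B t \<epsilon>"
      then have p: "\<epsilon> < \<bar>p - t\<bar>" by (simp add: punctured_def)
      have "norm (O0 p) \<le> 64 * sqrt \<rho> / (\<bar>p - t\<bar> * sqrt \<bar>p - t\<bar>)"
        unfolding O0_def real_norm_def by (rule odd_primitive_bound_0[OF d(1) \<rho>]) (use p \<epsilon> in auto)
      also have "\<dots> \<le> 64 * sqrt \<rho> / (\<epsilon> * sqrt \<epsilon>)"
        using p \<epsilon> \<rho> by (intro divide_left_mono mult_mono) auto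
      also have "\<dots> \<le> 64 * sqrt \<rho> / (\<epsilon> * sqrt \<epsilon>) * (1 + 1 / sqrt \<bar>p - t\<bar>)"
        using \<rho> \<epsilon> by (simp add: distrib_left)
      finally show "norm (O0 p) \<le> 64 * sqrt \<rho> / (\<epsilon> * sqrt \<epsilon>) * (1 + 1 / sqrt \<bar>p - t\<bar>)" .
    qed
  qed
  have O_mult: "set_integrable lborel X (\<lambda>p. O0 p *\<^sub>R F p)"
    if "set_integrable lborel X (\<lambda>p. O0 p *\<^sub>R (F p - F t))" "set_integrable lborel X O0" for X
    using set_integral_add(1)[OF that(1) set_integrable_scaleR_left[OF that(2), of "F t"]] by (simp add: algebra_simps)
  have RY: "R p *\<^sub>R F p = Y p *\<^sub>R F p + c N *\<^sub>R (O0 p *\<^sub>R F p)" if "odd N" for p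
    using that by (simp add: Y_def S0_def O0_def scaleR_diff_left)
  show "set_integrable lborel (punctured A B t \<epsilon>) (\<lambda>p. R p *\<^sub>R F p)" if od: "odd N" and \<epsilon>: "0 < \<epsilon>"
    unfolding RY[OF od] by (intro set_integral_add(1) Y_eps set_integrable_scaleR_right O_mult OF_eps O_eps \<epsilon>)
  show "((\<lambda>\<epsilon>. LBINT p:punctured A B t \<epsilon>. R p *\<^sub>R F p) \<longlongrightarrow> T) (at_right 0)" if od: "odd N"
  proof -
    have eq: "(LBINT p:punctured A B t \<epsilon>. R p *\<^sub>R F p)
      = (LBINT p:punctured A B t \<epsilon>. Y p *\<^sub>R F p) + c N *\<^sub>R (LBINT p:punctured A B t \<epsilon>. O0 p *\<^sub>R (F p - F t))"
      if \<epsilon>: "0 < \<epsilon>" for \<epsilon>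
    proof -
      have "(LBINT p:punctured A B t \<epsilon>. O0 p) = 0"
        unfolding O0_def using \<epsilon> by (intro odd_primitive_integral_0[OF d(1) \<rho> d(4,5)]) simp
      from cancel[OF this O_eps[OF \<epsilon>] OF_eps[OF \<epsilon>]]
      show ?thesis
        unfolding RY[OF od]
        using set_integral_add(2)[OF Y_eps[OF \<epsilon>] set_integrable_scaleR_right[OF O_mult[OF OF_eps[OF \<epsilon>] O_eps[OF \<epsilon>]], of "c N"]]
        by (simp only: set_integral_scaleR_right)
    qed
    have "(LBINT p:P. S i p *\<^sub>R F p) = (LBINT p:P. odd_primitive d \<rho> (\<tau> i) (p - t) *\<^sub>R (F p - F t))" for i
    proof -
      have oc: "continuous_on {A..B} (\<lambda>p. odd_primitive d \<rho> (\<tau> i) (p - t))"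
        using \<tau>(1)[of i] by (intro odd_primitive_continuous[OF d(1) \<rho>]) auto
      have "set_integrable lborel P (\<lambda>p. odd_primitive d \<rho> (\<tau> i) (p - t))"
        by (rule set_integrable_subset[OF borel_integrable_atLeastAtMost'[OF oc]]) (use PAB in \<open>auto simp: P_def\<close>)
      moreover have "set_integrable lborel P (\<lambda>p. odd_primitive d \<rho> (\<tau> i) (p - t) *\<^sub>R (F p - F t))"
        by (intro ci continuous_intros oc FAB)
      moreover have "(LBINT p:P. odd_primitive d \<rho> (\<tau> i) (p - t)) = 0"
        unfolding P_def by (rule odd_primitive_integral_0[OF d(1) \<rho> d(4,5)]) simp
      ultimately show ?thesis using od by (simp add: S_def cancel)
    qed
    then have "(\<lambda>i. LBINT p:P. S i p *\<^sub>R F p) \<longlonglongrightarrow> (LBINT p:P. O0 p *\<^sub>R (F p - F t))"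
      using OF_conv by simp
    then have T: "T = (LBINT p:P. Y p *\<^sub>R F p) + c N *\<^sub>R (LBINT p:P. O0 p *\<^sub>R (F p - F t))" by (rule T_eq)
    have "((\<lambda>\<epsilon>. (LBINT p:punctured A B t \<epsilon>. Y p *\<^sub>R F p) + c N *\<^sub>R (LBINT p:punctured A B t \<epsilon>. O0 p *\<^sub>R (F p - F t))) \<longlongrightarrow> T) (at_right 0)"
      unfolding T using punctured_limit[OF Y_int[unfolded P_def]] punctured_limit[OF OF_int[unfolded P_def]]
      unfolding P_def by (intro tendsto_intros)
    moreover have "\<forall>\<^sub>F \<epsilon> in at_right 0. (LBINT p:punctured A B t \<epsilon>. Y p *\<^sub>R F p)
        + c N *\<^sub>R (LBINT p:punctured A B t \<epsilon>. O0 p *\<^sub>R (F p - F t)) = (LBINT p:punctured A B t \<epsilon>. R p *\<^sub>R F p)"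
      using eventually_at_right_less[of 0] by eventually_elim (simp only: eq)
    ultimately show ?thesis by (rule Lim_transform_eventually)
  qed
qed

end

section \<open>Jacobi polynomials\<close>

definition jacobi_polynomial :: "real \<Rightarrow> real \<Rightarrow> nat \<Rightarrow> real poly" where
  "jacobi_polynomial \<alpha> \<beta> n = (\<Sum>k\<le>n. smult (((real n + \<alpha>) gchoose (n - k)) * ((real n + \<beta>) gchoose k))
     ([:- 1/2, 1/2:] ^ k * [:1/2, 1/2:] ^ (n - k)))"

lemma poly_jacobi_polynomial: "poly (jacobi_polynomial \<alpha> \<beta> n) x = jacobi_poly \<alpha> \<beta> n x"
  by (simp add: jacobi_polynomial_def jacobi_poly_def poly_sum diff_divide_distrib add_divide_distrib add.commute mult_ac)

lemma gbinomial_Suc_times: "real (Suc k) * (a gchoose Suc k) = (a - real k) * (a gchoose k)" for a :: real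
  using gbinomial_mult_1[of a k] by (simp add: algebra_simps)

text \<open>\<open>A\<close> and \<open>B\<close> stand for X^k and Z^m. Describing their
  derivatives by relations such as X A' = k A, which also hold at exponent 0, avoids truncated
  subtraction in exponents. The operator sends a monomial to itself and its two neighbours of equal
  total degree.\<close>

lemma jacobi_term_ode:
  fixes X Z A B a1 a2 b1 b2 k m \<alpha> \<beta> :: real
  assumes "X * a1 = k * A" "X * a2 = (k - 1) * a1" "Z * b1 = m * B" "Z * b2 = (m - 1) * b1"
  shows "X * Z * (a2 * B + 2 * a1 * b1 + A * b2) + ((\<alpha> + 1) * Z + (\<beta> + 1) * X) * (a1 * B + A * b1)
    = (k + \<alpha>) * (a1 * Z * B) + (2 * k * m + (\<alpha> + 1) * m + (\<beta> + 1) * k) * (A * B) + (m + \<beta>) * (A * b1 * X)"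
  using assms by algebra

lemma jacobi_polynomial_ode:
  fixes \<alpha> \<beta> x :: real and n :: nat
  defines "J \<equiv> jacobi_polynomial \<alpha> \<beta> n"
  shows "(1 - x\<^sup>2) * poly (pderiv (pderiv J)) x + (\<beta> - \<alpha> - (\<alpha> + \<beta> + 2) * x) * poly (pderiv J) x
    + real n * (real n + \<alpha> + \<beta> + 1) * poly J x = 0"
proof -
  define X where "X = (x - 1) / 2"
  define Z where "Z = (x + 1) / 2"
  define b where "b k = ((real n + \<alpha>) gchoose (n - k)) * ((real n + \<beta>) gchoose k)" for k
  define LX where "LX = [:- 1/2, 1/2 :: real:]"
  define LZ where "LZ = [:1/2, 1/2 :: real:]"
  define T where "T k = LX ^ k * LZ ^ (n - k)" for k
  define A1 where "A1 k = real k * X ^ (k - 1)" for k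
  define A2 where "A2 k = real k * (real (k - 1) * X ^ (k - 1 - 1))" for k
  define B1 where "B1 k = real k * Z ^ (k - 1)" for k
  define B2 where "B2 k = real k * (real (k - 1) * Z ^ (k - 1 - 1))" for k
  have pX: "poly LX x = X" "poly LZ x = Z" by (simp_all add: LX_def LZ_def X_def Z_def field_simps)
  have J: "J = (\<Sum>k\<le>n. smult (b k) (T k))" unfolding J_def jacobi_polynomial_def b_def T_def LX_def LZ_def ..
  have pderiv_J: "pderiv (\<Sum>k\<in>K. smult (b k) (U k)) = (\<Sum>k\<in>K. smult (b k) (pderiv (U k)))" for K and U :: "nat \<Rightarrow> real poly"
    by (induction K rule: infinite_finite_induct) (auto simp: pderiv_add pderiv_smult)
  have T0: "poly (T k) x = X ^ k * Z ^ (n - k)" for k by (simp only: T_def poly_mult poly_power pX)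
  have dX: "pderiv LX = [:1/2:]" "pderiv LZ = [:1/2:]" by (simp_all add: LX_def LZ_def pderiv_pCons)
  have T1: "poly (pderiv (T k)) x = (A1 k * Z ^ (n - k) + X ^ k * B1 (n - k)) / 2" for k
    by (simp add: T_def pderiv_mult pderiv_power dX pX A1_def B1_def add_divide_distrib mult_ac)
  have T2: "poly (pderiv (pderiv (T k))) x = (A2 k * Z ^ (n - k) + 2 * A1 k * B1 (n - k) + X ^ k * B2 (n - k)) / 4" for k
    by (simp add: T_def pderiv_mult pderiv_power pderiv_add pderiv_smult dX pX A1_def B1_def A2_def B2_def)
      (simp add: add_divide_distrib algebra_simps)
  have X1: "X * A1 k = real k * X ^ k" "X * A2 k = (real k - 1) * A1 k"
    and Z1: "Z * B1 k = real k * Z ^ k" "Z * B2 k = (real k - 1) * B1 k" for k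
    by (cases k; cases "k - 1"; simp add: A1_def A2_def B1_def B2_def)+
  have P: "1 - x\<^sup>2 = - 4 * (X * Z)" "\<beta> - \<alpha> - (\<alpha> + \<beta> + 2) * x = - 2 * ((\<alpha> + 1) * Z + (\<beta> + 1) * X)"
    by (simp_all add: X_def Z_def field_simps power2_eq_square)
  have term_eq: "(1 - x\<^sup>2) * poly (pderiv (pderiv (T k))) x + (\<beta> - \<alpha> - (\<alpha> + \<beta> + 2) * x) * poly (pderiv (T k)) x
    = - ((real k + \<alpha>) * (A1 k * Z * Z ^ (n - k))
       + (2 * real k * real (n - k) + (\<alpha> + 1) * real (n - k) + (\<beta> + 1) * real k) * (X ^ k * Z ^ (n - k))
       + (real (n - k) + \<beta>) * (X ^ k * B1 (n - k) * X))" for k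
  proof -
    have "- 4 * u * (s / 4) + - 2 * p * (q / 2) = - (u * s + p * q)" for u s p q :: real by simp
    then show ?thesis unfolding P T1 T2 jacobi_term_ode[OF X1[of k] Z1[of "n - k"], symmetric] .
  qed
  \<comment> \<open>The ratio of consecutive coefficients in the defining sum; it allows the
    neighbouring monomials in \<open>S1\<close> and \<open>S3\<close> to be shifted back to index
    \<open>k\<close>.\<close>
  have rec: "b (Suc k) * (real (Suc k) * (real (Suc k) + \<alpha>)) = real (n - k) * (real (n - k) + \<beta>) * b k" if "k < n" for k
  proof -
    define m where "m = n - Suc k"
    have m: "n - k = Suc m" "n - Suc k = m" "real n = real m + real k + 1" using that by (auto simp: m_def)
    have 1: "real (Suc k) * ((real n + \<beta>) gchoose Suc k) = (real (n - k) + \<beta>) * ((real n + \<beta>) gchoose k)"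
      unfolding gbinomial_Suc_times using m(1,3) by simp
    have 2: "real (n - k) * ((real n + \<alpha>) gchoose (n - k)) = (real (Suc k) + \<alpha>) * ((real n + \<alpha>) gchoose m)"
      unfolding m(1) gbinomial_Suc_times using m(3) by simp
    have "b (Suc k) * (real (Suc k) * (real (Suc k) + \<alpha>))
      = (real (Suc k) * ((real n + \<beta>) gchoose Suc k)) * ((real (Suc k) + \<alpha>) * ((real n + \<alpha>) gchoose m))"
      by (simp add: b_def m(2))
    also have "\<dots> = real (n - k) * (real (n - k) + \<beta>) * b k" unfolding 1 2[symmetric] by (simp add: b_def)
    finally show ?thesis .
  qed
  have S1: "(\<Sum>k\<le>n. b k * ((real k + \<alpha>) * (A1 k * Z * Z ^ (n - k))))
    = (\<Sum>k\<le>n. real (n - k) * (real (n - k) + \<beta>) * b k * (X ^ k * Z ^ (n - k)))"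
  proof (cases n)
    case (Suc N)
    have "(\<Sum>k\<le>Suc N. b k * ((real k + \<alpha>) * (A1 k * Z * Z ^ (n - k))))
      = (\<Sum>k\<le>N. b (Suc k) * ((real (Suc k) + \<alpha>) * (A1 (Suc k) * Z * Z ^ (n - Suc k))))"
      by (subst sum.atMost_Suc_shift) (simp add: A1_def)
    also have "\<dots> = (\<Sum>k\<le>N. real (n - k) * (real (n - k) + \<beta>) * b k * (X ^ k * Z ^ (n - k)))"
    proof (rule sum.cong[OF refl])
      fix k assume "k \<in> {..N}"
      then have k: "k < n" "n - k = Suc (n - Suc k)" using Suc by auto
      have "b (Suc k) * ((real (Suc k) + \<alpha>) * (A1 (Suc k) * Z * Z ^ (n - Suc k)))
        = (b (Suc k) * (real (Suc k) * (real (Suc k) + \<alpha>))) * (X ^ k * Z ^ Suc (n - Suc k))"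
        by (simp add: A1_def)
      then show "b (Suc k) * ((real (Suc k) + \<alpha>) * (A1 (Suc k) * Z * Z ^ (n - Suc k)))
        = real (n - k) * (real (n - k) + \<beta>) * b k * (X ^ k * Z ^ (n - k))" unfolding rec[OF k(1)] k(2)[symmetric] .
    qed
    finally show ?thesis using Suc by simp
  qed (simp add: A1_def)
  have S3: "(\<Sum>k\<le>n. b k * ((real (n - k) + \<beta>) * (X ^ k * B1 (n - k) * X)))
    = (\<Sum>k\<le>n. real k * (real k + \<alpha>) * b k * (X ^ k * Z ^ (n - k)))"
  proof (cases n)
    case (Suc N)
    have "(\<Sum>k\<le>Suc N. real k * (real k + \<alpha>) * b k * (X ^ k * Z ^ (n - k)))
      = (\<Sum>k\<le>N. real (Suc k) * (real (Suc k) + \<alpha>) * b (Suc k) * (X ^ Suc k * Z ^ (n - Suc k)))"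
      by (subst sum.atMost_Suc_shift) simp
    also have "\<dots> = (\<Sum>k\<le>N. b k * ((real (n - k) + \<beta>) * (X ^ k * B1 (n - k) * X)))"
    proof (rule sum.cong[OF refl])
      fix k assume "k \<in> {..N}"
      then have k: "k < n" "n - k - 1 = n - Suc k" using Suc by auto
      have "real (Suc k) * (real (Suc k) + \<alpha>) * b (Suc k) * (X ^ Suc k * Z ^ (n - Suc k))
        = (b (Suc k) * (real (Suc k) * (real (Suc k) + \<alpha>))) * (X ^ Suc k * Z ^ (n - Suc k))" by simp
      then show "real (Suc k) * (real (Suc k) + \<alpha>) * b (Suc k) * (X ^ Suc k * Z ^ (n - Suc k))
        = b k * ((real (n - k) + \<beta>) * (X ^ k * B1 (n - k) * X))"
        unfolding rec[OF k(1)] unfolding B1_def k(2) by (simp add: mult_ac)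
    qed
    finally show ?thesis using Suc by (simp add: B1_def)
  qed (simp add: B1_def)
  have "(1 - x\<^sup>2) * poly (pderiv (pderiv J)) x + (\<beta> - \<alpha> - (\<alpha> + \<beta> + 2) * x) * poly (pderiv J) x
    = (\<Sum>k\<le>n. b k * ((1 - x\<^sup>2) * poly (pderiv (pderiv (T k))) x + (\<beta> - \<alpha> - (\<alpha> + \<beta> + 2) * x) * poly (pderiv (T k)) x))"
    unfolding J pderiv_J poly_sum poly_smult sum_distrib_left sum.distrib[symmetric]
    by (intro sum.cong refl) (simp add: algebra_simps)
  also have "\<dots> = - ((\<Sum>k\<le>n. b k * ((real k + \<alpha>) * (A1 k * Z * Z ^ (n - k))))
    + (\<Sum>k\<le>n. b k * ((2 * real k * real (n - k) + (\<alpha> + 1) * real (n - k) + (\<beta> + 1) * real k) * (X ^ k * Z ^ (n - k))))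
    + (\<Sum>k\<le>n. b k * ((real (n - k) + \<beta>) * (X ^ k * B1 (n - k) * X))))"
    unfolding term_eq by (simp only: distrib_left mult_minus_right sum.distrib sum_negf)
  \<comment> \<open>With m = n - k the three coefficients add up to (k + m) (k + m + \<alpha> +
    \<beta> + 1), which depends on n only.\<close>
  also have "\<dots> = - (\<Sum>k\<le>n. real n * (real n + \<alpha> + \<beta> + 1) * (b k * (X ^ k * Z ^ (n - k))))"
    unfolding S1 S3 sum.distrib[symmetric]
  proof (intro arg_cong[where f=uminus] sum.cong refl)
    fix k assume "k \<in> {..n}"
    then have "real (n - k) = real n - real k" by (simp add: of_nat_diff)
    then show "real (n - k) * (real (n - k) + \<beta>) * b k * (X ^ k * Z ^ (n - k)) +
         b k * ((2 * real k * real (n - k) + (\<alpha> + 1) * real (n - k) + (\<beta> + 1) * real k) * (X ^ k * Z ^ (n - k))) +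
         real k * (real k + \<alpha>) * b k * (X ^ k * Z ^ (n - k)) =
         real n * (real n + \<alpha> + \<beta> + 1) * (b k * (X ^ k * Z ^ (n - k)))"
      by (simp add: algebra_simps)
  qed
  also have "\<dots> = - (real n * (real n + \<alpha> + \<beta> + 1) * poly J x)"
    by (simp add: J poly_sum T0 sum_distrib_left)
  finally show ?thesis by simp
qed

text \<open>All products have leading coefficient 2^(-n), so Vandermonde's identity gives 2^(-n)
  times the binomial coefficient of 2 n + \<alpha> + \<beta> over n, whose factors are positive for
  \<alpha>, \<beta> > -1.\<close>

lemma jacobi_polynomial_degree:
  assumes "-1 < \<alpha>" "-1 < \<beta>"
  shows "degree (jacobi_polynomial \<alpha> \<beta> n) = n" and "jacobi_polynomial \<alpha> \<beta> n \<noteq> 0"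
proof -
  define T where "T k = [:- 1/2, 1/2:] ^ k * [:1/2, 1/2 :: real:] ^ (n - k)" for k
  have dT: "degree (T k) = n" "coeff (T k) n = (1/2) ^ n" if "k \<le> n" for k
  proof -
    show d: "degree (T k) = n" using that by (simp add: T_def degree_mult_eq degree_power_eq)
    have "lead_coeff (T k) = (1/2) ^ k * (1/2) ^ (n - k)" by (simp add: T_def lead_coeff_mult lead_coeff_power)
    also have "\<dots> = (1/2) ^ n" using that by (simp flip: power_add)
    finally show "coeff (T k) n = (1/2) ^ n" using d by simp
  qed
  have "coeff (jacobi_polynomial \<alpha> \<beta> n) n = (\<Sum>k\<le>n. ((real n + \<alpha>) gchoose (n - k)) * ((real n + \<beta>) gchoose k) * (1/2) ^ n)"
    unfolding jacobi_polynomial_def T_def[symmetric] coeff_sum coeff_smult by (intro sum.cong refl) (simp add: dT)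
  also have "\<dots> = (\<Sum>k\<le>n. ((real n + \<beta>) gchoose k) * ((real n + \<alpha>) gchoose (n - k))) * (1/2) ^ n"
    by (simp add: sum_distrib_right sum_distrib_left mult_ac)
  also have "\<dots> = (((real n + \<beta>) + (real n + \<alpha>)) gchoose n) * (1/2) ^ n"
    using gbinomial_Vandermonde[where a="real n + \<beta>" and b="real n + \<alpha>" and n=n] by (simp add: atLeast0AtMost)
  also have "\<dots> \<noteq> 0"
  proof -
    have "real n + \<beta> + (real n + \<alpha>) - real i \<noteq> 0" if "i < n" for i
    proof -
      have "real i \<le> real n - 1" "1 \<le> real n" using that by auto
      then show ?thesis using assms by linarith
    qed
    then show ?thesis by (simp add: gbinomial_prod_rev)
  qed
  finally have c: "coeff (jacobi_polynomial \<alpha> \<beta> n) n \<noteq> 0" .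
  then show "jacobi_polynomial \<alpha> \<beta> n \<noteq> 0" by auto
  have "degree (jacobi_polynomial \<alpha> \<beta> n) \<le> n"
    unfolding jacobi_polynomial_def T_def[symmetric]
    by (rule degree_sum_le) (auto intro: order_trans[OF degree_smult_le] simp: dT)
  with le_degree[OF c] show "degree (jacobi_polynomial \<alpha> \<beta> n) = n" by simp
qed

lemma polynomial_span:
  fixes J :: "nat \<Rightarrow> 'a::field poly"
  assumes J: "\<And>n. degree (J n) = n" "\<And>n. J n \<noteq> 0"
  shows "(\<And>i. m \<le> i \<Longrightarrow> coeff Q i = 0) \<Longrightarrow> \<exists>d. Q = (\<Sum>n<m. smult (d n) (J n))"
proof (induction m arbitrary: Q)
  case 0
  then have "Q = 0" by (intro poly_eqI) auto
  then show ?case by simp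
next
  case (Suc m)
  define a where "a = coeff Q m / coeff (J m) m"
  have Jm: "coeff (J m) m \<noteq> 0" using J(1)[of m] J(2)[of m] by (metis leading_coeff_0_iff)
  have "coeff (Q - smult a (J m)) i = 0" if "m \<le> i" for i
  proof (cases "i = m")
    case True
    then show ?thesis using Jm by (simp add: a_def)
  next
    case False
    then show ?thesis using that Suc.prems[of i] J(1)[of m] by (simp add: coeff_eq_0)
  qed
  then obtain d where d: "Q - smult a (J m) = (\<Sum>n<m. smult (d n) (J n))" using Suc.IH by blast
  have "Q = (\<Sum>n<Suc m. smult ((d(m := a)) n) (J n))"
    using d by (simp add: algebra_simps)
  then show ?case by blast
qed

section \<open>The Jacobi eigensystem\<close>

definition trig :: "real \<Rightarrow> real \<Rightarrow> real \<Rightarrow> real" where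
  "trig a b x = sin (x / 2) powr a * cos (x / 2) powr b"

lemma half_angle_pos: "0 < x \<Longrightarrow> x < pi \<Longrightarrow> 0 < sin (x / 2)" "0 < x \<Longrightarrow> x < pi \<Longrightarrow> 0 < cos (x / 2)"
  by (auto intro!: sin_gt_zero cos_gt_zero)

lemma trig_pos: "0 < x \<Longrightarrow> x < pi \<Longrightarrow> 0 < trig a b x"
  using half_angle_pos[of x] by (simp add: trig_def)

lemma trig_nonneg: "0 \<le> trig a b x"
  by (simp add: trig_def)

lemma trig_mult: "trig a b x * trig c d x = trig (a + c) (b + d) x"
  by (simp add: trig_def powr_add)

lemma trig_0: "0 < x \<Longrightarrow> x < pi \<Longrightarrow> trig 0 0 x = 1"
  using half_angle_pos[of x] by (simp add: trig_def)

lemma trig_shift: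
  assumes "0 < x" "x < pi"
  shows "trig (a + 1) b x = sin (x / 2) * trig a b x" "trig a (b + 1) x = cos (x / 2) * trig a b x"
  using half_angle_pos[OF assms] by (simp_all add: trig_def powr_add)

lemma trig_deriv:
  assumes "0 < x" "x < pi"
  shows "(trig a b has_real_derivative a / 2 * trig (a - 1) (b + 1) x - b / 2 * trig (a + 1) (b - 1) x) (at x)"
proof -
  have p: "0 < sin (x / 2)" "0 < cos (x / 2)" using half_angle_pos[OF assms] by auto
  have "((\<lambda>x. sin (x / 2) powr a) has_real_derivative a * sin (x / 2) powr (a - 1) * (cos (x / 2) / 2)) (at x)"
    using p by (auto intro!: derivative_eq_intros simp: powr_diff)
  moreover have "((\<lambda>x. cos (x / 2) powr b) has_real_derivative b * cos (x / 2) powr (b - 1) * (- sin (x / 2) / 2)) (at x)"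
    using p by (auto intro!: derivative_eq_intros simp: powr_diff)
  ultimately have "((\<lambda>x. sin (x / 2) powr a * cos (x / 2) powr b) has_real_derivative
      (a * sin (x / 2) powr (a - 1) * (cos (x / 2) / 2)) * cos (x / 2) powr b
      + (b * cos (x / 2) powr (b - 1) * (- sin (x / 2) / 2)) * sin (x / 2) powr a) (at x)"
    by (rule DERIV_mult)
  then show ?thesis
    using p by (simp add: trig_def[abs_def] powr_add mult_ac)
qed

lemma trig_continuous_on:
  assumes "0 < a" "0 < b"
  shows "continuous_on {0..pi} (trig a b)"
proof -
  have "0 \<le> sin (x / 2)" "0 \<le> cos (x / 2)" if "x \<in> {0..pi}" for x
    using that by (auto intro!: sin_ge_zero cos_ge_zero)
  then show ?thesis unfolding trig_def[abs_def]
    using assms by (intro continuous_intros continuous_on_powr') auto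
qed

lemma double_angle:
  "sin x = 2 * sin (x / 2) * cos (x / 2)" "cos x = (cos (x / 2))\<^sup>2 - (sin (x / 2))\<^sup>2" for x :: real
  using sin_double[of "x / 2"] cos_double[of "x / 2"] by simp_all

text \<open>Exchanges a possibly negative power of a sine or cosine that is at least 1/2 for its
  first power, after which the weight has an elementary primitive.\<close>

lemma half_powr_le:
  fixes c :: real
  assumes c: "1 / 2 \<le> c" "c \<le> 1" and a: "- 1 \<le> a"
  shows "c powr a \<le> 4 * c"
proof -
  have "c powr a \<le> c powr (- 1)" using c a by (intro powr_mono') auto
  also have "\<dots> = inverse c" using c by (simp add: powr_minus)
  also have "\<dots> \<le> 4 * c"
  proof -
    have "1 / 4 \<le> c * c" using mult_mono[of "1/2" c "1/2" c] c by simp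
    then show ?thesis using c by (simp add: field_simps)
  qed
  finally show ?thesis .
qed

locale jacobi =
  fixes \<alpha> \<beta> :: real
  assumes \<alpha>: "- 1 < \<alpha>" and \<beta>: "- 1 < \<beta>"
begin

abbreviation "w \<equiv> trig (2 * \<alpha> + 1) (2 * \<beta> + 1)"

text \<open>At every point the sine or the cosine of the half angle is at least 1/2, and its power
  may be replaced by the first power. The resulting majorant \<open>h\<close> is an exact
  derivative.\<close>

lemma weight_integrable: "set_integrable lborel {0<..<pi} w"
proof -
  define h where "h x = trig (2 * \<alpha> + 1) 1 x + trig 1 (2 * \<beta> + 1) x" for x
  define H where "H x = trig (2 * \<alpha> + 2) 0 x / (\<alpha> + 1) - trig 0 (2 * \<beta> + 2) x / (\<beta> + 1)" for x
  \<comment> \<open>Equal to \<open>H\<close> on the open interval, but with the exponents 0 left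
    out: as \<open>0 powr 0 = 0\<close>, \<open>H\<close> would jump at the endpoints.\<close>
  define H' where "H' x = sin (x / 2) powr (2 * \<alpha> + 2) / (\<alpha> + 1) - cos (x / 2) powr (2 * \<beta> + 2) / (\<beta> + 1)" for x
  have "(h has_integral H' pi - H' 0) {0..pi}"
  proof (rule fundamental_theorem_of_calculus_interior)
    have "0 \<le> sin (x / 2)" "0 \<le> cos (x / 2)" if "x \<in> {0..pi}" for x
      using that by (auto intro!: sin_ge_zero cos_ge_zero)
    then have "continuous_on {0..pi} (\<lambda>x. sin (x / 2) powr (2 * \<alpha> + 2))" "continuous_on {0..pi} (\<lambda>x. cos (x / 2) powr (2 * \<beta> + 2))"
      using \<alpha> \<beta> by (intro continuous_on_powr'; auto intro!: continuous_intros)+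
    then show "continuous_on {0..pi} H'" unfolding H'_def[abs_def]
      using \<alpha> \<beta> by (intro continuous_on_diff continuous_on_divide continuous_on_const) auto
    fix x assume x: "x \<in> {0<..<pi}"
    have "(H has_real_derivative h x) (at x)"
    proof -
      have ne: "\<alpha> + 1 \<noteq> 0" "\<beta> + 1 \<noteq> 0" using \<alpha> \<beta> by auto
      have "(2 * \<alpha> + 2) / 2 = \<alpha> + 1" "(2 * \<beta> + 2) / 2 = \<beta> + 1" by simp_all
      then show ?thesis
        unfolding H_def[abs_def] h_def
        using DERIV_diff[OF DERIV_cdivide[OF trig_deriv[of x "2 * \<alpha> + 2" 0], of "\<alpha> + 1"]
          DERIV_cdivide[OF trig_deriv[of x 0 "2 * \<beta> + 2"], of "\<beta> + 1"]] x ne by (simp add: add.commute)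
    qed
    then have "(H' has_real_derivative h x) (at x)"
    proof (rule has_field_derivative_transform_within_open[where S="{0<..<pi}"])
      fix y assume "y \<in> {0<..<pi}"
      then show "H y = H' y" using half_angle_pos[of y] by (simp add: H_def H'_def trig_def)
    qed (use x in auto)
    then show "(H' has_vector_derivative h x) (at x)" by (simp add: has_real_derivative_iff_has_vector_derivative)
  qed simp
  then have "h integrable_on {0<..<pi}"
    using integrable_on_open_interval[of h 0 pi] by (auto simp: integrable_on_def)
  then have i: "(\<lambda>x. 4 * h x) integrable_on {0<..<pi}" using integrable_cmul[of h "{0<..<pi}" 4] by simp
  show ?thesis
  proof (rule set_integrable_lborel_dominated[OF _ _ i])
    show "set_borel_measurable borel {0<..<pi} w"
      unfolding set_borel_measurable_def trig_def by measurable
    fix x :: real assume "x \<in> {0<..<pi}"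
    then have p: "0 < sin (x / 2)" "0 < cos (x / 2)" using half_angle_pos[of x] by auto
    have "norm (w x) \<le> 4 * (sin (x / 2) powr (2 * \<alpha> + 1) * cos (x / 2) + sin (x / 2) * cos (x / 2) powr (2 * \<beta> + 1))"
    proof (cases "1 / 2 \<le> cos (x / 2)")
      case True
      have "cos (x / 2) powr (2 * \<beta> + 1) \<le> 4 * cos (x / 2)" using True \<beta> by (intro half_powr_le) auto
      then have "sin (x / 2) powr (2 * \<alpha> + 1) * cos (x / 2) powr (2 * \<beta> + 1) \<le> sin (x / 2) powr (2 * \<alpha> + 1) * (4 * cos (x / 2))"
        by (intro mult_left_mono) auto
      moreover have "0 \<le> sin (x / 2) * cos (x / 2) powr (2 * \<beta> + 1)" using p by simp
      ultimately show ?thesis by (simp add: trig_def abs_mult)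
    next
      case False
      have "1 / 2 \<le> sin (x / 2)"
      proof (rule ccontr)
        assume "\<not> 1 / 2 \<le> sin (x / 2)"
        then have "(sin (x / 2))\<^sup>2 < (1/2)\<^sup>2" "(cos (x / 2))\<^sup>2 < (1/2)\<^sup>2"
          using False p by (intro power_strict_mono; simp)+
        then show False using sin_cos_squared_add[of "x / 2"] by (simp add: power_divide)
      qed
      then have "sin (x / 2) powr (2 * \<alpha> + 1) \<le> 4 * sin (x / 2)" using \<alpha> by (intro half_powr_le) auto
      then have "sin (x / 2) powr (2 * \<alpha> + 1) * cos (x / 2) powr (2 * \<beta> + 1) \<le> (4 * sin (x / 2)) * cos (x / 2) powr (2 * \<beta> + 1)"
        by (intro mult_right_mono) auto
      moreover have "0 \<le> sin (x / 2) powr (2 * \<alpha> + 1) * cos (x / 2)" using p by simp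
      ultimately show ?thesis by (simp add: trig_def abs_mult)
    qed
    then show "norm (w x) \<le> 4 * h x" using p by (simp add: h_def trig_def)
  qed simp
qed

lemma jacobi_measure_integral:
  fixes f :: "real \<Rightarrow> 'a::{banach, second_countable_topology}"
  assumes f: "set_integrable lborel {0<..<pi} (\<lambda>x. w x *\<^sub>R f x)"
  shows "integrable (jacobi_measure \<alpha> \<beta>) f"
    and "(LINT x|jacobi_measure \<alpha> \<beta>. f x) = (LBINT x:{0<..<pi}. w x *\<^sub>R f x)"
proof -
  define M where "M = restrict_space lborel {0<..<pi}"
  have J: "jacobi_measure \<alpha> \<beta> = density M (\<lambda>x. ennreal (w x))"
    by (simp add: jacobi_measure_def M_def trig_def)
  have wb: "w \<in> borel_measurable lborel" unfolding trig_def by measurable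
  then have wm: "w \<in> borel_measurable M" unfolding M_def by (rule measurable_restrict_space1)
  have "(\<lambda>x. indicat_real {0<..<pi} x *\<^sub>R (w x *\<^sub>R f x)) \<in> borel_measurable lborel"
    using f borel_measurable_integrable by (auto simp: set_integrable_def)
  \<comment> \<open>The weight is positive on (0, pi), so measurability of \<open>f\<close> is
    recovered from that of the weighted function by division.\<close>
  then have "(\<lambda>x. inverse (w x) *\<^sub>R (indicat_real {0<..<pi} x *\<^sub>R (w x *\<^sub>R f x))) \<in> borel_measurable lborel"
    by (rule borel_measurable_scaleR[OF borel_measurable_inverse[OF wb]])
  then have "(\<lambda>x. inverse (w x) *\<^sub>R (indicat_real {0<..<pi} x *\<^sub>R (w x *\<^sub>R f x))) \<in> borel_measurable M"
    unfolding M_def by (rule measurable_restrict_space1)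
  then have fm: "f \<in> borel_measurable M"
  proof (rule measurable_cong[THEN iffD1, rotated])
    fix x assume "x \<in> space M"
    then have "0 < x" "x < pi" by (auto simp: M_def space_restrict_space)
    then show "inverse (w x) *\<^sub>R (indicat_real {0<..<pi} x *\<^sub>R (w x *\<^sub>R f x)) = f x"
      using trig_pos[of x "2 * \<alpha> + 1" "2 * \<beta> + 1"] by simp
  qed
  have nn: "AE x in M. 0 \<le> w x" by (simp add: trig_nonneg)
  show "integrable (jacobi_measure \<alpha> \<beta>) f"
    unfolding J integrable_density[OF fm wm nn] unfolding M_def
    using f by (subst integrable_restrict_space) (auto simp: set_integrable_def)
  show "(LINT x|jacobi_measure \<alpha> \<beta>. f x) = (LBINT x:{0<..<pi}. w x *\<^sub>R f x)"
    unfolding J integral_density[OF fm wm nn] unfolding M_def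
    by (subst integral_restrict_space) (auto simp: set_lebesgue_integral_def)
qed

lemma weighted_integrable:
  fixes f :: "real \<Rightarrow> real"
  assumes f: "continuous_on {0..pi} f"
  shows "set_integrable lborel {0<..<pi} (\<lambda>x. w x * f x)"
proof -
  have "bounded (f ` {0..pi})" using f by (intro compact_imp_bounded compact_continuous_image) auto
  then obtain C where C: "\<forall>x\<in>{0..pi}. norm (f x) \<le> C" by (auto simp: bounded_iff)
  have "set_borel_measurable borel {0<..<pi} f"
    by (rule set_borel_measurable_continuous_borel[OF _ continuous_on_subset[OF f]]) auto
  moreover have "w \<in> borel_measurable borel" unfolding trig_def by measurable
  ultimately have m: "(\<lambda>x. indicat_real {0<..<pi} x *\<^sub>R (w x * f x)) \<in> borel_measurable borel"
    using borel_measurable_times[of w borel "\<lambda>x. indicat_real {0<..<pi} x *\<^sub>R f x"]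
    by (simp add: set_borel_measurable_def mult_ac)
  have i: "integrable lborel (\<lambda>x. C * (indicat_real {0<..<pi} x *\<^sub>R w x))"
    using weight_integrable by (simp add: set_integrable_def)
  show ?thesis unfolding set_integrable_def
  proof (rule Bochner_Integration.integrable_bound[OF i])
    show "AE x in lborel. norm (indicat_real {0<..<pi} x *\<^sub>R (w x * f x)) \<le> norm (C * (indicat_real {0<..<pi} x *\<^sub>R w x))"
    proof (rule AE_I2)
      fix x
      show "norm (indicat_real {0<..<pi} x *\<^sub>R (w x * f x)) \<le> norm (C * (indicat_real {0<..<pi} x *\<^sub>R w x))"
        using C[rule_format, of x] trig_nonneg[of "2 * \<alpha> + 1" "2 * \<beta> + 1" x]
        by (cases "x \<in> {0<..<pi}") (auto simp: abs_mult mult.commute intro!: mult_right_mono)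
    qed
  qed (use m in simp)
qed

definition I :: "(real \<Rightarrow> real) \<Rightarrow> real" where
  "I f = (LBINT x:{0<..<pi}. w x * f x)"

lemma I_eq: "continuous_on {0..pi} f \<Longrightarrow> I f = (LINT x|jacobi_measure \<alpha> \<beta>. f x)"
  using jacobi_measure_integral(2)[of f] weighted_integrable[of f] by (simp add: I_def)

lemma I_add: "continuous_on {0..pi} f \<Longrightarrow> continuous_on {0..pi} g \<Longrightarrow> I (\<lambda>x. f x + g x) = I f + I g"
  using set_integral_add(2)[OF weighted_integrable weighted_integrable, of f g] by (simp add: I_def distrib_left)

lemma I_cmult: "I (\<lambda>x. c * f x) = c * I f"
  unfolding I_def set_integral_mult_right[symmetric] by (simp only: mult.left_commute)

lemma I_sum:
  assumes "\<And>i. i \<in> A \<Longrightarrow> continuous_on {0..pi} (f i)"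
  shows "I (\<lambda>x. \<Sum>i\<in>A. f i x) = (\<Sum>i\<in>A. I (f i))"
  using assms
proof (induction A rule: infinite_finite_induct)
  case (insert i A)
  have "I (\<lambda>x. f i x + (\<Sum>i\<in>A. f i x)) = I (f i) + I (\<lambda>x. \<Sum>i\<in>A. f i x)"
    by (intro I_add continuous_intros insert.prems) (use insert.prems in auto)
  with insert show ?case by simp
qed (simp_all add: I_def)

lemma I_mono:
  assumes "continuous_on {0..pi} f" "continuous_on {0..pi} g" "\<And>x. x \<in> {0<..<pi} \<Longrightarrow> f x \<le> g x"
  shows "I f \<le> I g"
  unfolding I_def by (intro set_integral_mono weighted_integrable assms mult_left_mono trig_nonneg)

lemma I_nonneg: "(\<And>x. 0 \<le> f x) \<Longrightarrow> 0 \<le> I f"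
  unfolding I_def set_lebesgue_integral_def by (intro Bochner_Integration.integral_nonneg) (simp add: trig_nonneg)

lemma weight_continuous_on: "0 < a \<Longrightarrow> b < pi \<Longrightarrow> continuous_on {a..b} (trig c d)"
  by (intro continuous_at_imp_continuous_on ballI DERIV_isCont[OF trig_deriv]) auto

lemma subinterval_integrable:
  assumes "0 < a" "b < pi" and f: "continuous_on {0..pi} f"
  shows "set_integrable lborel {a..b} (\<lambda>x. w x * f x)"
    and "(LBINT x:{a..b}. w x * f x) = integral {a..b} (\<lambda>x. w x * f x)"
proof -
  have "continuous_on {a..b} f" by (rule continuous_on_subset[OF f]) (use assms in auto)
  then show i: "set_integrable lborel {a..b} (\<lambda>x. w x * f x)"
    by (intro borel_integrable_atLeastAtMost' continuous_intros weight_continuous_on assms)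
  show "(LBINT x:{a..b}. w x * f x) = integral {a..b} (\<lambda>x. w x * f x)"
    by (rule set_borel_integral_eq_integral(2)[OF i])
qed

lemma integral_le_I:
  assumes ab: "0 < a" "b < pi" and f: "continuous_on {0..pi} f" "\<And>x. 0 \<le> f x"
  shows "integral {a..b} (\<lambda>x. w x * f x) \<le> I f"
  unfolding subinterval_integrable(2)[OF ab f(1), symmetric] I_def set_lebesgue_integral_def
proof (rule integral_mono)
  show "integrable lborel (\<lambda>x. indicat_real {a..b} x *\<^sub>R (w x * f x))"
    using subinterval_integrable(1)[OF ab f(1)] by (simp add: set_integrable_def)
  show "integrable lborel (\<lambda>x. indicat_real {0<..<pi} x *\<^sub>R (w x * f x))"
    using weighted_integrable[OF f(1)] by (simp add: set_integrable_def)
  show "indicat_real {a..b} x *\<^sub>R (w x * f x) \<le> indicat_real {0<..<pi} x *\<^sub>R (w x * f x)" for x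
    using ab f(2)[of x] trig_nonneg[of "2 * \<alpha> + 1" "2 * \<beta> + 1" x] by (auto simp: indicator_def)
qed

lemma integral_eq_I:
  assumes ab: "0 < a" "b < pi" and f: "continuous_on {0..pi} f" "\<And>x. x \<notin> {a..b} \<Longrightarrow> f x = 0"
  shows "integral {a..b} (\<lambda>x. w x * f x) = I f"
  unfolding subinterval_integrable(2)[OF ab f(1), symmetric] I_def set_lebesgue_integral_def
proof (rule Bochner_Integration.integral_cong[OF refl])
  fix x
  show "indicat_real {a..b} x *\<^sub>R (w x * f x) = indicat_real {0<..<pi} x *\<^sub>R (w x * f x)"
    using ab f(2)[of x] by (cases "x \<in> {a..b}") auto
qed

abbreviation "JP n \<equiv> jacobi_polynomial \<alpha> \<beta> n"

lemma half_angle_ode: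
  fixes x :: real
  shows "(sin x)\<^sup>2 * poly (pderiv (pderiv (JP n))) (cos x)
    = 2 * ((\<alpha> + 1) * (cos (x / 2))\<^sup>2 - (\<beta> + 1) * (sin (x / 2))\<^sup>2) * poly (pderiv (JP n)) (cos x)
      - real n * (real n + \<alpha> + \<beta> + 1) * poly (JP n) (cos x)"
proof -
  define E where "E = (\<alpha> + 1) * (cos (x / 2))\<^sup>2 - (\<beta> + 1) * (sin (x / 2))\<^sup>2"
  have B: "\<beta> - \<alpha> - (\<alpha> + \<beta> + 2) * cos x = - 2 * E"
  proof -
    have "\<beta> - \<alpha> = (\<beta> - \<alpha>) * ((sin (x / 2))\<^sup>2 + (cos (x / 2))\<^sup>2)" by simp
    then show ?thesis unfolding double_angle(2)[of x] E_def by algebra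
  qed
  show ?thesis
    using jacobi_polynomial_ode[where x="cos x" and \<alpha>=\<alpha> and \<beta>=\<beta> and n=n]
    unfolding B sin_squared_eq[of x] E_def[symmetric] by simp
qed

text \<open>Lagrange's identity: up to the difference of eigenvalues, the weighted product is the
  derivative of a multiple of sin^(2\<alpha>+2) cos^(2\<beta>+2) of the half angle times the
  Wronskian \<open>D\<close>. The boundary values vanish because both exponents are
  positive.\<close>

lemma orthogonal:
  assumes "n \<noteq> m"
  shows "I (\<lambda>x. poly (JP n) (cos x) * poly (JP m) (cos x)) = 0"
proof -
  define \<Lambda> where "\<Lambda> n = real n * (real n + \<alpha> + \<beta> + 1)" for n
  define P where "P n x = poly (JP n) (cos x)" for n x
  define P1 where "P1 n x = poly (pderiv (JP n)) (cos x)" for n x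
  define P2 where "P2 n x = poly (pderiv (pderiv (JP n))) (cos x)" for n x
  define D where "D x = P1 n x * P m x - P n x * P1 m x" for x
  define G where "G x = - 2 * (trig (2 * \<alpha> + 2) (2 * \<beta> + 2) x * D x)" for x
  have "((\<lambda>x. (\<Lambda> m - \<Lambda> n) * (w x * (P n x * P m x))) has_integral G pi - G 0) {0..pi}"
  proof (rule fundamental_theorem_of_calculus_interior)
    show "continuous_on {0..pi} G" unfolding G_def[abs_def] D_def P_def P1_def
      using \<alpha> \<beta> by (intro continuous_intros trig_continuous_on) auto
    fix x assume x: "x \<in> {0<..<pi}"
    define s where "s = sin (x / 2)"
    define c where "c = cos (x / 2)"
    have sc: "0 < s" "0 < c" using half_angle_pos[of x] x by (auto simp: s_def c_def)
    define A where "A = trig (2 * \<alpha> + 2) (2 * \<beta> + 2)"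
    have Ax: "A x = w x * (s * c)"
      using x trig_shift(1)[of x "2 * \<alpha> + 1" "2 * \<beta> + 2"] trig_shift(2)[of x "2 * \<alpha> + 1" "2 * \<beta> + 1"]
      by (simp add: A_def s_def c_def add.commute)
    have A1: "trig (2 * \<alpha> + 2 - 1) (2 * \<beta> + 2 + 1) x = w x * c\<^sup>2" "trig (2 * \<alpha> + 2 + 1) (2 * \<beta> + 2 - 1) x = w x * s\<^sup>2"
      using x trig_shift(2)[of x "2 * \<alpha> + 1" "2 * \<beta> + 1"] trig_shift(2)[of x "2 * \<alpha> + 1" "2 * \<beta> + 2"]
        trig_shift(1)[of x "2 * \<alpha> + 1" "2 * \<beta> + 1"] trig_shift(1)[of x "2 * \<alpha> + 2" "2 * \<beta> + 1"]
      by (simp_all add: s_def c_def power2_eq_square add.commute mult_ac)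
    have dA: "(A has_real_derivative w x * ((\<alpha> + 1) * c\<^sup>2 - (\<beta> + 1) * s\<^sup>2)) (at x)"
      using trig_deriv[of x "2 * \<alpha> + 2" "2 * \<beta> + 2"] x unfolding A1 A_def by (simp add: add_divide_distrib algebra_simps)
    have dD: "(D has_real_derivative - sin x * (P2 n x * P m x - P n x * P2 m x)) (at x)"
      unfolding D_def[abs_def] P_def P1_def P2_def
      by (auto intro!: derivative_eq_intros DERIV_chain2[OF poly_DERIV] simp: algebra_simps)
    have "(G has_real_derivative - 2 * ((w x * ((\<alpha> + 1) * c\<^sup>2 - (\<beta> + 1) * s\<^sup>2)) * D x
        + (- sin x * (P2 n x * P m x - P n x * P2 m x)) * A x)) (at x)"
      unfolding G_def[abs_def] A_def[symmetric] by (rule DERIV_cmult[OF DERIV_mult[OF dA dD]])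
    also have "- 2 * ((w x * ((\<alpha> + 1) * c\<^sup>2 - (\<beta> + 1) * s\<^sup>2)) * D x
        + (- sin x * (P2 n x * P m x - P n x * P2 m x)) * A x) = (\<Lambda> m - \<Lambda> n) * (w x * (P n x * P m x))"
    proof -
      have "sin x * A x = w x * (sin x)\<^sup>2 / 2"
        using double_angle(1)[of x] by (simp add: Ax s_def c_def power2_eq_square)
      moreover have "(sin x)\<^sup>2 * P2 k x = 2 * ((\<alpha> + 1) * c\<^sup>2 - (\<beta> + 1) * s\<^sup>2) * P1 k x - \<Lambda> k * P k x" for k
        using half_angle_ode[of x k] by (simp add: P_def P1_def P2_def \<Lambda>_def s_def c_def)
      from this[of n] this[of m] calculation show ?thesis unfolding D_def by algebra
    qed
    finally show "(G has_vector_derivative (\<Lambda> m - \<Lambda> n) * (w x * (P n x * P m x))) (at x)"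
      by (simp add: has_real_derivative_iff_has_vector_derivative)
  qed simp
  note hi = integral_unique[OF this]
  have "G pi - G 0 = 0" using \<alpha> \<beta> by (simp add: G_def trig_def)
  then have "integral {0..pi} (\<lambda>x. (\<Lambda> m - \<Lambda> n) * (w x * (P n x * P m x))) = 0" unfolding hi .
  \<comment> \<open>Distinct degrees have distinct eigenvalues: m + n >= 1 and \<alpha> + \<beta> >
    -2 make the second factor positive.\<close>
  moreover have "\<Lambda> m - \<Lambda> n \<noteq> 0"
  proof -
    have "\<Lambda> m - \<Lambda> n = (real m - real n) * (real m + real n + \<alpha> + \<beta> + 1)" by (simp add: \<Lambda>_def algebra_simps)
    moreover have "1 \<le> real m + real n" using assms by (cases m; cases n) auto
    then have "0 < real m + real n + \<alpha> + \<beta> + 1" using \<alpha> \<beta> by linarith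
    ultimately show ?thesis using assms by simp
  qed
  moreover have si: "set_integrable lborel {0<..<pi} (\<lambda>x. w x * (P n x * P m x))"
    unfolding P_def by (intro weighted_integrable continuous_intros)
  have "I (\<lambda>x. P n x * P m x) = integral {0..pi} (\<lambda>x. w x * (P n x * P m x))"
    unfolding I_def set_borel_integral_eq_integral(2)[OF si]
    using integral_open_interval[of 0 pi "\<lambda>x. w x * (P n x * P m x)"] by simp
  ultimately show ?thesis by (simp add: P_def)
qed

text \<open>Otherwise the polynomial would vanish on the infinite set cos {1..2}; the interval
  \<open>{1..2}\<close> lies well inside (0, pi), where the weight is positive and
  continuous.\<close>

lemma norm_pos: "0 < I (\<lambda>x. (poly (JP n) (cos x))\<^sup>2)"
proof (rule ccontr)
  assume "\<not> 0 < I (\<lambda>x. (poly (JP n) (cos x))\<^sup>2)"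
  then have I0: "I (\<lambda>x. (poly (JP n) (cos x))\<^sup>2) \<le> 0" by simp
  have c: "continuous_on S (\<lambda>x. (poly (JP n) (cos x))\<^sup>2)" for S by (intro continuous_intros)
  define f where "f x = w x * (poly (JP n) (cos x))\<^sup>2" for x
  have fc: "continuous_on {1..2} f" unfolding f_def
    by (intro continuous_intros weight_continuous_on) (use pi_gt3 in auto)
  have f0: "0 \<le> f x" for x by (simp add: f_def trig_nonneg)
  have "integral {1..2} f \<le> 0"
    unfolding f_def by (rule order_trans[OF integral_le_I[OF _ _ c] I0]) (use pi_gt3 in simp_all)
  moreover have "0 \<le> integral {1..2} f" by (rule integral_nonneg[OF integrable_continuous_real[OF fc] f0])
  ultimately have "integral {1..2} f = 0" by linarith
  then have hi: "(f has_integral 0) (cbox 1 2)"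
    using integrable_integral[OF integrable_continuous_real[OF fc]] by (simp only: box_real)
  have z: "f x = 0" if "x \<in> {1..2}" for x
    by (rule has_integral_0_cbox_imp_0[OF _ f0 hi]) (use fc that in \<open>simp_all add: box_real\<close>)
  have "poly (JP n) (cos x) = 0" if "1 \<le> x" "x \<le> 2" for x
  proof -
    have "0 < w x" using pi_gt3 that by (intro trig_pos) auto
    then show ?thesis using z[of x] that by (simp add: f_def)
  qed
  then have "cos ` {1..2} \<subseteq> {y. poly (JP n) y = 0}" by auto
  moreover have "finite {y. poly (JP n) y = 0}" using jacobi_polynomial_degree(2)[OF \<alpha> \<beta>] by (rule poly_roots_finite)
  ultimately have "finite (cos ` {1..2 :: real})" by (rule finite_subset)
  moreover have "inj_on cos {1..2 :: real}"
  proof (rule inj_onI)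
    fix x y :: real assume "x \<in> {1..2}" "y \<in> {1..2}" "cos x = cos y"
    then show "x = y" using pi_gt3 by (intro cos_inj_pi[of x y]) simp_all
  qed
  ultimately have "finite {1..2 :: real}" by (rule finite_imageD)
  then show False using infinite_Icc[of "1 :: real" 2] by simp
qed

lemma jacobi_const_eq: "jacobi_const \<alpha> \<beta> n = 1 / sqrt (I (\<lambda>x. (poly (JP n) (cos x))\<^sup>2))"
  unfolding jacobi_const_def poly_jacobi_polynomial[symmetric] by (subst I_eq) (auto intro!: continuous_intros)

definition Q :: "nat \<Rightarrow> real poly" where
  "Q n = smult (jacobi_const \<alpha> \<beta> n) (JP n)"

lemma jacobi_fun_eq: "jacobi_fun \<alpha> \<beta> n x = poly (Q n) (cos x)"
  by (simp add: jacobi_fun_def Q_def poly_jacobi_polynomial)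

lemma orthonormal: "I (\<lambda>x. poly (Q n) (cos x) * poly (Q m) (cos x)) = (if n = m then 1 else 0)"
proof -
  have "I (\<lambda>x. poly (Q n) (cos x) * poly (Q m) (cos x))
    = jacobi_const \<alpha> \<beta> n * jacobi_const \<alpha> \<beta> m * I (\<lambda>x. poly (JP n) (cos x) * poly (JP m) (cos x))"
    unfolding I_cmult[symmetric] by (simp add: Q_def mult_ac)
  then show ?thesis
    using orthogonal[of n m] norm_pos[of n] by (auto simp: jacobi_const_eq power2_eq_square)
qed

lemma Q_span:
  assumes "degree p < m"
  shows "\<exists>d. p = (\<Sum>n<m. smult (d n) (Q n))"
proof (rule polynomial_span)
  have "jacobi_const \<alpha> \<beta> n \<noteq> 0" for n using norm_pos[of n] by (simp add: jacobi_const_eq)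
  then show "degree (Q n) = n" "Q n \<noteq> 0" for n
    using jacobi_polynomial_degree[OF \<alpha> \<beta>, of n] by (simp_all add: Q_def)
  show "coeff p i = 0" if "m \<le> i" for i using assms that by (intro coeff_eq_0) simp
qed

text \<open>Pythagoras: the remainder \<open>D\<close> of the Fourier sum is orthogonal to all
  polynomials involved, so changing the coefficients only adds a square.\<close>

lemma best_approximation:
  assumes H: "continuous_on {0..pi} H"
  defines "c \<equiv> \<lambda>n. I (\<lambda>x. poly (Q n) (cos x) * H x)"
  shows "I (\<lambda>x. (H x - (\<Sum>n<m. c n * poly (Q n) (cos x)))\<^sup>2) \<le> I (\<lambda>x. (H x - (\<Sum>n<m. d n * poly (Q n) (cos x)))\<^sup>2)"
proof -
  define u where "u n x = poly (Q n) (cos x)" for n x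
  have uc: "continuous_on S (u n)" for S n unfolding u_def by (intro continuous_intros)
  define D where "D x = H x - (\<Sum>n<m. c n * u n x)" for x
  have Dc: "continuous_on {0..pi} D" unfolding D_def by (intro continuous_intros H uc)
  have D0: "I (\<lambda>x. u n x * D x) = 0" if n: "n < m" for n
  proof -
    have "I (\<lambda>x. u n x * D x) = I (\<lambda>x. u n x * H x + (\<Sum>k<m. - c k * (u n x * u k x)))"
      by (simp add: D_def right_diff_distrib sum_distrib_left sum_negf mult_ac)
    also have "\<dots> = I (\<lambda>x. u n x * H x) + (\<Sum>k<m. - c k * I (\<lambda>x. u n x * u k x))"
      unfolding I_cmult[symmetric] I_sum[of "{..<m}" "\<lambda>k x. - c k * (u n x * u k x)", OF continuous_on_mult_left[OF continuous_on_mult[OF uc uc]], symmetric]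
      by (intro I_add continuous_intros H uc)
    also have "\<dots> = c n + (\<Sum>k<m. if n = k then - c k else 0)"
      unfolding u_def orthonormal c_def by (simp add: if_distrib cong: if_cong)
    finally show ?thesis using n by simp
  qed
  have "I (\<lambda>x. (H x - (\<Sum>n<m. d n * u n x))\<^sup>2)
    = I (\<lambda>x. (D x)\<^sup>2 + ((\<Sum>n<m. 2 * (c n - d n) * (u n x * D x)) + (\<Sum>n<m. (c n - d n) * u n x)\<^sup>2))"
  proof (rule arg_cong[where f=I], rule ext)
    fix x
    have "H x - (\<Sum>n<m. d n * u n x) = D x + (\<Sum>n<m. (c n - d n) * u n x)"
      by (simp add: D_def left_diff_distrib sum_subtractf)
    moreover have "(\<Sum>n<m. 2 * (c n - d n) * (u n x * D x)) = 2 * D x * (\<Sum>n<m. (c n - d n) * u n x)"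
      by (simp add: sum_distrib_left mult_ac)
    ultimately show "(H x - (\<Sum>n<m. d n * u n x))\<^sup>2 = (D x)\<^sup>2 + ((\<Sum>n<m. 2 * (c n - d n) * (u n x * D x)) + (\<Sum>n<m. (c n - d n) * u n x)\<^sup>2)"
      by (simp add: power2_sum)
  qed
  also have "\<dots> = I (\<lambda>x. (D x)\<^sup>2) + ((\<Sum>n<m. 2 * (c n - d n) * I (\<lambda>x. u n x * D x)) + I (\<lambda>x. (\<Sum>n<m. (c n - d n) * u n x)\<^sup>2))"
  proof -
    have "I (\<lambda>x. \<Sum>n<m. 2 * (c n - d n) * (u n x * D x)) = (\<Sum>n<m. 2 * (c n - d n) * I (\<lambda>x. u n x * D x))"
      unfolding I_cmult[symmetric] by (intro I_sum continuous_intros uc Dc)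
    moreover have "I (\<lambda>x. (\<Sum>n<m. 2 * (c n - d n) * (u n x * D x)) + (\<Sum>n<m. (c n - d n) * u n x)\<^sup>2)
      = I (\<lambda>x. \<Sum>n<m. 2 * (c n - d n) * (u n x * D x)) + I (\<lambda>x. (\<Sum>n<m. (c n - d n) * u n x)\<^sup>2)"
      by (intro I_add continuous_intros uc Dc)
    moreover have "I (\<lambda>x. (D x)\<^sup>2 + ((\<Sum>n<m. 2 * (c n - d n) * (u n x * D x)) + (\<Sum>n<m. (c n - d n) * u n x)\<^sup>2))
      = I (\<lambda>x. (D x)\<^sup>2) + I (\<lambda>x. (\<Sum>n<m. 2 * (c n - d n) * (u n x * D x)) + (\<Sum>n<m. (c n - d n) * u n x)\<^sup>2)"
      by (intro I_add continuous_intros uc Dc)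
    ultimately show ?thesis by simp
  qed
  also have "\<dots> = I (\<lambda>x. (D x)\<^sup>2) + I (\<lambda>x. (\<Sum>n<m. (c n - d n) * u n x)\<^sup>2)" by (simp add: D0)
  also have "\<dots> \<ge> I (\<lambda>x. (D x)\<^sup>2)" by (simp add: I_nonneg)
  finally show ?thesis by (simp add: D_def u_def)
qed

text \<open>Weierstrass' theorem on [-1, 1] after the substitution y = cos x.\<close>

lemma polynomial_approximation:
  assumes H: "continuous_on {0..pi} H" and \<eta>: "0 < \<eta>"
  obtains p where "\<And>x. x \<in> {0..pi} \<Longrightarrow> \<bar>H x - poly p (cos x)\<bar> < \<eta>"
proof -
  have "continuous_on {-1..1} (\<lambda>y. H (arccos y))"
    by (rule continuous_on_compose2[OF H continuous_on_arccos']) (auto simp: arccos_lbound arccos_ubound)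
  then obtain g where g: "real_polynomial_function g" "\<And>y. y \<in> {-1..1} \<Longrightarrow> \<bar>H (arccos y) - g y\<bar> < \<eta>"
    using Stone_Weierstrass_real_polynomial_function[of "{-1..1}" "\<lambda>y. H (arccos y)" \<eta>] \<eta> by auto
  obtain a n where an: "g = (\<lambda>x. \<Sum>i\<le>n::nat. a i * x ^ i)" using g(1) by (auto simp: real_polynomial_function_iff_sum)
  show ?thesis
  proof (rule that)
    fix x :: real assume x: "x \<in> {0..pi}"
    have "poly (\<Sum>i\<le>n. monom (a i) i) y = g y" for y by (simp add: an poly_sum poly_monom)
    then show "\<bar>H x - poly (\<Sum>i\<le>n. monom (a i) i) (cos x)\<bar> < \<eta>"
      using g(2)[of "cos x"] x by (simp add: arccos_cos)
  qed
qed

end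

section \<open>Liouville normal form of the Jacobi equation\<close>

context jacobi
begin

abbreviation "\<omega> \<equiv> trig (\<alpha> + 1 / 2) (\<beta> + 1 / 2)"

lemma root_weight: "\<omega> x * \<omega> x = w x"
proof -
  have "\<alpha> + 1 / 2 + (\<alpha> + 1 / 2) = 2 * \<alpha> + 1" "\<beta> + 1 / 2 + (\<beta> + 1 / 2) = 2 * \<beta> + 1" by simp_all
  then show ?thesis by (simp only: trig_mult)
qed

definition log_slope :: "real \<Rightarrow> real" where
  "log_slope x = (2 * \<alpha> + 1) / 4 * (cos (x / 2) / sin (x / 2)) - (2 * \<beta> + 1) / 4 * (sin (x / 2) / cos (x / 2))"

text \<open>The trigonometric Poeschl-Teller potential. The Liouville transformation also shifts the
  eigenvalue n (n + \<alpha> + \<beta> + 1) by tau^2, which completes it to the square (n +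
  tau)^2.\<close>

definition potential :: "real \<Rightarrow> real" where
  "potential x = (\<alpha>\<^sup>2 - 1 / 4) / (4 * (sin (x / 2))\<^sup>2) + (\<beta>\<^sup>2 - 1 / 4) / (4 * (cos (x / 2))\<^sup>2)"

definition frequency :: "nat \<Rightarrow> real" where
  "frequency n = \<bar>real n + jacobi_tau \<alpha> \<beta>\<bar>"

definition mode :: "nat \<Rightarrow> real \<Rightarrow> real" where
  "mode n x = \<omega> x * poly (Q n) (cos x)"

definition mode' :: "nat \<Rightarrow> real \<Rightarrow> real" where
  "mode' n x = \<omega> x * (log_slope x * poly (Q n) (cos x) - sin x * poly (pderiv (Q n)) (cos x))"

lemma root_weight_deriv:
  assumes "0 < x" "x < pi"
  shows "(\<omega> has_real_derivative \<omega> x * log_slope x) (at x)"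
proof -
  have "0 < sin (x / 2)" "0 < cos (x / 2)" using half_angle_pos[OF assms] by auto
  then have "trig (a - 1) (b + 1) x = trig a b x * (cos (x / 2) / sin (x / 2))"
    "trig (a + 1) (b - 1) x = trig a b x * (sin (x / 2) / cos (x / 2))" for a b
    by (simp_all add: trig_def powr_add powr_diff)
  from trig_deriv[OF assms, of "\<alpha> + 1 / 2" "\<beta> + 1 / 2", unfolded this]
  show ?thesis by (rule DERIV_cong) (simp add: log_slope_def algebra_simps add_divide_distrib)
qed

lemma log_slope_deriv:
  assumes "0 < x" "x < pi"
  shows "(log_slope has_real_derivative - (2 * \<alpha> + 1) / (8 * (sin (x / 2))\<^sup>2) - (2 * \<beta> + 1) / (8 * (cos (x / 2))\<^sup>2)) (at x)"
proof -
  have p: "sin (x / 2) \<noteq> 0" "cos (x / 2) \<noteq> 0" using half_angle_pos[OF assms] by auto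
  have sc: "sin (x / 2) * sin (x / 2) + cos (x / 2) * cos (x / 2) = 1"
    using sin_cos_squared_add[of "x / 2"] by (simp add: power2_eq_square)
  have c: "((\<lambda>x. cos (x / 2) / sin (x / 2)) has_real_derivative - (1 / (2 * (sin (x / 2))\<^sup>2))) (at x)"
  proof -
    have "((\<lambda>x. cos (x / 2) / sin (x / 2)) has_real_derivative
        ((- sin (x / 2) / 2) * sin (x / 2) - cos (x / 2) * (cos (x / 2) / 2)) / (sin (x / 2) * sin (x / 2))) (at x)"
      using p by (auto intro!: derivative_eq_intros)
    also have "(- sin (x / 2) / 2) * sin (x / 2) - cos (x / 2) * (cos (x / 2) / 2) = - (1 / 2)" using sc by simp
    finally show ?thesis by (simp add: power2_eq_square)
  qed
  have t: "((\<lambda>x. sin (x / 2) / cos (x / 2)) has_real_derivative 1 / (2 * (cos (x / 2))\<^sup>2)) (at x)"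
  proof -
    have "((\<lambda>x. sin (x / 2) / cos (x / 2)) has_real_derivative
        ((cos (x / 2) / 2) * cos (x / 2) - sin (x / 2) * (- sin (x / 2) / 2)) / (cos (x / 2) * cos (x / 2))) (at x)"
      using p by (auto intro!: derivative_eq_intros)
    also have "(cos (x / 2) / 2) * cos (x / 2) - sin (x / 2) * (- sin (x / 2) / 2) = 1 / 2" using sc by simp
    finally show ?thesis by (simp add: power2_eq_square)
  qed
  have "a / 4 * - (1 / (2 * s)) = - a / (8 * s)" "a / 4 * (1 / (2 * s)) = a / (8 * s)" for a s :: real
    by simp_all
  with DERIV_diff[OF DERIV_cmult[OF c, of "(2 * \<alpha> + 1) / 4"] DERIV_cmult[OF t, of "(2 * \<beta> + 1) / 4"]]
  show ?thesis unfolding log_slope_def[abs_def] by (simp only:)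
qed

text \<open>Equivalently, \<open>\<omega>\<close> itself solves the normalised equation with
  eigenvalue tau^2: this is the case n = 0, where the polynomial factor is constant.\<close>

lemma riccati:
  assumes "0 < x" "x < pi"
  shows "(log_slope x)\<^sup>2 + (- (2 * \<alpha> + 1) / (8 * (sin (x / 2))\<^sup>2) - (2 * \<beta> + 1) / (8 * (cos (x / 2))\<^sup>2))
    = potential x - (jacobi_tau \<alpha> \<beta>)\<^sup>2"
proof -
  define u where "u = 1 / (sin (x / 2))\<^sup>2"
  define t where "t = 1 / (cos (x / 2))\<^sup>2"
  have p: "sin (x / 2) \<noteq> 0" "cos (x / 2) \<noteq> 0" using half_angle_pos[OF assms] by auto
  define C where "C = cos (x / 2) / sin (x / 2)"
  define S where "S = sin (x / 2) / cos (x / 2)"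
  have C2: "C\<^sup>2 = u - 1" and S2: "S\<^sup>2 = t - 1" and CS: "C * S = 1"
    using p sin_cos_squared_add[of "x / 2"] by (simp_all add: C_def S_def u_def t_def power_divide field_simps)
  have eq1: "(log_slope x)\<^sup>2 = ((2 * \<alpha> + 1) / 4)\<^sup>2 * C\<^sup>2 - 2 * ((2 * \<alpha> + 1) / 4 * ((2 * \<beta> + 1) / 4)) * (C * S) + ((2 * \<beta> + 1) / 4)\<^sup>2 * S\<^sup>2"
    unfolding log_slope_def C_def[symmetric] S_def[symmetric] by (simp add: power2_eq_square algebra_simps)
  have eq2: "potential x = (\<alpha>\<^sup>2 - 1 / 4) / 4 * u + (\<beta>\<^sup>2 - 1 / 4) / 4 * t"
    by (simp add: potential_def u_def t_def)
  have eq3: "- (2 * \<alpha> + 1) / (8 * (sin (x / 2))\<^sup>2) - (2 * \<beta> + 1) / (8 * (cos (x / 2))\<^sup>2) = - (2 * \<alpha> + 1) / 8 * u - (2 * \<beta> + 1) / 8 * t"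
    by (simp add: u_def t_def)
  show ?thesis unfolding eq1 eq2 eq3 C2 S2 CS jacobi_tau_def by (simp add: power2_eq_square field_simps)
qed

lemma Q_ode:
  "(sin x)\<^sup>2 * poly (pderiv (pderiv (Q n))) (cos x)
    = 2 * ((\<alpha> + 1) * (cos (x / 2))\<^sup>2 - (\<beta> + 1) * (sin (x / 2))\<^sup>2) * poly (pderiv (Q n)) (cos x)
      - real n * (real n + \<alpha> + \<beta> + 1) * poly (Q n) (cos x)"
proof -
  define k where "k = jacobi_const \<alpha> \<beta> n"
  have "k * ((sin x)\<^sup>2 * poly (pderiv (pderiv (JP n))) (cos x)) = k * (2 * ((\<alpha> + 1) * (cos (x / 2))\<^sup>2 - (\<beta> + 1) * (sin (x / 2))\<^sup>2) * poly (pderiv (JP n)) (cos x)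
      - real n * (real n + \<alpha> + \<beta> + 1) * poly (JP n) (cos x))"
    unfolding half_angle_ode ..
  moreover have eq: "poly (Q n) y = k * poly (JP n) y" "poly (pderiv (Q n)) y = k * poly (pderiv (JP n)) y"
    "poly (pderiv (pderiv (Q n))) y = k * poly (pderiv (pderiv (JP n))) y" for y
    by (simp_all add: Q_def k_def pderiv_smult)
  ultimately show ?thesis unfolding eq by (simp add: algebra_simps)
qed

lemma mode_deriv:
  assumes "0 < x" "x < pi"
  shows "(mode n has_real_derivative mode' n x) (at x)"
proof -
  have "((\<lambda>x. poly (Q n) (cos x)) has_real_derivative poly (pderiv (Q n)) (cos x) * - sin x) (at x)"
    by (rule DERIV_chain2[OF poly_DERIV DERIV_cos])
  from DERIV_mult[OF root_weight_deriv[OF assms] this]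
  show ?thesis unfolding mode_def[abs_def] mode'_def by (rule DERIV_cong) (simp add: algebra_simps)
qed

lemma mode'_deriv:
  assumes "0 < x" "x < pi"
  shows "(mode' n has_real_derivative (potential x - (frequency n)\<^sup>2) * mode n x) (at x)"
proof -
  define P where "P = poly (Q n) (cos x)"
  define P1 where "P1 = poly (pderiv (Q n)) (cos x)"
  define P2 where "P2 = poly (pderiv (pderiv (Q n))) (cos x)"
  define g where "g = log_slope x"
  define g' where "g' = - (2 * \<alpha> + 1) / (8 * (sin (x / 2))\<^sup>2) - (2 * \<beta> + 1) / (8 * (cos (x / 2))\<^sup>2)"
  have d: "((\<lambda>x. poly (Q n) (cos x)) has_real_derivative P1 * - sin x) (at x)"
    "((\<lambda>x. poly (pderiv (Q n)) (cos x)) has_real_derivative P2 * - sin x) (at x)"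
    unfolding P1_def P2_def by (rule DERIV_chain2[OF poly_DERIV DERIV_cos])+
  note D = DERIV_mult[OF root_weight_deriv[OF assms] DERIV_diff[OF DERIV_mult[OF log_slope_deriv[OF assms] d(1)] DERIV_mult[OF DERIV_sin d(2)]],
      folded g_def g'_def P_def P1_def]
  \<comment> \<open>The first-order coefficient of the Jacobi equation in half angles is exactly
    what makes the terms with \<open>P1\<close> cancel in the second derivative of the mode.\<close>
  have gs: "2 * g * sin x + cos x = 2 * ((\<alpha> + 1) * (cos (x / 2))\<^sup>2 - (\<beta> + 1) * (sin (x / 2))\<^sup>2)"
    using half_angle_pos[OF assms] unfolding double_angle[of x] g_def log_slope_def by (simp add: field_simps power2_eq_square)
  have ode: "(sin x)\<^sup>2 * P2 = (2 * g * sin x + cos x) * P1 - real n * (real n + \<alpha> + \<beta> + 1) * P"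
    unfolding gs P_def P1_def P2_def by (rule Q_ode)
  have e: "(frequency n)\<^sup>2 = real n * (real n + \<alpha> + \<beta> + 1) + (jacobi_tau \<alpha> \<beta>)\<^sup>2"
    by (simp add: frequency_def jacobi_tau_def power2_eq_square field_simps)
  have r: "g\<^sup>2 + g' = potential x - (jacobi_tau \<alpha> \<beta>)\<^sup>2"
    unfolding g_def g'_def by (rule riccati[OF assms])
  show ?thesis
    unfolding mode'_def[abs_def]
  proof (rule DERIV_cong[OF D])
    show "\<omega> x * g * (g * P - sin x * P1) + (g' * P + P1 * - sin x * g - (cos x * P1 + P2 * - sin x * sin x)) * \<omega> x
      = (potential x - (frequency n)\<^sup>2) * mode n x"
      unfolding mode_def P_def[symmetric] using ode e r by algebra
  qed
qed

text \<open>From tau > - 1/2: for n >= 1, n + tau > n - 1/2 >= n / 2.\<close>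

lemma frequency_ge: "real n / 2 \<le> frequency n"
  using \<alpha> \<beta> by (cases n) (auto simp: frequency_def jacobi_tau_def field_simps)

lemma mode_norm:
  assumes "0 < a" "a \<le> b" "b < pi"
  shows "integral {a..b} (\<lambda>x. (mode n x)\<^sup>2) \<le> 1"
proof -
  have "integral {a..b} (\<lambda>x. w x * (poly (Q n) (cos x) * poly (Q n) (cos x))) \<le> I (\<lambda>x. poly (Q n) (cos x) * poly (Q n) (cos x))"
    by (rule integral_le_I) (use assms in \<open>auto intro!: continuous_intros\<close>)
  then show ?thesis
    unfolding orthonormal root_weight[symmetric] mode_def by (simp add: power2_eq_square mult_ac)
qed

text \<open>Division by \<open>\<omega>\<close> turns expansions in modes into expansions in
  orthonormal polynomials. Weierstrass supplies some polynomial, and every Fourier sum long enough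
  to contain its degree approximates at least as well.\<close>

lemma mode_dense:
  assumes ab: "0 < a" "a < b" "b < pi" and h: "continuous_on UNIV h" "\<And>x. x \<notin> {a..b} \<Longrightarrow> h x = 0" and \<epsilon>: "0 < \<epsilon>"
  shows "\<exists>m\<ge>m0. integral {a..b} (\<lambda>x. (h x - (\<Sum>n<m. integral {a..b} (\<lambda>y. mode n y * h y) * mode n x))\<^sup>2) \<le> \<epsilon>"
proof -
  \<comment> \<open>Clamping the argument to \<open>{a..b}\<close> keeps the divisor positive and
    continuous on the whole line, while \<open>h\<close> vanishes outside that interval.\<close>
  define cl where "cl x = max a (min b x)" for x
  have cl: "0 < cl x" "cl x < pi" "x \<in> {a..b} \<Longrightarrow> cl x = x" for x using ab by (auto simp: cl_def)
  define H where "H x = h x / \<omega> (cl x)" for x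
  have \<omega>: "0 < \<omega> (cl x)" for x by (rule trig_pos[OF cl(1,2)])
  then have \<omega>0: "\<omega> (cl x) \<noteq> 0" for x by (metis less_irrefl)
  have "continuous_on UNIV (\<lambda>x. \<omega> (cl x))"
  proof (rule continuous_on_compose2[OF weight_continuous_on[OF ab(1,3)]])
    show "continuous_on UNIV cl" unfolding cl_def[abs_def] by (intro continuous_intros)
  qed (use ab in \<open>auto simp: cl_def\<close>)
  then have "continuous_on UNIV H" unfolding H_def[abs_def] by (intro continuous_on_divide h) (use \<omega>0 in auto)
  then have Hc: "continuous_on S H" for S by (rule continuous_on_subset) simp
  have H0: "H x = 0" if "x \<notin> {a..b}" for x using h(2)[OF that] by (simp add: H_def)
  have hH: "h x = \<omega> x * H x" if "x \<in> {a..b}" for x using cl(3)[OF that] \<omega>[of x] by (simp add: H_def)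
  define c where "c n = I (\<lambda>x. poly (Q n) (cos x) * H x)" for n
  have c: "integral {a..b} (\<lambda>y. mode n y * h y) = c n" for n
  proof -
    have "integral {a..b} (\<lambda>y. mode n y * h y) = integral {a..b} (\<lambda>x. w x * (poly (Q n) (cos x) * H x))"
    proof (rule Henstock_Kurzweil_Integration.integral_cong)
      fix x assume x: "x \<in> {a..b}"
      show "mode n x * h x = w x * (poly (Q n) (cos x) * H x)"
        unfolding mode_def hH[OF x] root_weight[symmetric] by (simp only: mult_ac)
    qed
    also have "\<dots> = c n" unfolding c_def
      by (rule integral_eq_I) (use ab H0 in \<open>auto intro!: continuous_intros Hc\<close>)
    finally show ?thesis .
  qed
  define W where "W = I (\<lambda>x. 1)"
  have W: "0 \<le> W" unfolding W_def by (rule I_nonneg) simp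
  define \<eta> where "\<eta> = sqrt (\<epsilon> / (W + 1))"
  have \<eta>: "0 < \<eta>" "\<eta>\<^sup>2 * W \<le> \<epsilon>"
  proof -
    show "0 < \<eta>" using \<epsilon> W by (simp add: \<eta>_def)
    have "\<eta>\<^sup>2 = \<epsilon> / (W + 1)" using \<epsilon> W by (simp add: \<eta>_def)
    then have "\<eta>\<^sup>2 * W + \<eta>\<^sup>2 = \<epsilon>" using W by (simp add: field_simps)
    then show "\<eta>\<^sup>2 * W \<le> \<epsilon>" using zero_le_power2[of \<eta>] by linarith
  qed
  obtain p where p: "\<And>x. x \<in> {0..pi} \<Longrightarrow> \<bar>H x - poly p (cos x)\<bar> < \<eta>"
    using polynomial_approximation[OF Hc \<eta>(1)] by blast
  define m where "m = max m0 (Suc (degree p))"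
  have "degree p < m" by (simp add: m_def less_max_iff_disj)
  then obtain d where d: "p = (\<Sum>n<m. smult (d n) (Q n))" using Q_span by blast
  have "integral {a..b} (\<lambda>x. (h x - (\<Sum>n<m. c n * mode n x))\<^sup>2) = integral {a..b} (\<lambda>x. w x * (H x - (\<Sum>n<m. c n * poly (Q n) (cos x)))\<^sup>2)"
  proof (rule Henstock_Kurzweil_Integration.integral_cong)
    fix x assume x: "x \<in> {a..b}"
    have "(\<Sum>n<m. c n * mode n x) = \<omega> x * (\<Sum>n<m. c n * poly (Q n) (cos x))"
      unfolding sum_distrib_left mode_def by (intro sum.cong refl) (simp only: mult_ac)
    then have "h x - (\<Sum>n<m. c n * mode n x) = \<omega> x * (H x - (\<Sum>n<m. c n * poly (Q n) (cos x)))"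
      by (simp add: hH[OF x] right_diff_distrib)
    then show "(h x - (\<Sum>n<m. c n * mode n x))\<^sup>2 = w x * (H x - (\<Sum>n<m. c n * poly (Q n) (cos x)))\<^sup>2"
      unfolding root_weight[symmetric] by (simp add: power2_eq_square mult_ac)
  qed
  also have "\<dots> \<le> I (\<lambda>x. (H x - (\<Sum>n<m. c n * poly (Q n) (cos x)))\<^sup>2)"
    by (rule integral_le_I) (use ab in \<open>auto intro!: continuous_intros Hc\<close>)
  also have "\<dots> \<le> I (\<lambda>x. (H x - (\<Sum>n<m. d n * poly (Q n) (cos x)))\<^sup>2)"
    unfolding c_def by (rule best_approximation[OF Hc])
  also have "\<dots> \<le> I (\<lambda>x. \<eta>\<^sup>2 * 1)"
  proof (rule I_mono)
    fix x :: real assume "x \<in> {0<..<pi}"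
    then have "\<bar>H x - (\<Sum>n<m. d n * poly (Q n) (cos x))\<bar> < \<eta>" using p[of x] unfolding d by (simp add: poly_sum)
    then have "\<bar>H x - (\<Sum>n<m. d n * poly (Q n) (cos x))\<bar>\<^sup>2 \<le> \<eta>\<^sup>2" by (intro power_mono) auto
    then show "(H x - (\<Sum>n<m. d n * poly (Q n) (cos x)))\<^sup>2 \<le> \<eta>\<^sup>2 * 1" by simp
  qed (auto intro!: continuous_intros Hc)
  also have "\<dots> = \<eta>\<^sup>2 * W" unfolding W_def by (rule I_cmult)
  also have "\<dots> \<le> \<epsilon>" by (rule \<eta>(2))
  finally show ?thesis unfolding c by (intro exI[of _ m]) (simp add: m_def)
qed

lemma potential_continuous: "continuous_on {0<..<pi} potential"
proof -
  have "sin (x / 2) \<noteq> 0" "cos (x / 2) \<noteq> 0" if "x \<in> {0<..<pi}" for x using half_angle_pos[of x] that by auto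
  then show ?thesis unfolding potential_def[abs_def] by (intro continuous_intros) auto
qed

sublocale complete_eigensystem 0 pi mode mode' potential frequency
proof unfold_locales
  show "(mode n has_real_derivative mode' n x) (at x)" if "0 < x" "x < pi" for n x by (rule mode_deriv[OF that])
  show "(mode' n has_real_derivative (potential x - (frequency n)\<^sup>2) * mode n x) (at x)" if "0 < x" "x < pi" for n x
    by (rule mode'_deriv[OF that])
  show "integral {a..b} (\<lambda>x. (mode n x)\<^sup>2) \<le> 1" if "0 < a" "a \<le> b" "b < pi" for n a b by (rule mode_norm[OF that])
qed (fact potential_continuous frequency_ge mode_dense)+

end

section \<open>Derivatives of Jacobi functions\<close>

text \<open>An explicit class of coefficient functions that is closed under differentiation on (0,
  pi) and contains the powers forming the potential and 1 / \<open>\<omega>\<close>; it stands in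
  for smoothness.\<close>

inductive trig_span :: "(real \<Rightarrow> real) \<Rightarrow> bool" where
  trig_span_monomial: "trig_span (\<lambda>x. k * trig a b x)"
| trig_span_add: "trig_span f \<Longrightarrow> trig_span g \<Longrightarrow> trig_span (\<lambda>x. f x + g x)"

lemma trig_span_deriv:
  "trig_span f \<Longrightarrow> \<exists>f'. trig_span f' \<and> (\<forall>x. 0 < x \<longrightarrow> x < pi \<longrightarrow> (f has_real_derivative f' x) (at x))"
proof (induction rule: trig_span.induct)
  case (trig_span_monomial k a b)
  define f' where "f' x = (k * (a / 2)) * trig (a - 1) (b + 1) x + (- k * (b / 2)) * trig (a + 1) (b - 1) x" for x
  have "((\<lambda>x. k * trig a b x) has_real_derivative f' x) (at x)" if "0 < x" "x < pi" for x
    by (rule DERIV_cong[OF DERIV_cmult[OF trig_deriv[OF that]]]) (simp add: f'_def algebra_simps)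
  moreover have "trig_span f'" unfolding f'_def[abs_def] by (intro trig_span.intros)
  ultimately show ?case by blast
next
  case (trig_span_add f g)
  then obtain f' g' where "trig_span f'" "trig_span g'"
    "\<And>x. 0 < x \<Longrightarrow> x < pi \<Longrightarrow> (f has_real_derivative f' x) (at x)"
    "\<And>x. 0 < x \<Longrightarrow> x < pi \<Longrightarrow> (g has_real_derivative g' x) (at x)" by blast
  then show ?case
    by (intro exI[of _ "\<lambda>x. f' x + g' x"]) (auto intro: trig_span.trig_span_add DERIV_add)
qed

lemma trig_span_mult: "trig_span f \<Longrightarrow> trig_span (\<lambda>x. k * trig a b x * f x)"
proof (induction rule: trig_span.induct)
  case (trig_span_monomial k' a' b')
  have "(\<lambda>x. k * trig a b x * (k' * trig a' b' x)) = (\<lambda>x. (k * k') * trig (a + a') (b + b') x)"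
    by (simp add: trig_mult[symmetric] mult_ac)
  then show ?case using trig_span.trig_span_monomial by metis
qed (auto simp: distrib_left intro: trig_span.trig_span_add)

lemma trig_span_0: "trig_span (\<lambda>x. 0)"
  using trig_span_monomial[of 0] by simp

lemma trig_span_cmult: "trig_span f \<Longrightarrow> trig_span (\<lambda>x. k * f x)"
proof (induction rule: trig_span.induct)
  case (trig_span_monomial k' a b)
  then show ?case using trig_span.trig_span_monomial[of "k * k'" a b] by (simp add: mult.assoc)
qed (auto simp: distrib_left intro: trig_span.trig_span_add)

lemma trig_span_sum: "(\<And>j. j \<in> J \<Longrightarrow> trig_span (f j)) \<Longrightarrow> trig_span (\<lambda>x. \<Sum>j\<in>J. f j x)"
  by (induction J rule: infinite_finite_induct) (auto intro: trig_span_0 trig_span_add)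

lemma trig_span_isCont: "trig_span f \<Longrightarrow> 0 < x \<Longrightarrow> x < pi \<Longrightarrow> isCont f x"
  using trig_span_deriv DERIV_isCont by blast

context jacobi
begin

text \<open>Row j expresses the derivative of jet entry j through the jet, by v'' = (q - e^2) v. The
  potential is spelt out in half-angle powers so that all entries stay in
  \<open>trig_span\<close>.\<close>

definition jet_matrix :: "nat \<Rightarrow> nat \<Rightarrow> real \<Rightarrow> real" where
  "jet_matrix j i x = (if i = Suc j then (if even j then 1 else - 1) else 0)
     + (if odd j \<and> i = j - 1 then (\<alpha>\<^sup>2 - 1 / 4) / 4 * trig (- 2) 0 x + (\<beta>\<^sup>2 - 1 / 4) / 4 * trig 0 (- 2) x else 0)"

lemma potential_trig:
  assumes "0 < x" "x < pi"
  shows "potential x = (\<alpha>\<^sup>2 - 1 / 4) / 4 * trig (- 2) 0 x + (\<beta>\<^sup>2 - 1 / 4) / 4 * trig 0 (- 2) x"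
proof -
  have "0 < sin (x / 2)" "0 < cos (x / 2)" using half_angle_pos[OF assms] by auto
  then have p: "sin (x / 2) powr - 2 = inverse ((sin (x / 2))\<^sup>2)" "cos (x / 2) powr - 2 = inverse ((cos (x / 2))\<^sup>2)"
    "sin (x / 2) powr 0 = 1" "cos (x / 2) powr 0 = 1"
    by (simp_all add: powr_minus)
  have "a / (4 * s) = a / 4 * inverse s" for a s :: real by (simp only: divide_inverse inverse_mult_distrib mult.assoc)
  then show ?thesis unfolding potential_def trig_def p by (simp only: mult_1 mult_1_right)
qed

lemma jet_deriv:
  assumes x: "0 < x" "x < pi" and j: "j \<le> N"
  shows "((\<lambda>x. jet x j n) has_real_derivative (\<Sum>i\<le>Suc N. jet_matrix j i x * jet x i n)) (at x)"
proof (cases "even j")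
  case True
  then have "(\<Sum>i\<le>Suc N. jet_matrix j i x * jet x i n) = (\<Sum>i\<le>Suc N. if i = Suc j then jet x i n else 0)"
    by (intro sum.cong refl) (simp add: jet_matrix_def)
  also have "\<dots> = frequency n ^ (2 * (j div 2)) * mode' n x"
    using True j by (simp add: jet_def)
  finally show ?thesis
    using DERIV_cmult[OF mode_deriv[OF x]] True by (simp add: jet_def[abs_def])
next
  case False
  then obtain m where m: "j = Suc (2 * m)" by (elim oddE) simp
  have "(\<Sum>i\<le>Suc N. jet_matrix j i x * jet x i n)
    = (\<Sum>i\<le>Suc N. (if i = Suc j then - jet x i n else 0) + (if i = j - 1 then potential x * jet x i n else 0))"
    using False by (intro sum.cong refl) (auto simp: jet_matrix_def potential_trig[OF x])
  also have "\<dots> = - jet x (Suc j) n + potential x * jet x (j - 1) n"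
    using j by (simp add: sum.distrib del: sum.atMost_Suc)
  also have "\<dots> = frequency n ^ (2 * m) * ((potential x - (frequency n)\<^sup>2) * mode n x)"
    unfolding m jet_def by (simp add: algebra_simps power2_eq_square)
  finally have "(\<Sum>i\<le>Suc N. jet_matrix j i x * jet x i n) = frequency n ^ (2 * m) * ((potential x - (frequency n)\<^sup>2) * mode n x)" .
  moreover have "(\<lambda>x. jet x j n) = (\<lambda>x. frequency n ^ (2 * m) * mode' n x)" unfolding m jet_def by simp
  ultimately show ?thesis using DERIV_cmult[OF mode'_deriv[OF x], of "frequency n ^ (2 * m)" n] by simp
qed

text \<open>The top coefficient is fed only by the entry \<open>i = Suc j\<close> of
  \<open>jet_matrix\<close>, whose signs alternate between 1 and -1. Over N differentiations they
  multiply to (-1)^(N div 2), the sign in front of the point evaluation.\<close>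

lemma jet_combination_deriv:
  assumes c: "\<And>j. trig_span (c j)"
  shows "\<exists>c'. (\<forall>j. trig_span (c' j)) \<and> (\<forall>x. c' (Suc N) x = (if even N then 1 else - 1) * c N x) \<and>
    (\<forall>n x. 0 < x \<longrightarrow> x < pi \<longrightarrow>
      ((\<lambda>x. jet_combination x (\<lambda>j. c j x) N n) has_real_derivative jet_combination x (\<lambda>j. c' j x) (Suc N) n) (at x))"
proof -
  obtain d where d: "\<And>j. trig_span (d j)" "\<And>j x. 0 < x \<Longrightarrow> x < pi \<Longrightarrow> (c j has_real_derivative d j x) (at x)"
    using trig_span_deriv[OF c] by metis
  define c' where "c' i x = (if i \<le> N then d i x else 0) + (\<Sum>j\<le>N. jet_matrix j i x * c j x)" for i x
  have "trig_span (c' i)" for i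
  proof -
    have 1: "trig_span (\<lambda>x. if i \<le> N then d i x else 0)" using d(1) trig_span_0 by (cases "i \<le> N") simp_all
    have 2: "trig_span (\<lambda>x. jet_matrix j i x * c j x)" for j
    proof -
      have *: "trig_span (\<lambda>x. (if i = Suc j then (if even j then 1 else - 1) else 0) * c j x
          + (if odd j \<and> i = j - 1 then (\<alpha>\<^sup>2 - 1 / 4) / 4 * trig (- 2) 0 x * c j x + (\<beta>\<^sup>2 - 1 / 4) / 4 * trig 0 (- 2) x * c j x else 0))"
        by (cases "odd j \<and> i = j - 1"; simp only: if_True if_False simp_thms)
          (intro trig_span_add trig_span_cmult trig_span_mult trig_span_0 c)+
      have "(if i = Suc j then (if even j then 1 else - 1) else 0) * c j x
          + (if odd j \<and> i = j - 1 then (\<alpha>\<^sup>2 - 1 / 4) / 4 * trig (- 2) 0 x * c j x + (\<beta>\<^sup>2 - 1 / 4) / 4 * trig 0 (- 2) x * c j x else 0)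
        = jet_matrix j i x * c j x" for x
        unfolding jet_matrix_def distrib_right by (cases "odd j \<and> i = j - 1") (simp_all only: if_True if_False simp_thms distrib_right mult_zero_left)
      then show ?thesis using * by (simp only:)
    qed
    show ?thesis unfolding c'_def by (rule trig_span_add[OF 1 trig_span_sum[OF 2]])
  qed
  moreover have "c' (Suc N) x = (if even N then 1 else - 1) * c N x" for x
  proof -
    have "(\<Sum>j\<le>N. jet_matrix j (Suc N) x * c j x) = (\<Sum>j\<le>N. if j = N then (if even N then 1 else - 1) * c N x else 0)"
      by (intro sum.cong refl) (auto simp: jet_matrix_def)
    then show ?thesis by (simp add: c'_def)
  qed
  moreover have "((\<lambda>x. jet_combination x (\<lambda>j. c j x) N n) has_real_derivative jet_combination x (\<lambda>j. c' j x) (Suc N) n) (at x)"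
    if x: "0 < x" "x < pi" for n x
  proof -
    have "((\<lambda>x. \<Sum>j\<le>N. c j x * jet x j n) has_real_derivative
      (\<Sum>j\<le>N. d j x * jet x j n + (\<Sum>i\<le>Suc N. jet_matrix j i x * jet x i n) * c j x)) (at x)"
      by (intro DERIV_sum DERIV_mult d(2)[OF x] jet_deriv[OF x]) simp
    also have "(\<Sum>j\<le>N. d j x * jet x j n + (\<Sum>i\<le>Suc N. jet_matrix j i x * jet x i n) * c j x) = jet_combination x (\<lambda>j. c' j x) (Suc N) n"
    proof -
      have "(\<Sum>j\<le>N. (\<Sum>i\<le>Suc N. jet_matrix j i x * jet x i n) * c j x) = (\<Sum>j\<le>N. \<Sum>i\<le>Suc N. jet_matrix j i x * c j x * jet x i n)"
        unfolding sum_distrib_right by (simp only: mult_ac)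
      also have "\<dots> = (\<Sum>i\<le>Suc N. (\<Sum>j\<le>N. jet_matrix j i x * c j x) * jet x i n)"
        unfolding sum_distrib_right by (rule sum.swap)
      finally have 1: "(\<Sum>j\<le>N. (\<Sum>i\<le>Suc N. jet_matrix j i x * jet x i n) * c j x) = (\<Sum>i\<le>Suc N. (\<Sum>j\<le>N. jet_matrix j i x * c j x) * jet x i n)" .
      have 2: "(\<Sum>j\<le>N. d j x * jet x j n) = (\<Sum>i\<le>Suc N. (if i \<le> N then d i x else 0) * jet x i n)" by simp
      show ?thesis unfolding sum.distrib 1 2 jet_combination_def c'_def
        by (simp only: distrib_right sum.distrib)
    qed
    finally show ?thesis unfolding jet_combination_def .
  qed
  ultimately show ?thesis by blast
qed

lemma jacobi_fun_jet_expansion: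
  obtains c where "\<And>j. trig_span (c j)" "\<And>x. 0 < x \<Longrightarrow> x < pi \<Longrightarrow> c N x = (- 1) ^ (N div 2) / \<omega> x"
    "\<And>n x. 0 < x \<Longrightarrow> x < pi \<Longrightarrow> (deriv ^^ N) (jacobi_fun \<alpha> \<beta> n) x = jet_combination x (\<lambda>j. c j x) N n"
proof -
  have "\<exists>c. (\<forall>j. trig_span (c j)) \<and> (\<forall>x. 0 < x \<longrightarrow> x < pi \<longrightarrow> c N x = (- 1) ^ (N div 2) / \<omega> x)
    \<and> (\<forall>n x. 0 < x \<longrightarrow> x < pi \<longrightarrow> (deriv ^^ N) (jacobi_fun \<alpha> \<beta> n) x = jet_combination x (\<lambda>j. c j x) N n)"
  proof (induction N)
    case 0
    define c where "c j x = 1 * trig (- (\<alpha> + 1 / 2)) (- (\<beta> + 1 / 2)) x" for j :: nat and x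
    have "c 0 x = 1 / \<omega> x" if "0 < x" "x < pi" for x
    proof -
      have "c 0 x * \<omega> x = 1"
        unfolding c_def by (simp only: mult_1 trig_mult left_minus trig_0[OF that])
      then show ?thesis using trig_pos[OF that, of "\<alpha> + 1 / 2" "\<beta> + 1 / 2"] by (simp add: nonzero_eq_divide_eq)
    qed
    moreover have "jacobi_fun \<alpha> \<beta> n x = 1 / \<omega> x * mode n x" if "0 < x" "x < pi" for n x
      using trig_pos[OF that, of "\<alpha> + 1 / 2" "\<beta> + 1 / 2"] by (simp add: mode_def jacobi_fun_eq)
    moreover have "trig_span (c j)" for j unfolding c_def by (rule trig_span_monomial)
    ultimately show ?case by (intro exI[of _ c]) (simp add: jet_combination_def jet_def)
  next
    case (Suc N)
    then obtain c where c: "\<And>j. trig_span (c j)" "\<And>x. 0 < x \<Longrightarrow> x < pi \<Longrightarrow> c N x = (- 1) ^ (N div 2) / \<omega> x"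
      "\<And>n x. 0 < x \<Longrightarrow> x < pi \<Longrightarrow> (deriv ^^ N) (jacobi_fun \<alpha> \<beta> n) x = jet_combination x (\<lambda>j. c j x) N n" by blast
    obtain c' where c': "\<And>j. trig_span (c' j)" "\<And>x. c' (Suc N) x = (if even N then 1 else - 1) * c N x"
      "\<And>n x. 0 < x \<Longrightarrow> x < pi \<Longrightarrow>
      ((\<lambda>x. jet_combination x (\<lambda>j. c j x) N n) has_real_derivative jet_combination x (\<lambda>j. c' j x) (Suc N) n) (at x)"
      using jet_combination_deriv[where c=c and N=N, OF c(1)] by blast
    have "c' (Suc N) x = (- 1) ^ (Suc N div 2) / \<omega> x" if "0 < x" "x < pi" for x
      unfolding c'(2) c(2)[OF that] by (cases "even N") (auto elim!: evenE oddE)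
    moreover have "(deriv ^^ Suc N) (jacobi_fun \<alpha> \<beta> n) x = jet_combination x (\<lambda>j. c' j x) (Suc N) n" if x: "0 < x" "x < pi" for n x
    proof -
      have "((deriv ^^ N) (jacobi_fun \<alpha> \<beta> n) has_real_derivative jet_combination x (\<lambda>j. c' j x) (Suc N) n) (at x)"
        by (rule has_field_derivative_transform_within_open[OF c'(3)[OF x], where S="{0<..<pi}"]) (use x c(3) in auto)
      then show ?thesis by (simp add: DERIV_imp_deriv)
    qed
    ultimately show ?case using c'(1) by blast
  qed
  then show ?thesis using that by blast
qed

lemma jacobi_fun_deriv:
  assumes x: "0 < x" "x < pi"
  shows "((deriv ^^ N) (jacobi_fun \<alpha> \<beta> n) has_real_derivative (deriv ^^ Suc N) (jacobi_fun \<alpha> \<beta> n) x) (at x)"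
proof -
  obtain c where c: "\<And>j. trig_span (c j)" "\<And>x. 0 < x \<Longrightarrow> x < pi \<Longrightarrow> c N x = (- 1) ^ (N div 2) / \<omega> x"
    "\<And>n x. 0 < x \<Longrightarrow> x < pi \<Longrightarrow> (deriv ^^ N) (jacobi_fun \<alpha> \<beta> n) x = jet_combination x (\<lambda>j. c j x) N n"
    using jacobi_fun_jet_expansion[of N] by blast
  obtain D where "((\<lambda>x. jet_combination x (\<lambda>j. c j x) N n) has_real_derivative D) (at x)"
    using jet_combination_deriv[where c=c and N=N, OF c(1)] x by blast
  then have "((deriv ^^ N) (jacobi_fun \<alpha> \<beta> n) has_real_derivative D) (at x)"
    by (rule has_field_derivative_transform_within_open[where S="{0<..<pi}"]) (use x c(3) in auto)
  then show ?thesis by (simp add: DERIV_imp_deriv)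
qed

lemma jacobi_fun_deriv_bound:
  assumes ab: "0 < a" "a \<le> b" "b < pi"
  obtains C where "\<And>n x. a \<le> x \<Longrightarrow> x \<le> b \<Longrightarrow> \<bar>(deriv ^^ N) (jacobi_fun \<alpha> \<beta> n) x\<bar> \<le> C * (1 + frequency n) ^ N"
proof -
  obtain c where c: "\<And>j. trig_span (c j)" "\<And>x. 0 < x \<Longrightarrow> x < pi \<Longrightarrow> c N x = (- 1) ^ (N div 2) / \<omega> x"
    "\<And>n x. 0 < x \<Longrightarrow> x < pi \<Longrightarrow> (deriv ^^ N) (jacobi_fun \<alpha> \<beta> n) x = jet_combination x (\<lambda>j. c j x) N n"
    using jacobi_fun_jet_expansion[of N] by blast
  obtain V where V: "0 < V" "\<And>t j n. a \<le> t \<Longrightarrow> t \<le> b \<Longrightarrow> \<bar>jet t j n\<bar> \<le> V * (1 + frequency n) ^ j"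
    using jet_bound_on[OF ab] by blast
  have "\<exists>K. \<forall>x\<in>{a..b}. \<bar>c j x\<bar> \<le> K" for j
  proof -
    have "continuous_on {a..b} (c j)"
      using ab by (intro continuous_at_imp_continuous_on ballI trig_span_isCont[OF c(1)]) auto
    then have "bounded (c j ` {a..b})" by (intro compact_imp_bounded compact_continuous_image) auto
    then show ?thesis by (auto simp: bounded_iff)
  qed
  then obtain K where K: "\<And>j x. x \<in> {a..b} \<Longrightarrow> \<bar>c j x\<bar> \<le> K j" by metis
  show ?thesis
  proof (rule that)
    fix n x assume x: "a \<le> x" "x \<le> b"
    have K0: "0 \<le> K j" for j using K[of x j] x by (meson abs_ge_zero atLeastAtMost_iff order_trans)
    have "\<bar>jet_combination x (\<lambda>j. c j x) N n\<bar> \<le> (\<Sum>j\<le>N. \<bar>c j x * jet x j n\<bar>)"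
      unfolding jet_combination_def by (rule sum_abs)
    also have "\<dots> \<le> (\<Sum>j\<le>N. K j * (V * (1 + frequency n) ^ N))"
    proof (rule sum_mono)
      fix j assume "j \<in> {..N}"
      then have "V * (1 + frequency n) ^ j \<le> V * (1 + frequency n) ^ N"
        using V(1) e_nonneg[of n] by (intro mult_left_mono power_increasing) auto
      then have "\<bar>jet x j n\<bar> \<le> V * (1 + frequency n) ^ N" using V(2)[OF x, of j n] by linarith
      then show "\<bar>c j x * jet x j n\<bar> \<le> K j * (V * (1 + frequency n) ^ N)"
        unfolding abs_mult using K[of x j] x K0 by (intro mult_mono) auto
    qed
    also have "\<dots> = (\<Sum>j\<le>N. K j) * V * (1 + frequency n) ^ N" by (simp add: sum_distrib_right mult.assoc)
    finally show "\<bar>(deriv ^^ N) (jacobi_fun \<alpha> \<beta> n) x\<bar> \<le> (\<Sum>j\<le>N. K j) * V * (1 + frequency n) ^ N"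
      using c(3)[of x n] x ab by simp
  qed
qed

text \<open>Weierstrass' test on a compact neighbourhood of the point: derivatives of order N grow
  like (1 + frequency)^N, which the exponential factor outweighs.\<close>

lemma poisson_series_deriv:
  assumes t: "0 < t" and a: "\<And>n. \<bar>a n\<bar> \<le> A * exp (- (t * frequency n))" and x: "0 < x" "x < pi"
  shows "(deriv ^^ N) (\<lambda>u. \<Sum>n. a n * jacobi_fun \<alpha> \<beta> n u) x = (\<Sum>n. a n * (deriv ^^ N) (jacobi_fun \<alpha> \<beta> n) x)"
  using x
proof (induction N arbitrary: x)
  case (Suc N)
  define lo where "lo = x / 2"
  define hi where "hi = (x + pi) / 2"
  have ab: "0 < lo" "lo < x" "x < hi" "hi < pi" using Suc.prems by (auto simp: lo_def hi_def)
  have A: "0 \<le> A" using order_trans[OF abs_ge_zero a[of 0]] by (simp add: zero_le_mult_iff)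
  have bd: "\<exists>M. \<forall>n x. lo \<le> x \<longrightarrow> x \<le> hi \<longrightarrow> norm (a n * (deriv ^^ k) (jacobi_fun \<alpha> \<beta> n) x) \<le> M / (1 + (frequency n)\<^sup>2)" for k
  proof -
    obtain C where C: "\<And>n x. lo \<le> x \<Longrightarrow> x \<le> hi \<Longrightarrow> \<bar>(deriv ^^ k) (jacobi_fun \<alpha> \<beta> n) x\<bar> \<le> C * (1 + frequency n) ^ k"
      using jacobi_fun_deriv_bound[of lo hi k] ab by (metis less_imp_le order.strict_trans)
    have C0: "0 \<le> C"
      by (rule poly_bound_nonneg[OF C[of x]]) (use ab in auto)
    obtain K where K: "\<And>n. (1 + frequency n) ^ k * exp (- (t * frequency n)) \<le> K / (1 + (frequency n)\<^sup>2)"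
      using polynomial_exp_summable_bound[OF t] by blast
    have "norm (a n * (deriv ^^ k) (jacobi_fun \<alpha> \<beta> n) x) \<le> (A * C * K) / (1 + (frequency n)\<^sup>2)" if x: "lo \<le> x" "x \<le> hi" for n x
    proof -
      have "norm (a n * (deriv ^^ k) (jacobi_fun \<alpha> \<beta> n) x) \<le> (A * exp (- (t * frequency n))) * (C * (1 + frequency n) ^ k)"
        unfolding real_norm_def abs_mult using a[of n] C[OF x, of n] A by (intro mult_mono) auto
      also have "\<dots> = (A * C) * ((1 + frequency n) ^ k * exp (- (t * frequency n)))" by (simp add: mult_ac)
      also have "\<dots> \<le> (A * C) * (K / (1 + (frequency n)\<^sup>2))" using A C0 by (intro mult_left_mono K) auto
      finally show ?thesis by simp
    qed
    then show ?thesis by blast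
  qed
  obtain M1 where M1: "\<And>n x. lo \<le> x \<Longrightarrow> x \<le> hi \<Longrightarrow> norm (a n * (deriv ^^ Suc N) (jacobi_fun \<alpha> \<beta> n) x) \<le> M1 / (1 + (frequency n)\<^sup>2)"
    using bd[of "Suc N"] by blast
  obtain M0 where M0: "\<And>n x. lo \<le> x \<Longrightarrow> x \<le> hi \<Longrightarrow> norm (a n * (deriv ^^ N) (jacobi_fun \<alpha> \<beta> n) x) \<le> M0 / (1 + (frequency n)\<^sup>2)"
    using bd[of N] by blast
  have "((\<lambda>x. \<Sum>n. a n * (deriv ^^ N) (jacobi_fun \<alpha> \<beta> n) x) has_real_derivative (\<Sum>n. a n * (deriv ^^ Suc N) (jacobi_fun \<alpha> \<beta> n) x)) (at x)"
  proof (rule has_field_derivative_series'(2)[of "{lo..hi}"])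
    show "((\<lambda>x. a n * (deriv ^^ N) (jacobi_fun \<alpha> \<beta> n) x) has_real_derivative a n * (deriv ^^ Suc N) (jacobi_fun \<alpha> \<beta> n) y) (at y within {lo..hi})"
      if "y \<in> {lo..hi}" for n y
      by (rule has_field_derivative_at_within[OF DERIV_cmult[OF jacobi_fun_deriv]]) (use that ab in auto)
    show "uniformly_convergent_on {lo..hi} (\<lambda>n x. \<Sum>i<n. a i * (deriv ^^ Suc N) (jacobi_fun \<alpha> \<beta> i) x)"
      by (rule Weierstrass_m_test'[OF M1 inverse_energy_summable]) auto
    show "summable (\<lambda>n. a n * (deriv ^^ N) (jacobi_fun \<alpha> \<beta> n) x)"
      by (rule summable_comparison_test'[OF inverse_energy_summable M0]) (use ab in auto)
  qed (use ab in auto)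
  then have "((deriv ^^ N) (\<lambda>u. \<Sum>n. a n * jacobi_fun \<alpha> \<beta> n u) has_real_derivative (\<Sum>n. a n * (deriv ^^ Suc N) (jacobi_fun \<alpha> \<beta> n) x)) (at x)"
    by (rule has_field_derivative_transform_within_open[where S="{0<..<pi}"]) (use Suc in auto)
  then show ?case by (simp add: DERIV_imp_deriv)
qed simp

text \<open>Only \<phi> is brought to normal form. In \<theta> the derivatives of the Jacobi
  functions themselves serve as coefficients, so a single factor \<open>\<omega> \<phi>\<close> is
  divided out.\<close>

lemma riesz_jacobi_kernel_eq:
  assumes \<theta>: "0 < \<theta>" "\<theta> < pi" and \<phi>: "0 < \<phi>" "\<phi> < pi"
  shows "riesz_jacobi_kernel \<alpha> \<beta> N \<theta> \<phi> = riesz (\<lambda>n. (deriv ^^ N) (jacobi_fun \<alpha> \<beta> n) \<theta>) N \<phi> / \<omega> \<phi>"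
proof -
  have \<omega>: "0 < \<omega> \<phi>" by (rule trig_pos[OF \<phi>])
  obtain V where V: "\<And>n. \<bar>mode n \<phi>\<bar> \<le> V" using v_bounded[of \<phi> \<phi>] \<phi> by (metis order_refl)
  have m: "jacobi_fun \<alpha> \<beta> n \<phi> = mode n \<phi> / \<omega> \<phi>" for n using \<omega> by (simp add: mode_def jacobi_fun_eq)
  have "(deriv ^^ N) (\<lambda>u. jacobi_poisson_kernel \<alpha> \<beta> t u \<phi>) \<theta> = heat (\<lambda>n. (deriv ^^ N) (jacobi_fun \<alpha> \<beta> n) \<theta>) t \<phi> / \<omega> \<phi>"
    if t: "0 < t" for t
  proof -
    define a where "a n = exp (- (t * frequency n)) * (mode n \<phi> / \<omega> \<phi>)" for n
    have "\<bar>a n\<bar> \<le> (V / \<omega> \<phi>) * exp (- (t * frequency n))" for n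
      using V[of n] \<omega> by (simp add: a_def abs_mult divide_right_mono mult.commute)
    note d = poisson_series_deriv[OF t this \<theta>]
    have "(\<lambda>u. jacobi_poisson_kernel \<alpha> \<beta> t u \<phi>) = (\<lambda>u. \<Sum>n. a n * jacobi_fun \<alpha> \<beta> n u)"
      by (simp add: jacobi_poisson_kernel_def a_def m frequency_def mult_ac)
    then have "(deriv ^^ N) (\<lambda>u. jacobi_poisson_kernel \<alpha> \<beta> t u \<phi>) \<theta> = (\<Sum>n. a n * (deriv ^^ N) (jacobi_fun \<alpha> \<beta> n) \<theta>)"
      by (simp only: d)
    also have "\<dots> = (\<Sum>n. ((deriv ^^ N) (jacobi_fun \<alpha> \<beta> n) \<theta> * mode n \<phi> * exp (- (t * frequency n))) / \<omega> \<phi>)"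
      by (simp add: a_def mult_ac)
    also have "\<dots> = heat (\<lambda>n. (deriv ^^ N) (jacobi_fun \<alpha> \<beta> n) \<theta>) t \<phi> / \<omega> \<phi>"
    proof -
      obtain C where C: "\<And>n x. \<theta> \<le> x \<Longrightarrow> x \<le> \<theta> \<Longrightarrow> \<bar>(deriv ^^ N) (jacobi_fun \<alpha> \<beta> n) x\<bar> \<le> C * (1 + frequency n) ^ N"
        using jacobi_fun_deriv_bound[of \<theta> \<theta> N] \<theta> by (metis order_refl)
      show ?thesis unfolding heat_def
        by (rule suminf_divide[OF heat_summable[OF C[OF order_refl order_refl] \<phi> t]])
    qed
    finally show ?thesis .
  qed
  then have "(LBINT t:{0<..}. (deriv ^^ N) (\<lambda>u. jacobi_poisson_kernel \<alpha> \<beta> t u \<phi>) \<theta> * t ^ (N - 1))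
    = (LBINT t:{0<..}. (1 / \<omega> \<phi>) * (heat (\<lambda>n. (deriv ^^ N) (jacobi_fun \<alpha> \<beta> n) \<theta>) t \<phi> * t ^ (N - 1)))"
    by (intro set_lebesgue_integral_cong) auto
  then show ?thesis unfolding riesz_jacobi_kernel_def riesz_def set_integral_mult_right by simp
qed

end

section \<open>Riesz-Jacobi transforms\<close>

lemma deriv_funpow_const: "1 \<le> N \<Longrightarrow> (deriv ^^ N) (\<lambda>x :: real. c) = (\<lambda>x. 0 :: real)"
proof (induction N rule: nat_induct_at_least)
  case (Suc n)
  then show ?case by (simp add: fun_eq_iff)
qed (simp add: fun_eq_iff)

lemma test_function_support:
  assumes f: "test_function_on {a<..<b} f" and \<theta>: "\<theta> \<in> {a<..<b}"
  obtains A B m M where "a < A" "A < m" "m \<le> M" "M < B" "B < b" "A < \<theta>" "\<theta> < B" "\<And>x. x \<notin> {m..M} \<Longrightarrow> f x = 0"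
proof -
  \<comment> \<open>Including \<theta> makes the interval to be chosen contain the evaluation point
    even when it lies outside the support.\<close>
  define K where "K = insert \<theta> (closure {x. f x \<noteq> 0})"
  have K: "compact K" "K \<noteq> {}" "K \<subseteq> {a<..<b}" using f \<theta> by (auto simp: K_def test_function_on_def)
  obtain m where m: "m \<in> K" "\<And>x. x \<in> K \<Longrightarrow> m \<le> x" using compact_attains_inf[OF K(1,2)] by blast
  obtain M where M: "M \<in> K" "\<And>x. x \<in> K \<Longrightarrow> x \<le> M" using compact_attains_sup[OF K(1,2)] by blast
  have mM: "a < m" "m \<le> \<theta>" "\<theta> \<le> M" "M < b" using K(3) m M by (auto simp: K_def)
  have "f x = 0" if "x \<notin> {m..M}" for x
  proof (rule ccontr)
    assume "f x \<noteq> 0"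
    then have "x \<in> K" using closure_subset[of "{x. f x \<noteq> 0}"] by (auto simp: K_def)
    then show False using m(2) M(2) that by auto
  qed
  then show ?thesis using mM by (intro that[of "(a + m) / 2" m M "(M + b) / 2"]) auto
qed

lemma test_function_derivs:
  assumes f: "test_function_on S f" and z: "\<And>x. x \<notin> {m..M} \<Longrightarrow> f x = 0"
  obtains f1 f2 where "\<And>x. (f has_vector_derivative f1 x) (at x)" "\<And>x. (f1 has_vector_derivative f2 x) (at x)"
    "continuous_on UNIV f2" "\<And>x. x \<notin> {m..M} \<Longrightarrow> f1 x = 0"
proof -
  define f1 where "f1 x = vector_derivative f (at x)" for x
  define f2 where "f2 x = vector_derivative f1 (at x)" for x
  have D: "((\<lambda>g y. vector_derivative g (at y)) ^^ k) f differentiable (at x)" for k x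
    using f by (simp add: test_function_on_def)
  have d: "f differentiable (at x)" "f1 differentiable (at x)" "f2 differentiable (at x)" for x
    using D[of 0 x] D[of 1 x] D[of 2 x] by (simp_all add: f1_def[abs_def] f2_def[abs_def] numeral_2_eq_2)
  have 1: "(f has_vector_derivative f1 x) (at x)" "(f1 has_vector_derivative f2 x) (at x)" for x
    using d[of x] by (simp_all add: f1_def f2_def vector_derivative_works)
  have 2: "continuous_on UNIV f2"
    by (intro continuous_at_imp_continuous_on ballI differentiable_imp_continuous_within d(3))
  have 3: "f1 x = 0" if "x \<notin> {m..M}" for x
  proof -
    have "(f has_vector_derivative 0) (at x)"
      by (rule has_vector_derivative_transform_within_open[of "\<lambda>x. 0" 0 x "- {m..M}"]) (use z that in \<open>auto simp: open_Compl\<close>)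
    then show ?thesis using 1(1) vector_derivative_unique_at by blast
  qed
  show ?thesis by (rule that[OF 1 2 3])
qed

context jacobi
begin

lemma jacobi_measure_transfer:
  fixes g h :: "real \<Rightarrow> complex"
  assumes eq: "\<And>x. indicat_real {0<..<pi} x *\<^sub>R (w x *\<^sub>R g x) = indicat_real S x *\<^sub>R h x"
    and h: "set_integrable lborel S h"
  shows "integrable (jacobi_measure \<alpha> \<beta>) g" and "(LINT x|jacobi_measure \<alpha> \<beta>. g x) = (LBINT x:S. h x)"
proof -
  have "set_integrable lborel {0<..<pi} (\<lambda>x. w x *\<^sub>R g x)" using h unfolding set_integrable_def eq .
  note * = jacobi_measure_integral[OF this]
  show "integrable (jacobi_measure \<alpha> \<beta>) g" by (rule *(1))
  show "(LINT x|jacobi_measure \<alpha> \<beta>. g x) = (LBINT x:S. h x)" unfolding *(2) set_lebesgue_integral_def eq ..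
qed

text \<open>Absorbing \<open>\<omega>\<close> into the test function makes its Jacobi coefficients
  plain integrals against modes. Two integrations by parts give their decay, with no boundary terms
  since \<open>A\<close> and \<open>B\<close> lie outside \<open>{m..M}\<close>.\<close>

lemma weighted_test_function:
  assumes f: "test_function_on {0<..<pi} f" and z: "\<And>x. x \<notin> {m..M} \<Longrightarrow> f x = 0"
    and AB: "0 < A" "A < m" "m \<le> M" "M < B" "B < pi"
  defines "F \<equiv> \<lambda>x. \<omega> x *\<^sub>R f x"
  obtains K0 L where "continuous_on UNIV F"
    "\<And>n. norm (integral {A..B} (\<lambda>x. mode n x *\<^sub>R F x)) \<le> K0 / (1 + (frequency n)\<^sup>2)"
    "\<And>p q. p \<in> {A..B} \<Longrightarrow> q \<in> {A..B} \<Longrightarrow> norm (F p - F q) \<le> L * \<bar>p - q\<bar>"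
proof -
  obtain f1 f2 where f1: "\<And>x. (f has_vector_derivative f1 x) (at x)" and f2: "\<And>x. (f1 has_vector_derivative f2 x) (at x)"
    and f2c: "continuous_on UNIV f2" and z1: "\<And>x. x \<notin> {m..M} \<Longrightarrow> f1 x = 0"
    by (rule test_function_derivs[OF f z]) (assumption, blast)
  have fc: "continuous_on S f" "continuous_on S f1" "continuous_on S f2" for S
    using f1 f2 continuous_on_subset[OF f2c]
    by (auto intro!: continuous_at_imp_continuous_on has_vector_derivative_continuous)
  obtain w1 where w1: "trig_span w1" "\<And>x. 0 < x \<Longrightarrow> x < pi \<Longrightarrow> (\<omega> has_real_derivative w1 x) (at x)"
    using trig_span_deriv[OF trig_span_monomial[of 1 "\<alpha> + 1 / 2" "\<beta> + 1 / 2"]] by auto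
  obtain w2 where w2: "trig_span w2" "\<And>x. 0 < x \<Longrightarrow> x < pi \<Longrightarrow> (w1 has_real_derivative w2 x) (at x)"
    using trig_span_deriv[OF w1(1)] by auto
  define F1 where "F1 x = \<omega> x *\<^sub>R f1 x + w1 x *\<^sub>R f x" for x
  define F2 where "F2 x = (\<omega> x *\<^sub>R f2 x + w1 x *\<^sub>R f1 x) + (w1 x *\<^sub>R f1 x + w2 x *\<^sub>R f x)" for x
  have dF: "(F has_vector_derivative F1 x) (at x)" and dF1: "(F1 has_vector_derivative F2 x) (at x)" if "0 < x" "x < pi" for x
    unfolding F_def F1_def[abs_def] F2_def
    by (intro has_vector_derivative_add has_vector_derivative_scaleR w1(2) w2(2) f1 f2 that)+
  have in0: "0 < x" "x < pi" if "x \<in> {A..B}" for x using that AB by auto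
  have tc: "continuous_on {A..B} w" if "trig_span w" for w
    by (intro continuous_at_imp_continuous_on ballI trig_span_isCont that in0)
  have \<omega>c: "continuous_on {A..B} \<omega>" by (rule weight_continuous_on) (use AB in auto)
  have c: "continuous_on {A..B} F" "continuous_on {A..B} F1" "continuous_on {A..B} F2"
    unfolding F_def F1_def[abs_def] F2_def[abs_def] by (intro continuous_intros \<omega>c tc w1 w2 fc)+
  have Fc: "continuous_on UNIV F"
  proof -
    have "continuous_on {0<..<pi} F"
      by (intro continuous_at_imp_continuous_on ballI has_vector_derivative_continuous[OF dF]) auto
    moreover have "continuous_on (- {m..M}) F"
      by (rule continuous_on_eq[OF continuous_on_const[of _ 0]]) (simp add: F_def z)
    ultimately have "continuous_on ({0<..<pi} \<union> - {m..M}) F"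
      by (intro continuous_on_open_Un) (auto simp: open_Compl)
    moreover have "{0<..<pi} \<union> - {m..M} = UNIV" using AB by auto
    ultimately show ?thesis by simp
  qed
  have bounded: "\<exists>K. \<forall>x\<in>{A..B}. norm (h x) \<le> K" if "continuous_on {A..B} h" for h :: "real \<Rightarrow> complex"
    using compact_imp_bounded[OF compact_continuous_image[OF that compact_Icc]] by (auto simp: bounded_iff)
  obtain L where L: "\<And>x. x \<in> {A..B} \<Longrightarrow> norm (F1 x) \<le> L" using bounded[OF c(2)] by blast
  have Lip: "norm (F p - F q) \<le> L * \<bar>p - q\<bar>" if "p \<in> {A..B}" "q \<in> {A..B}" for p q
  proof -
    have "norm (F p - F q) \<le> L * norm (p - q)"
    proof (rule differentiable_bound[of "{A..B}" F "\<lambda>x h. h *\<^sub>R F1 x"])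
      show "(F has_derivative (\<lambda>h. h *\<^sub>R F1 x)) (at x within {A..B})" if "x \<in> {A..B}" for x
        using has_vector_derivative_at_within[OF dF[OF in0[OF that]]] by (simp add: has_vector_derivative_def)
      show "onorm (\<lambda>h. h *\<^sub>R F1 x) \<le> L" if "x \<in> {A..B}" for x
      proof (rule onorm_le)
        fix h
        show "norm (h *\<^sub>R F1 x) \<le> L * norm h" using mult_right_mono[OF L[OF that], of "\<bar>h\<bar>"] by (simp add: mult.commute)
      qed
    qed (use that in auto)
    then show ?thesis by simp
  qed
  have AB': "0 < A" "A \<le> B" "B < pi" using AB by auto
  obtain V where V: "V > 0" "\<And>n x. A \<le> x \<Longrightarrow> x \<le> B \<Longrightarrow> \<bar>mode n x\<bar> \<le> V" using v_bounded[OF AB'] by metis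
  have mc: "continuous_on {A..B} (mode n)" "continuous_on {A..B} (mode' n)" for n
    using AB' by (auto intro!: v_continuous_on v'_continuous_on)
  have mode_integral: "\<exists>K\<ge>0. \<forall>n. norm (integral {A..B} (\<lambda>x. mode n x *\<^sub>R h x)) \<le> K" if h: "continuous_on {A..B} h" for h :: "real \<Rightarrow> complex"
  proof -
    obtain K where K: "\<And>x. x \<in> {A..B} \<Longrightarrow> norm (h x) \<le> K" using bounded[OF h] by blast
    have K0: "0 \<le> K" using order_trans[OF norm_ge_zero K[of A]] AB' by simp
    have "norm (integral {A..B} (\<lambda>x. mode n x *\<^sub>R h x)) \<le> (V * K) * (B - A)" for n
    proof (rule integral_bound[OF AB'(2)])
      show "continuous_on {A..B} (\<lambda>x. mode n x *\<^sub>R h x)" by (intro continuous_intros mc h)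
      show "norm (mode n x *\<^sub>R h x) \<le> V * K" if "x \<in> {A..B}" for x
        unfolding norm_scaleR using V K[OF that] that K0 by (intro mult_mono) auto
    qed
    moreover have "0 \<le> (V * K) * (B - A)" using V(1) K0 AB' by simp
    ultimately show ?thesis by blast
  qed
  \<comment> \<open>G is F'' - q F, so that the squared frequency times a coefficient of
    \<open>F\<close> is minus the coefficient of \<open>G\<close>.\<close>
  define G where "G x = F2 x - potential x *\<^sub>R F x" for x
  have Gc: "continuous_on {A..B} G"
    unfolding G_def[abs_def] using AB'
    by (intro continuous_intros c continuous_on_subset[OF potential_continuous]) auto
  obtain K1 where K1: "K1 \<ge> 0" "\<And>n. norm (integral {A..B} (\<lambda>x. mode n x *\<^sub>R G x)) \<le> K1" using mode_integral[OF Gc] by blast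
  obtain K2 where K2: "K2 \<ge> 0" "\<And>n. norm (integral {A..B} (\<lambda>x. mode n x *\<^sub>R F x)) \<le> K2" using mode_integral[OF c(1)] by blast
  have decay: "norm (integral {A..B} (\<lambda>x. mode n x *\<^sub>R F x)) \<le> (K1 + K2) / (1 + (frequency n)\<^sup>2)" for n
  proof -
    define k where "k = integral {A..B} (\<lambda>x. mode n x *\<^sub>R F x)"
    define W where "W x = mode n x *\<^sub>R F1 x - mode' n x *\<^sub>R F x" for x
    have "((\<lambda>x. mode n x *\<^sub>R G x + (frequency n)\<^sup>2 *\<^sub>R (mode n x *\<^sub>R F x)) has_integral W B - W A) {A..B}"
    proof (rule fundamental_theorem_of_calculus[OF AB'(2)])
      fix x assume x: "x \<in> {A..B}"
      have "(W has_vector_derivative (mode n x *\<^sub>R F2 x + mode' n x *\<^sub>R F1 x)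
          - (mode' n x *\<^sub>R F1 x + ((potential x - (frequency n)\<^sup>2) * mode n x) *\<^sub>R F x)) (at x)"
        unfolding W_def[abs_def]
        by (intro has_vector_derivative_diff has_vector_derivative_scaleR mode_deriv mode'_deriv dF dF1 in0[OF x])
      also have "(mode n x *\<^sub>R F2 x + mode' n x *\<^sub>R F1 x)
          - (mode' n x *\<^sub>R F1 x + ((potential x - (frequency n)\<^sup>2) * mode n x) *\<^sub>R F x)
        = mode n x *\<^sub>R G x + (frequency n)\<^sup>2 *\<^sub>R (mode n x *\<^sub>R F x)"
        by (simp add: G_def algebra_simps)
      finally show "(W has_vector_derivative mode n x *\<^sub>R G x + (frequency n)\<^sup>2 *\<^sub>R (mode n x *\<^sub>R F x)) (at x within {A..B})"
        by (rule has_vector_derivative_at_within)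
    qed
    moreover have "W A = 0" "W B = 0" using z[of A] z[of B] z1[of A] z1[of B] AB by (auto simp: W_def F1_def F_def)
    moreover have "((\<lambda>x. mode n x *\<^sub>R G x + (frequency n)\<^sup>2 *\<^sub>R (mode n x *\<^sub>R F x)) has_integral
        integral {A..B} (\<lambda>x. mode n x *\<^sub>R G x) + (frequency n)\<^sup>2 *\<^sub>R k) {A..B}"
      unfolding k_def
      by (intro has_integral_add has_integral_cmul integrable_integral integrable_continuous_real continuous_intros mc Gc c)
    ultimately have "integral {A..B} (\<lambda>x. mode n x *\<^sub>R G x) + (frequency n)\<^sup>2 *\<^sub>R k = 0"
      by (metis (no_types, lifting) diff_zero has_integral_unique)
    then have "(frequency n)\<^sup>2 *\<^sub>R k = - integral {A..B} (\<lambda>x. mode n x *\<^sub>R G x)" by (simp add: eq_neg_iff_add_eq_0 add.commute)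
    then have "norm ((frequency n)\<^sup>2 *\<^sub>R k) \<le> K1" using K1(2)[of n] by simp
    then have "(frequency n)\<^sup>2 * norm k \<le> K1" by simp
    moreover have "norm k \<le> K2" unfolding k_def by (rule K2(2))
    ultimately have "norm k * (1 + (frequency n)\<^sup>2) \<le> K1 + K2" by (simp add: distrib_left mult.commute)
    moreover have "0 < 1 + (frequency n)\<^sup>2" by (simp add: add_pos_nonneg)
    ultimately show ?thesis by (simp add: k_def[symmetric] pos_le_divide_eq)
  qed
  show ?thesis by (rule that[OF Fc decay Lip])
qed

lemma riesz_jacobi_representation:
  assumes N: "1 \<le> N" and f: "test_function_on {0<..<pi} f" and \<theta>: "\<theta> \<in> {0<..<pi}"
  shows "odd N \<Longrightarrow> has_pv_integral (\<lambda>\<phi>. complex_of_real (riesz_jacobi_kernel \<alpha> \<beta> N \<theta> \<phi>) * f \<phi>)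
      (riesz_jacobi_transform \<alpha> \<beta> N f \<theta>) (jacobi_measure \<alpha> \<beta>) \<theta>"
    and "even N \<Longrightarrow> integrable (jacobi_measure \<alpha> \<beta>) (\<lambda>\<phi>. complex_of_real (riesz_jacobi_kernel \<alpha> \<beta> N \<theta> \<phi>) * f \<phi>)"
    and "even N \<Longrightarrow> riesz_jacobi_transform \<alpha> \<beta> N f \<theta> = (-1) ^ (N div 2) * f \<theta> +
      (LINT \<phi>|jacobi_measure \<alpha> \<beta>. complex_of_real (riesz_jacobi_kernel \<alpha> \<beta> N \<theta> \<phi>) * f \<phi>)"
proof -
  obtain A B m M where AB: "0 < A" "A < m" "m \<le> M" "M < B" "B < pi" "A < \<theta>" "\<theta> < B"
    and z: "\<And>x. x \<notin> {m..M} \<Longrightarrow> f x = 0"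
    by (rule test_function_support[OF f \<theta>]) blast
  define F where "F x = \<omega> x *\<^sub>R f x" for x
  obtain K0 L where F: "continuous_on UNIV F"
    and k: "\<And>n. norm (integral {A..B} (\<lambda>x. mode n x *\<^sub>R F x)) \<le> K0 / (1 + (frequency n)\<^sup>2)"
    and Lip: "\<And>p q. p \<in> {A..B} \<Longrightarrow> q \<in> {A..B} \<Longrightarrow> norm (F p - F q) \<le> L * \<bar>p - q\<bar>"
    unfolding F_def[abs_def] by (rule weighted_test_function[OF f z AB(1-5)]) (assumption, blast)
  have AB': "0 < A" "A \<le> B" "B < pi" using AB by auto
  have t: "0 < \<theta>" "\<theta> < pi" using \<theta> by auto
  have f0: "f x = 0" if "x \<notin> {A..B}" for x using z[of x] that AB by auto
  have F0: "F x = 0" if "x \<notin> {A..B}" for x using f0[OF that] by (simp add: F_def)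
  have FAB: "continuous_on {A..B} F" using F by (rule continuous_on_subset) simp
  obtain c where c: "\<And>j. trig_span (c j)" "\<And>x. 0 < x \<Longrightarrow> x < pi \<Longrightarrow> c N x = (- 1) ^ (N div 2) / \<omega> x"
    "\<And>n x. 0 < x \<Longrightarrow> x < pi \<Longrightarrow> (deriv ^^ N) (jacobi_fun \<alpha> \<beta> n) x = jet_combination x (\<lambda>j. c j x) N n"
    using jacobi_fun_jet_expansion[of N] by blast
  define g where "g = jet_combination \<theta> (\<lambda>j. c j \<theta>) N"
  have g: "(\<lambda>n. (deriv ^^ N) (jacobi_fun \<alpha> \<beta> n) \<theta>) = g" unfolding g_def using c(3)[OF t] by (simp add: fun_eq_iff)
  \<comment> \<open>The polynomial of degree 0 is constant, so its derivatives of order N >= 1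
    vanish; this matches the transform starting at degree 1 and the dropped entry of
    \<open>lower\<close>.\<close>
  have g0: "g 0 = 0"
  proof -
    have "jacobi_fun \<alpha> \<beta> 0 = (\<lambda>x. jacobi_const \<alpha> \<beta> 0)" by (simp add: fun_eq_iff jacobi_fun_def jacobi_poly_def)
    then show ?thesis unfolding g[symmetric] by (simp only: deriv_funpow_const[OF N])
  qed
  obtain Cg where Cg: "\<And>n. \<bar>g n\<bar> \<le> Cg * (1 + frequency n) ^ N"
    using jet_combination_bound[OF t] unfolding g_def by blast
  define R where "R = riesz g N"
  define T where "T = (\<Sum>n. lower N g n *\<^sub>R integral {A..B} (\<lambda>x. mode n x *\<^sub>R F x))"
  have g0': "jet_combination \<theta> (\<lambda>j. c j \<theta>) N 0 = 0" using g0 by (simp add: g_def)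
  have Lip': "norm (F p - F \<theta>) \<le> L * \<bar>p - \<theta>\<bar>" if "A \<le> p" "p \<le> B" for p
    using that AB by (intro Lip) auto
  note main = riesz_expansion[where F=F and L=L and c="\<lambda>j. c j \<theta>", OF N AB(1,6,7,5) F _ k _ g0',
      folded g_def, folded R_def T_def]
  have \<theta>AB: "\<theta> \<in> {A..B}" using AB by simp
  have \<omega>: "0 < \<omega> x" if "x \<in> {A..B}" for x using that AB by (intro trig_pos) auto
  have ind: "indicat_real {0<..<pi} x = 1" if "x \<in> {A..B}" for x using that AB by simp
  have kernel: "w x *\<^sub>R (complex_of_real (riesz_jacobi_kernel \<alpha> \<beta> N \<theta> x) * f x) = R x *\<^sub>R F x" if x: "x \<in> {A..B}" for x
  proof -
    have "riesz_jacobi_kernel \<alpha> \<beta> N \<theta> x = R x / \<omega> x"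
      unfolding R_def g[symmetric] by (rule riesz_jacobi_kernel_eq[OF t]) (use x AB in auto)
    then have "w x *\<^sub>R (complex_of_real (riesz_jacobi_kernel \<alpha> \<beta> N \<theta> x) * f x) = ((\<omega> x * \<omega> x) * (R x / \<omega> x)) *\<^sub>R f x"
      by (simp add: root_weight scaleR_conv_of_real)
    then show ?thesis using \<omega>[OF x] by (simp add: F_def mult.commute)
  qed
  have coeff: "jacobi_coeff \<alpha> \<beta> f n = integral {A..B} (\<lambda>x. mode n x *\<^sub>R F x)" for n
  proof -
    have "continuous_on {A..B} (mode n)" using AB' by (auto intro!: v_continuous_on)
    then have i: "set_integrable lborel {A..B} (\<lambda>x. mode n x *\<^sub>R F x)"
      by (intro borel_integrable_atLeastAtMost' continuous_intros FAB)
    have "indicat_real {0<..<pi} x *\<^sub>R (w x *\<^sub>R (f x * complex_of_real (jacobi_fun \<alpha> \<beta> n x)))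
      = indicat_real {A..B} x *\<^sub>R (mode n x *\<^sub>R F x)" for x
    proof (cases "x \<in> {A..B}")
      case True
      have "w x *\<^sub>R (f x * complex_of_real (jacobi_fun \<alpha> \<beta> n x)) = mode n x *\<^sub>R F x"
        unfolding root_weight[symmetric] by (simp add: F_def mode_def jacobi_fun_eq scaleR_conv_of_real)
      then show ?thesis using True ind[OF True] by simp
    qed (simp add: f0)
    from jacobi_measure_transfer(2)[OF this i] show ?thesis
      unfolding jacobi_coeff_def using set_borel_integral_eq_integral(2)[OF i] by simp
  qed
  have transform: "riesz_jacobi_transform \<alpha> \<beta> N f \<theta> = T"
  proof -
    have s: "summable (\<lambda>n. lower N g n *\<^sub>R integral {A..B} (\<lambda>x. mode n x *\<^sub>R F x))"
      by (rule heat_integral_limit(1)[OF AB' FAB k lower_bounded[OF Cg] LIMSEQ_inverse_real_of_nat]) simp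
    have "complex_of_real (1 / \<bar>real (Suc n) + jacobi_tau \<alpha> \<beta>\<bar> ^ N) * jacobi_coeff \<alpha> \<beta> f (Suc n)
        * complex_of_real ((deriv ^^ N) (jacobi_fun \<alpha> \<beta> (Suc n)) \<theta>)
      = lower N g (Suc n) *\<^sub>R integral {A..B} (\<lambda>x. mode (Suc n) x *\<^sub>R F x)" for n
      unfolding coeff g[symmetric] by (simp add: lower_def frequency_def scaleR_conv_of_real)
    then have "riesz_jacobi_transform \<alpha> \<beta> N f \<theta> = (\<Sum>n. lower N g (Suc n) *\<^sub>R integral {A..B} (\<lambda>x. mode (Suc n) x *\<^sub>R F x))"
      unfolding riesz_jacobi_transform_def by (simp only:)
    also have "\<dots> = T" unfolding T_def suminf_split_head[OF s] by (simp add: lower_def)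
    finally show ?thesis .
  qed
  define G where "G \<phi> = complex_of_real (riesz_jacobi_kernel \<alpha> \<beta> N \<theta> \<phi>) * f \<phi>" for \<phi>
  have even_case: "integrable (jacobi_measure \<alpha> \<beta>) G"
    "riesz_jacobi_transform \<alpha> \<beta> N f \<theta> = (-1) ^ (N div 2) * f \<theta> + (LINT \<phi>|jacobi_measure \<alpha> \<beta>. G \<phi>)" if ev: "even N"
  proof -
    have RI: "set_integrable lborel {A..B} (\<lambda>p. R p *\<^sub>R F p)" by (rule main(1)) (fact F0 Lip' ev)+
    have eq: "indicat_real {0<..<pi} x *\<^sub>R (w x *\<^sub>R G x) = indicat_real {A..B} x *\<^sub>R (R x *\<^sub>R F x)" for x
      using kernel[of x] ind[of x] by (cases "x \<in> {A..B}") (simp_all add: G_def f0)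
    show "integrable (jacobi_measure \<alpha> \<beta>) G" by (rule jacobi_measure_transfer(1)[OF eq RI])
    have "T = c N \<theta> *\<^sub>R F \<theta> + (LBINT p:{A..B}. R p *\<^sub>R F p)" by (rule main(2)) (fact F0 Lip' ev)+
    moreover have "c N \<theta> *\<^sub>R F \<theta> = (-1) ^ (N div 2) * f \<theta>"
      using c(2)[OF t] \<omega>[OF \<theta>AB] by (simp add: F_def scaleR_conv_of_real)
    ultimately show "riesz_jacobi_transform \<alpha> \<beta> N f \<theta> = (-1) ^ (N div 2) * f \<theta> + (LINT \<phi>|jacobi_measure \<alpha> \<beta>. G \<phi>)"
      unfolding transform jacobi_measure_transfer(2)[OF eq RI] by simp
  qed
  have odd_case: "has_pv_integral G (riesz_jacobi_transform \<alpha> \<beta> N f \<theta>) (jacobi_measure \<alpha> \<beta>) \<theta>" if od: "odd N"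
  proof -
    define P where "P \<epsilon> = {\<phi>. 0 < \<phi> \<and> \<phi> < pi \<and> \<bar>\<phi> - \<theta>\<bar> > \<epsilon>}" for \<epsilon>
    have RI: "set_integrable lborel (punctured A B \<theta> \<epsilon>) (\<lambda>p. R p *\<^sub>R F p)" if "0 < \<epsilon>" for \<epsilon>
      by (rule main(3)) (fact F0 Lip' od that)+
    \<comment> \<open>Since \<open>f\<close> vanishes outside \<open>{A..B}\<close>, truncating (0,
      pi) and truncating \<open>{A..B}\<close> around \<theta> give the same integrand.\<close>
    have eq: "indicat_real {0<..<pi} x *\<^sub>R (w x *\<^sub>R (indicat_real (P \<epsilon>) x *\<^sub>R G x))
      = indicat_real (punctured A B \<theta> \<epsilon>) x *\<^sub>R (R x *\<^sub>R F x)" for x \<epsilon>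
    proof (cases "x \<in> {A..B}")
      case True
      then have "indicat_real (P \<epsilon>) x = indicat_real (punctured A B \<theta> \<epsilon>) x" using AB by (auto simp: P_def punctured_def indicator_def)
      then show ?thesis using kernel[OF True] ind[OF True]
        by (cases "x \<in> punctured A B \<theta> \<epsilon>") (simp_all add: G_def)
    qed (simp add: G_def f0 F0)
    have pv: "set_integrable (jacobi_measure \<alpha> \<beta>) (P \<epsilon>) G"
      "(LINT \<phi>:P \<epsilon>|jacobi_measure \<alpha> \<beta>. G \<phi>) = (LBINT p:punctured A B \<theta> \<epsilon>. R p *\<^sub>R F p)" if "0 < \<epsilon>" for \<epsilon>
      using jacobi_measure_transfer[OF eq RI[OF that]] by (simp_all add: set_integrable_def set_lebesgue_integral_def)
    have "((\<lambda>\<epsilon>. LBINT p:punctured A B \<theta> \<epsilon>. R p *\<^sub>R F p) \<longlongrightarrow> T) (at_right 0)"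
      by (rule main(4)) (fact F0 Lip' od)+
    moreover have "\<forall>\<^sub>F \<epsilon> in at_right 0. (LBINT p:punctured A B \<theta> \<epsilon>. R p *\<^sub>R F p) = (LINT \<phi>:P \<epsilon>|jacobi_measure \<alpha> \<beta>. G \<phi>)"
      using eventually_at_right_less[of 0] by eventually_elim (simp add: pv)
    ultimately have "((\<lambda>\<epsilon>. LINT \<phi>:P \<epsilon>|jacobi_measure \<alpha> \<beta>. G \<phi>) \<longlongrightarrow> T) (at_right 0)" by (rule Lim_transform_eventually)
    then show ?thesis unfolding has_pv_integral_def transform using pv(1) by (simp add: P_def)
  qed
  show "odd N \<Longrightarrow> has_pv_integral (\<lambda>\<phi>. complex_of_real (riesz_jacobi_kernel \<alpha> \<beta> N \<theta> \<phi>) * f \<phi>)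
      (riesz_jacobi_transform \<alpha> \<beta> N f \<theta>) (jacobi_measure \<alpha> \<beta>) \<theta>"
    by (rule odd_case[unfolded G_def[abs_def]])
  show "even N \<Longrightarrow> integrable (jacobi_measure \<alpha> \<beta>) (\<lambda>\<phi>. complex_of_real (riesz_jacobi_kernel \<alpha> \<beta> N \<theta> \<phi>) * f \<phi>)"
    by (rule even_case(1)[unfolded G_def[abs_def]])
  show "even N \<Longrightarrow> riesz_jacobi_transform \<alpha> \<beta> N f \<theta> = (-1) ^ (N div 2) * f \<theta> +
      (LINT \<phi>|jacobi_measure \<alpha> \<beta>. complex_of_real (riesz_jacobi_kernel \<alpha> \<beta> N \<theta> \<phi>) * f \<phi>)"
    by (rule even_case(2)[unfolded G_def[abs_def]])
qed

end

theorem theorem2p2: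
  fixes \<alpha> \<beta> \<theta> :: real and N :: nat and f :: "real \<Rightarrow> complex"
  assumes "\<alpha> > -1" and "\<beta> > -1" and "N \<ge> 1"
    and "test_function_on {0<..<pi} f"
    and "\<theta> \<in> {0<..<pi}"
  shows
    "(odd N \<longrightarrow>
       has_pv_integral (\<lambda>\<phi>. complex_of_real (riesz_jacobi_kernel \<alpha> \<beta> N \<theta> \<phi>) * f \<phi>)
         (riesz_jacobi_transform \<alpha> \<beta> N f \<theta>) (jacobi_measure \<alpha> \<beta>) \<theta>) \<and>
     (even N \<longrightarrow>
       integrable (jacobi_measure \<alpha> \<beta>)
         (\<lambda>\<phi>. complex_of_real (riesz_jacobi_kernel \<alpha> \<beta> N \<theta> \<phi>) * f \<phi>) \<and>
       riesz_jacobi_transform \<alpha> \<beta> N f \<theta> =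
         (-1) ^ (N div 2) * f \<theta> +
         (LINT \<phi>|jacobi_measure \<alpha> \<beta>.
            complex_of_real (riesz_jacobi_kernel \<alpha> \<beta> N \<theta> \<phi>) * f \<phi>))"
proof -
  interpret jacobi \<alpha> \<beta> by unfold_locales (fact assms)+
  show ?thesis using riesz_jacobi_representation[OF assms(3-5)] by blast
qed

end
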